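(* Let $M$ be a complete non-positively curved Ricci surface biholomorphic to $\mathbb{C}\setminus\{0,1\}$, with three catenoidal ends (at the punctures $0,1,\infty$) and reducible induced metric $(-K)g_M$. If $M$ has total curvature $-4\pi$, then $M$ is isometric to the surface $\mathbb{C}\setminus\{0,1\}$ with the metric determined by Weierstrass data $$g=\lambda(z-1)^{\mu}z^{\nu}\frac{1}{z-b},\qquad \eta=\kappa(z-1)^{-\mu-1}z^{-\nu-1}(z-b)^2dz,\qquad b=\frac{(\mu+\nu-1)a_1a_2}{\nu},$$ for some $a_1,a_2\in\mathbb{C}\setminus\{0,1\}$, $\lambda,\kappa\in\mathbb{C}\setminus\{0\}$ and real $\mu,\nu>0$ satisfying $0<\mu+\nu<1$, $$\nu(\nu-1)=(\mu+\nu-1)\big[\nu(a_1+a_2)-(\mu+\nu)a_1a_2\big],$$ and $$\frac{\mu-1}{b-1}+\frac{\nu-1}{b}+\frac{1}{b-a_1}+\frac{1}{b-a_2}=0,$$ where $b\notin\{0,1,a_1,a_2\}$ (the case $a_1=a_2$ is allowed).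
   Context: Ricci surface: an orientable Riemannian surface $(M,g_M)$ whose Gauss curvature $K$ satisfies $K\Delta K+g_M(dK,dK)+4K^3=0$, where $\Delta=-\mathrm{div}\,\mathrm{grad}$ is the nonnegative Laplacian. It is non-positively curved if $K\le 0$. $M$ is regarded as a Riemann surface through the conformal class of $g_M$ and an orientation. Its total curvature is $\int_M K\,dA$. Weierstrass data: let $\pi:\tilde M\to M$ be the universal cover of a non-positively curved Ricci surface. There are a meromorphic function $g$ and a holomorphic 1-form $\eta$ (locally $\eta=\alpha\,dz$) on $\tilde M$, where $\eta$ has a zero of order $2m$ at each pole of $g$ of order $m$ and no other zeros, such that $\pi^*g_M=\frac14|\alpha|^2(1+|g|^2)^2|dz|^2$. The pair $(g,\eta)$ is called the Weierstrass data of $M$; it is unique up to $\eta\mapsto e^{i\theta}\eta$ and up to $(g,\eta)\mapsto(\tilde g,\tilde\eta)$ with $\tilde g=\sigma\cdot g$ ($\sigma\in PSU(2)$ acting by Möbius transformations) and $\tilde\eta=Q/d\tilde g$, where $Q:=dg\otimes\eta$ is the Hopf differential. Catenoidal end: suppose $M$ has finite total curvature and is biholomorphic to $S_k\setminus\{p_1,\dots,p_r\}$, with $S_k$ a compact Riemann surface of genus $k$. The puncture $p_i$ is a catenoidal end if it has a neighbourhood on which $Q$ is well defined (single-valued on the punctured neighbourhood, descending from the universal cover) and meromorphic, with $\mathrm{ord}_{p_i}Q=-2$. Reducible: the metric $(-K)g_M$ has constant Gauss curvature $1$ (with conical singularities at zeros of $K$) and pulls back to $\frac{4\,dg\,d\bar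 g}{(1+|g|^2)^2}$ on $\tilde M$. There is a monodromy representation $\rho:\pi_1(M)\to PSU(2)$ with $g\circ\tau^{-1}=\rho(\tau)\cdot g$ for all $\tau\in\pi_1(M)$. The metric $(-K)g_M$ is reducible if the image of $\rho$ is abelian (possibly trivial). The surface determined by (multivalued) Weierstrass data $g$, $\eta=\alpha\,dz$ on $\mathbb{C}\setminus\{0,1\}$ is $\mathbb{C}\setminus\{0,1\}$ with the (single-valued) metric $\frac14|\alpha|^2(1+|g|^2)^2|dz|^2$. *)

theory Defs
  imports "HOL-Complex_Analysis.Complex_Analysis" "HOL-Algebra.Coset"
begin

no_notation fps_nth (infixl \<open>$\<close> 75)

section \<open>Conformal metrics on plane domains\<close>

text \<open>
  Throughout, an open connected set \<open>S\<close> of complex numbers together with a function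
  \<open>h > 0\<close> on \<open>S\<close> stands for the Riemann surface \<open>S\<close> with the conformal Riemannian
  metric \<open>h \<bar>dz\<bar>\<^sup>2\<close>.  A Riemannian surface that is biholomorphic to \<open>S\<close>
  (for the complex structure given by its conformal class and an orientation) is exactly a
  surface of this kind, once the metric is written in the global coordinate \<open>z\<close>.
\<close>

definition partial_x :: "(complex \<Rightarrow> 'b::real_normed_vector) \<Rightarrow> complex \<Rightarrow> 'b" where
  "partial_x f z = frechet_derivative f (at z) 1"

definition partial_y :: "(complex \<Rightarrow> 'b::real_normed_vector) \<Rightarrow> complex \<Rightarrow> 'b" where
  "partial_y f z = frechet_derivative f (at z) \<i>"

text \<open>\<open>f\<close> is of class $C^k$ in the real sense on the open set \<open>S\<close>.\<close>

primrec Ck_on :: "nat \<Rightarrow> complex set \<Rightarrow> (complex \<Rightarrow> 'b::real_normed_vector) \<Rightarrow> bool" where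
  "Ck_on 0 S f \<longleftrightarrow> continuous_on S f"
| "Ck_on (Suc k) S f \<longleftrightarrow> (\<forall>z\<in>S. f differentiable (at z)) \<and>
      Ck_on k S (partial_x f) \<and> Ck_on k S (partial_y f)"

definition smooth_on :: "complex set \<Rightarrow> (complex \<Rightarrow> 'b::real_normed_vector) \<Rightarrow> bool" where
  "smooth_on S f \<longleftrightarrow> (\<forall>k. Ck_on k S f)"

definition conformal_metric :: "complex set \<Rightarrow> (complex \<Rightarrow> real) \<Rightarrow> bool" where
  "conformal_metric S h \<longleftrightarrow> open S \<and> connected S \<and> smooth_on S h \<and> (\<forall>z\<in>S. 0 < h z)"

text \<open>The nonnegative Laplacian $-\mathrm{div}\,\mathrm{grad}$ of \<open>h \<bar>dz\<bar>\<^sup>2\<close>.\<close>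

definition laplacian :: "(complex \<Rightarrow> real) \<Rightarrow> (complex \<Rightarrow> real) \<Rightarrow> complex \<Rightarrow> real" where
  "laplacian h f z = - (partial_x (partial_x f) z + partial_y (partial_y f) z) / h z"

text \<open>The square norm of \<open>df\<close> with respect to the metric \<open>h \<bar>dz\<bar>\<^sup>2\<close>.\<close>

definition grad_sq :: "(complex \<Rightarrow> real) \<Rightarrow> (complex \<Rightarrow> real) \<Rightarrow> complex \<Rightarrow> real" where
  "grad_sq h f z = ((partial_x f z)\<^sup>2 + (partial_y f z)\<^sup>2) / h z"

text \<open>
  For $h = e^{2u}$ the Gauss curvature is $-e^{-2u}(u_{xx}+u_{yy})$; here
  $u = \frac12\ln h$ and \<open>laplacian\<close> has the opposite sign of $\partial_x^2+\partial_y^2$.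
\<close>

definition gauss_curvature :: "(complex \<Rightarrow> real) \<Rightarrow> complex \<Rightarrow> real" where
  "gauss_curvature h z = laplacian h (\<lambda>w. ln (h w) / 2) z"

definition ricci_surface :: "complex set \<Rightarrow> (complex \<Rightarrow> real) \<Rightarrow> bool" where
  "ricci_surface S h \<longleftrightarrow> conformal_metric S h \<and>
     (\<forall>z\<in>S. gauss_curvature h z * laplacian h (gauss_curvature h) z
            + grad_sq h (gauss_curvature h) z + 4 * (gauss_curvature h z) ^ 3 = 0)"

definition nonpositively_curved :: "complex set \<Rightarrow> (complex \<Rightarrow> real) \<Rightarrow> bool" where
  "nonpositively_curved S h \<longleftrightarrow> (\<forall>z\<in>S. gauss_curvature h z \<le> 0)"

text \<open>The area element of \<open>h \<bar>dz\<bar>\<^sup>2\<close> is \<open>h dx dy\<close>.\<close>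

definition finite_total_curvature :: "complex set \<Rightarrow> (complex \<Rightarrow> real) \<Rightarrow> bool" where
  "finite_total_curvature S h \<longleftrightarrow> set_integrable lborel S (\<lambda>z. gauss_curvature h z * h z)"

definition total_curvature :: "complex set \<Rightarrow> (complex \<Rightarrow> real) \<Rightarrow> real" where
  "total_curvature S h = set_lebesgue_integral lborel S (\<lambda>z. gauss_curvature h z * h z)"

definition curve_length :: "(complex \<Rightarrow> real) \<Rightarrow> (real \<Rightarrow> complex) \<Rightarrow> real" where
  "curve_length h c =
     integral {0..1} (\<lambda>t. sqrt (h (c t)) * norm (vector_derivative c (at t)))"

definition riemannian_dist ::
    "complex set \<Rightarrow> (complex \<Rightarrow> real) \<Rightarrow> complex \<Rightarrow> complex \<Rightarrow> real" where
  "riemannian_dist S h x y = (if x \<in> S \<and> y \<in> S then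
     (INF c \<in> {c. valid_path c \<and> path_image c \<subseteq> S \<and> pathstart c = x \<and> pathfinish c = y}.
        curve_length h c) else 0)"

definition complete_metric :: "complex set \<Rightarrow> (complex \<Rightarrow> real) \<Rightarrow> bool" where
  "complete_metric S h \<longleftrightarrow> Metric_space.mcomplete S (riemannian_dist S h)"

definition isometric ::
    "complex set \<Rightarrow> (complex \<Rightarrow> real) \<Rightarrow> complex set \<Rightarrow> (complex \<Rightarrow> real) \<Rightarrow> bool" where
  "isometric S h S' h' \<longleftrightarrow>
     (\<exists>\<phi> \<psi>. homeomorphism S S' \<phi> \<psi> \<and> smooth_on S \<phi> \<and> smooth_on S' \<psi> \<and>
        (\<forall>z\<in>S. \<forall>v w.
           h' (\<phi> z) * (frechet_derivative \<phi> (at z) v \<bullet> frechet_derivative \<phi> (at z) w)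
             = h z * (v \<bullet> w)))"


section \<open>Weierstrass data on the universal cover\<close>

text \<open>
  By uniformization, the universal cover of a plane domain \<open>S\<close> omitting at least two points
  is realised by a simply connected plane domain \<open>U\<close>.  The covering map is \<open>cov\<close>.
\<close>

definition universal_cover ::
    "complex set \<Rightarrow> (complex \<Rightarrow> complex) \<Rightarrow> complex set \<Rightarrow> bool" where
  "universal_cover U cov S \<longleftrightarrow> open U \<and> simply_connected U \<and>
     cov holomorphic_on U \<and> covering_space U cov S"

text \<open>
  The metric \<open>h \<bar>dz\<bar>\<^sup>2\<close> on \<open>S\<close> is \<open>1/4 \<bar>\<alpha>\<bar>\<^sup>2 (1 + \<bar>g\<bar>\<^sup>2)\<^sup>2 \<bar>dz\<bar>\<^sup>2\<close>.
  At a pole of \<open>g\<close> the right-hand side has to be read as a limit, so for continuous \<open>h\<close>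
  it suffices to ask for the identity away from the poles.
\<close>

definition metric_of_data ::
    "complex set \<Rightarrow> (complex \<Rightarrow> complex) \<Rightarrow> (complex \<Rightarrow> complex) \<Rightarrow> (complex \<Rightarrow> real) \<Rightarrow> bool" where
  "metric_of_data S g \<alpha> h \<longleftrightarrow>
     (\<forall>z\<in>S. \<not> is_pole g z \<longrightarrow> h z = 1/4 * (norm (\<alpha> z))\<^sup>2 * (1 + (norm (g z))\<^sup>2)\<^sup>2)"

text \<open>
  The 1-form is \<open>\<eta> = \<alpha> dw\<close> in the global coordinate \<open>w\<close> of \<open>U\<close>; the pole order of \<open>g\<close>
  is \<open>- zorder g\<close>.
\<close>

definition weierstrass_data ::
    "complex set \<Rightarrow> (complex \<Rightarrow> complex) \<Rightarrow> (complex \<Rightarrow> real)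
       \<Rightarrow> (complex \<Rightarrow> complex) \<Rightarrow> (complex \<Rightarrow> complex) \<Rightarrow> bool" where
  "weierstrass_data U cov h g \<alpha> \<longleftrightarrow>
     g nicely_meromorphic_on U \<and> \<alpha> holomorphic_on U \<and>
     (\<forall>w\<in>U. is_pole g w \<longrightarrow> zorder \<alpha> w = 2 * (- zorder g w)) \<and>
     (\<forall>w\<in>U. \<not> is_pole g w \<longrightarrow> \<alpha> w \<noteq> 0) \<and>
     metric_of_data U g \<alpha> (\<lambda>w. h (cov w) * (norm (deriv cov w))\<^sup>2)"

text \<open>
  \<open>\<phi>\<close> is a holomorphic coordinate near a puncture of the surface, mapping a punctured
  neighbourhood of \<open>0\<close> onto a punctured neighbourhood of the puncture.  The Hopf differential
  is \<open>dg \<otimes> \<eta> = g' \<alpha> dw\<^sup>2\<close> on \<open>U\<close>.  That it descends to the form \<open>q d\<zeta>\<^sup>2\<close> in the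
  coordinate \<open>\<zeta>\<close> means \<open>g' \<alpha> dw\<^sup>2 = q d\<zeta>\<^sup>2\<close> where \<open>\<phi> \<zeta> = cov w\<close>, that is
  \<open>\<phi>' d\<zeta> = cov' dw\<close>.  The function \<open>q\<close> has order \<open>-2\<close> at the puncture; the clause
  \<open>is_pole\<close> is there because \<open>zorder\<close> is unspecified for functions that vanish identically.
\<close>

definition catenoidal_end ::
    "complex set \<Rightarrow> (complex \<Rightarrow> complex) \<Rightarrow> (complex \<Rightarrow> complex) \<Rightarrow> (complex \<Rightarrow> complex)
       \<Rightarrow> (complex \<Rightarrow> complex) \<Rightarrow> bool" where
  "catenoidal_end U cov g \<alpha> \<phi> \<longleftrightarrow>
     (\<exists>r>0. \<exists>q. q meromorphic_on ball 0 r \<and> is_pole q 0 \<and> zorder q 0 = -2 \<and>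
        (\<forall>\<zeta>\<in>ball 0 r - {0}. \<forall>w\<in>U. cov w = \<phi> \<zeta> \<and> \<not> is_pole g w \<longrightarrow>
           deriv g w * \<alpha> w = q \<zeta> * (deriv cov w / deriv \<phi> \<zeta>)\<^sup>2))"


section \<open>Monodromy and reducibility\<close>

definition SU2 :: "(complex^2^2) monoid" where
  "SU2 = \<lparr>carrier = {A. (\<chi> i j. cnj (A $ j $ i)) ** A = mat 1 \<and> det A = 1},
          mult = (**), one = mat 1\<rparr>"

definition PSU2 :: "(complex^2^2) set monoid" where
  "PSU2 = SU2 Mod {mat 1, - mat 1}"

text \<open>
  \<open>y = (a x + b) / (c x + d)\<close> for finite \<open>x\<close> and \<open>y\<close>, without a division.  Since \<open>A\<close> is
  invertible, this relation excludes \<open>c x + d = 0\<close>.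
\<close>

definition moebius_rel :: "complex^2^2 \<Rightarrow> complex \<Rightarrow> complex \<Rightarrow> bool" where
  "moebius_rel A x y \<longleftrightarrow> y * (A $ 2 $ 1 * x + A $ 2 $ 2) = A $ 1 $ 1 * x + A $ 1 $ 2"

text \<open>
  The fundamental group, acting as deck transformations on the universal cover.  The product
  of \<open>\<sigma>\<close> and \<open>\<tau>\<close> is "first \<open>\<sigma>\<close>, then \<open>\<tau>\<close>": with this convention the rule
  \<open>g \<circ> \<tau>\<inverse> = \<rho> \<tau> \<cdot> g\<close>, where matrices act from the left, defines a homomorphism.
  Deck transformations are functions on \<open>U\<close> only, hence \<open>extensional\<close>.
\<close>

definition deck_group ::
    "complex set \<Rightarrow> (complex \<Rightarrow> complex) \<Rightarrow> (complex \<Rightarrow> complex) monoid" where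
  "deck_group U cov =
     \<lparr>carrier = {\<tau> \<in> extensional U. (\<exists>\<tau>'. homeomorphism U U \<tau> \<tau>') \<and> (\<forall>w\<in>U. cov (\<tau> w) = cov w)},
      mult = (\<lambda>\<sigma> \<tau>. compose U \<tau> \<sigma>), one = (\<lambda>w\<in>U. w)\<rparr>"

text \<open>
  \<open>g \<circ> \<tau>\<inverse> = \<rho> \<tau> \<cdot> g\<close> as meromorphic functions on \<open>U\<close>, stated at the points where
  both sides are finite.  The elements of \<open>PSU2\<close> are cosets of matrices.
\<close>

definition monodromy_representation ::
    "complex set \<Rightarrow> (complex \<Rightarrow> complex) \<Rightarrow> (complex \<Rightarrow> complex)
       \<Rightarrow> ((complex \<Rightarrow> complex) \<Rightarrow> (complex^2^2) set) \<Rightarrow> bool" where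
  "monodromy_representation U cov g \<rho> \<longleftrightarrow>
     \<rho> \<in> hom (deck_group U cov) PSU2 \<and>
     (\<forall>\<tau>\<in>carrier (deck_group U cov). \<forall>A\<in>\<rho> \<tau>. \<forall>w\<in>U.
        \<not> is_pole g w \<and> \<not> is_pole g (inv_into U \<tau> w) \<longrightarrow>
        moebius_rel A (g w) (g (inv_into U \<tau> w)))"

definition reducible ::
    "complex set \<Rightarrow> (complex \<Rightarrow> complex) \<Rightarrow> (complex \<Rightarrow> complex) \<Rightarrow> bool" where
  "reducible U cov g \<longleftrightarrow>
     (\<exists>\<rho>. monodromy_representation U cov g \<rho> \<and>
        comm_group (PSU2\<lparr>carrier := \<rho> ` carrier (deck_group U cov)\<rparr>))"

text \<open>
  The multivalued data \<open>g = \<lambda> (z-1)\<^sup>\<mu> z\<^sup>\<nu> / (z-b)\<close> and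
  \<open>\<eta> = \<kappa> (z-1)\<^sup>-\<^sup>\<mu>\<^sup>-\<^sup>1 z\<^sup>-\<^sup>\<nu>\<^sup>-\<^sup>1 (z-b)\<^sup>2 dz\<close>, given by their principal branches.  As \<open>\<mu>\<close> and
  \<open>\<nu>\<close> are real, the moduli, and so the metric, do not depend on the branch.
\<close>

definition data_g :: "complex \<Rightarrow> real \<Rightarrow> real \<Rightarrow> complex \<Rightarrow> complex \<Rightarrow> complex" where
  "data_g lam \<mu> \<nu> b z =
     lam * (z - 1) powr of_real \<mu> * z powr of_real \<nu> * (1 / (z - b))"

definition data_eta :: "complex \<Rightarrow> real \<Rightarrow> real \<Rightarrow> complex \<Rightarrow> complex \<Rightarrow> complex" where
  "data_eta \<kappa> \<mu> \<nu> b z =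
     \<kappa> * (z - 1) powr of_real (- \<mu> - 1) * z powr of_real (- \<nu> - 1) * (z - b)\<^sup>2"

end

theory Submission
  imports Defs "HOL-Real_Asymp.Real_Asymp"
begin

text \<open>
  Write the metric as $e^{2u}|dz|^2$ with $\Delta u = -Kh \ge 0$.  A row vector \<open>r = (r1, r2)\<close>
  gives a holomorphic form $(r_1 g + r_2)^2 \eta$, and for a unit vector \<open>r\<close> and its orthogonal
  complement the moduli of the two forms add up to $2e^u$.  The modulus of such a form is
  single-valued where \<open>r\<close> is an eigenvector of the monodromy.  Finite total curvature bounds
  \<open>u\<close> by a multiple of $|\ln|x||$ in the coordinate \<open>x\<close> of an end, so on the half-plane covering
  that end each of the two forms is an exponential times a holomorphic nonvanishing function of \<open>x\<close>;
  the double pole of the Hopf differential, which is their Wronskian, then makes the exponents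
  opposite, \<open>\<nu>\<close> and \<open>-\<nu>\<close>, or equal and at most \<open>-1\<close>.  Integrating $\Delta u$ turns the total
  curvature $-4\pi$ into the condition that the numbers \<open>\<nu>\<close> of the three ends add up to 1.
  This excludes the second possibility, and it excludes a monodromy group that is abelian only
  in \<open>PSU(2)\<close>, because there every \<open>\<nu>\<close> would be at least \<open>1/2\<close>.  Hence the monodromy has a common
  eigenvector.  The logarithmic derivatives of the two resulting forms are rational functions on the
  sphere, the product of the forms is a square, and counting zeros leaves one double zero \<open>b\<close>
  for one form and no zero for the other.  Integrating gives the metric; \<open>a1\<close> and \<open>a2\<close> are
  the roots of the quadratic polynomial that the required relations prescribe.
\<close>

section \<open>Directional derivatives and Green's formula\<close>

text \<open>The bound on \<open>u\<close> at an end is the analytic heart. There the Hopf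
  differential is P dx^2/x^2 with P nonvanishing, and Liouville's equation turns this into (Delta u)
  e^(2u) |z-p|^4 = |P|^2, with p = 0 for the end at infinity. So wherever v = u + ln|z-p| is very
  negative its Laplacian is large, and finite total curvature bounds the averages of the negative
  part of v. Green's formula bounds the averages of v itself from above linearly in |ln|z-p||, hence
  also those of the positive part, and the mean value inequality makes the bound pointwise. This is
  what rules out essential singularities of the forms.

  The forms (r1 g + r2)^2 eta are holomorphic on the whole cover because eta vanishes to twice the
  order of each pole of g; they replace the pair (g, eta), whose poles would otherwise have to be
  carried through every argument. Elements that commute only in PSU(2) have lifts to SU(2) that
  commute up to sign, which is why fourth powers of eigenvalues occur. The final isometry is the
  identity: the data are fitted to the given metric.\<close>

definition has_dd :: "'a::real_normed_vector \<Rightarrow> 'a set \<Rightarrow> ('a \<Rightarrow> real) \<Rightarrow> ('a \<Rightarrow> real) \<Rightarrow> bool" where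
  "has_dd e S f f' \<longleftrightarrow> (\<forall>z\<in>S. ((\<lambda>t. f (z + t *\<^sub>R e)) has_real_derivative f' z) (at 0))"

lemma has_dd_line:
  assumes "has_dd e S f f'" "z + s *\<^sub>R e \<in> S"
  shows "((\<lambda>t. f (z + t *\<^sub>R e)) has_real_derivative f' (z + s *\<^sub>R e)) (at s)"
proof -
  have "((\<lambda>t. f ((z + s *\<^sub>R e) + t *\<^sub>R e)) has_real_derivative f' (z + s *\<^sub>R e)) (at 0)"
    using assms unfolding has_dd_def by blast
  then have "((\<lambda>t. f (z + (t + s) *\<^sub>R e)) has_real_derivative f' (z + s *\<^sub>R e)) (at 0)"
    by (simp add: algebra_simps)
  then show ?thesis
    using DERIV_shift[of "\<lambda>t. f (z + t *\<^sub>R e)" "f' (z + s *\<^sub>R e)" 0 s] by simp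
qed

lemma has_dd_zero_open:
  assumes "has_dd e S f f'" "open T" "T \<subseteq> S" "\<And>z. z \<in> T \<Longrightarrow> f z = 0" "z \<in> T"
  shows "f' z = 0"
proof -
  have "((\<lambda>t. f (z + t *\<^sub>R e)) has_real_derivative f' z) (at 0)"
    using assms unfolding has_dd_def by blast
  moreover have "\<forall>\<^sub>F t in nhds 0. z + t *\<^sub>R e \<in> T"
  proof -
    have "((\<lambda>t. z + t *\<^sub>R e) \<longlongrightarrow> z + 0 *\<^sub>R e) (nhds 0)"
      by (intro tendsto_intros) (simp add: filterlim_ident)
    then show ?thesis using assms(2,5) by (simp add: topological_tendstoD)
  qed
  then have "\<forall>\<^sub>F t in nhds 0. f (z + t *\<^sub>R e) = 0"
    by eventually_elim (use assms in auto)
  ultimately have "((\<lambda>t. 0) has_real_derivative f' z) (at 0)"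
    by (subst (asm) DERIV_cong_ev[of 0 0 _ "\<lambda>_. 0" "f' z" "f' z"]) (auto)
  then show ?thesis by (simp add: DERIV_unique)
qed

lemma set_integrable_compact_support:
  fixes f :: "'a::euclidean_space \<Rightarrow> real"
  assumes "open S" "compact K" "K \<subseteq> S" "continuous_on S f" "\<And>z. z \<in> S - K \<Longrightarrow> f z = 0"
  shows "set_integrable lborel S f"
proof -
  have "integrable lborel (\<lambda>x. indicator K x *\<^sub>R f x)"
    by (rule borel_integrable_compact) (use assms continuous_on_subset in auto)
  also have "(\<lambda>x. indicator K x *\<^sub>R f x) = (\<lambda>x. indicator S x *\<^sub>R f x)"
    using assms(3,5) by (auto simp: indicator_def fun_eq_iff)
  finally show ?thesis unfolding set_integrable_def .
qed

text \<open>Difference quotients of \<open>f\<close> integrate to 0 by translation invariance; pass to the limit by dominated convergence.\<close>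

lemma integral_dd_compact_support:
  fixes f :: "'a::euclidean_space \<Rightarrow> real"
  assumes d: "has_dd e UNIV f f'" and c: "continuous_on UNIV f" "continuous_on UNIV f'"
    and K: "compact K" "\<And>z. z \<notin> K \<Longrightarrow> f z = 0"
  shows "integral\<^sup>L lborel f' = 0"
proof -
  have f'0: "f' z = 0" if "z \<notin> K" for z
    using has_dd_zero_open[OF d, of "- K" z] K that by (auto simp: compact_imp_closed open_Compl)
  have fm: "f \<in> borel_measurable borel" and fm': "f' \<in> borel_measurable borel"
    using c by (auto intro: borel_measurable_continuous_onI)
  have fi: "integrable lborel f"
    using set_integrable_compact_support[of UNIV K f] K c by (auto simp: set_integrable_def)
  \<comment> \<open>\<open>K'\<close> contains the supports of all difference quotients with step at
    most 1.\<close>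
  define K' where "K' = {x + y | x y. x \<in> K \<and> y \<in> cball 0 (norm e)}"
  have K': "compact K'" unfolding K'_def by (intro compact_sums K) auto
  have "compact (f' ` K)" by (intro compact_continuous_image continuous_on_subset[OF c(2)] K) auto
  then obtain B where B: "\<And>z. z \<in> K \<Longrightarrow> \<bar>f' z\<bar> \<le> B" "B > 0"
    by (force dest!: compact_imp_bounded simp: bounded_pos)
  then have B': "\<bar>f' z\<bar> \<le> B" for z using f'0[of z] by (cases "z \<in> K") auto
  define t where "t n = 1 / real (Suc n)" for n
  have t: "0 < t n" "t n \<le> 1" for n by (auto simp: t_def)
  define D where "D n z = (f (z + t n *\<^sub>R e) - f z) / t n" for n z
  have Dm: "D n \<in> borel_measurable lborel" for n
  proof -
    have "(\<lambda>z. f (z + t n *\<^sub>R e)) \<in> borel_measurable borel"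
      by (intro borel_measurable_continuous_onI continuous_on_compose2[OF c(1)] continuous_intros) auto
    then show ?thesis unfolding D_def using fm by measurable
  qed
  have shift: "integrable lborel (\<lambda>z. f (z + v))" "integral\<^sup>L lborel (\<lambda>z. f (z + v)) = integral\<^sup>L lborel f" for v
  proof -
    have e: "distr lborel borel (\<lambda>z. v + z) = (lborel :: 'a measure)"
      by (rule lborel_distr_plus)
    have "integrable (distr lborel borel (\<lambda>z. v + z)) f" using fi e by simp
    then show "integrable lborel (\<lambda>z. f (z + v))"
      by (subst (asm) integrable_distr_eq) (use fm in \<open>auto simp: add.commute\<close>)
    have "integral\<^sup>L (distr lborel borel (\<lambda>z. v + z)) f = integral\<^sup>L lborel (\<lambda>z. f (v + z))"
      by (rule integral_distr) (use fm in auto)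
    then show "integral\<^sup>L lborel (\<lambda>z. f (z + v)) = integral\<^sup>L lborel f"
      using e by (simp add: add.commute)
  qed
  have D0: "integral\<^sup>L lborel (D n) = 0" for n
    unfolding D_def using shift[of "t n *\<^sub>R e"] fi by simp
  have bd: "norm (D n z) \<le> B * indicator K' z" for n z
  proof (cases "z \<in> K'")
    case True
    obtain x where x: "0 < x" "x < t n"
      "f (z + t n *\<^sub>R e) - f (z + 0 *\<^sub>R e) = (t n - 0) * f' (z + x *\<^sub>R e)"
      using MVT2[of 0 "t n" "\<lambda>s. f (z + s *\<^sub>R e)" "\<lambda>s. f' (z + s *\<^sub>R e)"] has_dd_line[OF d] t[of n] by auto
    then have "D n z = f' (z + x *\<^sub>R e)" using t[of n] by (simp add: D_def)
    then show ?thesis using B' True by simp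
  next
    case False
    have "z \<notin> K"
    proof
      assume "z \<in> K"
      then have "z + 0 \<in> K'" unfolding K'_def by (intro CollectI exI conjI) auto
      then show False using False by simp
    qed
    moreover have "z + t n *\<^sub>R e \<notin> K"
    proof
      assume "z + t n *\<^sub>R e \<in> K"
      moreover have "norm (- t n *\<^sub>R e) \<le> norm e" using t[of n] by (simp add: mult_left_le_one_le)
      ultimately have "(z + t n *\<^sub>R e) + (- t n *\<^sub>R e) \<in> K'"
        unfolding K'_def mem_Collect_eq
        by (intro exI[of _ "z + t n *\<^sub>R e"] exI[of _ "- t n *\<^sub>R e"]) simp
      then show False using False by simp
    qed
    ultimately have "D n z = 0" using K(2) by (simp add: D_def)
    then show ?thesis using B(2) by simp
  qed
  have lim: "(\<lambda>n. D n z) \<longlonglongrightarrow> f' z" for z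
  proof -
    have "((\<lambda>s. f (z + s *\<^sub>R e)) has_real_derivative f' z) (at 0)"
      using d unfolding has_dd_def by blast
    then have "((\<lambda>s. (f (z + s *\<^sub>R e) - f z) / s) \<longlongrightarrow> f' z) (at 0)"
      by (simp add: has_field_derivative_iff)
    moreover have "filterlim t (at 0) sequentially"
      unfolding t_def filterlim_at using LIMSEQ_inverse_real_of_nat by (auto simp: inverse_eq_divide)
    ultimately show ?thesis unfolding D_def by (rule filterlim_compose)
  qed
  have "integrable lborel (\<lambda>z. B * indicator K' z)"
    by (intro integrable_mult_right integrable_real_indicator emeasure_compact_finite K')
       (simp add: borel_closed compact_imp_closed[OF K'])
  then have "(\<lambda>n. integral\<^sup>L lborel (D n)) \<longlonglongrightarrow> integral\<^sup>L lborel f'"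
  proof (rule integral_dominated_convergence[rotated 2])
    show "AE z in lborel. (\<lambda>n. D n z) \<longlonglongrightarrow> f' z" using lim by (rule AE_I2)
    show "AE z in lborel. norm (D n z) \<le> B * indicator K' z" for n using bd by (rule AE_I2)
    show "f' \<in> borel_measurable lborel" using fm' by simp
    show "D n \<in> borel_measurable lborel" for n by (rule Dm)
  qed
  then have "(\<lambda>n. 0) \<longlonglongrightarrow> integral\<^sup>L lborel f'" by (simp only: D0)
  then show ?thesis using LIMSEQ_unique tendsto_const by blast
qed

text \<open>Extension by zero reduces this to the whole space. The open sets \<open>S\<close> and
  \<open>- K\<close> cover everything; the extension agrees with \<open>f\<close> on the first and
  vanishes on the second, so continuity and line derivatives are inherited.\<close>

lemma set_integral_dd_compact_support:
  fixes f :: "'a::euclidean_space \<Rightarrow> real"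
  assumes d: "has_dd e S f f'" and S: "open S" and c: "continuous_on S f" "continuous_on S f'"
    and K: "compact K" "K \<subseteq> S" "\<And>z. z \<in> S - K \<Longrightarrow> f z = 0"
  shows "set_lebesgue_integral lborel S f' = 0"
proof -
  define F where "F z = (if z \<in> S then f z else 0)" for z
  define F' where "F' z = (if z \<in> S then f' z else 0)" for z
  have oK: "open (- K)" using K by (auto simp: compact_imp_closed)
  have f'0: "f' z = 0" if "z \<in> S - K" for z
    using has_dd_zero_open[OF d, of "S - K" z] K S that by (auto simp: compact_imp_closed open_Diff)
  have un: "UNIV = S \<union> - K" using K by auto
  have cF: "continuous_on UNIV F" unfolding un
    by (rule continuous_on_open_Un[OF S oK])
       (rule continuous_on_eq[OF c(1)], use K in \<open>auto simp: F_def intro: continuous_on_eq[OF continuous_on_const[of _ 0]]\<close>)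
  have cF': "continuous_on UNIV F'" unfolding un
    by (rule continuous_on_open_Un[OF S oK])
       (rule continuous_on_eq[OF c(2)], use f'0 in \<open>auto simp: F'_def intro: continuous_on_eq[OF continuous_on_const[of _ 0]]\<close>)
  have line: "\<forall>\<^sub>F t in nhds 0. z + t *\<^sub>R e \<in> T" if "open T" "z \<in> T" for z and T :: "'a set"
  proof -
    have "((\<lambda>t. z + t *\<^sub>R e) \<longlongrightarrow> z + 0 *\<^sub>R e) (nhds 0)"
      by (intro tendsto_intros) (simp add: filterlim_ident)
    then show ?thesis using that by (simp add: topological_tendstoD)
  qed
  have "has_dd e UNIV F F'"
    unfolding has_dd_def
  proof
    fix z
    show "((\<lambda>t. F (z + t *\<^sub>R e)) has_real_derivative F' z) (at 0)"
    proof (cases "z \<in> S")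
      case True
      have "((\<lambda>t. f (z + t *\<^sub>R e)) has_real_derivative f' z) (at 0)"
        using d True unfolding has_dd_def by blast
      moreover have "\<forall>\<^sub>F t in nhds 0. F (z + t *\<^sub>R e) = f (z + t *\<^sub>R e)"
        using line[OF S True] by eventually_elim (auto simp: F_def)
      ultimately show ?thesis
        using True by (subst DERIV_cong_ev[of 0 0 _ "\<lambda>t. f (z + t *\<^sub>R e)" "F' z" "f' z"]) (auto simp: F'_def)
    next
      case False
      then have "z \<in> - K" using K by auto
      then have "\<forall>\<^sub>F t in nhds 0. F (z + t *\<^sub>R e) = 0"
        using line[OF oK] K by (force elim: eventually_mono simp: F_def)
      then show ?thesis
        using False by (subst DERIV_cong_ev[of 0 0 _ "\<lambda>t. 0" "F' z" "0"]) (auto simp: F'_def)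
    qed
  qed
  then have "integral\<^sup>L lborel F' = 0"
    by (rule integral_dd_compact_support) (use cF cF' K in \<open>auto simp: F_def\<close>)
  moreover have "F' = (\<lambda>z. indicator S z *\<^sub>R f' z)" by (auto simp: F'_def indicator_def)
  ultimately show ?thesis by (simp add: set_lebesgue_integral_def)
qed

text \<open>Green's formula is proved one direction at a time, so regularity is required only along
  the lines in direction \<open>e\<close>. The derivatives are explicit arguments, so that their
  continuity can be stated separately.\<close>

definition dC2 :: "'a::real_normed_vector \<Rightarrow> 'a set \<Rightarrow> ('a \<Rightarrow> real) \<Rightarrow> ('a \<Rightarrow> real) \<Rightarrow> ('a \<Rightarrow> real) \<Rightarrow> bool" where
  "dC2 e S f f1 f2 \<longleftrightarrow> has_dd e S f f1 \<and> has_dd e S f1 f2 \<and>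
     continuous_on S f \<and> continuous_on S f1 \<and> continuous_on S f2"

lemma has_dd_mult:
  assumes "has_dd e S f f'" "has_dd e S g g'"
  shows "has_dd e S (\<lambda>z. f z * g z) (\<lambda>z. f' z * g z + f z * g' z)"
  using assms unfolding has_dd_def by (auto intro!: derivative_eq_intros)

lemma has_dd_diff:
  assumes "has_dd e S f f'" "has_dd e S g g'"
  shows "has_dd e S (\<lambda>z. f z - g z) (\<lambda>z. f' z - g' z)"
  using assms unfolding has_dd_def by (auto intro!: derivative_eq_intros)

text \<open>The difference of the two integrands is the derivative along \<open>e\<close> of c u1 -
  u c1, which vanishes off \<open>K\<close> because \<open>c\<close> and its derivative do.\<close>

lemma Green_direction:
  fixes u :: "'a::euclidean_space \<Rightarrow> real"
  assumes u: "dC2 e S u u1 u2" and c: "dC2 e S c c1 c2"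
    and S: "open S" "compact K" "K \<subseteq> S" "\<And>z. z \<in> S - K \<Longrightarrow> c z = 0"
  shows "set_integrable lborel S (\<lambda>z. c z * u2 z)" "set_integrable lborel S (\<lambda>z. u z * c2 z)"
    "(LINT z:S|lborel. c z * u2 z) = (LINT z:S|lborel. u z * c2 z)"
proof -
  note [continuous_intros] = u[unfolded dC2_def, THEN conjunct2, THEN conjunct2, THEN conjunct1]
    u[unfolded dC2_def, THEN conjunct2, THEN conjunct2, THEN conjunct2, THEN conjunct1]
    u[unfolded dC2_def, THEN conjunct2, THEN conjunct2, THEN conjunct2, THEN conjunct2]
    c[unfolded dC2_def, THEN conjunct2, THEN conjunct2, THEN conjunct1]
    c[unfolded dC2_def, THEN conjunct2, THEN conjunct2, THEN conjunct2, THEN conjunct1]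
    c[unfolded dC2_def, THEN conjunct2, THEN conjunct2, THEN conjunct2, THEN conjunct2]
  have oSK: "open (S - K)" using S by (auto simp: compact_imp_closed open_Diff)
  have c1: "c1 z = 0" if "z \<in> S - K" for z
    using has_dd_zero_open[of e S c c1 "S - K" z] c S(4) oSK that by (auto simp: dC2_def)
  have c2: "c2 z = 0" if "z \<in> S - K" for z
    using has_dd_zero_open[of e S c1 c2 "S - K" z] c c1 oSK that by (auto simp: dC2_def)
  show i1: "set_integrable lborel S (\<lambda>z. c z * u2 z)"
    by (rule set_integrable_compact_support[OF S(1-3)]) (auto intro!: continuous_intros S(4))
  show i2: "set_integrable lborel S (\<lambda>z. u z * c2 z)"
    by (rule set_integrable_compact_support[OF S(1-3)]) (auto intro!: continuous_intros c2)
  have "has_dd e S (\<lambda>z. c z * u1 z - u z * c1 z)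
      (\<lambda>z. (c1 z * u1 z + c z * u2 z) - (u1 z * c1 z + u z * c2 z))"
    using u c unfolding dC2_def by (intro has_dd_diff has_dd_mult) auto
  then have "has_dd e S (\<lambda>z. c z * u1 z - u z * c1 z) (\<lambda>z. c z * u2 z - u z * c2 z)"
    by (simp add: mult.commute)
  then have "(LINT z:S|lborel. c z * u2 z - u z * c2 z) = 0"
    by (rule set_integral_dd_compact_support[OF _ S(1) _ _ S(2,3)])
       (auto intro!: continuous_intros simp: S(4) c1)
  then show "(LINT z:S|lborel. c z * u2 z) = (LINT z:S|lborel. u z * c2 z)"
    using i1 i2 by (simp add: set_integral_diff)
qed

text \<open>\<open>g\<close> is the square norm of the gradient and \<open>l\<close> the Laplacian of \<open>u\<close>, which is of class $C^2$ along both axes.\<close>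

definition lapG :: "complex set \<Rightarrow> (complex \<Rightarrow> real) \<Rightarrow> (complex \<Rightarrow> real) \<Rightarrow> (complex \<Rightarrow> real) \<Rightarrow> bool" where
  "lapG S u g l \<longleftrightarrow> (\<exists>ux uxx uy uyy. dC2 1 S u ux uxx \<and> dC2 \<i> S u uy uyy \<and>
     (\<forall>z\<in>S. g z = (ux z)\<^sup>2 + (uy z)\<^sup>2 \<and> l z = uxx z + uyy z))"

lemma lapG_continuous:
  assumes "lapG S u g l"
  shows "continuous_on S u" "continuous_on S g" "continuous_on S l"
proof -
  obtain ux uxx uy uyy where *: "dC2 1 S u ux uxx" "dC2 \<i> S u uy uyy"
     "\<And>z. z \<in> S \<Longrightarrow> g z = (ux z)\<^sup>2 + (uy z)\<^sup>2" "\<And>z. z \<in> S \<Longrightarrow> l z = uxx z + uyy z"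
    using assms unfolding lapG_def by blast
  show "continuous_on S u" using * by (auto simp: dC2_def)
  have "continuous_on S (\<lambda>z. (ux z)\<^sup>2 + (uy z)\<^sup>2)" "continuous_on S (\<lambda>z. uxx z + uyy z)"
    using *(1,2) unfolding dC2_def by (auto intro!: continuous_intros)
  then show "continuous_on S g" "continuous_on S l"
    using *(3,4) continuous_on_cong by force+
qed

lemma dC2_subset: "dC2 e S u a b \<Longrightarrow> T \<subseteq> S \<Longrightarrow> dC2 e T u a b"
  unfolding dC2_def has_dd_def using continuous_on_subset by blast

lemma lapG_subset: "lapG S u g l \<Longrightarrow> T \<subseteq> S \<Longrightarrow> lapG T u g l"
  unfolding lapG_def using dC2_subset by (meson subsetD)

lemma has_dd_cong:
  assumes "open S" "\<And>z. z \<in> S \<Longrightarrow> f z = g z" "\<And>z. z \<in> S \<Longrightarrow> f' z = g' z" "has_dd e S f f'"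
  shows "has_dd e S g g'"
  unfolding has_dd_def
proof
  fix z assume z: "z \<in> S"
  have "((\<lambda>t. z + t *\<^sub>R e) \<longlongrightarrow> z + 0 *\<^sub>R e) (nhds 0)"
    by (intro tendsto_intros) (simp add: filterlim_ident)
  then have "\<forall>\<^sub>F t in nhds 0. z + t *\<^sub>R e \<in> S" using z assms(1) by (simp add: topological_tendstoD)
  then have "\<forall>\<^sub>F t in nhds 0. f (z + t *\<^sub>R e) = g (z + t *\<^sub>R e)"
    by eventually_elim (use assms in auto)
  then show "((\<lambda>t. g (z + t *\<^sub>R e)) has_real_derivative g' z) (at 0)"
    using assms z unfolding has_dd_def
    by (subst DERIV_cong_ev[of 0 0 _ "\<lambda>t. f (z + t *\<^sub>R e)" "g' z" "f' z"]) (auto simp: eq_commute)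
qed

lemma lapG_cong:
  assumes "open S" "\<And>z. z \<in> S \<Longrightarrow> u z = v z" "\<And>z. z \<in> S \<Longrightarrow> g z = g' z" "\<And>z. z \<in> S \<Longrightarrow> l z = l' z" "lapG S u g l"
  shows "lapG S v g' l'"
proof -
  have *: "dC2 e S v a b" if "dC2 e S u a b" for e a b
    using that assms(2) has_dd_cong[OF assms(1), of u v a a e] continuous_on_cong[of S S u v]
    unfolding dC2_def by auto
  show ?thesis using assms(5) * assms(3,4) unfolding lapG_def by metis
qed

lemma has_dd_add:
  assumes "has_dd e S f f'" "has_dd e S g g'"
  shows "has_dd e S (\<lambda>z. f z + g z) (\<lambda>z. f' z + g' z)"
  using assms unfolding has_dd_def by (auto intro!: derivative_eq_intros)

lemma has_dd_cmult:
  assumes "has_dd e S f f'"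
  shows "has_dd e S (\<lambda>z. c * f z) (\<lambda>z. c * f' z)"
  using assms unfolding has_dd_def by (auto intro!: derivative_eq_intros)

lemma dC2_add: "dC2 e S u a b \<Longrightarrow> dC2 e S v a' b' \<Longrightarrow> dC2 e S (\<lambda>z. u z + v z) (\<lambda>z. a z + a' z) (\<lambda>z. b z + b' z)"
  unfolding dC2_def by (auto intro!: has_dd_add continuous_intros)

lemma dC2_cmult: "dC2 e S u a b \<Longrightarrow> dC2 e S (\<lambda>z. c * u z) (\<lambda>z. c * a z) (\<lambda>z. c * b z)"
  unfolding dC2_def by (auto intro!: has_dd_cmult continuous_intros)

text \<open>The square norm of the gradient is not additive, so it is left existential; only the
  Laplacian is tracked. The same convention is used for scalar multiples.\<close>

lemma lapG_add:
  assumes "lapG S u g l" "lapG S v g' l'"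
  shows "\<exists>g''. lapG S (\<lambda>z. u z + v z) g'' (\<lambda>z. l z + l' z)"
proof -
  obtain ux uxx uy uyy where *: "dC2 1 S u ux uxx" "dC2 \<i> S u uy uyy" "\<forall>z\<in>S. l z = uxx z + uyy z"
    using assms unfolding lapG_def by blast
  obtain vx vxx vy vyy where **: "dC2 1 S v vx vxx" "dC2 \<i> S v vy vyy" "\<forall>z\<in>S. l' z = vxx z + vyy z"
    using assms unfolding lapG_def by blast
  show ?thesis unfolding lapG_def
    by (rule exI, rule exI[of _ "\<lambda>z. ux z + vx z"], rule exI[of _ "\<lambda>z. uxx z + vxx z"],
        rule exI[of _ "\<lambda>z. uy z + vy z"], rule exI[of _ "\<lambda>z. uyy z + vyy z"])
       (use * ** in \<open>auto intro!: dC2_add\<close>)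
qed

lemma lapG_cmult:
  assumes "lapG S u g l"
  shows "\<exists>g''. lapG S (\<lambda>z. c * u z) g'' (\<lambda>z. c * l z)"
proof -
  obtain ux uxx uy uyy where *: "dC2 1 S u ux uxx" "dC2 \<i> S u uy uyy" "\<forall>z\<in>S. l z = uxx z + uyy z"
    using assms unfolding lapG_def by blast
  show ?thesis unfolding lapG_def
    by (rule exI, rule exI[of _ "\<lambda>z. c * ux z"], rule exI[of _ "\<lambda>z. c * uxx z"],
        rule exI[of _ "\<lambda>z. c * uy z"], rule exI[of _ "\<lambda>z. c * uyy z"])
       (use * in \<open>auto intro!: dC2_cmult simp: algebra_simps\<close>)
qed

lemma lapG_const: "lapG S (\<lambda>_. c) (\<lambda>_. 0) (\<lambda>_. 0)"
  unfolding lapG_def dC2_def has_dd_def by (rule exI[of _ "\<lambda>_. 0"])+ auto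

lemma Green_lapG:
  assumes u: "lapG S u g l" and c: "lapG S c g' l'"
    and S: "open S" "compact K" "K \<subseteq> S" "\<And>z. z \<in> S - K \<Longrightarrow> c z = 0"
  shows "set_integrable lborel S (\<lambda>z. c z * l z)" "set_integrable lborel S (\<lambda>z. u z * l' z)"
    "(LINT z:S|lborel. c z * l z) = (LINT z:S|lborel. u z * l' z)"
proof -
  obtain ux uxx uy uyy where *: "dC2 1 S u ux uxx" "dC2 \<i> S u uy uyy" "\<And>z. z \<in> S \<Longrightarrow> l z = uxx z + uyy z"
    using u unfolding lapG_def by blast
  obtain cx cxx cy cyy where **: "dC2 1 S c cx cxx" "dC2 \<i> S c cy cyy" "\<And>z. z \<in> S \<Longrightarrow> l' z = cxx z + cyy z"
    using c unfolding lapG_def by blast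
  note G1 = Green_direction[OF *(1) **(1) S] and G2 = Green_direction[OF *(2) **(2) S]
  have e1: "indicator S z *\<^sub>R (c z * l z) = indicator S z *\<^sub>R (c z * uxx z) + indicator S z *\<^sub>R (c z * uyy z)"
    and e2: "indicator S z *\<^sub>R (u z * l' z) = indicator S z *\<^sub>R (u z * cxx z) + indicator S z *\<^sub>R (u z * cyy z)" for z
    using *(3)[of z] **(3)[of z] by (auto simp: indicator_def algebra_simps)
  show "set_integrable lborel S (\<lambda>z. c z * l z)" "set_integrable lborel S (\<lambda>z. u z * l' z)"
    using G1 G2 unfolding set_integrable_def e1 e2 by auto
  show "(LINT z:S|lborel. c z * l z) = (LINT z:S|lborel. u z * l' z)"
    using G1 G2 unfolding set_integrable_def set_lebesgue_integral_def e1 e2 by simp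
qed

section \<open>Composition with functions of one real variable\<close>

definition rC2 :: "(real \<Rightarrow> real) \<Rightarrow> (real \<Rightarrow> real) \<Rightarrow> (real \<Rightarrow> real) \<Rightarrow> bool" where
  "rC2 k k1 k2 \<longleftrightarrow> (\<forall>x. (k has_real_derivative k1 x) (at x)) \<and>
     (\<forall>x. (k1 has_real_derivative k2 x) (at x)) \<and> continuous_on UNIV k2"

lemma dC2_compose:
  assumes "rC2 k k1 k2" "dC2 e S u u1 u2"
  shows "dC2 e S (\<lambda>z. k (u z)) (\<lambda>z. k1 (u z) * u1 z) (\<lambda>z. k2 (u z) * (u1 z)\<^sup>2 + k1 (u z) * u2 z)"
proof -
  have ck: "continuous_on UNIV k" "continuous_on UNIV k1" "continuous_on UNIV k2"
    using assms(1) unfolding rC2_def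
    by (auto intro!: DERIV_isCont continuous_at_imp_continuous_on)
  have d: "has_dd e S (\<lambda>z. k (u z)) (\<lambda>z. k1 (u z) * u1 z)" "has_dd e S (\<lambda>z. k1 (u z)) (\<lambda>z. k2 (u z) * u1 z)"
  proof -
    have *: "((\<lambda>t. h (u (z + t *\<^sub>R e))) has_real_derivative h' (u z) * u1 z) (at 0)"
      if "\<And>x. (h has_real_derivative h' x) (at x)" "z \<in> S" for h h' z
      using DERIV_chain2[of h "h' (u z)" "\<lambda>t. u (z + t *\<^sub>R e)" 0 "u1 z" UNIV] that assms(2)
      unfolding dC2_def has_dd_def by simp
    show "has_dd e S (\<lambda>z. k (u z)) (\<lambda>z. k1 (u z) * u1 z)" "has_dd e S (\<lambda>z. k1 (u z)) (\<lambda>z. k2 (u z) * u1 z)"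
      unfolding has_dd_def using *[of k k1] *[of k1 k2] assms(1) unfolding rC2_def by auto
  qed
  have c: "continuous_on S (\<lambda>z. k (u z))" "continuous_on S (\<lambda>z. k1 (u z))" "continuous_on S (\<lambda>z. k2 (u z))"
    using ck assms(2) unfolding dC2_def by (auto intro: continuous_on_compose2)
  have "has_dd e S (\<lambda>z. k1 (u z) * u1 z) (\<lambda>z. (k2 (u z) * u1 z) * u1 z + k1 (u z) * u2 z)"
    using has_dd_mult[OF d(2), of u1 u2] assms unfolding dC2_def by auto
  then show ?thesis
    using d c assms(2) unfolding dC2_def by (auto intro!: continuous_intros simp: power2_eq_square mult.assoc)
qed

text \<open>The chain rule for the Laplacian contains k2(u) times the square norm of the gradient.
  This term is the reason why \<open>lapG\<close> carries the gradient at all.\<close>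

lemma lapG_compose:
  assumes "rC2 k k1 k2" "lapG S u g l"
  shows "lapG S (\<lambda>z. k (u z)) (\<lambda>z. (k1 (u z))\<^sup>2 * g z) (\<lambda>z. k2 (u z) * g z + k1 (u z) * l z)"
proof -
  obtain ux uxx uy uyy where *: "dC2 1 S u ux uxx" "dC2 \<i> S u uy uyy"
    "\<And>z. z \<in> S \<Longrightarrow> g z = (ux z)\<^sup>2 + (uy z)\<^sup>2" "\<And>z. z \<in> S \<Longrightarrow> l z = uxx z + uyy z"
    using assms(2) unfolding lapG_def by blast
  show ?thesis unfolding lapG_def
    by (rule exI, rule exI, rule exI, rule exI, rule conjI[OF dC2_compose[OF assms(1) *(1)] conjI[OF dC2_compose[OF assms(1) *(2)]]])
       (use * in \<open>auto simp: algebra_simps power2_eq_square\<close>)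
qed

text \<open>For $r \ne 0$ this regularizes $\ln|z-p|$, which is the case $r = 0$.\<close>

definition logabs :: "complex \<Rightarrow> real \<Rightarrow> complex \<Rightarrow> real" where
  "logabs p r z = ln ((cmod (z - p))\<^sup>2 + r\<^sup>2) / 2"

lemma logabs_0: "z \<noteq> p \<Longrightarrow> logabs p 0 z = ln (cmod (z - p))"
  by (simp add: logabs_def ln_realpow)

lemma dC2_logabs:
  assumes "\<And>z. z \<in> S \<Longrightarrow> r \<noteq> 0 \<or> z \<noteq> p"
  shows "dC2 e S (logabs p r) (\<lambda>z. ((z - p) \<bullet> e) / ((cmod (z - p))\<^sup>2 + r\<^sup>2))
     (\<lambda>z. (cmod e)\<^sup>2 / ((cmod (z - p))\<^sup>2 + r\<^sup>2) - 2 * ((z - p) \<bullet> e)\<^sup>2 / ((cmod (z - p))\<^sup>2 + r\<^sup>2)\<^sup>2)"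
proof -
  have pos: "(cmod (z - p))\<^sup>2 + r\<^sup>2 > 0" if "z \<in> S" for z
    using assms[OF that] by (auto simp: add_pos_nonneg add_nonneg_pos)
  note pos' = pos[unfolded cmod_power2]
  have n: "(Re z - Re p)\<^sup>2 + (Im z - Im p)\<^sup>2 + r\<^sup>2 > 0" if "z \<in> S" for z
    using pos'[OF that] by simp
  have "has_dd e S (logabs p r) (\<lambda>z. ((z - p) \<bullet> e) / ((cmod (z - p))\<^sup>2 + r\<^sup>2))"
    unfolding has_dd_def
  proof
    fix z assume z: "z \<in> S"
    define D where "D = (Re z - Re p)\<^sup>2 + (Im z - Im p)\<^sup>2 + r\<^sup>2"
    define I where "I = (Re z - Re p) * Re e + (Im z - Im p) * Im e"
    have D: "D > 0" using n[OF z] by (simp add: D_def)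
    have "((\<lambda>t. (Re z + t * Re e - Re p)\<^sup>2 + (Im z + t * Im e - Im p)\<^sup>2 + r\<^sup>2) has_real_derivative 2 * I) (at 0)"
      by (auto intro!: derivative_eq_intros simp: I_def algebra_simps)
    then have "((\<lambda>t. ln ((Re z + t * Re e - Re p)\<^sup>2 + (Im z + t * Im e - Im p)\<^sup>2 + r\<^sup>2) / 2) has_real_derivative
        (1 / D * (2 * I)) / 2) (at 0)"
      by (intro DERIV_cdivide DERIV_chain2[where f = ln])
         (use D in \<open>simp_all add: D_def DERIV_ln_divide\<close>)
    moreover have "(1 / D * (2 * I)) / 2 = I / D" by simp
    ultimately show "((\<lambda>t. logabs p r (z + t *\<^sub>R e)) has_real_derivative ((z - p) \<bullet> e) / ((cmod (z - p))\<^sup>2 + r\<^sup>2)) (at 0)"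
      unfolding logabs_def cmod_power2 inner_complex_def D_def I_def by simp
  qed
  moreover have "has_dd e S (\<lambda>z. ((z - p) \<bullet> e) / ((cmod (z - p))\<^sup>2 + r\<^sup>2))
    (\<lambda>z. (cmod e)\<^sup>2 / ((cmod (z - p))\<^sup>2 + r\<^sup>2) - 2 * ((z - p) \<bullet> e)\<^sup>2 / ((cmod (z - p))\<^sup>2 + r\<^sup>2)\<^sup>2)"
    unfolding has_dd_def
  proof
    fix z assume z: "z \<in> S"
    define D where "D = (Re z - Re p)\<^sup>2 + (Im z - Im p)\<^sup>2 + r\<^sup>2"
    define I where "I = (Re z - Re p) * Re e + (Im z - Im p) * Im e"
    define N where "N = (Re e)\<^sup>2 + (Im e)\<^sup>2"
    have D: "D > 0" using n[OF z] by (simp add: D_def)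
    have "((\<lambda>t. ((Re z + t * Re e - Re p) * Re e + (Im z + t * Im e - Im p) * Im e) /
        ((Re z + t * Re e - Re p)\<^sup>2 + (Im z + t * Im e - Im p)\<^sup>2 + r\<^sup>2)) has_real_derivative
        (N * D - I * (2 * I)) / (D * D)) (at 0)"
      by (rule derivative_eq_intros | rule refl | use D in \<open>simp add: D_def I_def N_def power2_eq_square algebra_simps\<close>)+
    moreover have "(N * D - I * (2 * I)) / (D * D) = N / D - 2 * I\<^sup>2 / D\<^sup>2"
      using D by (simp add: field_simps power2_eq_square)
    ultimately show "((\<lambda>t. ((z + t *\<^sub>R e - p) \<bullet> e) / ((cmod (z + t *\<^sub>R e - p))\<^sup>2 + r\<^sup>2)) has_real_derivative
      (cmod e)\<^sup>2 / ((cmod (z - p))\<^sup>2 + r\<^sup>2) - 2 * ((z - p) \<bullet> e)\<^sup>2 / ((cmod (z - p))\<^sup>2 + r\<^sup>2)\<^sup>2) (at 0)"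
      unfolding cmod_power2 inner_complex_def by (simp add: D_def I_def N_def)
  qed
  moreover have "continuous_on S (logabs p r)"
    "continuous_on S (\<lambda>z. ((z - p) \<bullet> e) / ((cmod (z - p))\<^sup>2 + r\<^sup>2))"
    "continuous_on S (\<lambda>z. (cmod e)\<^sup>2 / ((cmod (z - p))\<^sup>2 + r\<^sup>2) - 2 * ((z - p) \<bullet> e)\<^sup>2 / ((cmod (z - p))\<^sup>2 + r\<^sup>2)\<^sup>2)"
    unfolding logabs_def using pos by (auto intro!: continuous_intros) (metis less_irrefl pos)+
  ultimately show ?thesis unfolding dC2_def by blast
qed

text \<open>For r = 0 this is the harmonicity of the logarithm. For r \<noteq> 0 the Laplacian is a
  smoothed point mass at p, half the area density of a round sphere in stereographic projection; its
  total mass 2 pi is computed in \<open>sphere_area\<close>.\<close>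

lemma lapG_logabs:
  assumes "\<And>z. z \<in> S \<Longrightarrow> r \<noteq> 0 \<or> z \<noteq> p"
  shows "lapG S (logabs p r) (\<lambda>z. (cmod (z - p))\<^sup>2 / ((cmod (z - p))\<^sup>2 + r\<^sup>2)\<^sup>2)
     (\<lambda>z. 2 * r\<^sup>2 / ((cmod (z - p))\<^sup>2 + r\<^sup>2)\<^sup>2)"
proof -
  let ?D = "\<lambda>z. (cmod (z - p))\<^sup>2 + r\<^sup>2"
  have g: "(cmod (z - p))\<^sup>2 / (?D z)\<^sup>2 = (((z - p) \<bullet> 1) / ?D z)\<^sup>2 + (((z - p) \<bullet> \<i>) / ?D z)\<^sup>2" for z
    unfolding cmod_power2 by (simp add: power_divide add_divide_distrib)
  have l: "2 * r\<^sup>2 / (?D z)\<^sup>2 = ((cmod 1)\<^sup>2 / ?D z - 2 * ((z - p) \<bullet> 1)\<^sup>2 / (?D z)\<^sup>2)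
      + ((cmod \<i>)\<^sup>2 / ?D z - 2 * ((z - p) \<bullet> \<i>)\<^sup>2 / (?D z)\<^sup>2)" if "z \<in> S" for z
  proof -
    have "?D z > 0" using assms[OF that] by (auto simp: add_pos_nonneg add_nonneg_pos)
    moreover have "(1 / D - 2 * x\<^sup>2 / D\<^sup>2) + (1 / D - 2 * y\<^sup>2 / D\<^sup>2) = 2 * c / D\<^sup>2"
      if "D > 0" "D = x\<^sup>2 + y\<^sup>2 + c" for D x y c :: real
    proof -
      have "2 * D / D\<^sup>2 = 2 / D" using that(1) by (simp add: power2_eq_square)
      then have "(1 / D - 2 * x\<^sup>2 / D\<^sup>2) + (1 / D - 2 * y\<^sup>2 / D\<^sup>2) = (2 * D - 2 * x\<^sup>2 - 2 * y\<^sup>2) / D\<^sup>2"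
        by (simp add: diff_divide_distrib)
      also have "2 * D - 2 * x\<^sup>2 - 2 * y\<^sup>2 = 2 * c" using that by simp
      finally show ?thesis .
    qed
    ultimately show ?thesis by (simp add: cmod_power2)
  qed
  show ?thesis unfolding lapG_def
    by (rule exI, rule exI, rule exI, rule exI,
        rule conjI[OF dC2_logabs[OF assms] conjI[OF dC2_logabs[OF assms] ballI[OF conjI[OF g l]]]])
qed

section \<open>Truncated powers\<close>

lemma DERIV_max_power:
  fixes x :: real
  assumes n: "n \<ge> 2"
  shows "((\<lambda>x. (max 0 x) ^ n) has_real_derivative real n * (max 0 x) ^ (n - 1)) (at x)"
proof -
  consider "x > 0" | "x < 0" | "x = 0" by linarith
  then show ?thesis
  proof cases
    case 1
    have "\<forall>\<^sub>F y in nhds x. y \<in> {0<..}"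
      using 1 by (intro eventually_nhds_in_open) auto
    then have ev: "\<forall>\<^sub>F y in nhds x. (max 0 y) ^ n = y ^ n"
      by (rule eventually_mono) (simp add: max_def)
    have "((\<lambda>y. y ^ n) has_real_derivative real n * x ^ (n - 1)) (at x)"
      using DERIV_pow[of n x UNIV] by simp
    then show ?thesis using 1 DERIV_cong_ev[OF refl ev refl] by (simp add: max_def)
  next
    case 2
    have "\<forall>\<^sub>F y in nhds x. y \<in> {..<0}"
      using 2 by (intro eventually_nhds_in_open) auto
    then have ev: "\<forall>\<^sub>F y in nhds x. (max 0 y) ^ n = 0"
      by (rule eventually_mono) (use n in \<open>simp add: max_def\<close>)
    show ?thesis using 2 n DERIV_cong_ev[OF refl ev refl] by (simp add: max_def power_0_left)
  next
    case 3
    have "((\<lambda>h::real. (max 0 h) ^ n / h) \<longlongrightarrow> 0) (at 0)"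
    proof (rule Lim_null_comparison)
      have "norm ((max 0 h) ^ n / h) \<le> \<bar>h\<bar> ^ (n - 1)" for h :: real
      proof (cases "h > 0")
        case True
        then have "(max 0 h) ^ n / h = h ^ (n - 1)" using n by (simp add: power_diff)
        then show ?thesis using True by simp
      next
        case False
        then have "(max 0 h) ^ n = 0" using n by (simp add: max_def power_0_left)
        then show ?thesis by (simp only: div_0 norm_zero) simp
      qed
      then show "\<forall>\<^sub>F h in at 0. norm ((max 0 h) ^ n / h) \<le> \<bar>h\<bar> ^ (n - 1)"
        by (intro always_eventually allI)
      have "((\<lambda>h::real. \<bar>h\<bar> ^ (n - 1)) \<longlongrightarrow> \<bar>0\<bar> ^ (n - 1)) (at 0)" by (intro tendsto_intros)
      then show "((\<lambda>h::real. \<bar>h\<bar> ^ (n - 1)) \<longlongrightarrow> 0) (at 0)" using n by (simp add: power_0_left)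
    qed
    then show ?thesis using 3 n unfolding has_field_derivative_iff by (simp add: power_0_left)
  qed
qed

text \<open>The truncated cube is a spline that vanishes on a half-line and is still twice
  continuously differentiable. All cutoff functions below are built from it.\<close>

lemma rC2_max_cube: "rC2 (\<lambda>x. (max 0 x) ^ 3) (\<lambda>x. 3 * (max 0 x)\<^sup>2) (\<lambda>x. 6 * max 0 x)"
  unfolding rC2_def
proof (intro conjI allI)
  show "((\<lambda>x. (max 0 x) ^ 3) has_real_derivative 3 * (max 0 x)\<^sup>2) (at x)" for x :: real
    using DERIV_max_power[of 3 x] by simp
  show "((\<lambda>x. 3 * (max 0 x)\<^sup>2) has_real_derivative 6 * max 0 x) (at x)" for x :: real
    using DERIV_cmult[OF DERIV_max_power[of 2 x], of 3] by simp
  show "continuous_on UNIV (\<lambda>x::real. 6 * max 0 x)" by (intro continuous_intros)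
qed

lemma rC2_add: "rC2 k k1 k2 \<Longrightarrow> rC2 h h1 h2 \<Longrightarrow> rC2 (\<lambda>x. k x + h x) (\<lambda>x. k1 x + h1 x) (\<lambda>x. k2 x + h2 x)"
  unfolding rC2_def by (intro conjI allI DERIV_add continuous_intros) auto

lemma rC2_cmult: "rC2 k k1 k2 \<Longrightarrow> rC2 (\<lambda>x. c * k x) (\<lambda>x. c * k1 x) (\<lambda>x. c * k2 x)"
  unfolding rC2_def by (intro conjI allI DERIV_cmult continuous_intros) auto

lemma rC2_affine:
  assumes "rC2 k k1 k2"
  shows "rC2 (\<lambda>x. k (a * x + b)) (\<lambda>x. a * k1 (a * x + b)) (\<lambda>x. a\<^sup>2 * k2 (a * x + b))"
proof -
  have *: "((\<lambda>x. h (a * x + b)) has_real_derivative h' (a * x + b) * a) (at x)"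
    if "\<And>x. (h has_real_derivative h' x) (at x)" for h h' x
    by (rule DERIV_chain2[OF that]) (auto intro!: derivative_eq_intros)
  have 1: "((\<lambda>x. k (a * x + b)) has_real_derivative a * k1 (a * x + b)) (at x)" for x
    using *[of k k1 x] assms unfolding rC2_def mult.commute[of a "k1 (a * x + b)"] by blast
  have 2: "((\<lambda>x. a * k1 (a * x + b)) has_real_derivative a\<^sup>2 * k2 (a * x + b)) (at x)" for x
  proof -
    have "((\<lambda>x. k1 (a * x + b)) has_real_derivative k2 (a * x + b) * a) (at x)"
      using *[of k1 k2 x] assms unfolding rC2_def by blast
    from DERIV_cmult[OF this, of a] show ?thesis
      by (rule DERIV_cong) (simp add: power2_eq_square)
  qed
  have 3: "continuous_on UNIV (\<lambda>x. a\<^sup>2 * k2 (a * x + b))"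
  proof -
    have "continuous_on UNIV k2" using assms unfolding rC2_def by (elim conjE)
    then have "continuous_on UNIV (\<lambda>x. k2 (a * x + b))"
      by (rule continuous_on_compose2) (auto intro!: continuous_intros)
    then show ?thesis by (rule continuous_on_mult_left)
  qed
  show ?thesis unfolding rC2_def by (intro conjI allI 1 2 3)
qed

section \<open>A mean value inequality and logarithmic growth at a puncture\<close>

text \<open>A second difference of truncated cubes: convex, zero for x \<le> 0 and affine of slope 6
  for x \<ge> 2. Its second derivative \<open>hat\<close> is the tent on [0, 2] with peak 6 at
  1.\<close>

definition ramp :: "real \<Rightarrow> real" where
  "ramp x = (max 0 x) ^ 3 - 2 * (max 0 (x - 1)) ^ 3 + (max 0 (x - 2)) ^ 3"
definition ramp' :: "real \<Rightarrow> real" where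
  "ramp' x = 3 * (max 0 x)\<^sup>2 - 6 * (max 0 (x - 1))\<^sup>2 + 3 * (max 0 (x - 2))\<^sup>2"
definition hat :: "real \<Rightarrow> real" where
  "hat x = 6 * max 0 x - 12 * max 0 (x - 1) + 6 * max 0 (x - 2)"

lemma rC2_ramp: "rC2 ramp ramp' hat"
proof -
  have 1: "rC2 (\<lambda>x. (max 0 (1 * x + c)) ^ 3) (\<lambda>x. 1 * (3 * (max 0 (1 * x + c))\<^sup>2)) (\<lambda>x. 1\<^sup>2 * (6 * max 0 (1 * x + c)))" for c :: real
    by (rule rC2_affine[OF rC2_max_cube])
  have e: "(max 0 x) ^ 3 + (- 2) * (max 0 (1 * x + (- 1))) ^ 3 + (max 0 (1 * x + (- 2))) ^ 3 = ramp x"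
    "3 * (max 0 x)\<^sup>2 + (- 2) * (1 * (3 * (max 0 (1 * x + (- 1)))\<^sup>2)) + 1 * (3 * (max 0 (1 * x + (- 2)))\<^sup>2) = ramp' x"
    "6 * max 0 x + (- 2) * (1\<^sup>2 * (6 * max 0 (1 * x + (- 1)))) + 1\<^sup>2 * (6 * max 0 (1 * x + (- 2))) = hat x" for x
    unfolding ramp_def ramp'_def hat_def by auto
  show ?thesis
    using rC2_add[OF rC2_add[OF rC2_max_cube rC2_cmult[OF 1[of "-1"], of "-2"]] 1[of "-2"]]
    unfolding e .
qed

lemma continuous_hat: "continuous_on UNIV hat"
  using rC2_ramp by (simp add: rC2_def)

lemma hat_bounds: "0 \<le> hat x" "hat x \<le> 6"
  by (auto simp: hat_def max_def)

lemma hat_eq_0: "x \<le> 0 \<Longrightarrow> hat x = 0" "x \<ge> 2 \<Longrightarrow> hat x = 0"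
  by (auto simp: hat_def max_def)

lemma hat_ge_1: "1/3 \<le> x \<Longrightarrow> x \<le> 5/3 \<Longrightarrow> 1 \<le> hat x"
  by (auto simp: hat_def max_def)

lemma ramp_eq: "x \<le> 0 \<Longrightarrow> ramp x = 0" "x \<ge> 2 \<Longrightarrow> ramp x = 6 * x - 6"
  "x \<le> 0 \<Longrightarrow> ramp' x = 0" "x \<ge> 2 \<Longrightarrow> ramp' x = 6"
  by (auto simp: ramp_def ramp'_def max_def power2_eq_square power3_eq_cube algebra_simps)

lemma ramp'_bounds: "0 \<le> ramp' x" "ramp' x \<le> 6"
proof -
  have d: "(ramp' has_real_derivative hat x) (at x)" for x using rC2_ramp by (simp add: rC2_def)
  have mono: "ramp' a \<le> ramp' b" if "a \<le> b" for a b
    using that by (rule DERIV_nonneg_imp_nondecreasing) (intro exI conjI, rule d, rule hat_bounds)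
  show "0 \<le> ramp' x" using mono[of "min 0 x" x] ramp_eq(3)[of "min 0 x"] by simp
  show "ramp' x \<le> 6" using mono[of x "max 2 x"] ramp_eq(4)[of "max 2 x"] by simp
qed

lemma ramp_bounds: "0 \<le> ramp x" "ramp x \<le> 6 * max 0 x"
proof -
  have d: "(ramp has_real_derivative ramp' x) (at x)" for x using rC2_ramp by (simp add: rC2_def)
  have "ramp (min 0 x) \<le> ramp x"
    by (rule DERIV_nonneg_imp_nondecreasing) (simp, intro exI conjI, rule d, rule ramp'_bounds)
  then show "0 \<le> ramp x" using ramp_eq(1)[of "min 0 x"] by simp
  show "ramp x \<le> 6 * max 0 x"
  proof (cases "x \<le> 0")
    case False
    have "6 * 0 - ramp 0 \<le> 6 * x - ramp x"
    proof (rule DERIV_nonneg_imp_nondecreasing[of 0 x "\<lambda>x. 6 * x - ramp x"])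
      fix y show "\<exists>d. ((\<lambda>x. 6 * x - ramp x) has_real_derivative d) (at y) \<and> 0 \<le> d"
        using ramp'_bounds[of y] by (intro exI[of _ "6 - ramp' y"]) (auto intro!: derivative_eq_intros d)
    qed (use False in auto)
    then show ?thesis using False ramp_eq(1)[of 0] by simp
  qed (simp add: ramp_eq(1))
qed

section \<open>Change of scale and the area of the sphere\<close>

lemma integrable_affine_complex:
  fixes f :: "complex \<Rightarrow> real"
  assumes f: "f \<in> borel_measurable borel" and c: "c > (0::real)"
  shows "integrable lborel f \<longleftrightarrow> integrable lborel (\<lambda>w. f (p + c *\<^sub>R w))"
    "integral\<^sup>L lborel f = c\<^sup>2 * integral\<^sup>L lborel (\<lambda>w. f (p + c *\<^sub>R w))"
proof -
  have e: "(lborel :: complex measure) = density (distr lborel borel (\<lambda>x. p + c *\<^sub>R x)) (\<lambda>_. ennreal (c\<^sup>2))"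
    using lborel_affine[of c p] c by simp
  have m: "(\<lambda>x. p + c *\<^sub>R x) \<in> measurable lborel borel" by measurable
  show "integrable lborel f \<longleftrightarrow> integrable lborel (\<lambda>w. f (p + c *\<^sub>R w))"
    apply (subst e)
    apply (subst integrable_density)
    using f c m by (simp_all add: integrable_distr_eq)
  show "integral\<^sup>L lborel f = c\<^sup>2 * integral\<^sup>L lborel (\<lambda>w. f (p + c *\<^sub>R w))"
    apply (subst e)
    apply (subst integral_density)
    using f c m by (simp_all add: integral_distr)
qed

text \<open>A layer-cake computation takes the place of polar coordinates: the integrand is the
  integral of 4/(1+r)^3 over r \<ge> |z|^2, Fubini exchanges the order, and the disc |z|^2 \<le> r
  has area pi r. The remaining integral has the antiderivative 2 pi r^2/(1+r)^2.\<close>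

lemma nn_integral_sphere_area:
  "(\<integral>\<^sup>+(z::complex). ennreal (2 / ((cmod z)\<^sup>2 + 1)\<^sup>2) \<partial>lborel) = ennreal (2 * pi)"
proof -
  have inner: "ennreal (2 / ((cmod z)\<^sup>2 + 1)\<^sup>2) =
      (\<integral>\<^sup>+r. ennreal (4 / (1 + r) ^ 3) * indicator {(cmod z)\<^sup>2..} r \<partial>lborel)" for z :: complex
  proof -
    have "(\<integral>\<^sup>+r. ennreal (4 / (1 + r) ^ 3) * indicator {(cmod z)\<^sup>2..} r \<partial>lborel)
       = ennreal (0 - (- 2 / (1 + (cmod z)\<^sup>2)\<^sup>2))"
    proof (rule nn_integral_FTC_atLeast)
      fix x assume "(cmod z)\<^sup>2 \<le> x"
      then have x: "x \<ge> 0" by (meson order_trans zero_le_power2)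
      show "((\<lambda>r. - 2 / (1 + r)\<^sup>2) has_real_derivative 4 / (1 + x) ^ 3) (at x)"
      proof -
        have "((\<lambda>r. - 2 / (1 + r)\<^sup>2) has_real_derivative
            (0 * (1 + x)\<^sup>2 - (- 2) * (2 * (1 + x))) / ((1 + x)\<^sup>2 * (1 + x)\<^sup>2)) (at x)"
          using x by (auto intro!: derivative_eq_intros) (simp only: minus_divide_left, simp add: add.commute)
        moreover have "(0 * y\<^sup>2 - (- 2) * (2 * y)) / (y\<^sup>2 * y\<^sup>2) = 4 / y ^ 3" if "y \<noteq> 0" for y :: real
          using that by (simp add: power2_eq_square power3_eq_cube)
        moreover have "1 + x \<noteq> 0" using x by simp
        ultimately show ?thesis by metis
      qed
      show "0 \<le> 4 / (1 + x) ^ 3" using x by simp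
    next
      show "((\<lambda>r::real. - 2 / (1 + r)\<^sup>2) \<longlongrightarrow> 0) at_top" by real_asymp
    qed simp
    then show ?thesis by (simp add: add.commute)
  qed
  have "(\<integral>\<^sup>+(z::complex). ennreal (2 / ((cmod z)\<^sup>2 + 1)\<^sup>2) \<partial>lborel)
      = (\<integral>\<^sup>+z. (\<integral>\<^sup>+r. ennreal (4 / (1 + r) ^ 3) * indicator {(cmod z)\<^sup>2..} r \<partial>lborel) \<partial>lborel)"
    by (simp only: inner)
  also have "\<dots> = (\<integral>\<^sup>+r. (\<integral>\<^sup>+z. ennreal (4 / (1 + r) ^ 3) * indicator {(cmod (z::complex))\<^sup>2..} r \<partial>lborel) \<partial>lborel)"
    by (rule lborel_pair.Fubini'[symmetric]) (simp add: indicator_def case_prod_beta' cong: if_cong, measurable)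
  also have "\<dots> = (\<integral>\<^sup>+r. ennreal (4 * pi * r / (1 + r) ^ 3) * indicator {0..} r \<partial>lborel)"
  proof (rule nn_integral_cong)
    fix r :: real
    show "(\<integral>\<^sup>+z. ennreal (4 / (1 + r) ^ 3) * indicator {(cmod (z::complex))\<^sup>2..} r \<partial>lborel)
      = ennreal (4 * pi * r / (1 + r) ^ 3) * indicator {0..} r"
    proof (cases "r \<ge> 0")
      case True
      have "indicator {(cmod (z::complex))\<^sup>2..} r = (indicator (cball 0 (sqrt r)) z :: ennreal)" for z
      proof -
        have "(cmod z)\<^sup>2 \<le> r \<longleftrightarrow> cmod z \<le> sqrt r"
          by (metis abs_norm_cancel real_sqrt_abs real_sqrt_le_iff)
        then show ?thesis by (simp add: indicator_def)
      qed
      then have "(\<integral>\<^sup>+z. ennreal (4 / (1 + r) ^ 3) * indicator {(cmod (z::complex))\<^sup>2..} r \<partial>lborel)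
         = ennreal (4 / (1 + r) ^ 3) * emeasure lborel (cball (0::complex) (sqrt r))"
        by (simp add: nn_integral_cmult_indicator)
      also have "\<dots> = ennreal (4 * pi * r / (1 + r) ^ 3)"
        using True by (simp add: emeasure_cball unit_ball_vol_2 ennreal_mult[symmetric] mult_ac)
      finally show ?thesis using True by simp
    next
      case False
      have "\<not> (cmod (z::complex))\<^sup>2 \<le> r" for z using False by (meson order_trans zero_le_power2)
      then show ?thesis using False by simp
    qed
  qed
  also have "\<dots> = ennreal (2 * pi - 2 * pi * 0\<^sup>2 / (1 + 0)\<^sup>2)"
  proof (rule nn_integral_FTC_atLeast)
    fix x :: real assume x: "0 \<le> x"
    have "(2 * pi * (2 * x)) * (1 + x)\<^sup>2 - (2 * pi * x\<^sup>2) * (2 * (1 + x)) = 4 * pi * x * (1 + x)"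
      by (simp add: power2_eq_square algebra_simps)
    moreover have "4 * pi * x * y / (y\<^sup>2 * y\<^sup>2) = 4 * pi * x / y ^ 3" if "y \<noteq> 0" for y
      using that by (simp add: power2_eq_square power3_eq_cube)
    ultimately have "((2 * pi * (2 * x)) * (1 + x)\<^sup>2 - (2 * pi * x\<^sup>2) * (2 * (1 + x))) / ((1 + x)\<^sup>2 * (1 + x)\<^sup>2) = 4 * pi * x / (1 + x) ^ 3"
      using x by (metis add_nonneg_eq_0_iff zero_le_one zero_neq_one)
    moreover have "((\<lambda>r. 2 * pi * r\<^sup>2 / (1 + r)\<^sup>2) has_real_derivative
        ((2 * pi * (2 * x)) * (1 + x)\<^sup>2 - (2 * pi * x\<^sup>2) * (2 * (1 + x))) / ((1 + x)\<^sup>2 * (1 + x)\<^sup>2)) (at x)"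
      using x by (auto intro!: derivative_eq_intros)
    ultimately show "((\<lambda>r. 2 * pi * r\<^sup>2 / (1 + r)\<^sup>2) has_real_derivative 4 * pi * x / (1 + x) ^ 3) (at x)" by simp
    show "0 \<le> 4 * pi * x / (1 + x) ^ 3" using x by simp
  next
    show "((\<lambda>r::real. 2 * pi * r\<^sup>2 / (1 + r)\<^sup>2) \<longlongrightarrow> 2 * pi) at_top" by real_asymp
  qed simp
  finally show ?thesis by simp
qed

lemma sphere_area:
  assumes r: "r > 0"
  shows "integrable lborel (\<lambda>z. 2 * r\<^sup>2 / ((cmod (z - p))\<^sup>2 + r\<^sup>2)\<^sup>2)"
    "integral\<^sup>L lborel (\<lambda>z. 2 * r\<^sup>2 / ((cmod (z - p))\<^sup>2 + r\<^sup>2)\<^sup>2) = 2 * pi"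
proof -
  let ?f = "\<lambda>z. 2 * r\<^sup>2 / ((cmod (z - p))\<^sup>2 + r\<^sup>2)\<^sup>2"
  let ?g = "\<lambda>z::complex. 2 / ((cmod z)\<^sup>2 + 1)\<^sup>2"
  have g: "has_bochner_integral lborel ?g (2 * pi)"
    by (rule has_bochner_integral_nn_integral) (auto simp: nn_integral_sphere_area)
  have gi: "integrable lborel ?g" "integral\<^sup>L lborel ?g = 2 * pi"
    using g by (simp_all add: has_bochner_integral_iff)
  have e: "?f (p + r *\<^sub>R w) = (1 / r\<^sup>2) * ?g w" for w
  proof -
    have "(cmod (p + r *\<^sub>R w - p))\<^sup>2 + r\<^sup>2 = r\<^sup>2 * ((cmod w)\<^sup>2 + 1)"
      by (simp add: power_mult_distrib algebra_simps)
    then show ?thesis using r by (simp add: power_mult_distrib power2_eq_square)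
  qed
  have m: "?f \<in> borel_measurable borel" by measurable
  show "integrable lborel ?f"
    unfolding integrable_affine_complex(1)[OF m r, of p] e by (intro integrable_mult_right gi)
  show "integral\<^sup>L lborel ?f = 2 * pi"
    unfolding integrable_affine_complex(2)[OF m r, of p] e integral_mult_right_zero gi using r by simp
qed

text \<open>A smeared mean value inequality for subharmonic functions. The test function is
  \<open>ramp\<close> of ln \<rho> minus a regularized logarithm centred at z0. Its Laplacian is a
  tent-weighted density on an annulus minus \<open>ramp'\<close> times a mass 2 pi that concentrates
  at z0, where \<open>ramp'\<close> is 6; this gives the factor 12 pi.\<close>

lemma mean_value_hat:
  assumes S: "open S" and u: "lapG S u g l" and l: "\<And>z. z \<in> S \<Longrightarrow> l z \<ge> 0"
    and \<rho>: "\<rho> > 0" "cball z0 \<rho> \<subseteq> S"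
  shows "12 * pi * u z0 \<le> (LINT z:S|lborel. u z * (hat (ln \<rho> - logabs z0 0 z) / (cmod (z - z0))\<^sup>2))"
proof -
  define K where "K = cball z0 \<rho>"
  have K: "compact K" "K \<subseteq> S" "z0 \<in> K" using \<rho> by (auto simp: K_def)
  have cu: "continuous_on S u" using lapG_continuous[OF u] by blast
  have z0S: "z0 \<in> S" using K by blast
  obtain M where M: "M > 0" "\<And>z. z \<in> K \<Longrightarrow> \<bar>u z\<bar> \<le> M"
  proof -
    have "compact (u ` K)" by (intro compact_continuous_image continuous_on_subset[OF cu] K)
    then show ?thesis using that by (force dest!: compact_imp_bounded simp: bounded_pos)
  qed
  define r where "r n = 1 / real (Suc n)" for n
  have r: "r n > 0" for n by (simp add: r_def)
  have rlim: "r \<longlonglongrightarrow> 0" unfolding r_def using LIMSEQ_inverse_real_of_nat by (simp add: inverse_eq_divide)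
  define D where "D n z = (cmod (z - z0))\<^sup>2 + (r n)\<^sup>2" for n z
  have Dpos: "D n z > 0" for n z using r[of n] by (simp add: D_def add_nonneg_pos)
  define x where "x n z = - 1 * logabs z0 (r n) z + ln \<rho>" for n z
  have xD: "x n z = ln \<rho> - ln (D n z) / 2" for n z by (simp add: x_def logabs_def D_def)
  have x_out: "x n z \<le> 0" if "z \<notin> K" for n z
  proof -
    have "\<rho> < cmod (z - z0)" using that by (simp add: K_def dist_norm norm_minus_commute)
    then have "\<rho>\<^sup>2 \<le> (cmod (z - z0))\<^sup>2" using \<rho> by (intro power_mono) auto
    then have "\<rho>\<^sup>2 \<le> D n z" by (simp add: D_def add_increasing2)
    then have "ln (\<rho>\<^sup>2) \<le> ln (D n z)" using \<rho> Dpos by (subst ln_le_cancel_iff) auto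
    then show ?thesis using \<rho> by (simp add: xD ln_realpow)
  qed
  have lapc: "lapG S (\<lambda>z. ramp (x n z)) (\<lambda>z. (- 1 * ramp' (x n z))\<^sup>2 * ((cmod (z - z0))\<^sup>2 / (D n z)\<^sup>2))
     (\<lambda>z. (- 1)\<^sup>2 * hat (x n z) * ((cmod (z - z0))\<^sup>2 / (D n z)\<^sup>2) + (- 1 * ramp' (x n z)) * (2 * (r n)\<^sup>2 / (D n z)\<^sup>2))" for n
    unfolding x_def D_def
    using lapG_compose[OF rC2_affine[OF rC2_ramp, of "-1" "ln \<rho>"] lapG_logabs[of S "r n" z0]] r[of n] by auto
  have cx: "continuous_on UNIV (x n)" and cD: "continuous_on UNIV (D n)" for n
  proof -
    show "continuous_on UNIV (D n)" unfolding D_def by (intro continuous_intros)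
    then show "continuous_on UNIV (x n)" unfolding xD using Dpos by (intro continuous_intros) (auto simp: less_imp_neq[symmetric])
  qed
  have cr: "continuous_on UNIV ramp'" using rC2_ramp unfolding rC2_def
    by (auto intro!: DERIV_isCont continuous_at_imp_continuous_on)
  have ch: "continuous_on S (\<lambda>z. hat (x n z))" "continuous_on S (\<lambda>z. ramp' (x n z))" "continuous_on S (D n)" for n
    using continuous_on_compose2[OF continuous_hat cx[of n]] continuous_on_compose2[OF cr cx[of n]] cD
    by (auto intro: continuous_on_subset)
  define A where "A n z = u z * (hat (x n z) * ((cmod (z - z0))\<^sup>2 / (D n z)\<^sup>2))" for n z
  define B where "B n z = u z * (ramp' (x n z) * (2 * (r n)\<^sup>2 / (D n z)\<^sup>2))" for n z
  have Ai: "set_integrable lborel S (A n)" for n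
    by (rule set_integrable_compact_support[OF S K(1,2)])
       (use Dpos in \<open>auto simp: A_def less_imp_neq[symmetric] hat_eq_0 x_out intro!: continuous_intros cu ch\<close>)
  have Bi: "set_integrable lborel S (B n)" for n
    by (rule set_integrable_compact_support[OF S K(1,2)])
       (use Dpos in \<open>auto simp: B_def less_imp_neq[symmetric] ramp_eq x_out intro!: continuous_intros cu ch\<close>)
  \<comment> \<open>Green's formula moves the Laplacian onto the cutoff; the integral on the other
    side is nonnegative because \<open>ramp\<close> and \<open>l\<close> are.\<close>
  have le: "(LINT z:S|lborel. B n z) \<le> (LINT z:S|lborel. A n z)" for n
  proof -
    have "0 \<le> (LINT z:S|lborel. ramp (x n z) * l z)"
      unfolding set_lebesgue_integral_def using l ramp_bounds
      by (intro Bochner_Integration.integral_nonneg) (auto simp: indicator_def)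
    also have "\<dots> = (LINT z:S|lborel. A n z - B n z)"
      using Green_lapG(3)[OF u lapc S K(1,2)] x_out ramp_eq(1) by (auto simp: A_def B_def algebra_simps)
    also have "\<dots> = (LINT z:S|lborel. A n z) - (LINT z:S|lborel. B n z)"
      by (rule set_integral_diff(2)[OF Ai Bi])
    finally show ?thesis by simp
  qed
  \<comment> \<open>The weight vanishes where \<open>x n z\<close> \<ge> 2, that is where
    \<open>D n z\<close> is at most \<rho>^2 / exp 4. Elsewhere |z - z0|^2 / D^2 \<le> 1 / D, which
    yields the dominating constant.\<close>
  have limA: "(\<lambda>n. LINT z:S|lborel. A n z) \<longlonglongrightarrow>
      (LINT z:S|lborel. u z * (hat (ln \<rho> - logabs z0 0 z) / (cmod (z - z0))\<^sup>2))"
    unfolding set_lebesgue_integral_def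
  proof (rule integral_dominated_convergence[where w = "\<lambda>z. indicator K z * (M * (6 * (exp 4 / \<rho>\<^sup>2)))"])
    have c0: "continuous_on (S - {z0}) (\<lambda>z. u z * (hat (ln \<rho> - logabs z0 0 z) / (cmod (z - z0))\<^sup>2))"
      unfolding logabs_def
      by (intro continuous_intros continuous_on_subset[OF cu] continuous_on_compose2[OF continuous_hat]) auto
    have "(\<lambda>z. indicator (S - {z0}) z *\<^sub>R (u z * (hat (ln \<rho> - logabs z0 0 z) / (cmod (z - z0))\<^sup>2))) \<in> borel_measurable borel"
      by (rule borel_measurable_continuous_on_indicator[OF _ c0]) (use S in auto)
    also have "(\<lambda>z. indicator (S - {z0}) z *\<^sub>R (u z * (hat (ln \<rho> - logabs z0 0 z) / (cmod (z - z0))\<^sup>2)))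
      = (\<lambda>z. indicator S z *\<^sub>R (u z * (hat (ln \<rho> - logabs z0 0 z) / (cmod (z - z0))\<^sup>2)))"
      by (auto simp: indicator_def fun_eq_iff)
    finally show "(\<lambda>z. indicator S z *\<^sub>R (u z * (hat (ln \<rho> - logabs z0 0 z) / (cmod (z - z0))\<^sup>2))) \<in> borel_measurable lborel"
      by simp
    show "(\<lambda>z. indicator S z *\<^sub>R A n z) \<in> borel_measurable lborel" for n
      using Ai[of n] unfolding set_integrable_def by (rule borel_measurable_integrable)
    show "integrable lborel (\<lambda>z. indicator K z * (M * (6 * (exp 4 / \<rho>\<^sup>2))))"
      using borel_integrable_compact[OF K(1), of "\<lambda>_. M * (6 * (exp 4 / \<rho>\<^sup>2))"] by simp
    show "AE z in lborel. (\<lambda>n. indicator S z *\<^sub>R A n z) \<longlonglongrightarrow> indicator S z *\<^sub>R (u z * (hat (ln \<rho> - logabs z0 0 z) / (cmod (z - z0))\<^sup>2))"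
    proof (rule AE_I2)
      fix z
      show "(\<lambda>n. indicator S z *\<^sub>R A n z) \<longlonglongrightarrow> indicator S z *\<^sub>R (u z * (hat (ln \<rho> - logabs z0 0 z) / (cmod (z - z0))\<^sup>2))"
      proof (cases "z = z0")
        case False
        have "(\<lambda>n. D n z) \<longlonglongrightarrow> (cmod (z - z0))\<^sup>2 + 0\<^sup>2" unfolding D_def by (intro tendsto_intros rlim)
        then have Dl: "(\<lambda>n. D n z) \<longlonglongrightarrow> (cmod (z - z0))\<^sup>2" by simp
        have "(\<lambda>n. x n z) \<longlonglongrightarrow> ln \<rho> - ln ((cmod (z - z0))\<^sup>2) / 2"
          unfolding xD using False by (intro tendsto_intros Dl) auto
        then have "(\<lambda>n. x n z) \<longlonglongrightarrow> ln \<rho> - logabs z0 0 z" by (simp add: logabs_def)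
        then have "(\<lambda>n. hat (x n z)) \<longlonglongrightarrow> hat (ln \<rho> - logabs z0 0 z)"
          by (rule isCont_tendsto_compose[rotated]) (use continuous_hat in \<open>simp add: continuous_on_eq_continuous_at\<close>)
        then have "(\<lambda>n. indicator S z *\<^sub>R A n z) \<longlonglongrightarrow> indicator S z *\<^sub>R (u z * (hat (ln \<rho> - logabs z0 0 z) *
            ((cmod (z - z0))\<^sup>2 / ((cmod (z - z0))\<^sup>2)\<^sup>2)))"
          unfolding A_def using False by (intro tendsto_intros Dl) auto
        then show ?thesis using False by (simp add: power2_eq_square)
      qed (simp add: A_def)
    qed
    show "AE z in lborel. norm (indicator S z *\<^sub>R A n z) \<le> indicator K z * (M * (6 * (exp 4 / \<rho>\<^sup>2)))" for n
    proof (rule AE_I2)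
      fix z
      show "norm (indicator S z *\<^sub>R A n z) \<le> indicator K z * (M * (6 * (exp 4 / \<rho>\<^sup>2)))"
      proof (cases "z \<in> K \<and> x n z < 2")
        case True
        have "ln \<rho> - 2 < ln (D n z) / 2" using True by (simp add: xD)
        then have "exp (2 * ln \<rho> - 4) < exp (ln (D n z))" by (subst exp_less_cancel_iff) linarith
        moreover have "exp (2 * ln \<rho>) = \<rho>\<^sup>2"
          using \<rho> by (metis exp_ln exp_of_nat_mult of_nat_numeral)
        ultimately have "\<rho>\<^sup>2 / exp 4 < D n z" using Dpos[of n z] by (simp add: exp_diff)
        then have i: "1 / D n z \<le> exp 4 / \<rho>\<^sup>2" using \<rho> Dpos[of n z] by (simp add: field_simps)
        have "(cmod (z - z0))\<^sup>2 / (D n z)\<^sup>2 \<le> D n z / (D n z)\<^sup>2"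
          by (intro divide_right_mono) (auto simp: D_def)
        also have "\<dots> \<le> exp 4 / \<rho>\<^sup>2" using i Dpos[of n z] by (simp add: power2_eq_square)
        finally have "\<bar>A n z\<bar> \<le> M * (6 * (exp 4 / \<rho>\<^sup>2))"
          unfolding A_def abs_mult using True M hat_bounds[of "x n z"] Dpos[of n z]
          by (intro mult_mono) auto
        then show ?thesis using True K by auto
      next
        case False
        then have "hat (x n z) = 0" using x_out[of z n] by (cases "z \<in> K") (auto intro: hat_eq_0)
        then show ?thesis using M \<rho> by (simp add: A_def)
      qed
    qed
  qed
  \<comment> \<open>The substitution z = z0 + r w turns the concentrating mass into the fixed
    density 2/(|w|^2 + 1)^2, while \<open>u\<close> and \<open>ramp'\<close> at the moving point
    tend to u z0 and 6.\<close>
  define G where "G n w = indicator S (z0 + r n *\<^sub>R w) * (u (z0 + r n *\<^sub>R w) * (ramp' (x n (z0 + r n *\<^sub>R w)) * (2 / ((cmod w)\<^sup>2 + 1)\<^sup>2)))" for n w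
  have Dsc: "D n (z0 + r n *\<^sub>R w) = (r n)\<^sup>2 * ((cmod w)\<^sup>2 + 1)" for n w
    using r[of n] by (simp add: D_def power_mult_distrib algebra_simps)
  have Gi: "integrable lborel (G n)" "(LINT z:S|lborel. B n z) = integral\<^sup>L lborel (G n)" for n
  proof -
    have m: "(\<lambda>z. indicator S z *\<^sub>R B n z) \<in> borel_measurable borel"
      using borel_measurable_integrable[OF Bi[of n, unfolded set_integrable_def]] by simp
    have e: "(\<lambda>w. indicator S (z0 + r n *\<^sub>R w) *\<^sub>R B n (z0 + r n *\<^sub>R w)) = (\<lambda>w. (1 / (r n)\<^sup>2) * G n w)"
      using r[of n] by (auto simp: G_def B_def Dsc fun_eq_iff power_mult_distrib power2_eq_square)
    have "integrable lborel (\<lambda>w. (1 / (r n)\<^sup>2) * G n w)"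
      using integrable_affine_complex(1)[OF m r[of n], of z0] Bi[of n] unfolding e set_integrable_def by simp
    then have "integrable lborel (\<lambda>w. (r n)\<^sup>2 * ((1 / (r n)\<^sup>2) * G n w))" by (rule integrable_mult_right)
    moreover have "(\<lambda>w. (r n)\<^sup>2 * ((1 / (r n)\<^sup>2) * G n w)) = G n" using r[of n] by (simp add: fun_eq_iff)
    ultimately show "integrable lborel (G n)" by (simp only:)
    show "(LINT z:S|lborel. B n z) = integral\<^sup>L lborel (G n)"
      using integrable_affine_complex(2)[OF m r[of n], of z0] r[of n] unfolding e set_lebesgue_integral_def by simp
  qed
  have limB: "(\<lambda>n. integral\<^sup>L lborel (G n)) \<longlonglongrightarrow> integral\<^sup>L lborel (\<lambda>w. (6 * u z0) * (2 / ((cmod w)\<^sup>2 + 1)\<^sup>2))"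
  proof (rule integral_dominated_convergence[where w = "\<lambda>w. (M * 6) * (2 / ((cmod w)\<^sup>2 + 1)\<^sup>2)"])
    show "(\<lambda>w. (6 * u z0) * (2 / ((cmod w)\<^sup>2 + 1)\<^sup>2)) \<in> borel_measurable lborel" by measurable
    show "G n \<in> borel_measurable lborel" for n using Gi(1)[of n] by (rule borel_measurable_integrable)
    show "integrable lborel (\<lambda>w. (M * 6) * (2 / ((cmod w)\<^sup>2 + 1)\<^sup>2))"
      using sphere_area(1)[of 1 0] by (intro integrable_mult_right) simp
    show "AE w in lborel. (\<lambda>n. G n w) \<longlonglongrightarrow> (6 * u z0) * (2 / ((cmod w)\<^sup>2 + 1)\<^sup>2)"
    proof (rule AE_I2)
      fix w
      have "(\<lambda>n. z0 + r n *\<^sub>R w) \<longlonglongrightarrow> z0 + 0 *\<^sub>R w" by (intro tendsto_intros rlim)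
      then have zl: "(\<lambda>n. z0 + r n *\<^sub>R w) \<longlonglongrightarrow> z0" by simp
      have ev1: "\<forall>\<^sub>F n in sequentially. z0 + r n *\<^sub>R w \<in> S" using topological_tendstoD[OF zl S z0S] .
      have ul: "(\<lambda>n. u (z0 + r n *\<^sub>R w)) \<longlonglongrightarrow> u z0"
        using zl by (rule isCont_tendsto_compose[rotated]) (use cu S z0S in \<open>simp add: continuous_on_eq_continuous_at\<close>)
      have "(\<lambda>n. (r n)\<^sup>2 * ((cmod w)\<^sup>2 + 1)) \<longlonglongrightarrow> 0\<^sup>2 * ((cmod w)\<^sup>2 + 1)" by (intro tendsto_intros rlim)
      then have "\<forall>\<^sub>F n in sequentially. (r n)\<^sup>2 * ((cmod w)\<^sup>2 + 1) < exp (2 * (ln \<rho> - 2))"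
        by (intro order_tendstoD(2)) auto
      then have ev2: "\<forall>\<^sub>F n in sequentially. ramp' (x n (z0 + r n *\<^sub>R w)) = 6"
      proof eventually_elim
        case (elim n)
        then have "ln (D n (z0 + r n *\<^sub>R w)) < 2 * (ln \<rho> - 2)"
          using Dpos[of n "z0 + r n *\<^sub>R w"] by (metis Dsc exp_gt_zero ln_exp ln_less_cancel_iff)
        then show ?case by (intro ramp_eq(4)) (simp add: xD)
      qed
      have "(\<lambda>n. u (z0 + r n *\<^sub>R w) * (6 * (2 / ((cmod w)\<^sup>2 + 1)\<^sup>2))) \<longlonglongrightarrow> u z0 * (6 * (2 / ((cmod w)\<^sup>2 + 1)\<^sup>2))"
        by (intro tendsto_intros ul)
      moreover have "\<forall>\<^sub>F n in sequentially. G n w = u (z0 + r n *\<^sub>R w) * (6 * (2 / ((cmod w)\<^sup>2 + 1)\<^sup>2))"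
        using ev1 ev2 by eventually_elim (simp add: G_def)
      ultimately show "(\<lambda>n. G n w) \<longlonglongrightarrow> (6 * u z0) * (2 / ((cmod w)\<^sup>2 + 1)\<^sup>2)"
        by (subst tendsto_cong[where g = "\<lambda>n. u (z0 + r n *\<^sub>R w) * (6 * (2 / ((cmod w)\<^sup>2 + 1)\<^sup>2))"]) (auto simp: mult_ac)
    qed
    show "AE w in lborel. norm (G n w) \<le> (M * 6) * (2 / ((cmod w)\<^sup>2 + 1)\<^sup>2)" for n
    proof (rule AE_I2)
      fix w
      show "norm (G n w) \<le> (M * 6) * (2 / ((cmod w)\<^sup>2 + 1)\<^sup>2)"
      proof (cases "z0 + r n *\<^sub>R w \<in> K")
        case True
        have "\<bar>G n w\<bar> \<le> 1 * (M * (6 * (2 / ((cmod w)\<^sup>2 + 1)\<^sup>2)))"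
          unfolding G_def abs_mult using True M ramp'_bounds
          by (intro mult_mono) (auto simp: indicator_def)
        then show ?thesis by (simp add: mult.assoc)
      next
        case False
        then show ?thesis using ramp_eq(3)[OF x_out[OF False, of n]] M by (simp add: G_def)
      qed
    qed
  qed
  have "integral\<^sup>L lborel (\<lambda>w::complex. (6 * u z0) * (2 / ((cmod w)\<^sup>2 + 1)\<^sup>2)) = 12 * pi * u z0"
    using sphere_area(2)[of 1 0] by (simp del: times_divide_eq_right)
  then have "(\<lambda>n. LINT z:S|lborel. B n z) \<longlonglongrightarrow> 12 * pi * u z0" using limB Gi(2) by simp
  then show ?thesis using LIMSEQ_le[OF _ limA] le by blast
qed

section \<open>Logarithmic growth at an end\<close>

lemma rC2_ramp_shift: "rC2 (\<lambda>s. ramp (s - a)) (\<lambda>s. ramp' (s - a)) (\<lambda>s. hat (s - a))"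
  using rC2_affine[OF rC2_ramp, of 1 "- a"] by simp

lemma rC2_flip:
  assumes "rC2 k k1 k2" "\<sigma>\<^sup>2 = 1"
  shows "rC2 (\<lambda>s. k (\<sigma> * s)) (\<lambda>s. \<sigma> * k1 (\<sigma> * s)) (\<lambda>s. k2 (\<sigma> * s))"
  using rC2_affine[OF assms(1), of \<sigma> 0] assms(2) by simp

text \<open>The ratio bounds are those of a disc whose radius is a quarter of the distance of its
  centre to the puncture; the bound 1/3 is 4/3 - 1 from the quotient y / x.\<close>

lemma abs_ln_quotient_le:
  fixes x y :: real
  assumes "y > 0" "3/4 * y \<le> x" "x \<le> 5/4 * y"
  shows "\<bar>ln x - ln y\<bar> \<le> 1/3"
proof -
  have x: "x > 0" using assms by linarith
  have "ln x - ln y = ln (x / y)" "ln y - ln x = ln (y / x)" using x assms by (simp_all add: ln_div)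
  moreover have "ln (x / y) \<le> x / y - 1" "ln (y / x) \<le> y / x - 1"
    using x assms by (auto intro!: ln_le_minus_one)
  moreover have "x / y \<le> 5/4" "y / x \<le> 4/3" using x assms by (simp_all add: field_simps)
  ultimately show ?thesis by linarith
qed

text \<open>With \<sigma> = 1 at a finite puncture and \<sigma> = -1 at infinity, s = \<sigma>
  ln|z-p| tends to minus infinity at the end, and v = u + ln|z-p| has the same Laplacian as u. Three
  estimates combine. Tent-weighted averages of v over logarithmic annuli are at most linear in the
  position, by Green's formula. The last hypothesis bounds the negative part of v by |z-p|^2 l / m,
  so the averages of the positive part obey the same bound. The mean value inequality on a disc of
  radius |z0-p|/4 then bounds v at z0.\<close>

lemma log_growth_at_puncture:
  assumes S: "open S" and \<sigma>: "\<sigma>\<^sup>2 = (1::real)"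
    and reg: "\<And>z. z \<noteq> p \<Longrightarrow> \<sigma> * logabs p 0 z \<le> c \<Longrightarrow> z \<in> S" and pS: "p \<notin> S"
    and u: "lapG S u g l" and l: "\<And>z. z \<in> S \<Longrightarrow> l z \<ge> 0" and li: "set_integrable lborel S l"
    and m: "m > 0" "\<And>z. z \<noteq> p \<Longrightarrow> \<sigma> * logabs p 0 z \<le> c \<Longrightarrow>
        m * exp (- 2 * (u z + logabs p 0 z)) \<le> (cmod (z - p))\<^sup>2 * l z"
  shows "\<exists>C. \<forall>z. z \<noteq> p \<longrightarrow> \<sigma> * logabs p 0 z \<le> c - 3 \<longrightarrow> u z + logabs p 0 z \<le> C * (1 + \<bar>logabs p 0 z\<bar>)"
proof -
  define L where "L = logabs p 0"
  define s where "s z = \<sigma> * L z" for z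
  \<comment> \<open>The weight \<open>w a\<close> lives on a \<le> s \<le> a + 2, so for a \<le> d
    its support stays in the region s \<le> c, which lies in \<open>S\<close>.\<close>
  define d where "d = c - 2"
  define v where "v z = u z + L z" for z
  have \<sigma>': "\<bar>\<sigma>\<bar> = 1" using \<sigma> by (simp add: power2_eq_1_iff) auto
  have lapL: "lapG S L (\<lambda>z. (cmod (z - p))\<^sup>2 / ((cmod (z - p))\<^sup>2)\<^sup>2) (\<lambda>_. 0)"
    using lapG_logabs[of S 0 p] pS unfolding L_def by auto
  obtain g' where lapv: "lapG S v g' l"
    using lapG_add[OF u lapL] unfolding v_def by auto
  have cv: "continuous_on S v" and cL: "continuous_on S L"
    using lapG_continuous[OF lapv] lapG_continuous[OF lapL] by auto
  have cs: "continuous_on S s" unfolding s_def by (intro continuous_intros cL)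
  define w where "w a z = hat (s z - a) / (cmod (z - p))\<^sup>2" for a z
  define K where "K T = {z. \<sigma> * L z \<in> {T..c} \<and> z \<noteq> p}" for T
  have exp_L: "exp (L z) = cmod (z - p)" if "z \<noteq> p" for z
    using that by (simp add: L_def logabs_0)
  have K: "compact (K T)" "K T \<subseteq> S" for T
  proof -
    show "K T \<subseteq> S" using reg by (auto simp: K_def L_def)
    define A where "A = min (\<sigma> * T) (\<sigma> * c)"
    define B where "B = max (\<sigma> * T) (\<sigma> * c)"
    have "K T = cball p (exp B) - ball p (exp A)" if "T \<le> c"
    proof -
      have AB: "\<sigma> * L z \<in> {T..c} \<longleftrightarrow> A \<le> L z \<and> L z \<le> B" for z
        using \<sigma>' that by (cases "\<sigma> \<ge> 0") (auto simp: A_def B_def)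
      have "z \<in> K T \<longleftrightarrow> z \<in> cball p (exp B) - ball p (exp A)" for z
      proof (cases "z = p")
        case False
        then show ?thesis unfolding K_def mem_Collect_eq AB
          using exp_le_cancel_iff[of A "L z"] exp_le_cancel_iff[of "L z" B]
          by (auto simp: exp_L dist_norm norm_minus_commute)
      qed (auto simp: K_def)
      then show ?thesis by blast
    qed
    moreover have "K T = {}" if "\<not> T \<le> c" using that by (auto simp: K_def)
    ultimately show "compact (K T)" by (cases "T \<le> c") (auto intro: compact_diff)
  qed
  have wi: "set_integrable lborel S (\<lambda>z. f z * w a z)" if "continuous_on S f" "a \<le> d" for f a
  proof (rule set_integrable_compact_support[OF S K(1)[of a] K(2)])
    show "continuous_on S (\<lambda>z. f z * w a z)" unfolding w_def using that pS
      by (auto intro!: continuous_intros cs continuous_on_compose2[OF continuous_hat])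
    fix z assume z: "z \<in> S - K a"
    then have "z \<noteq> p" using pS by auto
    then have "s z < a \<or> s z > c" using z by (auto simp: K_def s_def)
    then have "s z - a \<le> 0 \<or> s z - a \<ge> 2" using that(2) by (auto simp: d_def)
    then show "f z * w a z = 0" by (auto simp: w_def hat_eq_0)
  qed
  define I where "I = (LINT z:S|lborel. l z)"
  define J where "J a = (LINT z:S|lborel. v z * w a z)" for a
  define C1 where "C1 = 40 * I + \<bar>J (d - 1)\<bar> + \<bar>J d\<bar>"
  have I: "I \<ge> 0" unfolding I_def set_lebesgue_integral_def using l
    by (intro Bochner_Integration.integral_nonneg) (auto simp: indicator_def)
  have J: "J T \<le> C1 * (1 + c - T)" if T: "T \<le> d - 1" for T
  proof -
    \<comment> \<open>The coefficients 1, -(d - T), d - T - 1 add up to 0, and so do their products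
      with the shifts T, d - 1, d. The affine tails of the three ramps therefore cancel and
      \<open>k\<close> vanishes outside [T, c].\<close>
    define k where "k x = ramp (x - T) + (- (d - T)) * ramp (x - (d - 1)) + (d - T - 1) * ramp (x - d)" for x
    define k2 where "k2 x = hat (x - T) + (- (d - T)) * hat (x - (d - 1)) + (d - T - 1) * hat (x - d)" for x
    obtain k1 where k: "rC2 k k1 k2"
      using rC2_add[OF rC2_add[OF rC2_ramp_shift[of T] rC2_cmult[OF rC2_ramp_shift[of "d - 1"], of "- (d - T)"]]
        rC2_cmult[OF rC2_ramp_shift[of d], of "d - T - 1"]] unfolding k_def k2_def by blast
    have k_out: "k x = 0" if "x \<le> T \<or> x \<ge> c" for x
    proof (cases "x \<le> T")
      case True
      then show ?thesis using T by (simp add: k_def ramp_eq)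
    next
      case False
      then have "x \<ge> d + 2" using that by (simp add: d_def)
      then show ?thesis using T by (simp add: k_def ramp_eq algebra_simps)
    qed
    \<comment> \<open>On [T, c] the three terms are at most 6 (c - T), 0 and 12 (c - T); the
      constant 40 leaves room.\<close>
    have k_bd: "k x \<le> 40 * (1 + c - T)" for x
    proof (cases "T \<le> x \<and> x \<le> c")
      case True
      have 1: "ramp (x - T) \<le> 6 * (c - T)" using ramp_bounds(2)[of "x - T"] True by (auto simp: max_def)
      have 2: "(- (d - T)) * ramp (x - (d - 1)) \<le> 0"
        using T ramp_bounds(1) by (intro mult_nonpos_nonneg) auto
      have 3: "(d - T - 1) * ramp (x - d) \<le> (c - T) * 12"
        using T ramp_bounds[of "x - d"] True by (intro mult_mono) (auto simp: d_def max_def split: if_splits)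
      have "6 * (c - T) + 0 + (c - T) * 12 \<le> 40 * (1 + c - T)" using True by (simp add: algebra_simps)
      then show ?thesis unfolding k_def by (rule order_trans[OF add_mono[OF add_mono[OF 1 2] 3]])
    next
      case False
      then show ?thesis using k_out[of x] T by (auto simp: d_def)
    qed
    have lapk: "lapG S (\<lambda>z. k (s z)) (\<lambda>z. (\<sigma> * k1 (\<sigma> * L z))\<^sup>2 * ((cmod (z - p))\<^sup>2 / ((cmod (z - p))\<^sup>2)\<^sup>2))
       (\<lambda>z. k2 (s z) * ((cmod (z - p))\<^sup>2 / ((cmod (z - p))\<^sup>2)\<^sup>2))"
      using lapG_compose[OF rC2_flip[OF k \<sigma>] lapL] unfolding s_def by simp
    have van: "k (s z) = 0" if "z \<in> S - K T" for z
    proof -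
      have "z \<noteq> p" using that pS by auto
      then show ?thesis using that by (intro k_out) (auto simp: K_def s_def)
    qed
    note G = Green_lapG[OF lapv lapk S K(1)[of T] K(2)[of T] van]
    have e: "v z * (k2 (s z) * ((cmod (z - p))\<^sup>2 / ((cmod (z - p))\<^sup>2)\<^sup>2))
       = v z * w T z + ((- (d - T)) * (v z * w (d - 1) z) + (d - T - 1) * (v z * w d z))" for z
      by (cases "z = p") (simp_all add: w_def k2_def field_simps power2_eq_square)
    have "(LINT z:S|lborel. v z * w T z + ((- (d - T)) * (v z * w (d - 1) z) + (d - T - 1) * (v z * w d z)))
      = J T + ((- (d - T)) * J (d - 1) + (d - T - 1) * J d)"
      unfolding J_def using T
      by (subst set_integral_add(2) set_integral_mult_right set_integrable_mult_right wi[OF cv] | simp add: wi[OF cv])+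
    then have "J T + ((- (d - T)) * J (d - 1) + (d - T - 1) * J d) = (LINT z:S|lborel. k (s z) * l z)"
      using G(3) unfolding e by simp
    also have "\<dots> \<le> (LINT z:S|lborel. (40 * (1 + c - T)) * l z)"
      by (rule set_integral_mono[OF G(1)]) (use li k_bd l in \<open>auto intro!: mult_right_mono\<close>)
    also have "\<dots> = 40 * (1 + c - T) * I" by (simp add: I_def)
    finally have "J T \<le> 40 * (1 + c - T) * I + (d - T) * J (d - 1) - (d - T - 1) * J d" by (simp add: algebra_simps)
    also have "\<dots> \<le> 40 * (1 + c - T) * I + (1 + c - T) * \<bar>J (d - 1)\<bar> + (1 + c - T) * \<bar>J d\<bar>"
    proof -
      have "(d - T) * J (d - 1) \<le> (1 + c - T) * \<bar>J (d - 1)\<bar>"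
        using T by (intro order_trans[OF mult_left_mono[OF abs_ge_self] mult_right_mono]) (auto simp: d_def)
      moreover have "(d - T - 1) * (- J d) \<le> (1 + c - T) * \<bar>J d\<bar>"
        using T by (intro order_trans[OF mult_left_mono[OF abs_ge_minus_self] mult_right_mono]) (auto simp: d_def)
      ultimately show ?thesis by simp
    qed
    finally show ?thesis unfolding C1_def by (simp add: algebra_simps)
  qed
  define C2 where "C2 = 150 * exp 4 * (C1 * (2 + \<bar>c\<bar>) + 6 / m * I)"
  have main: "12 * pi * v z0 \<le> 150 * exp 4 * (C1 * (2 + \<bar>c\<bar> + \<bar>L z0\<bar>) + 6 / m * I)"
    if z0: "z0 \<noteq> p" "s z0 \<le> c - 3" for z0
  proof -
    \<comment> \<open>The tent on [T, T + 2] is centred at the value of s at z0; on the disc around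
      z0 the value s - T stays within 1/3 of 1.\<close>
    define T where "T = s z0 - 1"
    define \<rho> where "\<rho> = cmod (z0 - p) / 4"
    have \<rho>: "\<rho> > 0" using z0 by (simp add: \<rho>_def)
    have T: "T \<le> d - 1" using z0 by (simp add: T_def d_def)
    have near: "z \<noteq> p" "\<bar>s z - s z0\<bar> \<le> 1/3" "cmod (z - p) \<le> 5 * \<rho>" "z \<in> S" if "z \<in> cball z0 \<rho>" for z
    proof -
      have 1: "cmod (z0 - z) \<le> \<rho>" using that by (simp add: dist_norm)
      have 2: "cmod (z - p) \<ge> 3/4 * cmod (z0 - p)"
        using norm_triangle_ineq[of "z0 - z" "z - p"] 1 by (simp add: \<rho>_def)
      have 3: "cmod (z - p) \<le> 5/4 * cmod (z0 - p)"
        using norm_triangle_ineq[of "z - z0" "z0 - p"] 1 by (simp add: \<rho>_def norm_minus_commute)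
      show zp: "z \<noteq> p" using 2 z0 by auto
      have "\<bar>L z - L z0\<bar> \<le> 1/3"
        using abs_ln_quotient_le[OF _ 2 3] z0 zp by (simp add: L_def logabs_0)
      moreover have "s z - s z0 = \<sigma> * (L z - L z0)" by (simp add: s_def algebra_simps)
      ultimately show s: "\<bar>s z - s z0\<bar> \<le> 1/3" using \<sigma>' by (simp add: abs_mult)
      show "cmod (z - p) \<le> 5 * \<rho>" using 3 by (simp add: \<rho>_def)
      have "s z \<le> c" using s z0(2) by linarith
      then show "z \<in> S" using reg[OF zp] by (simp add: s_def L_def)
    qed
    define vp where "vp z = max 0 (v z)" for z
    have cvp: "continuous_on S vp" unfolding vp_def by (intro continuous_intros cv)
    \<comment> \<open>For v < 0 one has -v \<le> 1 - 2 v \<le> exp(-2 v), which the hypothesis with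
      \<open>m\<close> bounds by |z-p|^2 l / m; the weight cancels |z-p|^2 and contributes at most
      6.\<close>
    have neg: "vp z * w T z \<le> v z * w T z + (6 / m) * l z" if z: "z \<in> S" for z
    proof (cases "z \<in> K d \<or> s z \<le> c")
      case False
      then have "w T z = 0" using T by (simp add: w_def hat_eq_0 d_def)
      then show ?thesis using l[OF z] m by simp
    next
      case True
      have zp: "z \<noteq> p" using z pS by auto
      have sc: "s z \<le> c" using True by (auto simp: K_def s_def)
      have "vp z - v z \<le> exp (- 2 * v z)"
        using exp_ge_add_one_self[of "- 2 * v z"] by (auto simp: vp_def max_def)
      also have "\<dots> \<le> (cmod (z - p))\<^sup>2 * l z / m"
        using m(2)[OF zp] sc m(1) by (simp add: s_def v_def L_def field_simps)
      finally have "(vp z - v z) * w T z \<le> (cmod (z - p))\<^sup>2 * l z / m * w T z"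
        by (rule mult_right_mono) (simp add: w_def hat_bounds)
      also have "\<dots> = l z / m * hat (s z - T)" using zp by (simp add: w_def)
      also have "\<dots> \<le> l z / m * 6" using l[OF z] m(1) hat_bounds by (intro mult_left_mono) auto
      finally show ?thesis by (simp add: algebra_simps)
    qed
    have "(LINT z:S|lborel. vp z * w T z) \<le> (LINT z:S|lborel. v z * w T z + (6 / m) * l z)"
      using T by (intro set_integral_mono wi[OF cvp] set_integral_add(1) wi[OF cv] set_integrable_mult_right li neg) auto
    also have "\<dots> = J T + (6 / m) * I"
      unfolding J_def I_def using T wi[OF cv, of T] li by (subst set_integral_add(2)) auto
    finally have vpw: "(LINT z:S|lborel. vp z * w T z) \<le> J T + (6 / m) * I" .
    have "12 * pi * v z0 \<le> (LINT z:S|lborel. v z * (hat (ln \<rho> - logabs z0 0 z) / (cmod (z - z0))\<^sup>2))"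
      by (rule mean_value_hat[OF S lapv l \<rho>]) (use near in auto)
    \<comment> \<open>The factor is 6 * 25 * exp 4. The tent is at most 6; on its support |z - z0| >
      \<rho> exp(-2) and |z - p| \<le> 5 \<rho>, so |z - p|^2 \<le> 25 exp 4 |z - z0|^2; and the
      tent in s is at least 1 there.\<close>
    also have "\<dots> \<le> (LINT z:S|lborel. (150 * exp 4) * (vp z * w T z))"
      unfolding set_lebesgue_integral_def
    proof (rule integral_mono')
      show "integrable lborel (\<lambda>z. indicator S z *\<^sub>R ((150 * exp 4) * (vp z * w T z)))"
        using set_integrable_mult_right[OF wi[OF cvp, of T], of "150 * exp 4"] T unfolding set_integrable_def by simp
      show "0 \<le> indicator S z *\<^sub>R ((150 * exp 4) * (vp z * w T z))" for z
        by (simp add: vp_def w_def hat_bounds)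
      fix z
      show "indicator S z *\<^sub>R (v z * (hat (ln \<rho> - logabs z0 0 z) / (cmod (z - z0))\<^sup>2)) \<le> indicator S z *\<^sub>R ((150 * exp 4) * (vp z * w T z))"
      proof (cases "z \<in> S \<and> hat (ln \<rho> - logabs z0 0 z) \<noteq> 0 \<and> z \<noteq> z0")
        case False
        then show ?thesis by (auto simp: vp_def w_def hat_bounds indicator_def)
      next
        case True
        define x where "x = cmod (z - z0)"
        have x: "x > 0" using True by (simp add: x_def)
        have "0 < ln \<rho> - ln x" "ln \<rho> - ln x < 2"
          using True hat_eq_0[of "ln \<rho> - ln x"] by (auto simp: logabs_0 x_def not_le[symmetric])
        then have x1: "x < \<rho>" and x2: "ln \<rho> < ln x + 2" using \<rho> x by (auto simp: ln_less_cancel_iff)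
        have "exp (ln \<rho>) < exp (ln x + 2)" using x2 by (subst exp_less_cancel_iff)
        then have "\<rho> < x * exp 2" using \<rho> x by (simp add: exp_add)
        then have "\<rho>\<^sup>2 \<le> (x * exp 2)\<^sup>2" using \<rho> by (intro power_mono) auto
        also have "\<dots> = x\<^sup>2 * exp 4" by (simp add: power_mult_distrib flip: exp_of_nat_mult) 
        finally have x3: "\<rho>\<^sup>2 \<le> x\<^sup>2 * exp 4" .
        have zc: "z \<in> cball z0 \<rho>" using x1 by (simp add: x_def dist_norm norm_minus_commute)
        note nz = near[OF zc]
        have "1/3 \<le> s z - T" "s z - T \<le> 5/3" using nz(2) unfolding T_def by linarith+
        then have h1: "1 \<le> hat (s z - T)" by (rule hat_ge_1)
        have "(cmod (z - p))\<^sup>2 \<le> (5 * \<rho>)\<^sup>2" using nz(3) by (intro power_mono) auto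
        also have "\<dots> \<le> 25 * (x\<^sup>2 * exp 4)" using x3 by (simp add: power_mult_distrib)
        finally have q: "(cmod (z - p))\<^sup>2 \<le> 25 * exp 4 * x\<^sup>2" by (simp add: mult_ac)
        have "hat (ln \<rho> - logabs z0 0 z) / x\<^sup>2 \<le> 6 / x\<^sup>2" using hat_bounds by (intro divide_right_mono) auto
        also have "\<dots> \<le> 150 * exp 4 * (1 / (cmod (z - p))\<^sup>2)"
          using q x nz(1) by (simp add: field_simps)
        also have "\<dots> \<le> 150 * exp 4 * w T z"
          unfolding w_def using h1 by (intro mult_left_mono divide_right_mono) auto
        finally have b: "hat (ln \<rho> - logabs z0 0 z) / x\<^sup>2 \<le> 150 * exp 4 * w T z" .
        have "v z * (hat (ln \<rho> - logabs z0 0 z) / x\<^sup>2) \<le> vp z * (hat (ln \<rho> - logabs z0 0 z) / x\<^sup>2)"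
          by (intro mult_right_mono) (auto simp: vp_def hat_bounds)
        also have "\<dots> \<le> vp z * (150 * exp 4 * w T z)" by (intro mult_left_mono b) (simp add: vp_def)
        finally show ?thesis using True by (simp add: x_def mult_ac)
      qed
    qed
    also have "\<dots> = 150 * exp 4 * (LINT z:S|lborel. vp z * w T z)" by simp
    also have "\<dots> \<le> 150 * exp 4 * (J T + (6 / m) * I)" using vpw by (intro mult_left_mono) auto
    also have "\<dots> \<le> 150 * exp 4 * (C1 * (2 + \<bar>c\<bar> + \<bar>L z0\<bar>) + 6 / m * I)"
    proof (intro mult_left_mono add_mono order_trans[OF J[OF T]])
      have "\<bar>s z0\<bar> = \<bar>L z0\<bar>" using \<sigma>' by (simp add: s_def abs_mult)
      then show "1 + c - T \<le> 2 + \<bar>c\<bar> + \<bar>L z0\<bar>" by (auto simp: T_def)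
      show "0 \<le> C1" using I by (simp add: C1_def)
      show "0 \<le> 6 / m" using m(1) by simp
    qed (auto intro: I)
    finally show ?thesis .
  qed
  have C1: "C1 \<ge> 0" using I by (simp add: C1_def)
  define C where "C = (150 * exp 4 * (C1 * (2 + \<bar>c\<bar>) + 6 / m * I)) / (12 * pi)"
  have "v z \<le> C * (1 + \<bar>L z\<bar>)" if z: "z \<noteq> p" "s z \<le> c - 3" for z
  proof -
    have "C1 * (2 + \<bar>c\<bar> + \<bar>L z\<bar>) \<le> C1 * ((2 + \<bar>c\<bar>) * (1 + \<bar>L z\<bar>))"
      using C1 by (intro mult_left_mono) (auto simp: algebra_simps)
    moreover have "6 / m * I \<le> 6 / m * I * (1 + \<bar>L z\<bar>)"
      using mult_left_mono[of 1 "1 + \<bar>L z\<bar>" "6 / m * I"] I m(1) by simp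
    ultimately have "C1 * (2 + \<bar>c\<bar> + \<bar>L z\<bar>) + 6 / m * I \<le> (C1 * (2 + \<bar>c\<bar>) + 6 / m * I) * (1 + \<bar>L z\<bar>)"
      by (simp add: algebra_simps)
    then have "12 * pi * v z \<le> 150 * exp 4 * ((C1 * (2 + \<bar>c\<bar>) + 6 / m * I) * (1 + \<bar>L z\<bar>))"
      by (intro order_trans[OF main[OF z]] mult_left_mono) auto
    then show ?thesis unfolding C_def by (simp add: field_simps)
  qed
  then show ?thesis unfolding v_def s_def L_def by blast
qed

section \<open>The integral of the Laplacian on the twice punctured plane\<close>

definition punct :: "complex set" where "punct = - {0, 1}"

text \<open>Equals -ln|z-p| up to a bounded term near p and tends to 0 at infinity, so it carries a
  single logarithmic singularity in the plane.\<close>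

definition logpole :: "complex \<Rightarrow> complex \<Rightarrow> real" where
  "logpole p z = logabs p 1 z + (-1) * logabs p 0 z"

lemma logpole_bounds:
  assumes "z \<noteq> p"
  shows "0 \<le> logpole p z" "cmod (z - p) \<ge> 1 \<Longrightarrow> logpole p z \<le> 1/2" "- ln (cmod (z - p)) \<le> logpole p z"
proof -
  define x where "x = (cmod (z - p))\<^sup>2"
  have x: "x > 0" using assms by (simp add: x_def)
  have e: "logpole p z = (ln (x + 1) - ln x) / 2" by (simp add: logpole_def logabs_def x_def)
  have "ln x \<le> ln (x + 1)" "0 \<le> ln (x + 1)" using x by auto
  moreover have "ln x = 2 * ln (cmod (z - p))" using assms by (simp add: x_def ln_realpow)
  ultimately have "0 \<le> ln (x + 1) - ln x" "- ln (cmod (z - p)) * 2 \<le> ln (x + 1) - ln x" by linarith+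
  then show "0 \<le> logpole p z" "- ln (cmod (z - p)) \<le> logpole p z" unfolding e by simp_all
  assume "cmod (z - p) \<ge> 1"
  then have "x \<ge> 1" by (simp add: x_def)
  then have "(x + 1) / x - 1 \<le> 1" by (simp add: field_simps)
  moreover have "ln ((x + 1) / x) \<le> (x + 1) / x - 1" using x by (intro ln_le_minus_one) simp
  moreover have "ln ((x + 1) / x) = ln (x + 1) - ln x" using x by (simp add: ln_div)
  ultimately have "ln (x + 1) - ln x \<le> 1" by linarith
  then show "logpole p z \<le> 1/2" unfolding e by simp
qed

lemma open_punct: "open punct" unfolding punct_def by (simp add: open_Compl)

lemma lapG_logpole:
  assumes "p \<notin> S"
  shows "\<exists>g. lapG S (logpole p) g (\<lambda>z. 2 / ((cmod (z - p))\<^sup>2 + 1)\<^sup>2)"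
proof -
  have 1: "lapG S (logabs p 1) (\<lambda>z. (cmod (z - p))\<^sup>2 / ((cmod (z - p))\<^sup>2 + 1\<^sup>2)\<^sup>2) (\<lambda>z. 2 * 1\<^sup>2 / ((cmod (z - p))\<^sup>2 + 1\<^sup>2)\<^sup>2)"
    by (rule lapG_logabs) simp
  have "lapG S (logabs p 0) (\<lambda>z. (cmod (z - p))\<^sup>2 / ((cmod (z - p))\<^sup>2 + 0\<^sup>2)\<^sup>2) (\<lambda>z. 2 * 0\<^sup>2 / ((cmod (z - p))\<^sup>2 + 0\<^sup>2)\<^sup>2)"
    using assms by (intro lapG_logabs) auto
  from lapG_cmult[OF this, of "- 1"] obtain g where 2: "lapG S (\<lambda>z. - 1 * logabs p 0 z) g (\<lambda>z. - 1 * (2 * 0\<^sup>2 / ((cmod (z - p))\<^sup>2 + 0\<^sup>2)\<^sup>2))"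
    by blast
  from lapG_add[OF 1 2] show ?thesis by (simp add: logpole_def[abs_def])
qed

text \<open>Up to bounded terms it is -c0 ln|z| at 0, -c1 ln|z-1| at 1 and c2 ln|z| at infinity;
  each coefficient contributes 2 pi times itself to the integral of the Laplacian.\<close>

definition model :: "real \<Rightarrow> real \<Rightarrow> real \<Rightarrow> complex \<Rightarrow> real" where
  "model c0 c1 c2 z = c2 * logabs 0 1 z + (c0 * logpole 0 z + c1 * logpole 1 z)"

definition model_lap :: "real \<Rightarrow> real \<Rightarrow> real \<Rightarrow> complex \<Rightarrow> real" where
  "model_lap c0 c1 c2 z = c2 * (2 / ((cmod z)\<^sup>2 + 1)\<^sup>2) + (c0 * (2 / ((cmod z)\<^sup>2 + 1)\<^sup>2) + c1 * (2 / ((cmod (z - 1))\<^sup>2 + 1)\<^sup>2))"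

lemma lapG_model: "\<exists>g. lapG punct (model c0 c1 c2) g (model_lap c0 c1 c2)"
proof -
  have "lapG punct (logabs 0 1) (\<lambda>z. (cmod (z - 0))\<^sup>2 / ((cmod (z - 0))\<^sup>2 + 1\<^sup>2)\<^sup>2) (\<lambda>z. 2 * 1\<^sup>2 / ((cmod (z - 0))\<^sup>2 + 1\<^sup>2)\<^sup>2)"
    by (rule lapG_logabs) simp
  from lapG_cmult[OF this, of c2] obtain g1 where 1: "lapG punct (\<lambda>z. c2 * logabs 0 1 z) g1 (\<lambda>z. c2 * (2 / ((cmod z)\<^sup>2 + 1)\<^sup>2))"
    by auto
  obtain g2 where "lapG punct (logpole 0) g2 (\<lambda>z. 2 / ((cmod (z - 0))\<^sup>2 + 1)\<^sup>2)"
    using lapG_logpole[of 0 punct] by (auto simp: punct_def)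
  from lapG_cmult[OF this, of c0] obtain g2 where 2: "lapG punct (\<lambda>z. c0 * logpole 0 z) g2 (\<lambda>z. c0 * (2 / ((cmod z)\<^sup>2 + 1)\<^sup>2))"
    by auto
  obtain g3 where "lapG punct (logpole 1) g3 (\<lambda>z. 2 / ((cmod (z - 1))\<^sup>2 + 1)\<^sup>2)"
    using lapG_logpole[of 1 punct] by (auto simp: punct_def)
  from lapG_cmult[OF this, of c1] obtain g3 where 3: "lapG punct (\<lambda>z. c1 * logpole 1 z) g3 (\<lambda>z. c1 * (2 / ((cmod (z - 1))\<^sup>2 + 1)\<^sup>2))"
    by auto
  obtain g4 where "lapG punct (\<lambda>z. c0 * logpole 0 z + c1 * logpole 1 z) g4
     (\<lambda>z. c0 * (2 / ((cmod z)\<^sup>2 + 1)\<^sup>2) + c1 * (2 / ((cmod (z - 1))\<^sup>2 + 1)\<^sup>2))"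
    using lapG_add[OF 2 3] by blast
  from lapG_add[OF 1 this] show ?thesis unfolding model_def[abs_def] model_lap_def[abs_def] .
qed

lemma model_lap_integral:
  "set_integrable lborel punct (model_lap c0 c1 c2)"
  "(LINT z:punct|lborel. model_lap c0 c1 c2 z) = 2 * pi * (c0 + c1 + c2)"
proof -
  have 0: "integrable lborel (\<lambda>z::complex. 2 / ((cmod z)\<^sup>2 + 1)\<^sup>2)" "(LINT z|lborel. 2 / ((cmod (z::complex))\<^sup>2 + 1)\<^sup>2) = 2 * pi"
    using sphere_area[of 1 0] by simp_all
  have 1: "integrable lborel (\<lambda>z::complex. 2 / ((cmod (z - 1))\<^sup>2 + 1)\<^sup>2)" "(LINT z|lborel. 2 / ((cmod (z - 1))\<^sup>2 + 1)\<^sup>2) = 2 * pi"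
    using sphere_area[of 1 1] by simp_all
  have i: "integrable lborel (model_lap c0 c1 c2)"
    unfolding model_lap_def[abs_def] by (intro Bochner_Integration.integrable_add integrable_mult_right 0 1)
  have "(LINT z|lborel. model_lap c0 c1 c2 z) = c2 * (2 * pi) + (c0 * (2 * pi) + c1 * (2 * pi))"
    unfolding model_lap_def[abs_def]
    by (subst Bochner_Integration.integral_add integral_mult_right_zero 0 1 |
        intro Bochner_Integration.integrable_add integrable_mult_right 0 1 refl)+
  then have v: "(LINT z|lborel. model_lap c0 c1 c2 z) = 2 * pi * (c0 + c1 + c2)" by (simp add: algebra_simps)
  show "set_integrable lborel punct (model_lap c0 c1 c2)"
    unfolding set_integrable_def using i open_punct by (intro integrable_mult_indicator) auto
  have N: "{0, 1} \<in> null_sets (lborel :: complex measure)"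
    by (intro finite_imp_null_set_lborel) simp
  have "AE z in lborel. indicator punct z *\<^sub>R model_lap c0 c1 c2 z = model_lap c0 c1 c2 z"
    using AE_not_in[OF N] by eventually_elim (simp add: punct_def)
  moreover have m: "(\<lambda>z. indicator punct z *\<^sub>R model_lap c0 c1 c2 z) \<in> borel_measurable lborel"
    using \<open>set_integrable lborel punct (model_lap c0 c1 c2)\<close> unfolding set_integrable_def
    by (rule borel_measurable_integrable)
  ultimately have "(LINT z:punct|lborel. model_lap c0 c1 c2 z) = (LINT z|lborel. model_lap c0 c1 c2 z)"
    unfolding set_lebesgue_integral_def using borel_measurable_integrable[OF i]
    by (intro integral_cong_AE)
  then show "(LINT z:punct|lborel. model_lap c0 c1 c2 z) = 2 * pi * (c0 + c1 + c2)" using v by simp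
qed

text \<open>\<open>H\<close> tends to infinity at all three punctures, so functions of \<open>\<epsilon> H\<close> serve as cutoffs.\<close>

lemma integral_laplacian_bounded:
  assumes w: "lapG punct w g l" and bd: "\<And>z. z \<in> punct \<Longrightarrow> \<bar>w z\<bar> \<le> B" and li: "set_integrable lborel punct l"
  shows "(LINT z:punct|lborel. l z) = 0"
proof -
  define H where "H = model 1 1 1"
  define h where "h = model_lap 1 1 1"
  obtain gH where lapH: "lapG punct H gH h" using lapG_model unfolding H_def h_def by blast
  have gH0: "gH z \<ge> 0" if "z \<in> punct" for z
    using lapH that unfolding lapG_def by auto
  have h0: "h z \<ge> 0" for z unfolding h_def model_lap_def by simp
  have hi: "set_integrable lborel punct h" unfolding h_def by (rule model_lap_integral)
  have L0: "logabs 0 1 z \<ge> 0" "ln (cmod z) \<le> logabs 0 1 z" if "z \<noteq> 0" for z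
  proof -
    show "logabs 0 1 z \<ge> 0" by (simp add: logabs_def)
    have "ln ((cmod z)\<^sup>2) \<le> ln ((cmod z)\<^sup>2 + 1)" using that by (subst ln_le_cancel_iff) (auto simp: add_pos_nonneg)
    then show "ln (cmod z) \<le> logabs 0 1 z" using that by (simp add: logabs_def ln_realpow)
  qed
  have H0: "H z \<ge> 0" if "z \<in> punct" for z
    using that L0[of z] logpole_bounds(1)[of z 0] logpole_bounds(1)[of z 1] by (simp add: H_def model_def punct_def)
  define K where "K T = cball 0 (exp T) - (ball 0 (exp (- T)) \<union> ball (1::complex) (exp (- T)))" for T
  have K: "compact (K T)" "K T \<subseteq> punct" for T
  proof -
    show "compact (K T)" unfolding K_def by (intro compact_diff) auto
    show "K T \<subseteq> punct" by (auto simp: K_def punct_def)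
  qed
  have out: "H z > T" if "z \<in> punct - K T" for T z
  proof -
    have z: "z \<noteq> 0" "z \<noteq> 1" using that by (auto simp: punct_def)
    have "T < ln (cmod z) \<or> ln (cmod z) < - T \<or> ln (cmod (z - 1)) < - T"
    proof -
      have "exp T < cmod z \<or> cmod z < exp (- T) \<or> cmod (z - 1) < exp (- T)"
        using that by (auto simp: K_def dist_norm norm_minus_commute)
      then show ?thesis using z
        by (metis exp_less_cancel_iff exp_ln right_minus_eq zero_less_norm_iff)
    qed
    then show ?thesis
      using L0[OF z(1)] logpole_bounds(1,3)[OF z(1)] logpole_bounds(1,3)[OF z(2)]
      unfolding H_def model_def by auto
  qed
  define e where "e n = 1 / real (Suc n)" for n
  have e: "e n > 0" for n by (simp add: e_def)
  have elim: "e \<longlonglongrightarrow> 0" unfolding e_def using LIMSEQ_inverse_real_of_nat by (simp add: inverse_eq_divide)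
  \<comment> \<open>The cube of \<open>m n\<close> tends to 1 pointwise and vanishes where H exceeds
    1 / e n, hence off a compact set; cubing makes it twice continuously differentiable.\<close>
  define m where "m n z = max 0 (1 - e n * H z)" for n z
  have m1: "0 \<le> m n z" "m n z \<le> 1" if "z \<in> punct" for n z
    using H0[OF that] e[of n] by (auto simp: m_def)
  define c2 where "c2 n z = (- e n)\<^sup>2 * (6 * m n z) * gH z + (- e n) * (3 * (m n z)\<^sup>2) * h z" for n z
  have lapc: "\<exists>g. lapG punct (\<lambda>z. (m n z) ^ 3) g (c2 n)" for n
    using lapG_compose[OF rC2_affine[OF rC2_max_cube, of "- e n" 1] lapH]
    unfolding m_def c2_def by (auto simp: algebra_simps)
  have van: "(m n z) ^ 3 = 0" if "z \<in> punct - K (1 / e n)" for n z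
    using out[OF that] e[of n] by (simp add: m_def field_simps)
  define IH where "IH = (LINT z:punct|lborel. h z)"
  have bound: "\<bar>LINT z:punct|lborel. (m n z) ^ 3 * l z\<bar> \<le> B * (6 * e n * IH)" for n
  proof -
    obtain gc where lc: "lapG punct (\<lambda>z. (m n z) ^ 3) gc (c2 n)" using lapc by blast
    note G = Green_lapG[OF w lc open_punct K(1)[of "1 / e n"] K(2)[of "1 / e n"] van]
    note G1 = Green_lapG[OF lapG_const[of punct 1] lc open_punct K(1)[of "1 / e n"] K(2)[of "1 / e n"] van]
    have c2i: "set_integrable lborel punct (c2 n)" using G1(2) by simp
    \<comment> \<open>Testing the constant 1 against the cutoff shows that the Laplacian of the
      cutoff has integral 0. Its negative part is at most 3 e h, so its L1 norm is O(e n) without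
      any estimate of the gradient of \<open>H\<close>.\<close>
    have c20: "(LINT z:punct|lborel. c2 n z) = 0" using G1(3) by (simp add: set_lebesgue_integral_def)
    have le: "\<bar>c2 n z\<bar> \<le> c2 n z + 6 * e n * h z" if "z \<in> punct" for z
    proof -
      have "0 \<le> (- e n)\<^sup>2 * (6 * m n z) * gH z" using gH0[OF that] m1[OF that, of n] by simp
      moreover have "(m n z)\<^sup>2 \<le> 1" using m1[OF that, of n] by (simp add: power_le_one)
      then have "e n * (3 * (m n z)\<^sup>2) * h z \<le> e n * (3 * 1) * h z"
        using e[of n] h0[of z] by (intro mult_right_mono mult_left_mono) auto
      moreover have "0 \<le> e n * (3 * (m n z)\<^sup>2) * h z" using e[of n] h0[of z] by simp
      ultimately show ?thesis unfolding c2_def by (auto simp: abs_if)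
    qed
    have B0: "B \<ge> 0" using bd[of 2] by (force simp: punct_def)
    have "\<bar>LINT z:punct|lborel. (m n z) ^ 3 * l z\<bar> = \<bar>LINT z:punct|lborel. w z * c2 n z\<bar>"
      using G(3) by simp
    also have "\<dots> \<le> (LINT z:punct|lborel. B * (c2 n z + 6 * e n * h z))"
      unfolding set_lebesgue_integral_def
    proof (rule integral_abs_bound_integral)
      show "integrable lborel (\<lambda>z. indicator punct z *\<^sub>R (w z * c2 n z))" using G(2) by (simp add: set_integrable_def)
      show "integrable lborel (\<lambda>z. indicator punct z *\<^sub>R (B * (c2 n z + 6 * e n * h z)))"
        using set_integrable_mult_right[OF set_integral_add(1)[OF c2i set_integrable_mult_right[OF hi, of "6 * e n"]], of B]
        by (simp add: set_integrable_def)
      fix z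
      show "\<bar>indicator punct z *\<^sub>R (w z * c2 n z)\<bar> \<le> indicator punct z *\<^sub>R (B * (c2 n z + 6 * e n * h z))"
        using mult_mono[OF bd le, of z] B0 by (auto simp: indicator_def abs_mult)
    qed
    also have "\<dots> = B * ((LINT z:punct|lborel. c2 n z) + 6 * e n * IH)"
      unfolding IH_def using c2i hi by (simp add: set_integral_add)
    finally show ?thesis using c20 by simp
  qed
  have "(\<lambda>n. LINT z:punct|lborel. (m n z) ^ 3 * l z) \<longlonglongrightarrow> (LINT z:punct|lborel. l z)"
    unfolding set_lebesgue_integral_def
  proof (rule integral_dominated_convergence[where w = "\<lambda>z. \<bar>indicator punct z *\<^sub>R l z\<bar>"])
    show "(\<lambda>z. indicator punct z *\<^sub>R l z) \<in> borel_measurable lborel"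
      using li unfolding set_integrable_def by (rule borel_measurable_integrable)
    show "integrable lborel (\<lambda>z. \<bar>indicator punct z *\<^sub>R l z\<bar>)"
      using li unfolding set_integrable_def by (rule integrable_abs)
    show "(\<lambda>z. indicator punct z *\<^sub>R ((m n z) ^ 3 * l z)) \<in> borel_measurable lborel" for n
    proof -
      obtain gc where lc: "lapG punct (\<lambda>z. (m n z) ^ 3) gc (c2 n)" using lapc by blast
      show ?thesis using Green_lapG(1)[OF w lc open_punct K(1)[of "1 / e n"] K(2)[of "1 / e n"] van] unfolding set_integrable_def
        by (rule borel_measurable_integrable)
    qed
    show "AE z in lborel. (\<lambda>n. indicator punct z *\<^sub>R ((m n z) ^ 3 * l z)) \<longlonglongrightarrow> indicator punct z *\<^sub>R l z"
    proof (rule AE_I2)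
      fix z
      have "(\<lambda>n. indicator punct z *\<^sub>R ((m n z) ^ 3 * l z)) \<longlonglongrightarrow> indicator punct z *\<^sub>R ((max 0 (1 - 0 * H z)) ^ 3 * l z)"
        unfolding m_def by (intro tendsto_intros elim)
      then show "(\<lambda>n. indicator punct z *\<^sub>R ((m n z) ^ 3 * l z)) \<longlonglongrightarrow> indicator punct z *\<^sub>R l z" by simp
    qed
    show "AE z in lborel. norm (indicator punct z *\<^sub>R ((m n z) ^ 3 * l z)) \<le> \<bar>indicator punct z *\<^sub>R l z\<bar>" for n
    proof (rule AE_I2)
      fix z
      show "norm (indicator punct z *\<^sub>R ((m n z) ^ 3 * l z)) \<le> \<bar>indicator punct z *\<^sub>R l z\<bar>"
        using m1[of z n] by (auto simp: indicator_def abs_mult power_le_one intro!: mult_left_le_one_le)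
    qed
  qed
  then have lim: "(\<lambda>n. \<bar>LINT z:punct|lborel. (m n z) ^ 3 * l z\<bar>) \<longlonglongrightarrow> \<bar>LINT z:punct|lborel. l z\<bar>" by (rule tendsto_rabs)
  have "(\<lambda>n. B * (6 * e n * IH)) \<longlonglongrightarrow> B * (6 * 0 * IH)" by (intro tendsto_intros elim)
  then have "\<bar>LINT z:punct|lborel. l z\<bar> \<le> B * (6 * 0 * IH)"
    by (rule LIMSEQ_le[OF lim]) (use bound in blast)
  then show ?thesis by simp
qed

text \<open>Subtracting the model with the same logarithmic singularities leaves a function that is
  bounded on all of \<open>punct\<close>, so its Laplacian integrates to 0 and the integral is that
  of the model.\<close>

lemma integral_laplacian_log_asymptotics:
  assumes u: "lapG punct u g l" and li: "set_integrable lborel punct l"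
    and r: "r > 0" "r \<le> 1/2"
    and b0: "\<And>z. z \<noteq> 0 \<Longrightarrow> cmod z < r \<Longrightarrow> \<bar>u z + c0 * ln (cmod z)\<bar> \<le> B"
    and b1: "\<And>z. z \<noteq> 1 \<Longrightarrow> cmod (z - 1) < r \<Longrightarrow> \<bar>u z + c1 * ln (cmod (z - 1))\<bar> \<le> B"
    and b2: "\<And>z. cmod z > 1 / r \<Longrightarrow> \<bar>u z - c2 * ln (cmod z)\<bar> \<le> B"
  shows "(LINT z:punct|lborel. l z) = 2 * pi * (c0 + c1 + c2)"
proof -
  obtain gm where "lapG punct (model c0 c1 c2) gm (model_lap c0 c1 c2)" using lapG_model by blast
  from lapG_cmult[OF this, of "- 1"] obtain gm where lm: "lapG punct (\<lambda>z. - 1 * model c0 c1 c2 z) gm (\<lambda>z. - 1 * model_lap c0 c1 c2 z)"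
    by blast
  define w where "w z = u z + - 1 * model c0 c1 c2 z" for z
  obtain gw where lw: "lapG punct w gw (\<lambda>z. l z + - 1 * model_lap c0 c1 c2 z)"
    using lapG_add[OF u lm] unfolding w_def by blast
  have cw: "continuous_on punct w" using lapG_continuous[OF lw] by blast
  have bnd: "\<exists>M. \<forall>z\<in>cball p (1/2). \<bar>f z\<bar> \<le> M" if "continuous_on (cball p (1/2)) f" for p and f :: "complex \<Rightarrow> real"
    using compact_imp_bounded[OF compact_continuous_image[OF that]] by (auto simp: bounded_iff)
  have cla: "continuous_on S (logabs p 1)" for p S
    unfolding logabs_def by (intro continuous_intros) (auto simp: add_nonneg_eq_0_iff)
  have clp: "continuous_on S (logpole p)" if "p \<notin> S" for p S
    using that unfolding logpole_def logabs_def by (intro continuous_intros) (auto simp: add_nonneg_eq_0_iff)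
  \<comment> \<open>Near a finite puncture the singular part of the model cancels against that of
    \<open>u\<close>. What is left is continuous on the closed disc of radius 1/2, which avoids the
    other puncture.\<close>
  obtain M0 where M0: "\<And>z. z \<in> cball 0 (1/2) \<Longrightarrow> \<bar>c2 * logabs 0 1 z + (c0 * logabs 0 1 z + c1 * logpole 1 z)\<bar> \<le> M0"
    using bnd[of 0 "\<lambda>z. c2 * logabs 0 1 z + (c0 * logabs 0 1 z + c1 * logpole 1 z)"] 
    by (fastforce intro!: continuous_intros cla clp)
  obtain M1 where M1: "\<And>z. z \<in> cball 1 (1/2) \<Longrightarrow> \<bar>c2 * logabs 0 1 z + (c0 * logpole 0 z + c1 * logabs 1 1 z)\<bar> \<le> M1"
    using bnd[of 1 "\<lambda>z. c2 * logabs 0 1 z + (c0 * logpole 0 z + c1 * logabs 1 1 z)"] 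
    by (fastforce intro!: continuous_intros cla clp)
  define M2 where "M2 = \<bar>c0\<bar> + \<bar>c1\<bar> + \<bar>c2\<bar>"
  define K where "K = cball 0 (1 / r) - (ball 0 r \<union> ball (1::complex) r)"
  have K: "compact K" "K \<subseteq> punct" unfolding K_def using r by (auto intro!: compact_diff simp: punct_def)
  obtain M3 where M3: "\<And>z. z \<in> K \<Longrightarrow> \<bar>w z\<bar> \<le> M3"
    using compact_imp_bounded[OF compact_continuous_image[OF continuous_on_subset[OF cw K(2)] K(1)]]
    by (auto simp: bounded_iff)
  define N where "N = \<bar>B\<bar> + \<bar>M0\<bar> + \<bar>M1\<bar> + \<bar>M3\<bar>"
  have N: "B + M0 \<le> N" "B + M1 \<le> N" "B \<le> N" "M3 \<le> N" unfolding N_def by linarith+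
  have M2: "M2 \<ge> 0" by (simp add: M2_def)
  have wb: "\<bar>w z\<bar> \<le> N + M2" if z: "z \<in> punct" for z
  proof -
    have z0: "z \<noteq> 0" "z \<noteq> 1" using z by (auto simp: punct_def)
    have "cmod z < r \<or> cmod (z - 1) < r \<or> cmod z > 1 / r \<or> z \<in> K"
      using norm_minus_commute[of 1 z] by (auto simp: K_def dist_norm not_less)
    then consider "cmod z < r" | "cmod (z - 1) < r" | "cmod z > 1 / r" | "z \<in> K" by blast
    then show ?thesis
    proof cases
      case 1
      have "w z = (u z + c0 * ln (cmod z)) - (c2 * logabs 0 1 z + (c0 * logabs 0 1 z + c1 * logpole 1 z))"
        using z0 by (simp add: w_def model_def logpole_def[of 0] logabs_0 algebra_simps)
      moreover have "z \<in> cball 0 (1/2)" using 1 r by simp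
      ultimately show ?thesis using b0[OF z0(1) 1] M0[of z] N(1) M2 by linarith
    next
      case 2
      have "w z = (u z + c1 * ln (cmod (z - 1))) - (c2 * logabs 0 1 z + (c0 * logpole 0 z + c1 * logabs 1 1 z))"
        using z0 by (simp add: w_def model_def logpole_def[of 1] logabs_0 algebra_simps)
      moreover have "z \<in> cball 1 (1/2)" using 2 r by (simp add: dist_norm norm_minus_commute)
      ultimately show ?thesis using b1[OF z0(2) 2] M1[of z] N(2) M2 by linarith
    next
      case 3
      have "1 / r \<ge> 2" using r by (simp add: field_simps)
      then have "cmod z \<ge> 2" using 3 by linarith
      then have "cmod (z - 1) \<ge> 1" using norm_triangle_ineq2[of z 1] by simp
      have l: "0 \<le> logpole 0 z" "logpole 0 z \<le> 1" "0 \<le> logpole 1 z" "logpole 1 z \<le> 1"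
        using logpole_bounds[OF z0(1)] logpole_bounds[OF z0(2)] \<open>cmod z \<ge> 2\<close> \<open>cmod (z - 1) \<ge> 1\<close> by auto
      have "w z = (u z - c2 * ln (cmod z)) - (c2 * logpole 0 z + (c0 * logpole 0 z + c1 * logpole 1 z))"
        using z0 by (simp add: w_def model_def logpole_def[of 0] logabs_0 algebra_simps)
      moreover have "\<bar>c2 * logpole 0 z + (c0 * logpole 0 z + c1 * logpole 1 z)\<bar> \<le> \<bar>c2\<bar> * 1 + (\<bar>c0\<bar> * 1 + \<bar>c1\<bar> * 1)"
        using l by (intro order_trans[OF abs_triangle_ineq] add_mono) (auto simp: abs_mult mult_left_le)
      then have "\<bar>c2 * logpole 0 z + (c0 * logpole 0 z + c1 * logpole 1 z)\<bar> \<le> M2" by (simp add: M2_def)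
      ultimately show ?thesis using b2[OF 3] N(3) by linarith
    next
      case 4
      then show ?thesis using M3[OF 4] N(4) M2 by linarith
    qed
  qed
  have mi: "set_integrable lborel punct (\<lambda>z. - 1 * model_lap c0 c1 c2 z)"
    by (intro set_integrable_mult_right model_lap_integral)
  have "(LINT z:punct|lborel. l z + - 1 * model_lap c0 c1 c2 z) = 0"
    by (rule integral_laplacian_bounded[OF lw wb set_integral_add(1)[OF li mi]])
  then have "(LINT z:punct|lborel. l z) + (LINT z:punct|lborel. - 1 * model_lap c0 c1 c2 z) = 0"
    by (simp only: set_integral_add(2)[OF li mi])
  then have "(LINT z:punct|lborel. l z) + - 1 * (LINT z:punct|lborel. model_lap c0 c1 c2 z) = 0"
    by (simp only: set_integral_mult_right)
  then show ?thesis using model_lap_integral(2)[of c0 c1 c2] by simp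
qed

section \<open>Holomorphic functions with periodic modulus\<close>

lemma holomorphic_compose2:
  "g holomorphic_on T \<Longrightarrow> f holomorphic_on S \<Longrightarrow> f ` S \<subseteq> T \<Longrightarrow> (\<lambda>x. g (f x)) holomorphic_on S"
  using holomorphic_on_compose_gen[of f S g T] by (simp add: o_def)

text \<open>On a small ball where g has no zero the quotient f / g has modulus 1, so it is constant
  by the maximum principle; analytic continuation spreads the constant. If g vanishes identically,
  so does f.\<close>

lemma holomorphic_equal_modulus:
  assumes "f holomorphic_on S" "g holomorphic_on S" "open S" "connected S"
    and eq: "\<And>z. z \<in> S \<Longrightarrow> cmod (f z) = cmod (g z)"
  shows "\<exists>k. cmod k = 1 \<and> (\<forall>z\<in>S. f z = k * g z)"
proof (cases "\<exists>w\<in>S. g w \<noteq> 0")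
  case False
  then have "f z = 1 * g z" if "z \<in> S" for z using eq[OF that] that by auto
  then show ?thesis by (intro exI[of _ 1]) auto
next
  case True
  then obtain w where w: "w \<in> S" "g w \<noteq> 0" by blast
  define V where "V = {z \<in> S. g z \<noteq> 0}"
  have "V = S \<inter> g -` (- {0})" by (auto simp: V_def)
  then have oV: "open V"
    using continuous_open_preimage[OF holomorphic_on_imp_continuous_on[OF assms(2)] assms(3), of "- {0}"]
    by (simp add: open_Compl)
  have wV: "w \<in> V" using w by (simp add: V_def)
  obtain r where r: "r > 0" "ball w r \<subseteq> V" using oV wV open_contains_ball by blast
  have hol: "(\<lambda>z. f z / g z) holomorphic_on ball w r"
    using r by (intro holomorphic_on_divide holomorphic_on_subset[OF assms(1)] holomorphic_on_subset[OF assms(2)]) (auto simp: V_def)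
  have one: "cmod (f z / g z) = 1" if "z \<in> ball w r" for z
    using that r eq[of z] by (auto simp: norm_divide V_def subset_iff)
  have "(\<lambda>z. f z / g z) constant_on ball w r"
    by (rule maximum_modulus_principle[OF hol, of "ball w r" w]) (use one r in auto)
  then obtain k where k: "\<And>z. z \<in> ball w r \<Longrightarrow> f z / g z = k" unfolding constant_on_def by blast
  have k1: "cmod k = 1" using one[of w] k[of w] r by simp
  have "f z = k * g z" if "z \<in> S" for z
  proof (rule analytic_continuation_open[of "ball w r" S f "\<lambda>z. k * g z"])
    show "f z = k * g z" if "z \<in> ball w r" for z
      using k[OF that] that r by (auto simp: V_def subset_iff field_simps)
  qed (use assms r that in \<open>auto simp: V_def intro!: holomorphic_intros\<close>)
  with k1 show ?thesis by blast
qed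

lemma exp_periodic_int:
  fixes b :: "complex \<Rightarrow> complex"
  assumes "\<And>\<zeta>. Re \<zeta> < 0 \<Longrightarrow> b (\<zeta> + 2 * of_real pi * \<i>) = b \<zeta>" "Re \<zeta> < 0"
  shows "b (\<zeta> + of_int n * (2 * of_real pi * \<i>)) = b \<zeta>"
proof -
  have nat: "b (\<zeta> + of_nat m * (2 * of_real pi * \<i>)) = b \<zeta>" if "Re \<zeta> < 0" for m \<zeta>
  proof (induction m)
    case (Suc m)
    have "b ((\<zeta> + of_nat m * (2 * of_real pi * \<i>)) + 2 * of_real pi * \<i>) = b (\<zeta> + of_nat m * (2 * of_real pi * \<i>))"
      using that by (intro assms(1)) simp
    then show ?case using Suc by (simp add: algebra_simps)
  qed simp
  show ?thesis
  proof (cases "n \<ge> 0")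
    case True
    then show ?thesis using nat[OF assms(2), of "nat n"] by (simp add: of_nat_nat)
  next
    case False
    have "b ((\<zeta> + of_int n * (2 * of_real pi * \<i>)) + of_nat (nat (- n)) * (2 * of_real pi * \<i>)) = b (\<zeta> + of_int n * (2 * of_real pi * \<i>))"
      using assms(2) by (intro nat) simp
    moreover have "of_nat (nat (- n)) = (of_int (- n) :: complex)" using False by (simp add: of_nat_nat)
    ultimately show ?thesis by (simp add: algebra_simps)
  qed
qed

text \<open>Periodicity makes the value independent of the branch of the logarithm, so the cut of
  \<open>Ln\<close> does no harm: near x0 the branch Ln(x / x0) + Ln x0 may be used instead.\<close>

lemma exp_lift_periodic:
  fixes b :: "complex \<Rightarrow> complex"
  assumes hol: "b holomorphic_on {\<zeta>. Re \<zeta> < 0}"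
    and per: "\<And>\<zeta>. Re \<zeta> < 0 \<Longrightarrow> b (\<zeta> + 2 * of_real pi * \<i>) = b \<zeta>"
  shows "(\<lambda>x. b (Ln x)) holomorphic_on ball 0 1 - {0}"
    "\<And>\<zeta>. Re \<zeta> < 0 \<Longrightarrow> b (Ln (exp \<zeta>)) = b \<zeta>"
proof -
  have val: "b (Ln x) = b \<zeta>" if "exp \<zeta> = x" "Re \<zeta> < 0" for x \<zeta>
  proof -
    have "exp (Ln x) = exp \<zeta>" using that by auto
    then obtain n :: int where "Ln x = \<zeta> + (of_int (2 * n) * pi) * \<i>" unfolding exp_eq by blast
    then have "Ln x = \<zeta> + of_int n * (2 * of_real pi * \<i>)" by simp
    then show ?thesis using exp_periodic_int[of b \<zeta> n, OF per that(2)] by simp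
  qed
  then show "\<And>\<zeta>. Re \<zeta> < 0 \<Longrightarrow> b (Ln (exp \<zeta>)) = b \<zeta>" by blast
  have "(\<lambda>x. b (Ln x)) field_differentiable at x0" if x0: "x0 \<in> ball 0 1 - {0}" for x0
  proof -
    define V where "V = {x \<in> ball 0 1 - {0}. x / x0 \<notin> \<real>\<^sub>\<le>\<^sub>0}"
    have "V = (ball 0 1 - {0}) \<inter> (\<lambda>x. x / x0) -` (- \<real>\<^sub>\<le>\<^sub>0)" by (auto simp: V_def)
    moreover have "open ((ball 0 1 - {0}) \<inter> (\<lambda>x. x / x0) -` (- \<real>\<^sub>\<le>\<^sub>0 :: complex set))"
      by (rule continuous_open_preimage) (use x0 in \<open>auto intro!: continuous_intros open_Compl open_Diff\<close>)
    ultimately have oV: "open V" by simp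
    have x0V: "x0 \<in> V" using x0 by (auto simp: V_def)
    have ex: "exp (Ln (x / x0) + Ln x0) = x" "Re (Ln (x / x0) + Ln x0) < 0" if "x \<in> V" for x
    proof -
      have x: "x \<noteq> 0" "cmod x < 1" using that by (auto simp: V_def)
      show e: "exp (Ln (x / x0) + Ln x0) = x" using x x0 by (simp add: exp_add)
      have "exp (Re (Ln (x / x0) + Ln x0)) = cmod x" by (metis e norm_exp_eq_Re)
      then show "Re (Ln (x / x0) + Ln x0) < 0" using x by (metis exp_less_one_iff)
    qed
    have "(\<lambda>x. b (Ln (x / x0) + Ln x0)) holomorphic_on V"
    proof (rule holomorphic_compose2[OF hol])
      show "(\<lambda>x. Ln (x / x0) + Ln x0) holomorphic_on V"
        using x0 by (auto intro!: holomorphic_intros simp: V_def)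
    qed (use ex(2) in auto)
    moreover have "b (Ln (x / x0) + Ln x0) = b (Ln x)" if "x \<in> V" for x
      using val[OF ex[OF that]] by simp
    ultimately have "(\<lambda>x. b (Ln x)) holomorphic_on V" by (rule holomorphic_transform)
    then show ?thesis using oV x0V holomorphic_on_imp_differentiable_at by blast
  qed
  then show "(\<lambda>x. b (Ln x)) holomorphic_on ball 0 1 - {0}"
    unfolding holomorphic_on_def by (blast intro: field_differentiable_at_within)
qed

text \<open>Since the modulus is periodic, translation by 2 pi i multiplies \<open>a\<close> by a
  constant \<kappa> of modulus 1. Dividing by exp(k \<zeta>) with k = Arg \<kappa> / (2 pi) makes it
  a function of x = exp \<zeta> on the punctured disc. The growth bound is polynomial in 1 / |x| and
  excludes an essential singularity, so splitting off the order n at 0 leaves the exponent e = k +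
  n.\<close>

lemma periodic_modulus_exponent:
  fixes a :: "complex \<Rightarrow> complex"
  assumes hol: "a holomorphic_on {\<zeta>. Re \<zeta> < 0}"
    and per: "\<And>\<zeta>. Re \<zeta> < 0 \<Longrightarrow> cmod (a (\<zeta> + 2 * of_real pi * \<i>)) = cmod (a \<zeta>)"
    and nz: "\<exists>\<zeta>. Re \<zeta> < 0 \<and> a \<zeta> \<noteq> 0"
    and gr: "\<And>\<zeta>. Re \<zeta> < - R \<Longrightarrow> cmod (a \<zeta>) \<le> exp (C * (1 + \<bar>Re \<zeta>\<bar>))"
  obtains e :: real and \<rho> :: real and F where "0 < \<rho>" "\<rho> \<le> 1" "F holomorphic_on ball 0 \<rho>"
    "\<And>x. x \<in> ball 0 \<rho> \<Longrightarrow> F x \<noteq> 0"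
    "\<And>\<zeta>. Re \<zeta> < ln \<rho> \<Longrightarrow> a \<zeta> = exp (of_real e * \<zeta>) * F (exp \<zeta>)"
proof -
  define H where "H = {\<zeta>::complex. Re \<zeta> < 0}"
  have H: "open H" "connected H" unfolding H_def
    by (auto simp: open_halfspace_Re_lt convex_halfspace_Re_lt convex_connected)
  have shift: "(\<lambda>\<zeta>. a (\<zeta> + 2 * of_real pi * \<i>)) holomorphic_on H"
    by (rule holomorphic_compose2[OF hol]) (auto simp: H_def intro!: holomorphic_intros)
  obtain \<kappa> where \<kappa>: "cmod \<kappa> = 1" "\<And>\<zeta>. Re \<zeta> < 0 \<Longrightarrow> a (\<zeta> + 2 * of_real pi * \<i>) = \<kappa> * a \<zeta>"
    using holomorphic_equal_modulus[OF shift hol[folded H_def] H] per by (auto simp: H_def)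
  define k where "k = Arg \<kappa> / (2 * pi)"
  have \<kappa>k: "exp (of_real k * (2 * of_real pi * \<i>)) = \<kappa>"
  proof -
    have e: "of_real k * (2 * of_real pi * \<i>) = \<i> * of_real (Arg \<kappa>)" by (simp add: k_def)
    have "\<kappa> \<noteq> 0" using \<kappa> by auto
    then have "exp (\<i> * of_real (Arg \<kappa>)) = \<kappa>" using Arg_eq[of \<kappa>] \<kappa>(1) by simp
    then show ?thesis unfolding e .
  qed
  define b where "b \<zeta> = a \<zeta> * exp (- of_real k * \<zeta>)" for \<zeta>
  have bhol: "b holomorphic_on {\<zeta>. Re \<zeta> < 0}"
    unfolding b_def by (intro holomorphic_intros hol)
  have bper: "b (\<zeta> + 2 * of_real pi * \<i>) = b \<zeta>" if "Re \<zeta> < 0" for \<zeta>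
  proof -
    have "exp (- of_real k * (\<zeta> + 2 * of_real pi * \<i>)) = exp (- of_real k * \<zeta>) / exp (of_real k * (2 * of_real pi * \<i>))"
      by (simp add: exp_diff[symmetric] algebra_simps)
    moreover have "\<kappa> \<noteq> 0" using \<kappa>(1) by auto
    ultimately show ?thesis unfolding b_def \<kappa>k using \<kappa>(2)[OF that] by simp
  qed
  define F0 where "F0 x = b (Ln x)" for x
  have F0hol: "F0 holomorphic_on ball 0 1 - {0}" and F0: "\<And>\<zeta>. Re \<zeta> < 0 \<Longrightarrow> F0 (exp \<zeta>) = b \<zeta>"
    using exp_lift_periodic[OF bhol bper] unfolding F0_def by auto
  have aF0: "a \<zeta> = exp (of_real k * \<zeta>) * F0 (exp \<zeta>)" if "Re \<zeta> < 0" for \<zeta>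
    unfolding F0[OF that] b_def by (simp add: exp_minus field_simps)
  have iso: "isolated_singularity_at F0 0"
    unfolding isolated_singularity_at_def
    by (rule exI[of _ 1]) (use F0hol in \<open>auto simp: analytic_on_open open_Diff\<close>)
  \<comment> \<open>\<open>N\<close> is large enough that x^N times the function is O(|x|); absolute
    values are taken because neither \<open>C\<close> nor \<open>k\<close> has a known sign.\<close>
  define N where "N = nat \<lceil>\<bar>C\<bar> + \<bar>k\<bar> + 1\<rceil>"
  have N: "real N - C - k \<ge> 1" unfolding N_def by linarith
  have bd: "cmod (x ^ N * F0 x) \<le> exp C * cmod x" if x: "x \<noteq> 0" "cmod x < exp (- \<bar>R\<bar>)" for x
  proof -
    define t where "t = ln (cmod x)"
    have t: "t < - \<bar>R\<bar>" using x by (metis exp_less_cancel_iff exp_ln t_def zero_less_norm_iff)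
    have Re: "Re (Ln x) = t" using x by (simp add: t_def)
    have cx: "cmod x = exp t" using x by (simp add: t_def)
    have "cmod (F0 x) = cmod (a (Ln x)) * exp (- k * t)"
      unfolding F0_def b_def norm_mult norm_exp_eq_Re by (simp add: Re)
    also have "\<dots> \<le> exp (C * (1 + \<bar>t\<bar>)) * exp (- k * t)"
      using gr[of "Ln x"] t Re by (intro mult_right_mono) auto
    also have "\<dots> = exp (C - C * t - k * t)" using t by (simp add: exp_add[symmetric] algebra_simps)
    finally have "cmod (x ^ N * F0 x) \<le> exp t ^ N * exp (C - C * t - k * t)"
      by (simp add: norm_mult norm_power cx mult_left_mono)
    also have "\<dots> = exp (C + (real N - C - k) * t)"
      by (simp add: exp_of_nat_mult[symmetric] exp_add[symmetric] algebra_simps)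
    also have "(real N - C - k) * t \<le> 1 * t" using N t by (intro mult_right_mono_neg) auto
    then have "exp (C + (real N - C - k) * t) \<le> exp (C + t)" by simp
    finally show ?thesis by (simp add: exp_add cx)
  qed
  have lim0: "(\<lambda>x. x ^ N * F0 x) \<midarrow>0\<rightarrow> 0"
  proof (rule Lim_null_comparison)
    have "\<forall>\<^sub>F x in at 0. x \<in> ball 0 (exp (- \<bar>R\<bar>)) - {0}"
      by (intro eventually_at_in_open) auto
    then show "\<forall>\<^sub>F x in at 0. cmod (x ^ N * F0 x) \<le> exp C * cmod x"
      by eventually_elim (use bd in auto)
    have "((\<lambda>x. exp C * cmod x) \<longlongrightarrow> exp C * cmod (0::complex)) (at 0)" by (intro tendsto_intros)
    then show "((\<lambda>x::complex. exp C * cmod x) \<longlongrightarrow> 0) (at 0)" by simp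
  qed
  have ness: "not_essential F0 0"
  proof -
    have "not_essential (\<lambda>x. x ^ N * F0 x) 0" using lim0 unfolding not_essential_def by blast
    moreover have "isolated_singularity_at (\<lambda>x. x ^ N * F0 x) 0"
      unfolding isolated_singularity_at_def
      by (rule exI[of _ 1]) (use F0hol in \<open>auto simp: analytic_on_open open_Diff intro!: holomorphic_intros\<close>)
    moreover have "not_essential (\<lambda>x::complex. x ^ N) 0" "isolated_singularity_at (\<lambda>x::complex. x ^ N) 0"
      by (auto intro!: not_essential_analytic isolated_singularity_at_analytic analytic_intros)
    ultimately have "not_essential (\<lambda>x. (x ^ N * F0 x) / x ^ N) 0" by (intro not_essential_divide)
    moreover have "\<forall>\<^sub>F x in at 0. (x ^ N * F0 x) / x ^ N = F0 x"
      by (rule eventually_mono[OF eventually_neq_at_within[of 0 0 UNIV]]) simp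
    ultimately show ?thesis using not_essential_cong[of "\<lambda>x. (x ^ N * F0 x) / x ^ N" F0 0 0] by simp
  qed
  have freq: "\<exists>\<^sub>F x in at 0. F0 x \<noteq> 0"
  proof (rule ccontr)
    assume "\<not> ?thesis"
    then have "\<forall>\<^sub>F x in at 0. F0 x = 0" by (simp add: frequently_def)
    then obtain d where d: "d > 0" "\<And>x. x \<noteq> 0 \<Longrightarrow> dist x 0 < d \<Longrightarrow> F0 x = 0"
      unfolding eventually_at by blast
    define V where "V = {\<zeta>::complex. Re \<zeta> < min 0 (ln d)}"
    have a0: "a \<zeta> = 0" if "\<zeta> \<in> V" for \<zeta>
    proof -
      have "cmod (exp \<zeta>) < d" using that d by (simp add: V_def) (metis exp_less_cancel_iff exp_ln)
      then show ?thesis using aF0[of \<zeta>] that d(2)[of "exp \<zeta>"] by (simp add: V_def)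
    qed
    have "complex_of_real (min 0 (ln d) - 1) \<in> V" by (simp add: V_def min_def)
    then have Vne: "V \<noteq> {}" by blast
    have oV: "open V" unfolding V_def by (rule open_halfspace_Re_lt)
    have VH: "V \<subseteq> H" by (auto simp: V_def H_def)
    obtain \<zeta> where \<zeta>: "\<zeta> \<in> H" "a \<zeta> \<noteq> 0" using nz by (auto simp: H_def)
    have "a \<zeta> = 0"
      by (rule analytic_continuation_open[of V H a "\<lambda>_. 0"])
         (use Vne H hol[folded H_def] a0 \<zeta> oV VH in auto)
    then show False using \<zeta> by simp
  qed
  define n where "n = zorder F0 0"
  obtain r where r: "r > 0" "zor_poly F0 0 holomorphic_on cball 0 r" "zor_poly F0 0 0 \<noteq> 0"
     "\<And>w. w \<in> cball 0 r - {0} \<Longrightarrow> F0 w = zor_poly F0 0 w * w powi n \<and> zor_poly F0 0 w \<noteq> 0"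
    using zorder_exist[OF iso ness freq] unfolding n_def by auto
  define F where "F = zor_poly F0 0"
  show ?thesis
  proof (rule that[of "min r 1" F "k + of_int n"])
    show "F holomorphic_on ball 0 (min r 1)" using r(2) unfolding F_def by (rule holomorphic_on_subset) auto
    show "F x \<noteq> 0" if "x \<in> ball 0 (min r 1)" for x using r(3) r(4)[of x] that by (cases "x = 0") (auto simp: F_def)
    show "a \<zeta> = exp (of_real (k + of_int n) * \<zeta>) * F (exp \<zeta>)" if "Re \<zeta> < ln (min r 1)" for \<zeta>
    proof -
      have "ln (min r 1) \<le> 0" using r by simp
      then have neg: "Re \<zeta> < 0" using that by linarith
      have "cmod (exp \<zeta>) < min r 1" using that r(1)
        by (metis exp_less_cancel_iff exp_ln min_less_iff_conj norm_exp_eq_Re zero_less_one)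
      then have "F0 (exp \<zeta>) = F (exp \<zeta>) * exp \<zeta> powi n" using r(4)[of "exp \<zeta>"] by (auto simp: F_def)
      also have "exp \<zeta> powi n = exp (of_int n * \<zeta>)" by (simp add: exp_power_int)
      finally show ?thesis using aF0[OF neg] by (simp add: exp_add distrib_right)
    qed
  qed (use r in auto)
qed

section \<open>Exponents of two forms with a prescribed Wronskian\<close>

lemma tendsto_exp_at_bot_cases:
  fixes M f :: "real \<Rightarrow> real"
  assumes "\<forall>\<^sub>F t in at_bot. f t = exp (s * t) * M t" "(f \<longlongrightarrow> l) at_bot" "(M \<longlongrightarrow> m) at_bot"
  shows "l \<noteq> 0 \<Longrightarrow> s \<le> 0" "m \<noteq> 0 \<Longrightarrow> s \<ge> 0"
proof -
  have e0: "((\<lambda>t::real. exp (c * t)) \<longlongrightarrow> 0) at_bot" if "c > 0" for c :: real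
    using that by real_asymp
  show "s \<le> 0" if l: "l \<noteq> 0"
  proof (rule ccontr)
    assume "\<not> s \<le> 0"
    then have "((\<lambda>t. exp (s * t) * M t) \<longlongrightarrow> 0 * m) at_bot" by (intro tendsto_intros e0 assms(3)) auto
    then have "(f \<longlongrightarrow> 0 * m) at_bot" by (simp only: tendsto_cong[OF assms(1)])
    then show False using tendsto_unique[OF _ assms(2)] l by fastforce
  qed
  show "s \<ge> 0" if m: "m \<noteq> 0"
  proof (rule ccontr)
    assume "\<not> s \<ge> 0"
    then have "((\<lambda>t. exp (- s * t) * f t) \<longlongrightarrow> 0 * l) at_bot" by (intro tendsto_intros e0 assms(2)) auto
    moreover have "\<forall>\<^sub>F t in at_bot. exp (- s * t) * f t = M t"
      using assms(1) by eventually_elim (simp add: exp_minus)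
    ultimately have "(M \<longlongrightarrow> 0 * l) at_bot" using tendsto_cong by metis
    then show False using tendsto_unique[OF _ assms(3)] m by fastforce
  qed
qed

text \<open>Inserting the normal forms turns the Wronskian identity into x^(ea+eb) K^2 = 4 Q^2 F1 F2
  with x = exp \<zeta>, and the right side has a nonzero limit at 0. If ea \<noteq> eb then K(0)
  \<noteq> 0, so ea + eb = 0. If ea = eb then K = x D, where D may vanish at 0, so only 2 ea + 2
  \<le> 0 follows. No factor x^(-2) appears because derivatives are taken in the logarithmic
  coordinate.\<close>

lemma end_exponents:
  fixes a c F1 F2 Q :: "complex \<Rightarrow> complex" and ea eb \<rho> :: real
  assumes \<rho>: "0 < \<rho>" and F: "F1 holomorphic_on ball 0 \<rho>" "F2 holomorphic_on ball 0 \<rho>" "F1 0 \<noteq> 0" "F2 0 \<noteq> 0"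
    and a: "\<And>\<zeta>. Re \<zeta> < ln \<rho> \<Longrightarrow> a \<zeta> = exp (of_real ea * \<zeta>) * F1 (exp \<zeta>)"
    and c: "\<And>\<zeta>. Re \<zeta> < ln \<rho> \<Longrightarrow> c \<zeta> = exp (of_real eb * \<zeta>) * F2 (exp \<zeta>)"
    and W: "\<And>\<zeta>. Re \<zeta> < ln \<rho> \<Longrightarrow> (a \<zeta> * deriv c \<zeta> - c \<zeta> * deriv a \<zeta>)\<^sup>2 = 4 * (Q (exp \<zeta>))\<^sup>2 * a \<zeta> * c \<zeta>"
    and Q: "(Q \<longlongrightarrow> q0) (at 0)" "q0 \<noteq> 0"
  shows "(ea \<noteq> 0 \<and> eb = - ea) \<or> (ea = eb \<and> ea \<le> - 1)"
proof -
  have oH: "open {\<zeta>. Re \<zeta> < ln \<rho>}" by (simp add: open_halfspace_Re_lt)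
  have inball: "exp \<zeta> \<in> ball 0 \<rho>" if "Re \<zeta> < ln \<rho>" for \<zeta>
    using that \<rho> by (simp add: dist_norm) (metis exp_less_cancel_iff exp_ln)
  have der: "deriv f \<zeta> = exp (of_real e * \<zeta>) * (of_real e * G (exp \<zeta>) + exp \<zeta> * deriv G (exp \<zeta>))"
    if f: "\<And>\<zeta>. Re \<zeta> < ln \<rho> \<Longrightarrow> f \<zeta> = exp (of_real e * \<zeta>) * G (exp \<zeta>)" and G: "G holomorphic_on ball 0 \<rho>"
      and \<zeta>: "Re \<zeta> < ln \<rho>" for f G e \<zeta>
  proof -
    have G': "(G has_field_derivative deriv G (exp \<zeta>)) (at (exp \<zeta>))"
      using holomorphic_derivI[OF G open_ball inball[OF \<zeta>]] .
    have "((\<lambda>\<zeta>. G (exp \<zeta>)) has_field_derivative deriv G (exp \<zeta>) * exp \<zeta>) (at \<zeta>)"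
      using DERIV_chain2[of G "deriv G (exp \<zeta>)" exp \<zeta> "exp \<zeta>" UNIV] G' DERIV_exp[of \<zeta>] by simp
    then have "((\<lambda>\<zeta>. exp (of_real e * \<zeta>) * G (exp \<zeta>)) has_field_derivative
        exp (of_real e * \<zeta>) * (of_real e * G (exp \<zeta>) + exp \<zeta> * deriv G (exp \<zeta>))) (at \<zeta>)"
      by (auto intro!: derivative_eq_intros simp: algebra_simps)
    then have "(f has_field_derivative
        exp (of_real e * \<zeta>) * (of_real e * G (exp \<zeta>) + exp \<zeta> * deriv G (exp \<zeta>))) (at \<zeta>)"
      by (rule has_field_derivative_transform_within_open[OF _ oH]) (use \<zeta> f in auto)
    then show ?thesis by (rule DERIV_imp_deriv)
  qed
  define D where "D x = F1 x * deriv F2 x - F2 x * deriv F1 x" for x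
  define K where "K x = of_real (eb - ea) * F1 x * F2 x + x * D x" for x
  have key: "exp (of_real (ea + eb) * \<zeta>) * (K (exp \<zeta>))\<^sup>2 = 4 * (Q (exp \<zeta>))\<^sup>2 * F1 (exp \<zeta>) * F2 (exp \<zeta>)"
    if \<zeta>: "Re \<zeta> < ln \<rho>" for \<zeta>
  proof -
    let ?E = "exp (of_real ea * \<zeta>) * exp (of_real eb * \<zeta>)"
    have da: "deriv a \<zeta> = exp (of_real ea * \<zeta>) * (of_real ea * F1 (exp \<zeta>) + exp \<zeta> * deriv F1 (exp \<zeta>))"
      by (rule der[OF _ F(1) \<zeta>]) (rule a)
    have dc: "deriv c \<zeta> = exp (of_real eb * \<zeta>) * (of_real eb * F2 (exp \<zeta>) + exp \<zeta> * deriv F2 (exp \<zeta>))"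
      by (rule der[OF _ F(2) \<zeta>]) (rule c)
    have "a \<zeta> * deriv c \<zeta> - c \<zeta> * deriv a \<zeta> = ?E * K (exp \<zeta>)"
      unfolding da dc a[OF \<zeta>] c[OF \<zeta>] K_def D_def by (simp add: algebra_simps)
    then have "(?E * K (exp \<zeta>))\<^sup>2 = 4 * (Q (exp \<zeta>))\<^sup>2 * (?E * (F1 (exp \<zeta>) * F2 (exp \<zeta>)))"
      using W[OF \<zeta>] a[OF \<zeta>] c[OF \<zeta>] by (simp add: mult_ac)
    then have "?E * (?E * (K (exp \<zeta>))\<^sup>2) = ?E * (4 * (Q (exp \<zeta>))\<^sup>2 * (F1 (exp \<zeta>) * F2 (exp \<zeta>)))"
      by (simp add: power_mult_distrib power2_eq_square mult_ac)
    then have "?E * (K (exp \<zeta>))\<^sup>2 = 4 * (Q (exp \<zeta>))\<^sup>2 * (F1 (exp \<zeta>) * F2 (exp \<zeta>))" by simp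
    then show ?thesis by (simp add: exp_add distrib_right mult.assoc)
  qed
  \<comment> \<open>The limit is taken along the real axis in \<zeta>, where moduli of exponentials
    are real powers.\<close>
  have elim: "((\<lambda>t::real. exp (complex_of_real t)) \<longlongrightarrow> 0) at_bot"
  proof -
    have "((\<lambda>t::real. complex_of_real (exp t)) \<longlongrightarrow> of_real 0) at_bot"
      by (intro tendsto_of_real exp_at_bot)
    then show ?thesis by (simp add: exp_of_real)
  qed
  have elim': "filterlim (\<lambda>t::real. exp (complex_of_real t)) (at 0) at_bot"
    using elim by (simp add: filterlim_at)
  have cont: "((\<lambda>t::real. f (exp (complex_of_real t))) \<longlongrightarrow> f 0) at_bot" if "f holomorphic_on ball 0 \<rho>" for f
    by (rule isCont_tendsto_compose[OF _ elim])
       (use that \<rho> in \<open>auto intro!: continuous_on_interior holomorphic_on_imp_continuous_on\<close>)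
  have Dh: "D holomorphic_on ball 0 \<rho>" and Kh: "K holomorphic_on ball 0 \<rho>"
    unfolding K_def D_def using F by (auto intro!: holomorphic_intros)
  define f where "f t = cmod (4 * (Q (exp (complex_of_real t)))\<^sup>2 * F1 (exp (complex_of_real t)) * F2 (exp (complex_of_real t)))" for t :: real
  have flim: "(f \<longlongrightarrow> cmod (4 * q0\<^sup>2 * F1 0 * F2 0)) at_bot"
    unfolding f_def by (intro tendsto_intros cont F filterlim_compose[OF Q(1) elim'])
  have ev: "\<forall>\<^sub>F t in at_bot. t < ln \<rho>" by (rule eventually_gt_at_bot)
  have keyt: "f t = exp ((ea + eb) * t) * (cmod (K (exp (complex_of_real t))))\<^sup>2" if "t < ln \<rho>" for t
    using arg_cong[OF key[of "complex_of_real t"], of cmod] that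
    by (simp add: f_def norm_mult norm_power)
  show ?thesis
  proof (cases "ea = eb")
    case False
    have K0: "(cmod (K 0))\<^sup>2 \<noteq> 0" using False F by (simp add: K_def)
    have "((\<lambda>t. (cmod (K (exp (complex_of_real t))))\<^sup>2) \<longlongrightarrow> (cmod (K 0))\<^sup>2) at_bot"
      by (intro tendsto_intros cont Kh)
    note T = tendsto_exp_at_bot_cases[OF _ flim this, of "ea + eb"]
    have "\<forall>\<^sub>F t in at_bot. f t = exp ((ea + eb) * t) * (cmod (K (exp (complex_of_real t))))\<^sup>2"
      using ev by eventually_elim (rule keyt)
    then have "ea + eb \<le> 0" "ea + eb \<ge> 0" using T K0 Q(2) F by auto
    then show ?thesis using False by auto
  next
    case True
    have "((\<lambda>t. (cmod (D (exp (complex_of_real t))))\<^sup>2) \<longlongrightarrow> (cmod (D 0))\<^sup>2) at_bot"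
      by (intro tendsto_intros cont Dh)
    note T = tendsto_exp_at_bot_cases(1)[OF _ flim this, of "2 * ea + 2"]
    have "\<forall>\<^sub>F t in at_bot. f t = exp ((2 * ea + 2) * t) * (cmod (D (exp (complex_of_real t))))\<^sup>2"
      using ev
    proof eventually_elim
      case (elim t)
      have "exp ((ea + eb) * t) * (exp t)\<^sup>2 = exp ((2 * ea + 2) * t)"
        using True by (simp add: power2_eq_square exp_add[symmetric] algebra_simps)
      then show ?case using keyt[OF elim] True by (simp add: K_def norm_mult power_mult_distrib mult.assoc[symmetric])
    qed
    then have "2 * ea + 2 \<le> 0" using T Q(2) F by auto
    then show ?thesis using True by auto
  qed
qed

section \<open>Rational functions with simple poles\<close>

lemma entire_extension_finite:
  assumes "finite Z" "f holomorphic_on - Z" "\<And>c. c \<in> Z \<Longrightarrow> ((\<lambda>z. (z - c) * f z) \<longlongrightarrow> 0) (at c)"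
  shows "\<exists>g. g holomorphic_on UNIV \<and> (\<forall>z\<in>- Z. g z = f z)"
  using assms
proof (induction Z arbitrary: f rule: finite_induct)
  case empty
  then show ?case by auto
next
  case (insert c Z)
  have oZ: "open (- Z)" using insert.hyps by (simp add: finite_imp_closed open_Compl)
  have "f holomorphic_on (- Z) - {c}" using insert.prems(1) by (rule holomorphic_on_subset) auto
  moreover have "c \<in> interior (- Z)" using insert.hyps oZ by (simp add: interior_open)
  ultimately obtain g where g: "g holomorphic_on - Z" "\<And>z. z \<in> - Z - {c} \<Longrightarrow> g z = f z"
    using holomorphic_on_extend_lim[of f "- Z" c] insert.prems(2)[of c] by auto
  have "((\<lambda>z. (z - d) * g z) \<longlongrightarrow> 0) (at d)" if d: "d \<in> Z" for d
  proof -
    have o: "open (- (insert c Z - {d}))" using insert.hyps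
      by (intro open_Compl finite_imp_closed finite_Diff finite.insertI)
    have "\<forall>\<^sub>F z in at d. z \<in> - (insert c Z - {d}) - {d}" by (rule eventually_at_in_open[OF o]) simp
    then have "\<forall>\<^sub>F z in at d. (z - d) * f z = (z - d) * g z"
      by eventually_elim (use g(2) in auto)
    then show ?thesis using insert.prems(2)[of d] d tendsto_cong by fast
  qed
  from insert.IH[OF g(1) this] obtain k where "k holomorphic_on UNIV" "\<And>z. z \<in> - Z \<Longrightarrow> k z = g z" by blast
  then show ?case using g(2) by (intro exI[of _ k]) auto
qed

lemma simple_poles_rational:
  assumes Z: "finite Z" and f: "f holomorphic_on - Z"
    and res: "\<And>c. c \<in> Z \<Longrightarrow> ((\<lambda>z. (z - c) * f z) \<longlongrightarrow> n c) (at c)"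
    and inf: "((\<lambda>z. z * f z) \<longlongrightarrow> R) at_infinity"
  shows "\<And>z. z \<notin> Z \<Longrightarrow> f z = (\<Sum>c\<in>Z. n c / (z - c))" "R = (\<Sum>c\<in>Z. n c)"
proof -
  define g where "g z = f z - (\<Sum>c\<in>Z. n c / (z - c))" for z
  have gh: "g holomorphic_on - Z" unfolding g_def using f by (intro holomorphic_intros) auto
  have g0: "((\<lambda>z. (z - d) * g z) \<longlongrightarrow> 0) (at d)" if d: "d \<in> Z" for d
  proof -
    have "((\<lambda>z. (z - d) * (n c / (z - c))) \<longlongrightarrow> (if c = d then n d else 0)) (at d)" for c
    proof (cases "c = d")
      case True
      have "\<forall>\<^sub>F z in at d. (z - d) * (n c / (z - c)) = n d"
        by (rule eventually_mono[OF eventually_neq_at_within[of d d UNIV]]) (use True in simp)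
      then show ?thesis unfolding if_P[OF True] by (rule tendsto_eventually)
    next
      case False
      then have "((\<lambda>z. (z - d) * (n c / (z - c))) \<longlongrightarrow> (d - d) * (n c / (d - c))) (at d)"
        by (intro tendsto_intros) auto
      then show ?thesis using False by simp
    qed
    then have "((\<lambda>z. (z - d) * f z - (\<Sum>c\<in>Z. (z - d) * (n c / (z - c)))) \<longlongrightarrow> n d - (\<Sum>c\<in>Z. if c = d then n d else 0)) (at d)"
      by (intro tendsto_intros res d)
    then show ?thesis using Z d by (simp add: g_def right_diff_distrib sum_distrib_left)
  qed
  obtain k where k: "k holomorphic_on UNIV" "\<And>z. z \<in> - Z \<Longrightarrow> k z = g z"
    using entire_extension_finite[OF Z gh g0] by blast
  have ginf: "((\<lambda>z. z * g z) \<longlongrightarrow> R - (\<Sum>c\<in>Z. n c)) at_infinity"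
  proof -
    have "((\<lambda>z. z * (n c / (z - c))) \<longlongrightarrow> n c) at_infinity" for c
    proof -
      have "((\<lambda>z. n c / (1 - c * inverse z)) \<longlongrightarrow> n c / (1 - c * 0)) at_infinity"
        by (intro tendsto_intros tendsto_inverse_0) auto
      moreover have "\<forall>\<^sub>F z in at_infinity. n c / (1 - c * inverse z) = z * (n c / (z - c))"
        using eventually_not_equal_at_infinity[of 0]
      proof eventually_elim
        case (elim z)
        have "1 - c * inverse z = (z - c) / z" using elim by (simp add: field_simps)
        then show ?case by simp
      qed
      ultimately show ?thesis using tendsto_cong by fastforce
    qed
    then have "((\<lambda>z. z * f z - (\<Sum>c\<in>Z. z * (n c / (z - c)))) \<longlongrightarrow> R - (\<Sum>c\<in>Z. n c)) at_infinity"
      by (intro tendsto_intros inf)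
    then show ?thesis by (simp add: g_def right_diff_distrib sum_distrib_left)
  qed
  have evZ: "\<forall>\<^sub>F z in at_infinity. z \<in> - Z"
  proof -
    obtain B where "\<And>z. z \<in> Z \<Longrightarrow> cmod z \<le> B" using finite_imp_bounded[OF Z] by (auto simp: bounded_iff)
    then show ?thesis unfolding eventually_at_infinity by (intro exI[of _ "B + 1"]) force
  qed
  have "((\<lambda>z. (z * g z) * inverse z) \<longlongrightarrow> (R - (\<Sum>c\<in>Z. n c)) * 0) at_infinity"
    by (intro tendsto_intros ginf tendsto_inverse_0)
  moreover have "\<forall>\<^sub>F z in at_infinity. (z * g z) * inverse z = k z"
    using evZ eventually_not_equal_at_infinity[of 0] by eventually_elim (use k(2) in auto)
  ultimately have "(k \<longlongrightarrow> 0) at_infinity" using tendsto_cong by fastforce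
  then have k0: "k z = 0" for z using Liouville_weak_0[OF k(1)] by blast
  then have g00: "g z = 0" if "z \<notin> Z" for z using k(2)[of z] that by simp
  then show "\<And>z. z \<notin> Z \<Longrightarrow> f z = (\<Sum>c\<in>Z. n c / (z - c))" by (simp add: g_def)
  have "\<forall>\<^sub>F z in at_infinity. z * g z = 0" using evZ by eventually_elim (use g00 in auto)
  then have "((\<lambda>z. z * g z) \<longlongrightarrow> 0) at_infinity" by (simp add: tendsto_eventually)
  from tendsto_unique[OF trivial_limit_at_infinity ginf this] show "R = (\<Sum>c\<in>Z. n c)" by simp
qed

section \<open>Commuting elements of PSU(2)\<close>

definition su2 :: "complex^2^2 \<Rightarrow> bool" where
  "su2 M \<longleftrightarrow> M $ 1 $ 2 = - cnj (M $ 2 $ 1) \<and> M $ 2 $ 2 = cnj (M $ 1 $ 1) \<and>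
     (cmod (M $ 1 $ 1))\<^sup>2 + (cmod (M $ 2 $ 1))\<^sup>2 = 1"

text \<open>The inverse is the adjugate because the determinant is 1, and the adjoint because the
  matrix is unitary; the equations compare the two entrywise.\<close>

lemma SU2_imp_su2:
  assumes "M \<in> carrier SU2"
  shows "su2 M"
proof -
  let ?a = "M $ 1 $ 1" and ?b = "M $ 1 $ 2" and ?c = "M $ 2 $ 1" and ?d = "M $ 2 $ 2"
  have u: "(\<chi> i j. cnj (M $ j $ i)) ** M = mat 1" and d: "det M = 1" using assms by (auto simp: SU2_def)
  have *: "cnj ?a * ?a + cnj ?c * ?c = 1" "cnj ?a * ?b + cnj ?c * ?d = 0" "cnj ?b * ?b + cnj ?d * ?d = 1"
    using u by (auto simp: matrix_matrix_mult_def vec_eq_iff sum_2 forall_2 mat_def)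
  have det: "?a * ?d - ?b * ?c = 1" using d by (simp add: det_2)
  have 1: "?d = cnj ?a"
  proof -
    have "cnj ?a = cnj ?a * (?a * ?d - ?b * ?c)" using det by simp
    also have "\<dots> = (cnj ?a * ?a) * ?d - (cnj ?a * ?b) * ?c" by (simp add: algebra_simps)
    also have "cnj ?a * ?b = - (cnj ?c * ?d)" using *(2) by (simp add: add_eq_0_iff2)
    also have "(cnj ?a * ?a) * ?d - (- (cnj ?c * ?d)) * ?c = (cnj ?a * ?a + cnj ?c * ?c) * ?d" by (simp add: algebra_simps)
    finally show ?thesis using *(1) by simp
  qed
  have 2: "?b = - cnj ?c"
  proof -
    have "cnj ?c = cnj ?c * (?a * ?d - ?b * ?c)" using det by simp
    also have "\<dots> = (cnj ?c * ?d) * ?a - (cnj ?c * ?c) * ?b" by (simp add: algebra_simps)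
    also have "cnj ?c * ?d = - (cnj ?a * ?b)" using *(2) by (simp add: add_eq_0_iff)
    also have "(- (cnj ?a * ?b)) * ?a - (cnj ?c * ?c) * ?b = - ((cnj ?a * ?a + cnj ?c * ?c) * ?b)" by (simp add: algebra_simps)
    finally show ?thesis using *(1) by simp
  qed
  have "complex_of_real ((cmod ?a)\<^sup>2 + (cmod ?c)\<^sup>2) = 1"
    using *(1) unfolding of_real_add complex_norm_square by (simp add: mult.commute)
  then have 3: "(cmod ?a)\<^sup>2 + (cmod ?c)\<^sup>2 = 1" using of_real_eq_1_iff by blast
  show ?thesis using 1 2 3 by (simp add: su2_def)
qed

lemma PSU2_carrierE:
  assumes "X \<in> carrier PSU2"
  obtains A where "A \<in> carrier SU2" "X = {A, - A}"
proof -
  obtain A where A: "A \<in> carrier SU2" "X = {mat 1, - mat 1} #>\<^bsub>SU2\<^esub> A"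
    using assms by (auto simp: PSU2_def FactGroup_def RCOSETS_def)
  have "(- mat 1) ** A = - A"
  proof -
    have "(- mat 1) ** A = - (mat 1 ** A)" by (simp add: matrix_matrix_mult_def vec_eq_iff sum_negf)
    then show ?thesis by (simp add: matrix_mul_lid)
  qed
  then have "{mat 1, - mat 1} #>\<^bsub>SU2\<^esub> A = {A, - A}"
    by (auto simp: r_coset_def SU2_def matrix_mul_lid)
  then show ?thesis using A that by blast
qed

text \<open>The column (x, 1) keeps its length. This is how 1 + |g|^2 changes under a Moebius
  transformation.\<close>

lemma su2_norm_column:
  assumes "su2 M"
  shows "(cmod (M $ 1 $ 1 * x + M $ 1 $ 2))\<^sup>2 + (cmod (M $ 2 $ 1 * x + M $ 2 $ 2))\<^sup>2 = (cmod x)\<^sup>2 + 1"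
proof -
  obtain s t where s: "M $ 1 $ 1 = s" "M $ 2 $ 1 = t" "M $ 1 $ 2 = - cnj t" "M $ 2 $ 2 = cnj s"
    "(cmod s)\<^sup>2 + (cmod t)\<^sup>2 = 1" using assms unfolding su2_def by blast
  have 1: "s * cnj s + t * cnj t = 1"
    using arg_cong[OF s(5), of complex_of_real] unfolding of_real_add complex_norm_square by simp
  have "complex_of_real ((cmod (s * x - cnj t))\<^sup>2 + (cmod (t * x + cnj s))\<^sup>2) = (s * cnj s + t * cnj t) * (x * cnj x + 1)"
    unfolding of_real_add complex_norm_square by (simp add: algebra_simps)
  also have "\<dots> = complex_of_real ((cmod x)\<^sup>2 + 1)" unfolding 1 of_real_add complex_norm_square by simp
  finally show ?thesis unfolding s by (simp only: of_real_eq_iff add_uminus_conv_diff)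
qed

lemma su2_norm_row:
  assumes "su2 M"
  shows "(cmod (r1 * M $ 1 $ 1 + r2 * M $ 2 $ 1))\<^sup>2 + (cmod (r1 * M $ 1 $ 2 + r2 * M $ 2 $ 2))\<^sup>2 = (cmod r1)\<^sup>2 + (cmod r2)\<^sup>2"
proof -
  obtain s t where s: "M $ 1 $ 1 = s" "M $ 2 $ 1 = t" "M $ 1 $ 2 = - cnj t" "M $ 2 $ 2 = cnj s"
    "(cmod s)\<^sup>2 + (cmod t)\<^sup>2 = 1" using assms unfolding su2_def by blast
  have 1: "s * cnj s + t * cnj t = 1"
    using arg_cong[OF s(5), of complex_of_real] unfolding of_real_add complex_norm_square by simp
  have "complex_of_real ((cmod (r1 * s + r2 * t))\<^sup>2 + (cmod (r1 * - cnj t + r2 * cnj s))\<^sup>2)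
     = (s * cnj s + t * cnj t) * (r1 * cnj r1 + r2 * cnj r2)"
    unfolding of_real_add complex_norm_square by (simp add: algebra_simps)
  also have "\<dots> = complex_of_real ((cmod r1)\<^sup>2 + (cmod r2)\<^sup>2)" unfolding 1 of_real_add complex_norm_square by simp
  finally show ?thesis unfolding s by (simp only: of_real_eq_iff)
qed

text \<open>Eigenvectors act from the left because a row r pairs with the column (g, 1) to r1 g +
  r2. If y is the Moebius image of x under M with denominator c, then (r1 y + r2) c = r M (x, 1),
  which is l (r1 x + r2) for an eigenvector; so the form attached to r keeps its modulus.\<close>

definition row_eigen :: "complex^2^2 \<Rightarrow> complex \<Rightarrow> complex \<Rightarrow> complex \<Rightarrow> bool" where
  "row_eigen M r1 r2 l \<longleftrightarrow> (cmod r1)\<^sup>2 + (cmod r2)\<^sup>2 = 1 \<and> cmod l = 1 \<and>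
     r1 * M $ 1 $ 1 + r2 * M $ 2 $ 1 = l * r1 \<and> r1 * M $ 1 $ 2 + r2 * M $ 2 $ 2 = l * r2"

lemma row_eigenI:
  assumes M: "su2 M" and r: "(cmod r1)\<^sup>2 + (cmod r2)\<^sup>2 = 1"
    "r1 * M $ 1 $ 1 + r2 * M $ 2 $ 1 = l * r1" "r1 * M $ 1 $ 2 + r2 * M $ 2 $ 2 = l * r2"
  shows "row_eigen M r1 r2 l"
proof -
  have "(cmod (l * r1))\<^sup>2 + (cmod (l * r2))\<^sup>2 = 1"
    using su2_norm_row[OF M, of r1 r2] r by simp
  then have "(cmod l)\<^sup>2 * ((cmod r1)\<^sup>2 + (cmod r2)\<^sup>2) = 1"
    by (simp add: norm_mult power_mult_distrib distrib_left)
  then have "cmod l = 1" using r(1) by (simp add: power2_eq_1_iff) (metis norm_ge_zero not_one_le_zero neg_0_le_iff_le)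
  then show ?thesis using r by (simp add: row_eigen_def)
qed

lemma row_eigen_exists:
  assumes M: "su2 M"
  shows "\<exists>r1 r2 l. row_eigen M r1 r2 l"
proof (cases "M $ 2 $ 1 = 0")
  case True
  then have "M $ 1 $ 2 = 0" using M by (simp add: su2_def)
  then have "row_eigen M 1 0 (M $ 1 $ 1)" using True by (intro row_eigenI[OF M]) auto
  then show ?thesis by blast
next
  case False
  obtain s t where s: "M $ 1 $ 1 = s" "M $ 2 $ 1 = t" "M $ 1 $ 2 = - cnj t" "M $ 2 $ 2 = cnj s"
    "(cmod s)\<^sup>2 + (cmod t)\<^sup>2 = 1" using M unfolding su2_def by blast
  have 1: "s * cnj s + t * cnj t = 1"
    using arg_cong[OF s(5), of complex_of_real] unfolding of_real_add complex_norm_square by simp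
  \<comment> \<open>A root of the characteristic polynomial l^2 - (s + cnj s) l + 1; the row (t, l -
    s) is an eigenvector for it, nonzero since t is.\<close>
  define l where "l = ((s + cnj s) + csqrt ((s + cnj s)\<^sup>2 - 4)) / 2"
  have l: "l\<^sup>2 - (s + cnj s) * l + 1 = 0"
  proof -
    have "((T + q) / 2)\<^sup>2 - T * ((T + q) / 2) + 1 = (q\<^sup>2 - (T\<^sup>2 - 4)) / 4" for T q :: complex
      by (simp add: power2_eq_square field_simps)
    from this[of "s + cnj s" "csqrt ((s + cnj s)\<^sup>2 - 4)"] show ?thesis unfolding l_def by simp
  qed
  define n where "n = sqrt ((cmod t)\<^sup>2 + (cmod (l - s))\<^sup>2)"
  have t0: "t \<noteq> 0" using False s by simp
  have n: "n > 0" unfolding n_def using t0 by (simp add: add_pos_nonneg)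
  have e1: "t * s + (l - s) * t = l * t" by (simp add: algebra_simps)
  have "t * - cnj t + (l - s) * cnj s = l * cnj s - (s * cnj s + t * cnj t)" by (simp add: algebra_simps)
  also have "\<dots> = l * (l - s)" unfolding 1 using l by (simp add: power2_eq_square algebra_simps) 
  finally have e2: "t * - cnj t + (l - s) * cnj s = l * (l - s)" .
  have "row_eigen M (t / of_real n) ((l - s) / of_real n) l"
  proof (rule row_eigenI[OF M])
    have "(cmod (t / of_real n))\<^sup>2 + (cmod ((l - s) / of_real n))\<^sup>2 = ((cmod t)\<^sup>2 + (cmod (l - s))\<^sup>2) / n\<^sup>2"
      by (simp add: norm_divide power_divide add_divide_distrib)
    also have "n\<^sup>2 = (cmod t)\<^sup>2 + (cmod (l - s))\<^sup>2" unfolding n_def by simp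
    also have "((cmod t)\<^sup>2 + (cmod (l - s))\<^sup>2) / ((cmod t)\<^sup>2 + (cmod (l - s))\<^sup>2) = 1"
      using sum_power2_gt_zero_iff[of "cmod t" "cmod (l - s)"] t0 by simp
    finally show "(cmod (t / of_real n))\<^sup>2 + (cmod ((l - s) / of_real n))\<^sup>2 = 1" .
    show "t / of_real n * M $ 1 $ 1 + (l - s) / of_real n * M $ 2 $ 1 = l * (t / of_real n)"
      unfolding s using e1 n by (simp add: field_simps)
    have "t / of_real n * - cnj t + (l - s) / of_real n * cnj s = (t * - cnj t + (l - s) * cnj s) / of_real n"
      using n by (simp add: field_simps)
    then show "t / of_real n * M $ 1 $ 2 + (l - s) / of_real n * M $ 2 $ 2 = l * ((l - s) / of_real n)"
      unfolding s e2 by simp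
  qed
  then show ?thesis by blast
qed

text \<open>Conjugating the two eigenvector equations and exchanging them gives the equations for
  the orthogonal row; the eigenvalue becomes its conjugate, in accordance with determinant
  1.\<close>

lemma row_eigen_orth:
  assumes M: "su2 M" and r: "row_eigen M r1 r2 l"
  shows "row_eigen M (- cnj r2) (cnj r1) (cnj l)"
proof (rule row_eigenI[OF M])
  obtain s t where s: "M $ 1 $ 1 = s" "M $ 2 $ 1 = t" "M $ 1 $ 2 = - cnj t" "M $ 2 $ 2 = cnj s"
    using M unfolding su2_def by blast
  have 1: "r1 * s + r2 * t = l * r1" "r1 * - cnj t + r2 * cnj s = l * r2"
    using r unfolding row_eigen_def s by auto
  show "(cmod (- cnj r2))\<^sup>2 + (cmod (cnj r1))\<^sup>2 = 1" using r by (simp add: row_eigen_def)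
  show "- cnj r2 * M $ 1 $ 1 + cnj r1 * M $ 2 $ 1 = cnj l * - cnj r2"
    unfolding s using arg_cong[OF 1(2), of "\<lambda>z. - cnj z"] by (simp add: algebra_simps)
  show "- cnj r2 * M $ 1 $ 2 + cnj r1 * M $ 2 $ 2 = cnj l * cnj r1"
    unfolding s using arg_cong[OF 1(1), of cnj] by (simp add: algebra_simps)
qed

text \<open>An anticommuting pair would force $l^4 = 1$.\<close>

lemma row_eigen_commuting:
  assumes M: "su2 M" and N: "su2 N" and r: "row_eigen M r1 r2 l" and l: "l ^ 4 \<noteq> 1"
    and c: "M ** N = N ** M \<or> M ** N = - (N ** M)"
  shows "\<exists>k. row_eigen N r1 r2 k"
proof -
  define v1 where "v1 = r1 * N $ 1 $ 1 + r2 * N $ 2 $ 1"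
  define v2 where "v2 = r1 * N $ 1 $ 2 + r2 * N $ 2 $ 2"
  obtain e where e: "e = 1 \<or> e = - (1::complex)" "\<And>i j. (N ** M) $ i $ j = e * (M ** N) $ i $ j"
  proof (cases "M ** N = N ** M")
    case True
    then show ?thesis using that[of 1] by simp
  next
    case False
    then have "N ** M = - (M ** N)" using c by simp
    then show ?thesis using that[of "-1"] by simp
  qed
  have e': "N $ i $ 1 * M $ 1 $ j + N $ i $ 2 * M $ 2 $ j = e * (M $ i $ 1 * N $ 1 $ j + M $ i $ 2 * N $ 2 $ j)" for i j
    using e(2)[of i j] by (simp add: matrix_matrix_mult_def sum_2)
  have r': "r1 * M $ 1 $ 1 + r2 * M $ 2 $ 1 = l * r1" "r1 * M $ 1 $ 2 + r2 * M $ 2 $ 2 = l * r2"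
    "(cmod r1)\<^sup>2 + (cmod r2)\<^sup>2 = 1" using r by (auto simp: row_eigen_def)
  have v: "v1 * M $ 1 $ j + v2 * M $ 2 $ j = e * (l * (r1 * N $ 1 $ j + r2 * N $ 2 $ j))" for j
  proof -
    have "v1 * M $ 1 $ j + v2 * M $ 2 $ j
      = r1 * (N $ 1 $ 1 * M $ 1 $ j + N $ 1 $ 2 * M $ 2 $ j) + r2 * (N $ 2 $ 1 * M $ 1 $ j + N $ 2 $ 2 * M $ 2 $ j)"
      by (simp add: v1_def v2_def algebra_simps)
    also have "\<dots> = e * ((r1 * M $ 1 $ 1 + r2 * M $ 2 $ 1) * N $ 1 $ j + (r1 * M $ 1 $ 2 + r2 * M $ 2 $ 2) * N $ 2 $ j)"
      unfolding e' by (simp add: algebra_simps)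
    finally show ?thesis unfolding r' by (simp add: algebra_simps)
  qed
  have v1: "v1 * M $ 1 $ 1 + v2 * M $ 2 $ 1 = e * l * v1" and v2: "v1 * M $ 1 $ 2 + v2 * M $ 2 $ 2 = e * l * v2"
    using v[of 1] v[of 2] by (simp_all add: v1_def v2_def mult.assoc)
  \<comment> \<open>The determinant of the rows v = r N and r. Multiplying both rows by M preserves
    it, as det M = 1, but scales them by e l and l; so e l^2 d = d, and d = 0 because e l^2 \<noteq>
    1. Hence v is a multiple of r.\<close>
  define d where "d = v1 * r2 - v2 * r1"
  obtain s t where s: "M $ 1 $ 1 = s" "M $ 2 $ 1 = t" "M $ 1 $ 2 = - cnj t" "M $ 2 $ 2 = cnj s"
    "(cmod s)\<^sup>2 + (cmod t)\<^sup>2 = 1" using M unfolding su2_def by blast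
  have 1: "s * cnj s + t * cnj t = 1"
    using arg_cong[OF s(5), of complex_of_real] unfolding of_real_add complex_norm_square by simp
  have "(v1 * M $ 1 $ 1 + v2 * M $ 2 $ 1) * (r1 * M $ 1 $ 2 + r2 * M $ 2 $ 2)
      - (v1 * M $ 1 $ 2 + v2 * M $ 2 $ 2) * (r1 * M $ 1 $ 1 + r2 * M $ 2 $ 1) = (s * cnj s + t * cnj t) * d"
    unfolding s d_def by (simp add: algebra_simps)
  then have "e * l\<^sup>2 * d = d" unfolding v1 v2 r' 1 by (simp add: d_def power2_eq_square algebra_simps)
  moreover have "e * l\<^sup>2 \<noteq> 1"
  proof
    assume "e * l\<^sup>2 = 1"
    then have "(e * l\<^sup>2)\<^sup>2 = 1" by simp
    then have "e\<^sup>2 * l ^ 4 = 1" by (simp add: power_mult_distrib flip: power_mult)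
    then show False using e(1) l by auto
  qed
  ultimately have d0: "d = 0" by (metis mult_cancel_right1)
  define k where "k = v1 * cnj r1 + v2 * cnj r2"
  have rr: "r1 * cnj r1 + r2 * cnj r2 = 1"
    using arg_cong[OF r'(3), of complex_of_real] unfolding of_real_add complex_norm_square by simp
  have d0': "v1 * r2 = v2 * r1" using d0 by (simp add: d_def)
  have k1: "v1 = k * r1"
  proof -
    have "k * r1 = v1 * (r1 * cnj r1) + cnj r2 * (v2 * r1)" by (simp add: k_def algebra_simps)
    also have "\<dots> = v1 * (r1 * cnj r1 + r2 * cnj r2)" unfolding d0'[symmetric] by (simp add: algebra_simps)
    finally show ?thesis unfolding rr by simp
  qed
  have k2: "v2 = k * r2"
  proof -
    have "k * r2 = v2 * (r2 * cnj r2) + cnj r1 * (v1 * r2)" by (simp add: k_def algebra_simps)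
    also have "\<dots> = v2 * (r1 * cnj r1 + r2 * cnj r2)" unfolding d0' by (simp add: algebra_simps)
    finally show ?thesis unfolding rr by simp
  qed
  have "row_eigen N r1 r2 k"
    by (rule row_eigenI[OF N r'(3)]) (use k1 k2 in \<open>simp_all add: v1_def v2_def\<close>)
  then show ?thesis by blast
qed

text \<open>One matrix is chosen from each coset. Cosets consist of a matrix and its negative, so
  commuting in the quotient means commuting up to sign for the chosen matrices.\<close>

lemma reducible_matrices:
  assumes "reducible U cov g"
  obtains Mx where "\<And>\<tau>. \<tau> \<in> carrier (deck_group U cov) \<Longrightarrow> su2 (Mx \<tau>)"
    "\<And>\<tau> w. \<tau> \<in> carrier (deck_group U cov) \<Longrightarrow> w \<in> U \<Longrightarrow> \<not> is_pole g w \<Longrightarrow> \<not> is_pole g (inv_into U \<tau> w) \<Longrightarrow>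
        moebius_rel (Mx \<tau>) (g w) (g (inv_into U \<tau> w))"
    "\<And>\<sigma> \<tau>. \<sigma> \<in> carrier (deck_group U cov) \<Longrightarrow> \<tau> \<in> carrier (deck_group U cov) \<Longrightarrow>
        Mx \<sigma> ** Mx \<tau> = Mx \<tau> ** Mx \<sigma> \<or> Mx \<sigma> ** Mx \<tau> = - (Mx \<tau> ** Mx \<sigma>)"
proof -
  obtain \<rho> where \<rho>: "monodromy_representation U cov g \<rho>"
    "comm_group (PSU2\<lparr>carrier := \<rho> ` carrier (deck_group U cov)\<rparr>)"
    using assms unfolding reducible_def by blast
  let ?D = "carrier (deck_group U cov)"
  have "\<forall>\<tau>\<in>?D. \<exists>A. A \<in> carrier SU2 \<and> \<rho> \<tau> = {A, - A}"
  proof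
    fix \<tau> assume "\<tau> \<in> ?D"
    then have "\<rho> \<tau> \<in> carrier PSU2" using \<rho>(1) unfolding monodromy_representation_def hom_def by auto
    then show "\<exists>A. A \<in> carrier SU2 \<and> \<rho> \<tau> = {A, - A}" by (elim PSU2_carrierE) blast
  qed
  then obtain Mx where Mx: "\<And>\<tau>. \<tau> \<in> ?D \<Longrightarrow> Mx \<tau> \<in> carrier SU2 \<and> \<rho> \<tau> = {Mx \<tau>, - Mx \<tau>}" by metis
  show ?thesis
  proof (rule that[of Mx])
    show "su2 (Mx \<tau>)" if "\<tau> \<in> ?D" for \<tau> using Mx[OF that] SU2_imp_su2 by blast
    show "moebius_rel (Mx \<tau>) (g w) (g (inv_into U \<tau> w))"
      if "\<tau> \<in> ?D" "w \<in> U" "\<not> is_pole g w" "\<not> is_pole g (inv_into U \<tau> w)" for \<tau> w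
      using \<rho>(1) that Mx[OF that(1)] unfolding monodromy_representation_def by blast
    show "Mx \<sigma> ** Mx \<tau> = Mx \<tau> ** Mx \<sigma> \<or> Mx \<sigma> ** Mx \<tau> = - (Mx \<tau> ** Mx \<sigma>)" if "\<sigma> \<in> ?D" "\<tau> \<in> ?D" for \<sigma> \<tau>
    proof -
      interpret comm_group "PSU2\<lparr>carrier := \<rho> ` ?D\<rparr>" by (rule \<rho>(2))
      have neg: "(- A) ** B = - (A ** B)" "A ** (- B) = - (A ** B)" for A B :: "complex^2^2"
        by (simp_all add: matrix_matrix_mult_def vec_eq_iff sum_negf)
      have "\<rho> \<sigma> \<otimes>\<^bsub>PSU2\<^esub> \<rho> \<tau> = \<rho> \<tau> \<otimes>\<^bsub>PSU2\<^esub> \<rho> \<sigma>"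
        using m_comm[of "\<rho> \<sigma>" "\<rho> \<tau>"] that by simp
      then have "{A ** B |A B. A \<in> \<rho> \<sigma> \<and> B \<in> \<rho> \<tau>} = {A ** B |A B. A \<in> \<rho> \<tau> \<and> B \<in> \<rho> \<sigma>}"
        by (auto simp: PSU2_def FactGroup_def set_mult_def SU2_def set_eq_iff) blast+
      moreover have "Mx \<sigma> ** Mx \<tau> \<in> {A ** B |A B. A \<in> \<rho> \<sigma> \<and> B \<in> \<rho> \<tau>}"
        using Mx[OF that(1)] Mx[OF that(2)] by blast
      ultimately obtain A B where "Mx \<sigma> ** Mx \<tau> = A ** B" "A \<in> \<rho> \<tau>" "B \<in> \<rho> \<sigma>" by auto
      then show ?thesis using Mx[OF that(1)] Mx[OF that(2)] by (auto simp: neg)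
    qed
  qed
qed

section \<open>The forms attached to row vectors\<close>

text \<open>The tool that extends identities verified away from the isolated poles of g to all
  points.\<close>

lemma continuous_eq_of_eventually:
  fixes f1 f2 :: "complex \<Rightarrow> 'b::t2_space"
  assumes "open U" "continuous_on U f1" "continuous_on U f2" "w \<in> U" "\<forall>\<^sub>F z in at w. f1 z = f2 z"
  shows "f1 w = f2 w"
proof -
  have 1: "(f1 \<longlongrightarrow> f1 w) (at w)" "(f2 \<longlongrightarrow> f2 w) (at w)"
    using assms by (auto simp: continuous_on_eq_continuous_at isContD)
  have "(f2 \<longlongrightarrow> f1 w) (at w)" using 1(1) tendsto_cong[OF assms(5)] by blast
  then show ?thesis using 1(2) tendsto_unique[OF at_neq_bot] by blast
qed

locale ricci_weierstrass =
  fixes h :: "complex \<Rightarrow> real" and U :: "complex set" and cov g \<alpha> :: "complex \<Rightarrow> complex"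
  assumes conf: "conformal_metric punct h"
    and uc: "universal_cover U cov punct"
    and wd: "weierstrass_data U cov h g \<alpha>"
begin

lemma U_facts: "open U" "simply_connected U" "cov holomorphic_on U" "covering_space U cov punct" "cov ` U = punct"
  "connected U" "U \<noteq> {}" "locally path_connected U" "path_connected U"
proof -
  show *: "open U" "simply_connected U" "cov holomorphic_on U" "covering_space U cov punct"
    using uc by (auto simp: universal_cover_def)
  show "cov ` U = punct" using *(4) by (rule covering_space_imp_surjective)
  moreover have "2 \<in> punct" by (simp add: punct_def)
  ultimately show "U \<noteq> {}" by blast
  show "connected U" using *(2) by (rule simply_connected_imp_connected)
  show "path_connected U" using *(2) by (rule simply_connected_imp_path_connected)
  show "locally path_connected U" using *(1) by (rule open_imp_locally_path_connected)
qed

lemma cov_in: "w \<in> U \<Longrightarrow> cov w \<in> punct" using U_facts(5) by blast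

lemma h_facts: "continuous_on punct h" "z \<in> punct \<Longrightarrow> h z > 0"
proof -
  have "Ck_on 0 punct h" "\<forall>z\<in>punct. h z > 0" using conf by (auto simp: conformal_metric_def smooth_on_def)
  then show "continuous_on punct h" "z \<in> punct \<Longrightarrow> h z > 0" by auto
qed

lemma cov_local_inverse:
  assumes "w \<in> U"
  obtains V \<psi> where "open V" "cov w \<in> V" "V \<subseteq> punct" "\<psi> holomorphic_on V" "\<psi> ` V \<subseteq> U" "\<psi> (cov w) = w"
    "\<And>z. z \<in> V \<Longrightarrow> cov (\<psi> z) = z" "\<And>z. z \<in> V \<Longrightarrow> deriv cov (\<psi> z) * deriv \<psi> z = 1"
proof -
  obtain T u q where T: "w \<in> T" "openin (top_of_set U) T" "cov w \<in> u" "openin (top_of_set punct) u" "homeomorphism T u cov q"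
    using covering_space_local_homeomorphism[OF U_facts(4) assms] by blast
  have oT: "open T" "T \<subseteq> U" using T(2) U_facts(1) openin_open_eq by blast+
  have ou: "open u" "u \<subseteq> punct" using T(4) open_punct openin_open_eq by blast+
  have inj: "inj_on cov T" using T(5) by (metis homeomorphism_apply1 inj_onI)
  have im: "cov ` T = u" using T(5) by (simp add: homeomorphism_def)
  obtain \<psi> where \<psi>: "\<psi> holomorphic_on cov ` T" "\<And>z. z \<in> T \<Longrightarrow> deriv cov z * deriv \<psi> (cov z) = 1"
      "\<And>z. z \<in> T \<Longrightarrow> \<psi> (cov z) = z"
    using holomorphic_has_inverse[OF holomorphic_on_subset[OF U_facts(3) oT(2)] oT(1) inj] by blast
  show ?thesis
    by (rule that[of u \<psi>]) (use \<psi> im ou oT T in \<open>auto\<close>)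
qed

lemma cov_deriv_nz: "w \<in> U \<Longrightarrow> deriv cov w \<noteq> 0"
  by (erule cov_local_inverse) (metis mult_zero_left zero_neq_one)

text \<open>Phrased for the inverse map because the monodromy law is a law for g composed with
  inverses of deck transformations.\<close>

lemma deck_inverse:
  assumes "\<tau> \<in> carrier (deck_group U cov)"
  defines "\<sigma> \<equiv> inv_into U \<tau>"
  shows "continuous_on U \<sigma>" "inj_on \<sigma> U" "\<And>w. w \<in> U \<Longrightarrow> \<sigma> w \<in> U" "\<And>w. w \<in> U \<Longrightarrow> cov (\<sigma> w) = cov w"
proof -
  obtain \<tau>' where \<tau>: "homeomorphism U U \<tau> \<tau>'" "\<And>w. w \<in> U \<Longrightarrow> cov (\<tau> w) = cov w"
    using assms(1) by (auto simp: deck_group_def)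
  have im: "\<tau> ` U = U" using \<tau>(1) by (simp add: homeomorphism_def)
  have inj: "inj_on \<tau> U" using \<tau>(1) by (metis homeomorphism_apply1 inj_onI)
  have eq: "\<sigma> w = \<tau>' w" if "w \<in> U" for w
    using \<tau>(1) that inj unfolding \<sigma>_def
    by (metis homeomorphism_apply2 homeomorphism_image2 image_eqI inv_into_f_f)
  have "continuous_on U \<tau>'" using \<tau>(1) by (simp add: homeomorphism_def)
  then show "continuous_on U \<sigma>" using continuous_on_cong[of U U \<sigma> \<tau>'] eq by simp
  show "inj_on \<sigma> U" unfolding \<sigma>_def using im inj_on_inv_into[of U \<tau> U] by simp
  show into: "\<sigma> w \<in> U" if "w \<in> U" for w unfolding \<sigma>_def using im that by (simp add: inv_into_into)
  show "cov (\<sigma> w) = cov w" if "w \<in> U" for w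
    using \<tau>(2)[OF into[OF that]] im that unfolding \<sigma>_def by (simp add: f_inv_into_f)
qed

lemma lift_unique:
  assumes "continuous_on T f1" "f1 ` T \<subseteq> U" "continuous_on T f2" "f2 ` T \<subseteq> U" "connected T"
    "\<And>x. x \<in> T \<Longrightarrow> cov (f1 x) = cov (f2 x)" "a \<in> T" "f1 a = f2 a" "x \<in> T"
  shows "f1 x = f2 x"
proof (rule covering_space_lift_unique[OF U_facts(4), of f1 a f2 T "\<lambda>x. cov (f1 x)"])
  show "continuous_on T (\<lambda>x. cov (f1 x))"
    by (rule continuous_on_compose2[OF holomorphic_on_imp_continuous_on[OF U_facts(3)] assms(1,2)])
qed (use assms cov_in in auto)

text \<open>The covering map of the simply connected \<open>U\<close> lifts through itself, once
  sending w1 to w2 and once back. By uniqueness of lifts the two lifts are mutually inverse; the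
  deck transformation is the one whose inverse takes w1 to w2.\<close>

lemma deck_transitive:
  assumes "w1 \<in> U" "w2 \<in> U" "cov w1 = cov w2"
  obtains \<tau> where "\<tau> \<in> carrier (deck_group U cov)" "inv_into U \<tau> w1 = w2"
proof -
  have ccov: "continuous_on U cov" using U_facts(3) by (rule holomorphic_on_imp_continuous_on)
  have cP: "cov \<in> U \<rightarrow> punct" using cov_in by auto
  obtain f where f: "continuous_on U f" "f \<in> U \<rightarrow> U" "f w1 = w2" "\<And>y. y \<in> U \<Longrightarrow> cov (f y) = cov y"
    using covering_space_lift_strong[OF U_facts(4) assms(2,1) U_facts(2,8) ccov cP assms(3)] by blast
  obtain k where k: "continuous_on U k" "k \<in> U \<rightarrow> U" "k w2 = w1" "\<And>y. y \<in> U \<Longrightarrow> cov (k y) = cov y"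
    using covering_space_lift_strong[OF U_facts(4) assms(1,2) U_facts(2,8) ccov cP assms(3)[symmetric]] by blast
  have kf: "k (f x) = x" if "x \<in> U" for x
    by (rule lift_unique[of U "\<lambda>x. k (f x)" "\<lambda>x. x" w1])
       (use f k that assms U_facts in \<open>auto simp: Pi_iff intro!: continuous_on_compose2[of U k U f] continuous_on_id\<close>)
  have fk: "f (k x) = x" if "x \<in> U" for x
    by (rule lift_unique[of U "\<lambda>x. f (k x)" "\<lambda>x. x" w2])
       (use f k that assms U_facts in \<open>auto simp: Pi_iff intro!: continuous_on_compose2[of U f U k] continuous_on_id\<close>)
  define \<tau> where "\<tau> = restrict k U"
  have \<tau>: "\<tau> x = k x" if "x \<in> U" for x using that by (simp add: \<tau>_def)
  have c: "continuous_on U \<tau>" using continuous_on_cong[of U U \<tau> k] \<tau> k(1) by simp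
  have "homeomorphism U U \<tau> f"
    by (rule homeomorphismI) (use c f k \<tau> kf fk in \<open>auto simp: Pi_iff\<close>)
  then have "\<tau> \<in> carrier (deck_group U cov)"
    unfolding deck_group_def using k \<tau> by (auto simp: \<tau>_def)
  moreover have "inv_into U \<tau> w1 = w2"
  proof (rule inv_into_f_eq)
    show "inj_on \<tau> U" using \<tau> fk by (metis inj_onI)
    show "w2 \<in> U" "\<tau> w2 = w1" using assms \<tau> k by auto
  qed
  ultimately show ?thesis using that by blast
qed

text \<open>The forms $\eta$, $g\eta$ and $g^2\eta$ in the coordinate $z = cov\,w$; the last two are holomorphic across the poles of \<open>g\<close>.\<close>

definition A where "A w = \<alpha> w / deriv cov w"
definition D where "D = remove_sings (\<lambda>w. g w * A w)"
definition C where "C = remove_sings (\<lambda>w. (g w)\<^sup>2 * A w)"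

lemma A_holomorphic: "A holomorphic_on U"
proof -
  have "\<alpha> holomorphic_on U" using wd by (simp add: weierstrass_data_def)
  then show ?thesis unfolding A_def
    using U_facts cov_deriv_nz by (intro holomorphic_on_divide holomorphic_deriv) auto
qed

lemma g_mero: "g nicely_meromorphic_on U" "g meromorphic_on U"
  using wd by (auto simp: weierstrass_data_def nicely_meromorphic_on_def)

lemma nonpole:
  assumes "w \<in> U" "\<not> is_pole g w"
  shows "g analytic_on {w}" "A w \<noteq> 0" "h (cov w) = 1/4 * (cmod (A w))\<^sup>2 * (1 + (cmod (g w))\<^sup>2)\<^sup>2"
    "D w = g w * A w" "C w = (g w)\<^sup>2 * A w"
proof -
  show an: "g analytic_on {w}" using nicely_meromorphic_on_imp_analytic_at[OF g_mero(1) assms] .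
  have nz: "deriv cov w \<noteq> 0" using cov_deriv_nz assms by blast
  show "A w \<noteq> 0" using wd assms nz by (auto simp: weierstrass_data_def A_def)
  have "h (cov w) * (norm (deriv cov w))\<^sup>2 = 1/4 * (norm (\<alpha> w))\<^sup>2 * (1 + (norm (g w))\<^sup>2)\<^sup>2"
    using wd assms by (auto simp: weierstrass_data_def metric_of_data_def)
  then show "h (cov w) = 1/4 * (cmod (A w))\<^sup>2 * (1 + (cmod (g w))\<^sup>2)\<^sup>2"
    using nz by (simp add: A_def norm_divide power_divide field_simps)
  have Aan: "A analytic_on {w}" using A_holomorphic U_facts(1) assms(1) analytic_at by blast
  show "D w = g w * A w" "C w = (g w)\<^sup>2 * A w"
    unfolding D_def C_def using an Aan by (auto intro!: remove_sings_at_analytic analytic_intros)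
qed

lemma eventually_nonpole: "w \<in> U \<Longrightarrow> \<forall>\<^sub>F z in at w. \<not> is_pole g z \<and> z \<in> U"
proof (rule eventually_conj)
  assume w: "w \<in> U"
  show "\<forall>\<^sub>F z in at w. \<not> is_pole g z"
    using g_mero(2) w by (metis eventually_not_pole meromorphic_on_isolated_singularity meromorphic_on_subset empty_subsetI insert_subset)
  show "\<forall>\<^sub>F z in at w. z \<in> U" using eventually_at_in_open[OF U_facts(1) w] by (auto elim: eventually_mono)
qed

text \<open>At a pole of order m the function g behaves like (w - w0)^(-m) and \<alpha> like (w -
  w0)^(2m). Thus the product with g vanishes to order m and the product with g^2 has a finite
  limit.\<close>

lemma pole_limits:
  assumes "w0 \<in> U" "is_pole g w0"
  shows "((\<lambda>w. g w * A w) \<longlongrightarrow> 0) (at w0)" "\<exists>c. ((\<lambda>w. (g w)\<^sup>2 * A w) \<longlongrightarrow> c) (at w0)"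
proof -
  have "\<forall>\<^sub>F z in at w0. \<not> is_pole g z \<and> z \<in> U" using eventually_nonpole assms by blast
  then obtain d where d: "d > 0" "\<And>z. z \<noteq> w0 \<Longrightarrow> dist z w0 < d \<Longrightarrow> \<not> is_pole g z \<and> z \<in> U"
    unfolding eventually_at by auto
  define S where "S = ball w0 d"
  have "x \<in> U" if "x \<in> S" for x
    using that d(2)[of x] assms(1) by (cases "x = w0") (auto simp: S_def dist_commute)
  then have S: "open S" "connected S" "w0 \<in> S" "S \<subseteq> U"
    using d(1) by (auto simp: S_def)
  have gh: "g holomorphic_on S - {w0}"
  proof (rule analytic_imp_holomorphic)
    show "g analytic_on S - {w0}"
    proof (subst analytic_on_analytic_at, intro ballI)
      fix z assume "z \<in> S - {w0}"
      then show "g analytic_on {z}" using d(2)[of z] nonpole(1) by (auto simp: S_def dist_commute)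
    qed
  qed
  have ah: "\<alpha> holomorphic_on S" using wd S holomorphic_on_subset by (auto simp: weierstrass_data_def)
  have "w0 + of_real (d / 2) \<in> S - {w0}" using d(1) by (auto simp: S_def dist_norm)
  then have nc: "\<exists>w\<in>S. \<alpha> w \<noteq> 0"
    using wd d(2)[of "w0 + of_real (d / 2)"] d(1) by (auto simp: weierstrass_data_def S_def dist_norm)
  define n where "n = zorder g w0"
  obtain r1 where r1: "n < 0" "r1 > 0" "zor_poly g w0 holomorphic_on cball w0 r1"
    "\<And>w. w \<in> cball w0 r1 - {w0} \<Longrightarrow> g w = zor_poly g w0 w / (w - w0) ^ nat (- n)"
    using zorder_exist_pole[OF gh S(1,3) assms(2)] unfolding n_def by auto
  obtain r2 where r2': "r2 > 0 \<and> cball w0 r2 \<subseteq> S \<and> zor_poly \<alpha> w0 holomorphic_on cball w0 r2 \<and>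
      (\<forall>w\<in>cball w0 r2. \<alpha> w = zor_poly \<alpha> w0 w * (w - w0) ^ nat (zorder \<alpha> w0) \<and> zor_poly \<alpha> w0 w \<noteq> 0)"
    using conjunct2[OF zorder_exist_zero[OF ah S(1,2,3) nc]] by (elim exE)
  have r2: "r2 > 0" "zor_poly \<alpha> w0 holomorphic_on cball w0 r2"
    "\<And>w. w \<in> cball w0 r2 \<Longrightarrow> \<alpha> w = zor_poly \<alpha> w0 w * (w - w0) ^ nat (zorder \<alpha> w0)"
    using r2' by blast+
  define m where "m = nat (- n)"
  have m: "m > 0" using r1(1) by (simp add: m_def)
  have "zorder \<alpha> w0 = 2 * (- n)" using wd assms by (auto simp: weierstrass_data_def n_def)
  then have m2: "nat (zorder \<alpha> w0) = 2 * m" using r1(1) by (simp add: m_def nat_mult_distrib)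
  define P where "P = zor_poly g w0"
  define R where "R = zor_poly \<alpha> w0"
  define r where "r = min r1 r2"
  have r: "r > 0" using r1 r2 by (simp add: r_def)
  have ev: "\<forall>\<^sub>F w in at w0. w \<in> ball w0 r - {w0}" using r by (intro eventually_at_in_open) auto
  have Pl: "(P \<longlongrightarrow> P w0) (at w0)" and Rl: "(R \<longlongrightarrow> R w0) (at w0)"
  proof -
    have "isCont P w0" "isCont R w0"
      using r1(2,3) r2(1,2) unfolding P_def R_def
      by (auto intro!: continuous_on_interior[OF holomorphic_on_imp_continuous_on])
    then show "(P \<longlongrightarrow> P w0) (at w0)" "(R \<longlongrightarrow> R w0) (at w0)" by (auto simp: isContD)
  qed
  have dl: "((\<lambda>w. deriv cov w) \<longlongrightarrow> deriv cov w0) (at w0)"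
  proof -
    have "continuous_on U (deriv cov)" using U_facts by (intro holomorphic_on_imp_continuous_on holomorphic_deriv) auto
    then show ?thesis using assms(1) U_facts(1) by (simp add: continuous_on_eq_continuous_at isContD)
  qed
  have nz: "deriv cov w0 \<noteq> 0" using cov_deriv_nz assms by blast
  have e1: "\<forall>\<^sub>F w in at w0. P w * R w * (w - w0) ^ m / deriv cov w = g w * A w"
    using ev
  proof eventually_elim
    case (elim w)
    then have "g w = P w / (w - w0) ^ m" "\<alpha> w = R w * (w - w0) ^ (2 * m)" "w - w0 \<noteq> 0"
      using r1(4)[of w] r2(3)[of w] m2 by (auto simp: P_def R_def m_def r_def)
    then show ?case by (simp add: A_def mult_2 power_add)
  qed
  have e2: "\<forall>\<^sub>F w in at w0. (P w)\<^sup>2 * R w / deriv cov w = (g w)\<^sup>2 * A w"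
    using ev
  proof eventually_elim
    case (elim w)
    then have "g w = P w / (w - w0) ^ m" "\<alpha> w = R w * (w - w0) ^ (2 * m)" "w - w0 \<noteq> 0"
      using r1(4)[of w] r2(3)[of w] m2 by (auto simp: P_def R_def m_def r_def)
    then show ?case by (simp add: A_def mult_2 power_add power_divide power2_eq_square)
  qed
  have "((\<lambda>w. P w * R w * (w - w0) ^ m / deriv cov w) \<longlongrightarrow> P w0 * R w0 * (w0 - w0) ^ m / deriv cov w0) (at w0)"
    by (intro tendsto_intros Pl Rl dl nz)
  then show "((\<lambda>w. g w * A w) \<longlongrightarrow> 0) (at w0)" using tendsto_cong[OF e1] m by (simp add: power_0_left)
  have "((\<lambda>w. (P w)\<^sup>2 * R w / deriv cov w) \<longlongrightarrow> (P w0)\<^sup>2 * R w0 / deriv cov w0) (at w0)"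
    by (intro tendsto_intros Pl Rl dl nz)
  then show "\<exists>c. ((\<lambda>w. (g w)\<^sup>2 * A w) \<longlongrightarrow> c) (at w0)" using tendsto_cong[OF e2] by blast
qed

lemma remove_sings_holomorphic:
  assumes f: "f meromorphic_on U" and l: "\<And>w. w \<in> U \<Longrightarrow> \<exists>c. (f \<longlongrightarrow> c) (at w)"
  shows "remove_sings f holomorphic_on U"
proof (rule analytic_imp_holomorphic, subst analytic_on_analytic_at, intro ballI)
  fix w assume w: "w \<in> U"
  obtain c where c: "(f \<longlongrightarrow> c) (at w)" using l[OF w] by blast
  have iso: "isolated_singularity_at f w" using f w by (metis meromorphic_on_isolated_singularity meromorphic_on_subset empty_subsetI insert_subset)
  have "\<not> is_pole f w" using c not_tendsto_and_filterlim_at_infinity[OF at_neq_bot c] unfolding is_pole_def by blast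
  then have "\<not> is_pole (remove_sings f) w" using iso by simp
  then show "remove_sings f analytic_on {w}"
    using nicely_meromorphic_on_imp_analytic_at[OF remove_sings_nicely_meromorphic[OF f] w] by blast
qed

lemma DC_holomorphic: "D holomorphic_on U" "C holomorphic_on U"
proof -
  have Am: "A meromorphic_on U" using A_holomorphic U_facts(1) by (simp add: analytic_on_imp_meromorphic_on analytic_on_open)
  have lim: "\<exists>c. ((\<lambda>w. g w ^ k * A w) \<longlongrightarrow> c) (at w)" if "w \<in> U" "k = 1 \<or> k = 2" for w k
  proof (cases "is_pole g w")
    case True
    then show ?thesis using pole_limits[OF that(1) True] that(2) by auto
  next
    case False
    have "A analytic_on {w}" using A_holomorphic U_facts(1) that(1) analytic_at by blast
    then have "(\<lambda>w. g w ^ k * A w) analytic_on {w}" using nonpole(1)[OF that(1) False] by (intro analytic_intros)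
    then show ?thesis using analytic_at_imp_isCont isContD by blast
  qed
  show "D holomorphic_on U" unfolding D_def
  proof (rule remove_sings_holomorphic)
    show "(\<lambda>w. g w * A w) meromorphic_on U" by (intro meromorphic_on_mult g_mero Am)
    show "\<exists>c. ((\<lambda>w. g w * A w) \<longlongrightarrow> c) (at w)" if "w \<in> U" for w using lim[OF that, of 1] by simp
  qed
  show "C holomorphic_on U" unfolding C_def
  proof (rule remove_sings_holomorphic)
    show "(\<lambda>w. (g w)\<^sup>2 * A w) meromorphic_on U" by (intro meromorphic_on_mult meromorphic_on_power g_mero Am)
    show "\<exists>c. ((\<lambda>w. (g w)\<^sup>2 * A w) \<longlongrightarrow> c) (at w)" if "w \<in> U" for w using lim[OF that, of 2] by simp
  qed
qed

text \<open>The expansion of A (r1 g + r2)^2. Written with the three holomorphic coefficients it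
  makes sense at the poles of g as well.\<close>

definition Q where "Q r1 r2 w = r2\<^sup>2 * A w + 2 * r1 * r2 * D w + r1\<^sup>2 * C w"

lemma Q_holomorphic: "Q r1 r2 holomorphic_on U"
  unfolding Q_def using A_holomorphic DC_holomorphic by (intro holomorphic_intros)

lemma Q_continuous: "continuous_on U (Q r1 r2)"
  using Q_holomorphic by (rule holomorphic_on_imp_continuous_on)

lemma Q_nonpole: "w \<in> U \<Longrightarrow> \<not> is_pole g w \<Longrightarrow> Q r1 r2 w = A w * (r1 * g w + r2)\<^sup>2"
  unfolding Q_def using nonpole[of w] by (simp add: power2_eq_square algebra_simps)

lemma orth_norm:
  fixes r1 r2 x :: complex
  assumes "(cmod r1)\<^sup>2 + (cmod r2)\<^sup>2 = 1"
  shows "(cmod (r1 * x + r2))\<^sup>2 + (cmod (- cnj r2 * x + cnj r1))\<^sup>2 = 1 + (cmod x)\<^sup>2"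
proof -
  have 1: "r1 * cnj r1 + r2 * cnj r2 = 1"
    using arg_cong[OF assms, of complex_of_real] unfolding of_real_add complex_norm_square by simp
  have "complex_of_real ((cmod (r1 * x + r2))\<^sup>2 + (cmod (- cnj r2 * x + cnj r1))\<^sup>2)
     = (r1 * cnj r1 + r2 * cnj r2) * (1 + x * cnj x)"
    unfolding of_real_add complex_norm_square by (simp add: algebra_simps)
  also have "\<dots> = complex_of_real (1 + (cmod x)\<^sup>2)" unfolding 1 of_real_add complex_norm_square by simp
  finally show ?thesis by (simp only: of_real_eq_iff)
qed

text \<open>Away from poles, Parseval for the vector (g, 1) in the orthonormal pair of rows makes
  the left side |A| (1 + |g|^2), which is 2 sqrt(h) by the metric formula; continuity covers the
  poles.\<close>

lemma Q_norm_sum: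
  assumes r: "(cmod r1)\<^sup>2 + (cmod r2)\<^sup>2 = 1" and w: "w \<in> U"
  shows "cmod (Q r1 r2 w) + cmod (Q (- cnj r2) (cnj r1) w) = 2 * sqrt (h (cov w))"
proof (rule continuous_eq_of_eventually[OF U_facts(1) _ _ w])
  show "continuous_on U (\<lambda>w. cmod (Q r1 r2 w) + cmod (Q (- cnj r2) (cnj r1) w))"
    by (intro continuous_intros Q_continuous)
  have "continuous_on U (\<lambda>w. h (cov w))"
    by (rule continuous_on_compose2[OF h_facts(1) holomorphic_on_imp_continuous_on[OF U_facts(3)]]) (use cov_in in auto)
  then show "continuous_on U (\<lambda>w. 2 * sqrt (h (cov w)))" by (intro continuous_intros)
  show "\<forall>\<^sub>F w in at w. cmod (Q r1 r2 w) + cmod (Q (- cnj r2) (cnj r1) w) = 2 * sqrt (h (cov w))"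
    using eventually_nonpole[OF w]
  proof eventually_elim
    case (elim z)
    have "cmod (Q r1 r2 z) + cmod (Q (- cnj r2) (cnj r1) z) = cmod (A z) * (1 + (cmod (g z))\<^sup>2)"
      using Q_nonpole[of z] elim orth_norm[OF r, of "g z"] by (simp add: norm_mult norm_power distrib_left[symmetric])
    moreover have "h (cov z) = (cmod (A z) * (1 + (cmod (g z))\<^sup>2) / 2)\<^sup>2"
      using nonpole(3)[of z] elim by (simp add: power_mult_distrib power_divide)
    then have "sqrt (h (cov z)) = cmod (A z) * (1 + (cmod (g z))\<^sup>2) / 2"
      by (simp add: real_sqrt_abs abs_mult add_nonneg_nonneg)
    ultimately show ?case by simp
  qed
qed

text \<open>The polarization of the quadratic form \<open>Q\<close>: it is a square root of a product of two forms, which makes zeros of even order.\<close>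

definition Qm where "Qm r1 r2 s1 s2 w = r2 * s2 * A w + (r1 * s2 + r2 * s1) * D w + r1 * s1 * C w"

lemma Qm_holomorphic: "Qm r1 r2 s1 s2 holomorphic_on U"
  unfolding Qm_def using A_holomorphic DC_holomorphic by (intro holomorphic_intros)

lemma Q_mult_eq_square:
  assumes "w \<in> U"
  shows "Q r1 r2 w * Q s1 s2 w = (Qm r1 r2 s1 s2 w)\<^sup>2"
proof (rule continuous_eq_of_eventually[OF U_facts(1) _ _ assms])
  show "continuous_on U (\<lambda>w. Q r1 r2 w * Q s1 s2 w)" "continuous_on U (\<lambda>w. (Qm r1 r2 s1 s2 w)\<^sup>2)"
    by (intro continuous_intros Q_continuous holomorphic_on_imp_continuous_on[OF Qm_holomorphic])+
  show "\<forall>\<^sub>F w in at w. Q r1 r2 w * Q s1 s2 w = (Qm r1 r2 s1 s2 w)\<^sup>2"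
    using eventually_nonpole[OF assms]
  proof eventually_elim
    case (elim z)
    then show ?case using Q_nonpole[of z] nonpole(4,5)[of z]
      by (simp add: Qm_def power2_eq_square algebra_simps)
  qed
qed

section \<open>Behaviour under deck transformations\<close>

lemma eventually_nonpole_deck:
  assumes \<tau>: "\<tau> \<in> carrier (deck_group U cov)" and w: "w \<in> U"
  shows "\<forall>\<^sub>F z in at w. z \<in> U \<and> \<not> is_pole g z \<and> \<not> is_pole g (inv_into U \<tau> z)"
proof -
  let ?\<sigma> = "inv_into U \<tau>"
  note \<sigma> = deck_inverse[OF \<tau>]
  have "(?\<sigma> \<longlongrightarrow> ?\<sigma> w) (at w)" using \<sigma>(1) U_facts(1) w by (simp add: continuous_on_eq_continuous_at isContD)
  moreover have "\<forall>\<^sub>F z in at w. ?\<sigma> z \<noteq> ?\<sigma> w"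
    using eventually_at_in_open[OF U_facts(1) w] by eventually_elim (use \<sigma>(2) w in \<open>auto simp: inj_on_def\<close>)
  ultimately have "filterlim ?\<sigma> (at (?\<sigma> w)) (at w)" by (simp add: filterlim_at)
  moreover have "\<forall>\<^sub>F z in at (?\<sigma> w). \<not> is_pole g z"
    using eventually_nonpole[OF \<sigma>(3)[OF w]] by (auto elim: eventually_mono)
  ultimately have "\<forall>\<^sub>F z in at w. \<not> is_pole g (?\<sigma> z)" by (rule eventually_compose_filterlim[rotated])
  then show ?thesis using eventually_nonpole[OF w] by eventually_elim auto
qed

text \<open>With c the denominator of the Moebius transformation, invariance of the metric gives
  that |A| is multiplied by |c|^2, while r1 g + r2 is multiplied by l / c; so the modulus of the
  form is preserved. The argument of the factor of A remains unknown, but it is common to all forms.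
  Hence a comparison of two forms is an exact identity, stated without division.\<close>

lemma Q_deck:
  assumes \<tau>: "\<tau> \<in> carrier (deck_group U cov)" and M: "su2 M"
    and mo: "\<And>w. w \<in> U \<Longrightarrow> \<not> is_pole g w \<Longrightarrow> \<not> is_pole g (inv_into U \<tau> w) \<Longrightarrow> moebius_rel M (g w) (g (inv_into U \<tau> w))"
    and r: "row_eigen M r1 r2 l" and w: "w \<in> U"
  shows "cmod (Q r1 r2 (inv_into U \<tau> w)) = cmod (Q r1 r2 w)"
    "row_eigen M s1 s2 l' \<Longrightarrow>
      l\<^sup>2 * Q s1 s2 (inv_into U \<tau> w) * Q r1 r2 w = l'\<^sup>2 * Q s1 s2 w * Q r1 r2 (inv_into U \<tau> w)"
proof -
  define \<sigma> where "\<sigma> = inv_into U \<tau>"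
  note \<sigma> = deck_inverse[OF \<tau>, folded \<sigma>_def]
  note ev = eventually_nonpole_deck[OF \<tau> w, folded \<sigma>_def]
  have cQ: "continuous_on U (\<lambda>w. Q a b (\<sigma> w))" for a b
    by (rule continuous_on_compose2[OF Q_continuous \<sigma>(1)]) (use \<sigma>(3) in auto)
  have key: "\<exists>c. c \<noteq> 0 \<and> cmod (A (\<sigma> z)) = cmod (A z) * (cmod c)\<^sup>2 \<and>
      (\<forall>r1 r2 l. row_eigen M r1 r2 l \<longrightarrow> (r1 * g (\<sigma> z) + r2) * c = l * (r1 * g z + r2))"
    if z: "z \<in> U" "\<not> is_pole g z" "\<not> is_pole g (\<sigma> z)" for z
  proof -
    define x where "x = g z"
    define y where "y = g (\<sigma> z)"
    define c where "c = M $ 2 $ 1 * x + M $ 2 $ 2"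
    have yc: "y * c = M $ 1 $ 1 * x + M $ 1 $ 2"
      using mo[of z] z by (simp add: moebius_rel_def x_def y_def c_def \<sigma>_def)
    have "(cmod (M $ 1 $ 1 * x + M $ 1 $ 2))\<^sup>2 + (cmod c)\<^sup>2 = (cmod x)\<^sup>2 + 1"
      unfolding c_def by (rule su2_norm_column[OF M])
    then have "(cmod (y * c))\<^sup>2 + (cmod c)\<^sup>2 = (cmod x)\<^sup>2 + 1" by (simp only: yc)
    then have n: "(cmod c)\<^sup>2 * (1 + (cmod y)\<^sup>2) = 1 + (cmod x)\<^sup>2"
      by (simp add: norm_mult power_mult_distrib algebra_simps)
    have c0: "c \<noteq> 0"
    proof
      assume "c = 0"
      then have "1 + (cmod x)\<^sup>2 = 0" using n by simp
      then show False by (metis add_nonneg_eq_0_iff zero_le_one zero_le_power2 zero_neq_one)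
    qed
    have "1/4 * (cmod (A (\<sigma> z)))\<^sup>2 * (1 + (cmod y)\<^sup>2)\<^sup>2 = 1/4 * (cmod (A z))\<^sup>2 * (1 + (cmod x)\<^sup>2)\<^sup>2"
      using nonpole(3)[OF z(1,2)] nonpole(3)[OF \<sigma>(3)[OF z(1)] z(3)] \<sigma>(4)[OF z(1)] by (simp add: x_def y_def)
    then have "(cmod (A (\<sigma> z)) * (1 + (cmod y)\<^sup>2))\<^sup>2 = (cmod (A z) * (1 + (cmod x)\<^sup>2))\<^sup>2"
      by (simp add: power_mult_distrib)
    then have "cmod (A (\<sigma> z)) * (1 + (cmod y)\<^sup>2) = cmod (A z) * (1 + (cmod x)\<^sup>2)"
      by (rule power2_eq_imp_eq) auto
    then have "cmod (A (\<sigma> z)) * (1 + (cmod y)\<^sup>2) = cmod (A z) * (cmod c)\<^sup>2 * (1 + (cmod y)\<^sup>2)"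
      unfolding n[symmetric] by simp
    moreover have "1 + (cmod y)\<^sup>2 \<noteq> 0"
      by (metis add_nonneg_eq_0_iff zero_le_one zero_le_power2 zero_neq_one)
    ultimately have a: "cmod (A (\<sigma> z)) = cmod (A z) * (cmod c)\<^sup>2" by simp
    have "(r1 * y + r2) * c = l * (r1 * x + r2)" if "row_eigen M r1 r2 l" for r1 r2 l
    proof -
      have "(r1 * y + r2) * c = r1 * (y * c) + r2 * c" by (simp add: algebra_simps)
      also have "\<dots> = (r1 * M $ 1 $ 1 + r2 * M $ 2 $ 1) * x + (r1 * M $ 1 $ 2 + r2 * M $ 2 $ 2)"
        unfolding yc by (simp add: c_def algebra_simps)
      also have "\<dots> = l * (r1 * x + r2)" using that by (simp add: row_eigen_def algebra_simps)
      finally show ?thesis .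
    qed
    then show ?thesis using c0 a unfolding x_def y_def by blast
  qed
  show "cmod (Q r1 r2 (inv_into U \<tau> w)) = cmod (Q r1 r2 w)"
    unfolding \<sigma>_def[symmetric]
  proof (rule continuous_eq_of_eventually[OF U_facts(1) _ _ w])
    show "continuous_on U (\<lambda>w. cmod (Q r1 r2 (\<sigma> w)))" "continuous_on U (\<lambda>w. cmod (Q r1 r2 w))"
      by (intro continuous_intros cQ Q_continuous)+
    show "\<forall>\<^sub>F z in at w. cmod (Q r1 r2 (\<sigma> z)) = cmod (Q r1 r2 z)"
      using ev
    proof eventually_elim
      case (elim z)
      obtain c where c: "c \<noteq> 0" "cmod (A (\<sigma> z)) = cmod (A z) * (cmod c)\<^sup>2"
        "(r1 * g (\<sigma> z) + r2) * c = l * (r1 * g z + r2)" using key[of z] elim r by blast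
      have l1: "cmod l = 1" using r by (simp add: row_eigen_def)
      have "cmod (Q r1 r2 (\<sigma> z)) = cmod (A z) * (cmod ((r1 * g (\<sigma> z) + r2) * c))\<^sup>2"
        using Q_nonpole[of "\<sigma> z"] elim \<sigma>(3) c(2) by (simp add: norm_mult norm_power power_mult_distrib)
      also have "\<dots> = cmod (Q r1 r2 z)"
        unfolding c(3) using Q_nonpole[of z] elim l1 by (simp add: norm_mult norm_power)
      finally show ?case .
    qed
  qed
  assume s: "row_eigen M s1 s2 l'"
  show "l\<^sup>2 * Q s1 s2 (inv_into U \<tau> w) * Q r1 r2 w = l'\<^sup>2 * Q s1 s2 w * Q r1 r2 (inv_into U \<tau> w)"
    unfolding \<sigma>_def[symmetric]
  proof (rule continuous_eq_of_eventually[OF U_facts(1) _ _ w])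
    show "continuous_on U (\<lambda>w. l\<^sup>2 * Q s1 s2 (\<sigma> w) * Q r1 r2 w)" "continuous_on U (\<lambda>w. l'\<^sup>2 * Q s1 s2 w * Q r1 r2 (\<sigma> w))"
      by (intro continuous_intros cQ Q_continuous)+
    show "\<forall>\<^sub>F z in at w. l\<^sup>2 * Q s1 s2 (\<sigma> z) * Q r1 r2 z = l'\<^sup>2 * Q s1 s2 z * Q r1 r2 (\<sigma> z)"
      using ev
    proof eventually_elim
      case (elim z)
      obtain c where c: "c \<noteq> 0" "(r1 * g (\<sigma> z) + r2) * c = l * (r1 * g z + r2)"
        "(s1 * g (\<sigma> z) + s2) * c = l' * (s1 * g z + s2)" using key[of z] elim r s by blast
      have q: "Q a b (\<sigma> z) * c\<^sup>2 = A (\<sigma> z) * ((a * g (\<sigma> z) + b) * c)\<^sup>2" for a b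
        using Q_nonpole[of "\<sigma> z"] elim \<sigma>(3) by (simp add: power_mult_distrib)
      have "(l\<^sup>2 * Q s1 s2 (\<sigma> z) * Q r1 r2 z) * c\<^sup>2 = l\<^sup>2 * (Q s1 s2 (\<sigma> z) * c\<^sup>2) * Q r1 r2 z" by simp
      also have "\<dots> = l'\<^sup>2 * Q s1 s2 z * (Q r1 r2 (\<sigma> z) * c\<^sup>2)"
        unfolding q c using Q_nonpole[of z] elim by (simp add: power_mult_distrib)
      finally show ?case using c(1) by (simp add: mult.assoc)
    qed
  qed
qed

end

section \<open>Curvature and the Hopf differential\<close>

lemma dC2_ln:
  assumes N: "dC2 e S N N1 N2" and pos: "\<And>z. z \<in> S \<Longrightarrow> N z > 0"
  shows "dC2 e S (\<lambda>z. ln (N z)) (\<lambda>z. N1 z / N z) (\<lambda>z. (N2 z * N z - N1 z * N1 z) / (N z * N z))"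
proof -
  have d: "((\<lambda>t. N (z + t *\<^sub>R e)) has_real_derivative N1 z) (at 0)" "((\<lambda>t. N1 (z + t *\<^sub>R e)) has_real_derivative N2 z) (at 0)"
    if "z \<in> S" for z using N that unfolding dC2_def has_dd_def by auto
  have c: "continuous_on S N" "continuous_on S N1" "continuous_on S N2" using N unfolding dC2_def by auto
  have "has_dd e S (\<lambda>z. ln (N z)) (\<lambda>z. N1 z / N z)"
    unfolding has_dd_def
  proof
    fix z assume z: "z \<in> S"
    have "((\<lambda>t. ln (N (z + t *\<^sub>R e))) has_real_derivative 1 / N (z + 0 *\<^sub>R e) * N1 z) (at 0)"
      by (rule DERIV_chain2[where f = ln]) (use d(1)[OF z] pos[OF z] DERIV_ln_divide[of "N z"] in auto)
    then show "((\<lambda>t. ln (N (z + t *\<^sub>R e))) has_real_derivative N1 z / N z) (at 0)" by simp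
  qed
  moreover have "has_dd e S (\<lambda>z. N1 z / N z) (\<lambda>z. (N2 z * N z - N1 z * N1 z) / (N z * N z))"
    unfolding has_dd_def
  proof
    fix z assume z: "z \<in> S"
    show "((\<lambda>t. N1 (z + t *\<^sub>R e) / N (z + t *\<^sub>R e)) has_real_derivative (N2 z * N z - N1 z * N1 z) / (N z * N z)) (at 0)"
      using DERIV_divide[OF d(2)[OF z] d(1)[OF z]] pos[OF z] by simp
  qed
  moreover have "continuous_on S (\<lambda>z. ln (N z))" "continuous_on S (\<lambda>z. N1 z / N z)"
    "continuous_on S (\<lambda>z. (N2 z * N z - N1 z * N1 z) / (N z * N z))"
    using c pos by (auto intro!: continuous_intros simp: less_imp_neq[symmetric])
  ultimately show ?thesis unfolding dC2_def by blast
qed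

lemma dC2_norm_square:
  assumes V: "open V" and f: "f holomorphic_on V"
  defines "f1 \<equiv> deriv f" and "f2 \<equiv> deriv (deriv f)"
  shows "dC2 e V (\<lambda>z. c + ((Re (f z))\<^sup>2 + (Im (f z))\<^sup>2))
     (\<lambda>z. 2 * (Re (f z) * Re (f1 z * e) + Im (f z) * Im (f1 z * e)))
     (\<lambda>z. 2 * ((Re (f1 z * e))\<^sup>2 + (Im (f1 z * e))\<^sup>2 + Re (f z) * Re (f2 z * e * e) + Im (f z) * Im (f2 z * e * e)))"
proof -
  have h1: "f1 holomorphic_on V" and h2: "f2 holomorphic_on V"
    unfolding f1_def f2_def using f V by (auto intro!: holomorphic_deriv)
  have cf: "continuous_on V f" "continuous_on V f1" "continuous_on V f2"
    using f h1 h2 by (auto intro: holomorphic_on_imp_continuous_on)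
  have vd: "((\<lambda>t. k (z + t *\<^sub>R e)) has_vector_derivative deriv k z * e) (at 0)"
    if "k holomorphic_on V" "z \<in> V" for k z
  proof -
    have k: "(k has_field_derivative deriv k z) (at (z + 0 *\<^sub>R e))"
      using holomorphic_derivI[OF that(1) V that(2)] by simp
    have "((\<lambda>t. z + t *\<^sub>R e) has_vector_derivative e) (at 0)"
      by (auto intro!: derivative_eq_intros)
    then show ?thesis using field_vector_diff_chain_at[of "\<lambda>t. z + t *\<^sub>R e" e 0 k "deriv k z"] k
      by (simp add: o_def mult.commute)
  qed
  have R: "((\<lambda>t. Re (f (z + t *\<^sub>R e))) has_real_derivative Re (f1 z * e)) (at 0)"
     "((\<lambda>t. Im (f (z + t *\<^sub>R e))) has_real_derivative Im (f1 z * e)) (at 0)"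
     "((\<lambda>t. Re (f1 (z + t *\<^sub>R e) * e)) has_real_derivative Re (f2 z * e * e)) (at 0)"
     "((\<lambda>t. Im (f1 (z + t *\<^sub>R e) * e)) has_real_derivative Im (f2 z * e * e)) (at 0)" if "z \<in> V" for z
  proof -
    have "((\<lambda>t. f1 (z + t *\<^sub>R e) * e) has_vector_derivative f2 z * e * e) (at 0)"
      using has_vector_derivative_mult_left[OF vd[OF h1 that]] by (simp add: f1_def f2_def)
    then show "((\<lambda>t. Re (f1 (z + t *\<^sub>R e) * e)) has_real_derivative Re (f2 z * e * e)) (at 0)"
     "((\<lambda>t. Im (f1 (z + t *\<^sub>R e) * e)) has_real_derivative Im (f2 z * e * e)) (at 0)"
      by (rule has_field_derivative_Re has_field_derivative_Im)+
    show "((\<lambda>t. Re (f (z + t *\<^sub>R e))) has_real_derivative Re (f1 z * e)) (at 0)"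
     "((\<lambda>t. Im (f (z + t *\<^sub>R e))) has_real_derivative Im (f1 z * e)) (at 0)"
      using vd[OF f that] unfolding f1_def by (rule has_field_derivative_Re has_field_derivative_Im)+
  qed
  have "has_dd e V (\<lambda>z. c + ((Re (f z))\<^sup>2 + (Im (f z))\<^sup>2)) (\<lambda>z. 2 * (Re (f z) * Re (f1 z * e) + Im (f z) * Im (f1 z * e)))"
    unfolding has_dd_def
  proof
    fix z assume z: "z \<in> V"
    show "((\<lambda>t. c + ((Re (f (z + t *\<^sub>R e)))\<^sup>2 + (Im (f (z + t *\<^sub>R e)))\<^sup>2)) has_real_derivative
        2 * (Re (f z) * Re (f1 z * e) + Im (f z) * Im (f1 z * e))) (at 0)"
      by (rule derivative_eq_intros R[OF z] refl)+ (simp add: algebra_simps)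
  qed
  moreover have "has_dd e V (\<lambda>z. 2 * (Re (f z) * Re (f1 z * e) + Im (f z) * Im (f1 z * e)))
     (\<lambda>z. 2 * ((Re (f1 z * e))\<^sup>2 + (Im (f1 z * e))\<^sup>2 + Re (f z) * Re (f2 z * e * e) + Im (f z) * Im (f2 z * e * e)))"
    unfolding has_dd_def
  proof
    fix z assume z: "z \<in> V"
    show "((\<lambda>t. 2 * (Re (f (z + t *\<^sub>R e)) * Re (f1 (z + t *\<^sub>R e) * e) + Im (f (z + t *\<^sub>R e)) * Im (f1 (z + t *\<^sub>R e) * e))) has_real_derivative
        2 * ((Re (f1 z * e))\<^sup>2 + (Im (f1 z * e))\<^sup>2 + Re (f z) * Re (f2 z * e * e) + Im (f z) * Im (f2 z * e * e))) (at 0)"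
      by (rule derivative_eq_intros R[OF z] refl)+ (simp add: algebra_simps power2_eq_square)
  qed
  ultimately show ?thesis unfolding dC2_def by (intro conjI continuous_intros cf) auto
qed

text \<open>The case c = 0 is the harmonicity of ln|f|, the case c = 1 the potential of the
  spherical metric pulled back by f. Second derivatives of f cancel because the direction \<i>
  reverses their sign.\<close>

lemma lapG_ln_norm_square:
  assumes V: "open V" and f: "f holomorphic_on V" and pos: "\<And>z. z \<in> V \<Longrightarrow> c + (cmod (f z))\<^sup>2 > 0"
  shows "\<exists>g. lapG V (\<lambda>z. ln (c + (cmod (f z))\<^sup>2)) g (\<lambda>z. 4 * c * (cmod (deriv f z))\<^sup>2 / (c + (cmod (f z))\<^sup>2)\<^sup>2)"
proof -
  define N where "N z = c + ((Re (f z))\<^sup>2 + (Im (f z))\<^sup>2)" for z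
  have Npos: "N z > 0" if "z \<in> V" for z using pos[OF that] by (simp add: N_def cmod_power2)
  note d = dC2_ln[OF dC2_norm_square[OF V f, of _ c, folded N_def[abs_def]] Npos]
  have eq: "(\<lambda>z. ln (c + (cmod (f z))\<^sup>2)) = (\<lambda>z. ln (N z))" by (simp add: N_def cmod_power2)
  have alg: "(2 * ((a * 1)\<^sup>2 + b\<^sup>2 + x * p + y * q) * n - (2 * (x * a + y * b)) * (2 * (x * a + y * b))) / (n * n)
     + (2 * (b\<^sup>2 + a\<^sup>2 - x * p - y * q) * n - (2 * (y * a - x * b)) * (2 * (y * a - x * b))) / (n * n)
     = 4 * c * (a\<^sup>2 + b\<^sup>2) / n\<^sup>2"
    if "n > 0" "n = c + (x\<^sup>2 + y\<^sup>2)" for a b x y p q n :: real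
  proof -
    have "(2 * ((a * 1)\<^sup>2 + b\<^sup>2 + x * p + y * q) * n - (2 * (x * a + y * b)) * (2 * (x * a + y * b)))
      + (2 * (b\<^sup>2 + a\<^sup>2 - x * p - y * q) * n - (2 * (y * a - x * b)) * (2 * (y * a - x * b)))
      = 4 * (a\<^sup>2 + b\<^sup>2) * n - 4 * (a\<^sup>2 + b\<^sup>2) * (x\<^sup>2 + y\<^sup>2)"
      by (simp add: power2_eq_square algebra_simps)
    also have "\<dots> = 4 * c * (a\<^sup>2 + b\<^sup>2)" unfolding that(2) by (simp add: algebra_simps)
    finally show ?thesis by (simp add: add_divide_distrib[symmetric] power2_eq_square)
  qed
  have lap: "4 * c * (cmod (deriv f z))\<^sup>2 / (c + (cmod (f z))\<^sup>2)\<^sup>2 =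
     (2 * ((Re (deriv f z * 1))\<^sup>2 + (Im (deriv f z * 1))\<^sup>2 + Re (f z) * Re (deriv (deriv f) z * 1 * 1) + Im (f z) * Im (deriv (deriv f) z * 1 * 1)) * N z -
      2 * (Re (f z) * Re (deriv f z * 1) + Im (f z) * Im (deriv f z * 1)) * (2 * (Re (f z) * Re (deriv f z * 1) + Im (f z) * Im (deriv f z * 1)))) / (N z * N z)
   + (2 * ((Re (deriv f z * \<i>))\<^sup>2 + (Im (deriv f z * \<i>))\<^sup>2 + Re (f z) * Re (deriv (deriv f) z * \<i> * \<i>) + Im (f z) * Im (deriv (deriv f) z * \<i> * \<i>)) * N z -
      2 * (Re (f z) * Re (deriv f z * \<i>) + Im (f z) * Im (deriv f z * \<i>)) * (2 * (Re (f z) * Re (deriv f z * \<i>) + Im (f z) * Im (deriv f z * \<i>)))) / (N z * N z)"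
    if "z \<in> V" for z
    using alg[of "N z" "Re (f z)" "Im (f z)" "Re (deriv f z)" "Im (deriv f z)" "Re (deriv (deriv f) z)" "Im (deriv (deriv f) z)"] Npos[OF that]
    by (simp add: N_def cmod_power2 algebra_simps)
  show ?thesis unfolding eq lapG_def
    by (rule exI, rule exI, rule exI, rule exI, rule exI, rule conjI[OF d conjI[OF d ballI[OF conjI[OF refl lap]]]])
qed

lemma lapG_unique:
  assumes "lapG V u g1 l1" "lapG V u g2 l2" "open V" "z \<in> V"
  shows "l1 z = l2 z"
proof -
  have uniq: "a2 z = b2 z" if A: "dC2 e V u a1 a2" and B: "dC2 e V u b1 b2" for e a1 a2 b1 b2
  proof -
    have e1: "a1 y = b1 y" if "y \<in> V" for y
      using DERIV_unique[of "\<lambda>t. u (y + t *\<^sub>R e)" "a1 y" 0 "b1 y"] A B that unfolding dC2_def has_dd_def by blast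
    have hA: "has_dd e V a1 a2" using A unfolding dC2_def by (elim conjE)
    have "has_dd e V b1 a2"
      by (rule has_dd_cong[OF assms(3) _ _ hA]) (simp_all add: e1)
    then show ?thesis
      using DERIV_unique[of "\<lambda>t. b1 (z + t *\<^sub>R e)" "a2 z" 0 "b2 z"] B assms(4) unfolding dC2_def has_dd_def by blast
  qed
  obtain a1 a2 b1 b2 where a: "dC2 1 V u a1 a2" "dC2 \<i> V u b1 b2" "l1 z = a2 z + b2 z"
    using assms(1,4) unfolding lapG_def by blast
  obtain c1 c2 d1 d2 where c: "dC2 1 V u c1 c2" "dC2 \<i> V u d1 d2" "l2 z = c2 z + d2 z"
    using assms(2,4) unfolding lapG_def by blast
  show ?thesis using uniq[OF a(1) c(1)] uniq[OF a(2) c(2)] a(3) c(3) by simp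
qed

lemma differentiable_direction:
  fixes f :: "complex \<Rightarrow> real"
  assumes "f differentiable (at z)"
  shows "((\<lambda>t. f (z + t *\<^sub>R e)) has_real_derivative frechet_derivative f (at z) e) (at 0)"
proof -
  have f: "(f has_derivative frechet_derivative f (at z)) (at (z + 0 *\<^sub>R e))"
    using iffD1[OF frechet_derivative_works assms] by simp
  have l: "((\<lambda>t. z + t *\<^sub>R e) has_derivative (\<lambda>t. t *\<^sub>R e)) (at 0)"
    by (auto intro!: derivative_eq_intros)
  have "((\<lambda>t. f (z + t *\<^sub>R e)) has_derivative (\<lambda>t. frechet_derivative f (at z) (t *\<^sub>R e))) (at 0)"
    by (rule has_derivative_compose[OF l f])
  moreover have "linear (frechet_derivative f (at z))"
    using f by (simp add: has_derivative_linear)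
  then have "(\<lambda>t. frechet_derivative f (at z) (t *\<^sub>R e)) = (\<lambda>t. frechet_derivative f (at z) e * t)"
    by (simp add: linear_scale fun_eq_iff)
  ultimately show ?thesis by (simp add: has_field_derivative_def)
qed

lemma Ck_on_2_dC2:
  fixes f :: "complex \<Rightarrow> real"
  assumes "Ck_on (Suc (Suc 0)) S f"
  shows "dC2 1 S f (partial_x f) (partial_x (partial_x f))" "dC2 \<i> S f (partial_y f) (partial_y (partial_y f))"
    "\<And>z. z \<in> S \<Longrightarrow> f differentiable (at z)" "\<And>z. z \<in> S \<Longrightarrow> partial_x f differentiable (at z)"
    "\<And>z. z \<in> S \<Longrightarrow> partial_y f differentiable (at z)"
proof -
  show d: "\<And>z. z \<in> S \<Longrightarrow> f differentiable (at z)" "\<And>z. z \<in> S \<Longrightarrow> partial_x f differentiable (at z)"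
    "\<And>z. z \<in> S \<Longrightarrow> partial_y f differentiable (at z)" using assms by auto
  have c2: "continuous_on S (partial_x (partial_x f))" "continuous_on S (partial_y (partial_y f))" using assms by auto
  have cont: "continuous_on S k" if "\<And>z. z \<in> S \<Longrightarrow> k differentiable (at z)" for k :: "complex \<Rightarrow> real"
    using that by (meson continuous_at_imp_continuous_on differentiable_imp_continuous_within)
  have dd: "has_dd 1 S k (partial_x k)" "has_dd \<i> S k (partial_y k)"
    if "\<And>z. z \<in> S \<Longrightarrow> k differentiable (at z)" for k :: "complex \<Rightarrow> real"
    using that differentiable_direction unfolding has_dd_def partial_x_def partial_y_def by auto
  show "dC2 1 S f (partial_x f) (partial_x (partial_x f))" "dC2 \<i> S f (partial_y f) (partial_y (partial_y f))"
    unfolding dC2_def using d c2 cont dd by auto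
qed

text \<open>The bridge from iterated partial derivatives to derivatives along lines: the Laplacian
  of ln(h)/2 is -K h.\<close>

lemma gauss_curvature_lapG:
  assumes S: "open S" and sm: "smooth_on S h" and pos: "\<And>z. z \<in> S \<Longrightarrow> h z > 0"
  shows "\<exists>g. lapG S (\<lambda>z. ln (h z) / 2) g (\<lambda>z. - (gauss_curvature h z * h z))"
proof -
  have "Ck_on (Suc (Suc 0)) S h" using sm unfolding smooth_on_def by blast
  note C = Ck_on_2_dC2[OF this]
  let ?u = "\<lambda>z. ln (h z) / 2"
  have half: "dC2 e S ?u (\<lambda>z. 1/2 * (a z / h z)) (\<lambda>z. 1/2 * ((b z * h z - a z * a z) / (h z * h z)))"
    if "dC2 e S h a b" for e a b
    using dC2_cmult[OF dC2_ln[OF that pos], of "1/2"] by simp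
  \<comment> \<open>\<open>frechet_derivative\<close> is meaningful only at points of
    differentiability. So the function and its first partial derivative are shown to be
    differentiable before their values are read off from line derivatives.\<close>
  have second: "frechet_derivative (\<lambda>z. frechet_derivative ?u (at z) e) (at z) e = 1/2 * ((b z * h z - a z * a z) / (h z * h z))"
    if ab: "dC2 e S h a b" and da: "\<And>z. z \<in> S \<Longrightarrow> a differentiable (at z)" and z: "z \<in> S" for e a b z
  proof -
    have ud: "?u differentiable (at y)" if "y \<in> S" for y
    proof -
      have "ln differentiable (at (h y))"
        using DERIV_ln[OF pos[OF that]] real_differentiable_def by blast
      then have "(\<lambda>z. ln (h z)) differentiable (at y)"
        using differentiable_chain_at[OF C(3)[OF that], of ln] by (simp add: o_def)
      then show ?thesis by (intro differentiable_divide) auto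
    qed
    have first: "frechet_derivative ?u (at y) e = 1/2 * (a y / h y)" if "y \<in> S" for y
      using DERIV_unique[OF differentiable_direction[OF ud[OF that], of e]] half[OF ab] that
      unfolding dC2_def has_dd_def by blast
    have "(\<lambda>y. 1/2 * (a y / h y)) differentiable (at z)"
      using da[OF z] C(3)[OF z] pos[OF z] by (intro differentiable_mult differentiable_divide) auto
    then have d2: "(\<lambda>y. frechet_derivative ?u (at y) e) differentiable (at z)"
      unfolding differentiable_def
      by (elim exE) (rule exI, rule has_derivative_transform_within_open[OF _ S z], assumption, simp add: first)
    have "has_dd e S (\<lambda>y. frechet_derivative ?u (at y) e) (\<lambda>z. 1/2 * ((b z * h z - a z * a z) / (h z * h z)))"
      by (rule has_dd_cong[OF S _ refl, of "\<lambda>z. 1/2 * (a z / h z)"]) (use first half[OF ab] in \<open>auto simp: dC2_def\<close>)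
    then show ?thesis
      using DERIV_unique[OF differentiable_direction[OF d2, of e]] z unfolding has_dd_def by blast
  qed
  show ?thesis unfolding lapG_def
  proof (rule exI, rule exI, rule exI, rule exI, rule exI, rule conjI[OF half[OF C(1)] conjI[OF half[OF C(2)] ballI[OF conjI[OF refl]]]])
    fix z assume z: "z \<in> S"
    have "partial_x (partial_x ?u) z = 1/2 * ((partial_x (partial_x h) z * h z - partial_x h z * partial_x h z) / (h z * h z))"
      unfolding partial_x_def[of "partial_x ?u"] unfolding partial_x_def[of ?u, abs_def]
      by (rule second[OF C(1,4) z])
    moreover have "partial_y (partial_y ?u) z = 1/2 * ((partial_y (partial_y h) z * h z - partial_y h z * partial_y h z) / (h z * h z))"
      unfolding partial_y_def[of "partial_y ?u"] unfolding partial_y_def[of ?u, abs_def]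
      by (rule second[OF C(2,5) z])
    moreover have "- (gauss_curvature h z * h z) = partial_x (partial_x ?u) z + partial_y (partial_y ?u) z"
      using pos[OF z] by (simp add: gauss_curvature_def laplacian_def)
    ultimately show "- (gauss_curvature h z * h z) =
        1/2 * ((partial_x (partial_x h) z * h z - partial_x h z * partial_x h z) / (h z * h z)) +
        1/2 * ((partial_y (partial_y h) z * h z - partial_y h z * partial_y h z) / (h z * h z))" by simp
  qed
qed

context ricci_weierstrass
begin

text \<open>The flat Laplacian of \<open>u\<close> and at the same time the density of minus the
  total curvature with respect to Lebesgue measure.\<close>

definition ld where "ld z = - (gauss_curvature h z * h z)"
definition u where "u z = ln (h z) / 2"

lemma lap_u: "\<exists>k. lapG punct u k ld"
  using gauss_curvature_lapG[OF open_punct, of h] conf unfolding u_def[abs_def] ld_def[abs_def] conformal_metric_def by blast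

lemma ld_continuous: "continuous_on punct ld" using lap_u lapG_continuous by blast

text \<open>In a local coordinate sqrt(h) is |f| (1 + |k|^2) / 2 with f holomorphic without zeros
  and k a branch of g. Only ln(1 + |k|^2) contributes to the Laplacian, namely 4 |k'|^2 / (1 +
  |k|^2)^2. Multiplication by h cancels the denominator and leaves the squared modulus of the
  coefficient of the Hopf differential.\<close>

lemma liouville:
  assumes w: "w \<in> U" "\<not> is_pole g w"
  shows "ld (cov w) * h (cov w) = (cmod (deriv g w * \<alpha> w / (deriv cov w)\<^sup>2))\<^sup>2"
proof -
  obtain V \<psi> where V: "open V" "cov w \<in> V" "V \<subseteq> punct" "\<psi> holomorphic_on V" "\<psi> ` V \<subseteq> U" "\<psi> (cov w) = w"
    "\<And>z. z \<in> V \<Longrightarrow> cov (\<psi> z) = z" "\<And>z. z \<in> V \<Longrightarrow> deriv cov (\<psi> z) * deriv \<psi> z = 1"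
    using cov_local_inverse[OF w(1)] by blast
  have "\<forall>\<^sub>F z in nhds w. \<not> is_pole g z \<and> z \<in> U"
    using eventually_nonpole[OF w(1)] w by (simp add: eventually_nhds_conv_at)
  then obtain T where T: "open T" "w \<in> T" "\<And>z. z \<in> T \<Longrightarrow> \<not> is_pole g z \<and> z \<in> U"
    unfolding eventually_nhds by blast
  define V' where "V' = V \<inter> \<psi> -` T"
  have oV': "open V'" unfolding V'_def
    using continuous_open_preimage[OF holomorphic_on_imp_continuous_on[OF V(4)] V(1) T(1)] by simp
  have z0: "cov w \<in> V'" using V T by (simp add: V'_def)
  have gT: "g holomorphic_on T"
    by (rule analytic_imp_holomorphic, subst analytic_on_analytic_at) (use nonpole(1) T in blast)
  have \<psi>V': "\<psi> holomorphic_on V'" using V(4) by (rule holomorphic_on_subset) (auto simp: V'_def)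
  define f where "f z = A (\<psi> z)" for z
  define k where "k z = g (\<psi> z)" for z
  have fh: "f holomorphic_on V'" unfolding f_def
    by (rule holomorphic_compose2[OF A_holomorphic \<psi>V']) (use V in \<open>auto simp: V'_def\<close>)
  have kh: "k holomorphic_on V'" unfolding k_def
    by (rule holomorphic_compose2[OF gT \<psi>V']) (auto simp: V'_def)
  have np: "\<psi> z \<in> U" "\<not> is_pole g (\<psi> z)" if "z \<in> V'" for z using that T by (auto simp: V'_def)
  have fnz: "f z \<noteq> 0" if "z \<in> V'" for z using nonpole(2)[OF np[OF that]] by (simp add: f_def)
  obtain g1 where "lapG V' (\<lambda>z. ln (0 + (cmod (f z))\<^sup>2)) g1 (\<lambda>z. 4 * 0 * (cmod (deriv f z))\<^sup>2 / (0 + (cmod (f z))\<^sup>2)\<^sup>2)"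
    using lapG_ln_norm_square[OF oV' fh, of 0] fnz by auto
  from lapG_cmult[OF this, of "1/2"] obtain g1 where 1: "lapG V' (\<lambda>z. 1/2 * ln ((cmod (f z))\<^sup>2)) g1 (\<lambda>z. 0)"
    by auto
  obtain g2 where 2: "lapG V' (\<lambda>z. ln (1 + (cmod (k z))\<^sup>2)) g2 (\<lambda>z. 4 * 1 * (cmod (deriv k z))\<^sup>2 / (1 + (cmod (k z))\<^sup>2)\<^sup>2)"
    using lapG_ln_norm_square[OF oV' kh, of 1] by (auto simp: add_pos_nonneg)
  obtain g3 where "lapG V' (\<lambda>z. 1/2 * ln ((cmod (f z))\<^sup>2) + ln (1 + (cmod (k z))\<^sup>2)) g3
     (\<lambda>z. 0 + 4 * 1 * (cmod (deriv k z))\<^sup>2 / (1 + (cmod (k z))\<^sup>2)\<^sup>2)" using lapG_add[OF 1 2] by blast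
  from lapG_add[OF this lapG_const[of V' "- ln 2"]]
  obtain g4 where 4: "lapG V' (\<lambda>z. (1/2 * ln ((cmod (f z))\<^sup>2) + ln (1 + (cmod (k z))\<^sup>2)) + - ln 2) g4
     (\<lambda>z. 4 * (cmod (deriv k z))\<^sup>2 / (1 + (cmod (k z))\<^sup>2)\<^sup>2)" by auto
  have hz: "h z = 1/4 * (cmod (f z))\<^sup>2 * (1 + (cmod (k z))\<^sup>2)\<^sup>2" if "z \<in> V'" for z
    using nonpole(3)[OF np[OF that]] V(7)[of z] that by (simp add: f_def k_def V'_def)
  have ueq: "(1/2 * ln ((cmod (f z))\<^sup>2) + ln (1 + (cmod (k z))\<^sup>2)) + - ln 2 = u z" if "z \<in> V'" for z
  proof -
    have p: "1 + (cmod (k z))\<^sup>2 > 0" by (simp add: add_pos_nonneg)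
    have "ln (h z) = ln (1/4) + ln ((cmod (f z))\<^sup>2) + ln ((1 + (cmod (k z))\<^sup>2)\<^sup>2)"
    proof -
      have "ln (1/4 * a * b) = ln (1/4) + ln a + ln b" if "a > 0" "b > 0" for a b :: real
        using that by (simp add: ln_mult ln_div)
      then show ?thesis unfolding hz[OF that] using fnz[OF that] p by simp
    qed
    moreover have "ln ((1 + (cmod (k z))\<^sup>2)\<^sup>2) = 2 * ln (1 + (cmod (k z))\<^sup>2)" using p by (simp add: ln_realpow)
    moreover have "ln (1/4 :: real) = - 2 * ln 2"
      using ln_realpow[of 2 2] by (simp add: ln_div)
    ultimately show ?thesis by (simp add: u_def)
  qed
  have lu: "lapG V' u g4 (\<lambda>z. 4 * (cmod (deriv k z))\<^sup>2 / (1 + (cmod (k z))\<^sup>2)\<^sup>2)"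
    by (rule lapG_cong[OF oV' ueq refl refl 4])
  obtain g5 where "lapG punct u g5 ld" using lap_u by blast
  then have "lapG V' u g5 ld" by (rule lapG_subset) (use V in \<open>auto simp: V'_def\<close>)
  then have l: "ld (cov w) = 4 * (cmod (deriv k (cov w)))\<^sup>2 / (1 + (cmod (k (cov w)))\<^sup>2)\<^sup>2"
    using lapG_unique[OF _ lu oV' z0] by blast
  have "(k has_field_derivative deriv g w * deriv \<psi> (cov w)) (at (cov w))"
    unfolding k_def
  proof (rule DERIV_chain2[of g "deriv g w" \<psi> "cov w" "deriv \<psi> (cov w)" UNIV])
    show "(g has_field_derivative deriv g w) (at (\<psi> (cov w)))"
      using holomorphic_derivI[OF gT T(1,2)] V(6) by simp
    show "(\<psi> has_field_derivative deriv \<psi> (cov w)) (at (cov w))" using holomorphic_derivI[OF V(4,1,2)] .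
  qed
  then have dk: "deriv k (cov w) = deriv g w * deriv \<psi> (cov w)" by (rule DERIV_imp_deriv)
  have nz: "deriv cov w \<noteq> 0" using cov_deriv_nz w by blast
  then have "deriv \<psi> (cov w) = 1 / deriv cov w" using V(8)[OF V(2)] V(6) by (simp add: field_simps)
  then have dk': "deriv k (cov w) = deriv g w / deriv cov w" using dk by simp
  have "1 + (cmod (g w))\<^sup>2 \<noteq> 0" by (metis add_nonneg_eq_0_iff zero_le_one zero_le_power2 zero_neq_one)
  then have "ld (cov w) * h (cov w) = (cmod (deriv g w / deriv cov w))\<^sup>2 * (cmod (A w))\<^sup>2"
    unfolding l dk' nonpole(3)[OF w] k_def V(6) by simp
  also have "\<dots> = (cmod (deriv g w / deriv cov w * A w))\<^sup>2" by (simp add: norm_mult norm_divide power_mult_distrib power_divide)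
  also have "deriv g w / deriv cov w * A w = deriv g w * \<alpha> w / (deriv cov w)\<^sup>2" by (simp add: A_def power2_eq_square)
  finally show ?thesis .
qed

end

section \<open>Ends\<close>

text \<open>Holomorphic coordinates of the three ends, with \<open>\<sigma> = -1\<close> and \<open>p = 0\<close> at infinity.\<close>

definition end_map :: "(complex \<Rightarrow> complex) \<Rightarrow> complex \<Rightarrow> real \<Rightarrow> bool" where
  "end_map \<phi> p \<sigma> \<longleftrightarrow> p \<notin> punct \<and> \<sigma>\<^sup>2 = 1 \<and> \<phi> holomorphic_on ball 0 1 - {0} \<and> inj_on \<phi> (ball 0 1 - {0}) \<and>
     (\<forall>x\<in>ball 0 1 - {0}. \<phi> x \<in> punct \<and> cmod (deriv \<phi> x * x) = cmod (\<phi> x - p) \<and>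
        ln (cmod (\<phi> x - p)) = \<sigma> * ln (cmod x)) \<and>
     (\<forall>z. z \<noteq> p \<longrightarrow> \<sigma> * ln (cmod (z - p)) < 0 \<longrightarrow> (\<exists>x\<in>ball 0 1 - {0}. \<phi> x = z))"

lemma end_maps: "end_map (\<lambda>x. x) 0 1" "end_map (\<lambda>x. 1 + x) 1 1" "end_map (\<lambda>x. 1 / x) 0 (- 1)"
proof -
  have cne: "cmod x < 1 \<Longrightarrow> x \<noteq> 1" "cmod x < 1 \<Longrightarrow> 1 + x \<noteq> 0" for x :: complex
    by (auto simp: add_eq_0_iff)
  show "end_map (\<lambda>x. x) 0 1" unfolding end_map_def by (auto simp: punct_def)
  have d1: "deriv (\<lambda>x. 1 + x) x = 1" for x :: complex
    by (rule DERIV_imp_deriv) (auto intro!: derivative_eq_intros)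
  show "end_map (\<lambda>x. 1 + x) 1 1" unfolding end_map_def
  proof (intro conjI ballI allI impI)
    show "\<exists>x\<in>ball 0 1 - {0}. 1 + x = z" if "z \<noteq> 1" "1 * ln (cmod (z - 1)) < 0" for z :: complex
      using that by (intro bexI[of _ "z - 1"]) auto
  qed (use cne(2) in \<open>auto simp: punct_def d1 inj_on_def intro!: holomorphic_intros\<close>)
  have d2: "deriv (\<lambda>x. 1 / x) x * x = - 1 / x" if "x \<noteq> 0" for x :: complex
  proof -
    have "((\<lambda>x. 1 / x) has_field_derivative - 1 / (x * x)) (at x)"
      using that by (auto intro!: derivative_eq_intros)
    then show ?thesis using that by (simp add: DERIV_imp_deriv power2_eq_square)
  qed
  show "end_map (\<lambda>x. 1 / x) 0 (- 1)" unfolding end_map_def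
  proof (intro conjI ballI allI impI)
    fix z :: complex assume z: "z \<noteq> 0" "- 1 * ln (cmod (z - 0)) < 0"
    then have "cmod z > 1" by simp
    then show "\<exists>x\<in>ball 0 1 - {0}. 1 / x = z" using z
      by (intro bexI[of _ "1 / z"]) (auto simp: norm_divide)
  next
    fix x :: complex assume x: "x \<in> ball 0 1 - {0}"
    then show "1 / x \<in> punct" using cne(1)[of x] by (auto simp: punct_def)
    show "cmod (deriv (\<lambda>x. 1 / x) x * x) = cmod (1 / x - 0)" using x d2[of x] by (simp add: norm_divide)
    show "ln (cmod (1 / x - 0)) = - 1 * ln (cmod x)" using x by (simp add: norm_divide ln_div)
  qed (auto simp: punct_def inj_on_def intro!: holomorphic_intros)
qed

lemma end_mapD:
  assumes "end_map \<phi> p \<sigma>" "x \<noteq> 0" "cmod x < 1"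
  shows "\<phi> x \<in> punct" "\<phi> x \<noteq> p" "cmod (deriv \<phi> x * x) = cmod (\<phi> x - p)" "deriv \<phi> x \<noteq> 0"
    "ln (cmod (\<phi> x - p)) = \<sigma> * ln (cmod x)" "ln (cmod x) = \<sigma> * ln (cmod (\<phi> x - p))" "\<bar>\<sigma>\<bar> = 1"
    "(\<phi> has_field_derivative deriv \<phi> x) (at x)"
proof -
  have x: "x \<in> ball 0 1 - {0}" using assms by simp
  show 1: "\<phi> x \<in> punct" and 3: "cmod (deriv \<phi> x * x) = cmod (\<phi> x - p)" and 5: "ln (cmod (\<phi> x - p)) = \<sigma> * ln (cmod x)"
    using assms(1) x unfolding end_map_def by blast+
  show 2: "\<phi> x \<noteq> p" using 1 assms(1) unfolding end_map_def by auto
  show "deriv \<phi> x \<noteq> 0" using 2 3 by auto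
  have s: "\<sigma>\<^sup>2 = 1" using assms(1) unfolding end_map_def by blast
  then show "\<bar>\<sigma>\<bar> = 1" by (simp add: power2_eq_1_iff) auto
  show "ln (cmod x) = \<sigma> * ln (cmod (\<phi> x - p))" unfolding 5 using s by (simp add: power2_eq_square mult.assoc[symmetric])
  have "\<phi> holomorphic_on ball 0 1 - {0}" using assms(1) unfolding end_map_def by blast
  then show "(\<phi> has_field_derivative deriv \<phi> x) (at x)"
    by (rule holomorphic_derivI) (use x in \<open>auto intro: open_Diff\<close>)
qed

context ricci_weierstrass
begin

text \<open>The normal form of a catenoidal end: the Hopf differential is P dx^2 / x^2 with P
  holomorphic and without zeros up to the puncture x = 0.\<close>

definition hopf :: "(complex \<Rightarrow> complex) \<Rightarrow> (complex \<Rightarrow> complex) \<Rightarrow> real \<Rightarrow> bool" where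
  "hopf \<phi> P r \<longleftrightarrow> 0 < r \<and> r \<le> 1 \<and> P holomorphic_on ball 0 r \<and> (\<forall>x\<in>ball 0 r. P x \<noteq> 0) \<and>
     (\<forall>x\<in>ball 0 r - {0}. \<forall>w\<in>U. cov w = \<phi> x \<and> \<not> is_pole g w \<longrightarrow>
        deriv g w * \<alpha> w = P x / x\<^sup>2 * (deriv cov w / deriv \<phi> x)\<^sup>2)"

lemma catenoid_hopf:
  assumes "catenoidal_end U cov g \<alpha> \<phi>"
  shows "\<exists>P r. hopf \<phi> P r"
proof -
  obtain r q where q: "r > 0" "q meromorphic_on ball 0 r" "is_pole q 0" "zorder q 0 = - 2"
     "\<And>\<zeta> w. \<zeta> \<in> ball 0 r - {0} \<Longrightarrow> w \<in> U \<Longrightarrow> cov w = \<phi> \<zeta> \<and> \<not> is_pole g w \<Longrightarrow>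
           deriv g w * \<alpha> w = q \<zeta> * (deriv cov w / deriv \<phi> \<zeta>)\<^sup>2"
    using assms unfolding catenoidal_end_def by blast
  have "isolated_singularity_at q 0"
    using q(1,2) by (metis centre_in_ball meromorphic_on_isolated_singularity meromorphic_on_subset empty_subsetI insert_subset)
  then obtain r1 where r1: "r1 > 0" "q analytic_on ball 0 r1 - {0}" unfolding isolated_singularity_at_def by blast
  have qh: "q holomorphic_on ball 0 r1 - {0}" using r1(2) by (rule analytic_imp_holomorphic)
  have "(0::complex) \<in> ball 0 r1" using r1(1) by simp
  note Z = zorder_exist_pole[OF qh open_ball this q(3)]
  define P where "P = zor_poly q 0"
  have z0: "P 0 \<noteq> 0" unfolding P_def by (rule conjunct1[OF conjunct2[OF Z]])
  obtain r2 where r2: "r2 > 0" "P holomorphic_on cball 0 r2"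
     "\<And>w. w \<in> cball 0 r2 - {0} \<Longrightarrow> q w = P w / w\<^sup>2 \<and> P w \<noteq> 0"
    using conjunct2[OF conjunct2[OF Z]] unfolding P_def[symmetric] q(4) by auto
  define r3 where "r3 = min (min r r2) 1"
  have "hopf \<phi> P r3" unfolding hopf_def
  proof (intro conjI ballI impI)
    show "0 < r3" "r3 \<le> 1" using q(1) r2(1) by (auto simp: r3_def)
    show "P holomorphic_on ball 0 r3" by (rule holomorphic_on_subset[OF r2(2)]) (auto simp: r3_def)
    show "P x \<noteq> 0" if "x \<in> ball 0 r3" for x
      using z0 r2(3)[of x] that by (cases "x = 0") (auto simp: r3_def)
    fix x w assume x: "x \<in> ball 0 r3 - {0}" and w: "w \<in> U" "cov w = \<phi> x \<and> \<not> is_pole g w"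
    have "x \<in> cball 0 r2 - {0}" "x \<in> ball 0 r - {0}" using x by (auto simp: r3_def)
    then have "q x = P x / x\<^sup>2" using r2(3) by blast
    then show "deriv g w * \<alpha> w = P x / x\<^sup>2 * (deriv cov w / deriv \<phi> x)\<^sup>2"
      using q(5)[OF \<open>x \<in> ball 0 r - {0}\<close> w] by simp
  qed
  then show ?thesis by blast
qed

text \<open>The half-plane Re \<zeta> < 0 covers the punctured disc by x = exp \<zeta> and is simply
  connected, so the coordinate of the end lifts to \<open>U\<close>.\<close>

lemma lift_end:
  assumes em: "end_map \<phi> p \<sigma>"
  shows "\<exists>E. E holomorphic_on {\<zeta>. Re \<zeta> < 0} \<and> (\<forall>\<zeta>. Re \<zeta> < 0 \<longrightarrow> E \<zeta> \<in> U \<and> cov (E \<zeta>) = \<phi> (exp \<zeta>))"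
proof -
  have ex: "exp \<zeta> \<in> ball 0 1 - {0}" if "Re \<zeta> < 0" for \<zeta> :: complex using that by simp
  have f: "(\<lambda>\<zeta>. \<phi> (exp \<zeta>)) holomorphic_on {\<zeta>. Re \<zeta> < 0}"
    by (rule holomorphic_compose2[of \<phi> "ball 0 1 - {0}"])
       (use em ex in \<open>auto simp: end_map_def intro!: holomorphic_intros\<close>)
  have "(\<lambda>\<zeta>. \<phi> (exp \<zeta>)) \<in> {\<zeta>. Re \<zeta> < 0} \<rightarrow> punct" using end_mapD(1)[OF em] ex by auto
  then obtain E where "E holomorphic_on {\<zeta>. Re \<zeta> < 0}" "E \<in> {\<zeta>. Re \<zeta> < 0} \<rightarrow> U" "\<And>y. y \<in> {\<zeta>. Re \<zeta> < 0} \<Longrightarrow> cov (E y) = \<phi> (exp y)"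
    using covering_space_lift_holomorphic[OF U_facts(4,1,3) f]
      convex_imp_simply_connected[OF convex_halfspace_Re_lt[of 0]] convex_imp_locally_path_connected[OF convex_halfspace_Re_lt[of 0]]
    by blast
  then show ?thesis by (intro exI[of _ E]) auto
qed

text \<open>Liouville's equation in the coordinate of the end: |\<phi>' x| = |\<phi> - p| turns the
  double pole into |\<phi> - p|^(-4). Points under poles of g are reached by continuity.\<close>

lemma ld_end:
  assumes em: "end_map \<phi> p \<sigma>" and hp: "hopf \<phi> P r" and x0: "x0 \<in> ball 0 r - {0}"
  shows "ld (\<phi> x0) * h (\<phi> x0) * cmod (\<phi> x0 - p) ^ 4 = (cmod (P x0))\<^sup>2"
proof -
  have r: "0 < r" "r \<le> 1" "P holomorphic_on ball 0 r" using hp unfolding hopf_def by blast+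
  have sub: "x \<noteq> 0" "cmod x < 1" if "x \<in> ball 0 r - {0}" for x using that r by auto
  have \<phi>c: "continuous_on (ball 0 r - {0}) \<phi>"
  proof -
    have "\<phi> holomorphic_on ball 0 1 - {0}" using em unfolding end_map_def by blast
    then have "\<phi> holomorphic_on ball 0 r - {0}" by (rule holomorphic_on_subset) (use sub in auto)
    then show ?thesis by (rule holomorphic_on_imp_continuous_on)
  qed
  have \<phi>P: "\<phi> ` (ball 0 r - {0}) \<subseteq> punct" using end_mapD(1)[OF em sub] by blast
  show ?thesis
  proof (rule continuous_eq_of_eventually[of "ball 0 r - {0}", OF _ _ _ x0])
    show "open (ball (0::complex) r - {0})" by (simp add: open_Diff)
    show "continuous_on (ball 0 r - {0}) (\<lambda>x. ld (\<phi> x) * h (\<phi> x) * cmod (\<phi> x - p) ^ 4)"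
      by (intro continuous_intros \<phi>c continuous_on_compose2[OF ld_continuous \<phi>c \<phi>P] continuous_on_compose2[OF h_facts(1) \<phi>c \<phi>P])
    show "continuous_on (ball 0 r - {0}) (\<lambda>x. (cmod (P x))\<^sup>2)"
      by (intro continuous_intros continuous_on_subset[OF holomorphic_on_imp_continuous_on[OF r(3)]]) auto
    obtain w0 where w0: "w0 \<in> U" "cov w0 = \<phi> x0" using \<phi>P x0 U_facts(5) by (metis image_iff image_subset_iff)
    obtain V \<psi> where V: "open V" "\<phi> x0 \<in> V" "\<psi> holomorphic_on V" "\<psi> ` V \<subseteq> U" "\<psi> (\<phi> x0) = w0"
      "\<And>z. z \<in> V \<Longrightarrow> cov (\<psi> z) = z" using cov_local_inverse[OF w0(1)] unfolding w0(2) by metis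
    have \<phi>l: "(\<phi> \<longlongrightarrow> \<phi> x0) (at x0)" using \<phi>c x0 by (simp add: continuous_on_eq_continuous_at open_Diff isContD)
    have evV: "\<forall>\<^sub>F x in at x0. \<phi> x \<in> V" using topological_tendstoD[OF \<phi>l V(1,2)] .
    have evB: "\<forall>\<^sub>F x in at x0. x \<in> (ball 0 r - {0}) - {x0}"
      using x0 by (intro eventually_at_in_open) (auto simp: open_Diff)
    have "isCont \<psi> (\<phi> x0)" using V by (metis continuous_on_eq_continuous_at holomorphic_on_imp_continuous_on)
    then have \<psi>l: "((\<lambda>x. \<psi> (\<phi> x)) \<longlongrightarrow> w0) (at x0)" using isCont_tendsto_compose[OF _ \<phi>l] V(5) by metis
    \<comment> \<open>Injectivity of \<phi> makes the local lift avoid w0 itself, so that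
      isolatedness of the poles of g can be transported to x0.\<close>
    have "\<forall>\<^sub>F x in at x0. \<psi> (\<phi> x) \<noteq> w0"
      using evV evB
    proof eventually_elim
      case (elim x)
      have "inj_on \<phi> (ball 0 1 - {0})" using em unfolding end_map_def by blast
      moreover have "x \<in> ball 0 1 - {0}" "x0 \<in> ball 0 1 - {0}" using elim sub x0 by auto
      ultimately have "\<phi> x \<noteq> \<phi> x0" using elim by (auto simp: inj_on_def)
      then show ?case using V(6)[of "\<phi> x"] elim w0(2) by auto
    qed
    then have "filterlim (\<lambda>x. \<psi> (\<phi> x)) (at w0) (at x0)" using \<psi>l by (simp add: filterlim_at)
    then have "\<forall>\<^sub>F x in at x0. \<not> is_pole g (\<psi> (\<phi> x)) \<and> \<psi> (\<phi> x) \<in> U"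
      using eventually_nonpole[OF w0(1)] by (rule eventually_compose_filterlim[rotated])
    then show "\<forall>\<^sub>F x in at x0. ld (\<phi> x) * h (\<phi> x) * cmod (\<phi> x - p) ^ 4 = (cmod (P x))\<^sup>2"
      using evV evB
    proof eventually_elim
      case (elim x)
      define w where "w = \<psi> (\<phi> x)"
      have w: "w \<in> U" "\<not> is_pole g w" "cov w = \<phi> x" using elim V(6) by (auto simp: w_def)
      have x: "x \<in> ball 0 r - {0}" using elim by auto
      note e = end_mapD[OF em sub[OF x]]
      have nz: "deriv cov w \<noteq> 0" using cov_deriv_nz w by blast
      have "deriv g w * \<alpha> w = P x / x\<^sup>2 * (deriv cov w / deriv \<phi> x)\<^sup>2" using hp x w unfolding hopf_def by blast
      then have "deriv g w * \<alpha> w / (deriv cov w)\<^sup>2 = P x / (deriv \<phi> x * x)\<^sup>2"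
        using nz by (simp add: power_divide power_mult_distrib)
      then have "ld (\<phi> x) * h (\<phi> x) = (cmod (P x) / (cmod (deriv \<phi> x * x))\<^sup>2)\<^sup>2"
        using liouville[OF w(1,2)] w(3) by (simp add: norm_divide norm_power)
      also have "\<dots> = (cmod (P x))\<^sup>2 / cmod (\<phi> x - p) ^ 4" unfolding e(3) by (simp add: power_divide flip: power_mult)
      finally show ?case using e(2) by simp
    qed
  qed
qed

lemma exp_u: "z \<in> punct \<Longrightarrow> exp (u z) = sqrt (h z)"
proof -
  assume "z \<in> punct"
  then have "h z > 0" by (rule h_facts(2))
  then show ?thesis unfolding u_def by (simp add: ln_sqrt[symmetric])
qed

end

locale ricci_finite = ricci_weierstrass +
  assumes ld_nonneg: "z \<in> punct \<Longrightarrow> ld z \<ge> 0" and ld_int: "set_integrable lborel punct ld"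
begin

text \<open>The constant \<open>m\<close> is the minimum of |P|^2 on a closed disc, positive because
  P has no zeros. As h |z-p|^2 = exp(2 (u + ln|z-p|)), the identity of \<open>ld_end\<close> is
  exactly the lower bound on the Laplacian that \<open>log_growth_at_puncture\<close>
  requires.\<close>

lemma end_growth:
  assumes em: "end_map \<phi> p \<sigma>" and hp: "hopf \<phi> P r"
  shows "\<exists>C R. 0 < R \<and> R \<le> 1 \<and> (\<forall>x. x \<noteq> 0 \<longrightarrow> cmod x < R \<longrightarrow> u (\<phi> x) + ln (cmod (\<phi> x - p)) \<le> C * (1 + \<bar>ln (cmod x)\<bar>))"
proof -
  have r: "0 < r" "r \<le> 1" "P holomorphic_on ball 0 r" "\<And>x. x \<in> ball 0 r \<Longrightarrow> P x \<noteq> 0" using hp unfolding hopf_def by blast+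
  define c where "c = ln (r / 2)"
  have c0: "c < 0" using r by (simp add: c_def)
  have cont: "continuous_on (cball 0 (r/2)) (\<lambda>x. (cmod (P x))\<^sup>2)"
    by (intro continuous_intros continuous_on_subset[OF holomorphic_on_imp_continuous_on[OF r(3)]]) (use r in auto)
  obtain x1 where x1: "x1 \<in> cball 0 (r/2)" "\<And>x. x \<in> cball 0 (r/2) \<Longrightarrow> (cmod (P x1))\<^sup>2 \<le> (cmod (P x))\<^sup>2"
    using continuous_attains_inf[OF compact_cball _ cont] r(1) by auto
  define m where "m = (cmod (P x1))\<^sup>2"
  have m: "m > 0" using r(4)[of x1] x1(1) r(1) by (simp add: m_def)
  have \<sigma>: "\<sigma>\<^sup>2 = 1" "p \<notin> punct" using em unfolding end_map_def by blast+
  have reach: "\<exists>x. x \<noteq> 0 \<and> cmod x \<le> r / 2 \<and> \<phi> x = z" if z: "z \<noteq> p" "\<sigma> * logabs p 0 z \<le> c" for z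
  proof -
    have l: "\<sigma> * ln (cmod (z - p)) \<le> c" using z by (simp add: logabs_0)
    then have "\<sigma> * ln (cmod (z - p)) < 0" using c0 by linarith
    then obtain x where x: "x \<in> ball 0 1 - {0}" "\<phi> x = z" using em z(1) unfolding end_map_def by blast
    then have "ln (cmod x) \<le> ln (r / 2)" using end_mapD(6)[OF em, of x] l by (simp add: c_def)
    then have "cmod x \<le> r / 2" using x r(1) by (subst (asm) ln_le_cancel_iff) auto
    then show ?thesis using x by auto
  qed
  obtain k where k: "lapG punct u k ld" using lap_u by blast
  have "\<exists>C. \<forall>z. z \<noteq> p \<longrightarrow> \<sigma> * logabs p 0 z \<le> c - 3 \<longrightarrow> u z + logabs p 0 z \<le> C * (1 + \<bar>logabs p 0 z\<bar>)"
  proof (rule log_growth_at_puncture[OF open_punct \<sigma>(1) _ \<sigma>(2) k ld_nonneg ld_int m])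
    fix z assume z: "z \<noteq> p" "\<sigma> * logabs p 0 z \<le> c"
    obtain x where x: "x \<noteq> 0" "cmod x \<le> r / 2" "\<phi> x = z" using reach[OF z] by blast
    have x': "cmod x < 1" "x \<in> ball 0 r - {0}" "x \<in> cball 0 (r/2)" using x r by auto
    show zP: "z \<in> punct" using end_mapD(1)[OF em x(1) x'(1)] x(3) by simp
    have hz: "h z > 0" using h_facts(2)[OF zP] .
    define d where "d = cmod (z - p)"
    have d: "d > 0" using z by (simp add: d_def)
    have "ld z * h z * d ^ 4 = (cmod (P x))\<^sup>2" using ld_end[OF em hp x'(2)] x(3) by (simp add: d_def)
    moreover have "m \<le> (cmod (P x))\<^sup>2" unfolding m_def by (rule x1(2)[OF x'(3)])
    ultimately have le: "m \<le> (d\<^sup>2 * ld z) * (h z * d\<^sup>2)" by (simp add: power2_eq_square power4_eq_xxxx mult_ac)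
    have "exp (2 * (u z + logabs p 0 z)) = h z * d\<^sup>2"
    proof -
      have "exp (2 * (u z + logabs p 0 z)) = (exp (u z) * exp (logabs p 0 z))\<^sup>2"
        by (simp add: exp_add[symmetric] power2_eq_square)
      also have "exp (u z) = sqrt (h z)" by (rule exp_u[OF zP])
      also have "exp (logabs p 0 z) = d" using z(1) by (simp add: logabs_0 d_def)
      also have "(sqrt (h z) * d)\<^sup>2 = h z * d\<^sup>2" using hz by (simp add: power_mult_distrib)
      finally show ?thesis .
    qed
    then have "exp (- (2 * (u z + logabs p 0 z))) = 1 / (h z * d\<^sup>2)"
      unfolding exp_minus by (simp add: inverse_eq_divide)
    moreover have "- 2 * (u z + logabs p 0 z) = - (2 * (u z + logabs p 0 z))" by simp
    ultimately have "exp (- 2 * (u z + logabs p 0 z)) = 1 / (h z * d\<^sup>2)" by (simp only:)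
    then have "m * exp (- 2 * (u z + logabs p 0 z)) = m / (h z * d\<^sup>2)" by simp
    also have "\<dots> \<le> d\<^sup>2 * ld z" using le hz d by (simp add: divide_le_eq)
    finally show "m * exp (- 2 * (u z + logabs p 0 z)) \<le> (cmod (z - p))\<^sup>2 * ld z" by (simp add: d_def)
  qed
  then obtain C where C: "\<And>z. z \<noteq> p \<Longrightarrow> \<sigma> * logabs p 0 z \<le> c - 3 \<Longrightarrow> u z + logabs p 0 z \<le> C * (1 + \<bar>logabs p 0 z\<bar>)" by blast
  show ?thesis
  proof (rule exI[of _ C], rule exI[of _ "exp (c - 3)"], intro conjI allI impI)
    show "0 < exp (c - 3)" "exp (c - 3) \<le> 1" using c0 by auto
    fix x :: complex assume x: "x \<noteq> 0" "cmod x < exp (c - 3)"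
    have "exp (c - 3) \<le> 1" using c0 by simp
    then have x1: "cmod x < 1" using x by linarith
    note e = end_mapD[OF em x(1) x1]
    have "ln (cmod x) \<le> c - 3" using x by (metis exp_le_cancel_iff exp_ln less_imp_le zero_less_norm_iff)
    then have "\<sigma> * logabs p 0 (\<phi> x) \<le> c - 3" using e(6) unfolding logabs_0[OF e(2)] by simp
    from C[OF e(2) this] have "u (\<phi> x) + ln (cmod (\<phi> x - p)) \<le> C * (1 + \<bar>ln (cmod (\<phi> x - p))\<bar>)"
      unfolding logabs_0[OF e(2)] .
    moreover have "\<bar>ln (cmod (\<phi> x - p))\<bar> = \<bar>ln (cmod x)\<bar>" unfolding e(5) abs_mult e(7) by simp
    ultimately show "u (\<phi> x) + ln (cmod (\<phi> x - p)) \<le> C * (1 + \<bar>ln (cmod x)\<bar>)" by simp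
  qed
qed

end

text \<open>One end seen in the logarithmic coordinate \<zeta> = ln x; \<open>E\<close> lifts it to
  the universal cover.\<close>

locale ricci_end = ricci_finite +
  fixes \<phi> :: "complex \<Rightarrow> complex" and p :: complex and \<sigma> :: real and P :: "complex \<Rightarrow> complex" and r0 :: real
    and E :: "complex \<Rightarrow> complex"
  assumes em: "end_map \<phi> p \<sigma>" and hp: "hopf \<phi> P r0"
    and Eh: "E holomorphic_on {\<zeta>. Re \<zeta> < 0}"
    and EU: "Re \<zeta> < 0 \<Longrightarrow> E \<zeta> \<in> U" and Ecov: "Re \<zeta> < 0 \<Longrightarrow> cov (E \<zeta>) = \<phi> (exp \<zeta>)"
begin

text \<open>The derivative of z = \<phi>(exp \<zeta>) with respect to \<zeta>. It converts the
  coefficient of a form in z into its coefficient in \<zeta>.\<close>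

definition psi where "psi \<zeta> = deriv \<phi> (exp \<zeta>) * exp \<zeta>"

lemma oH: "open {\<zeta>::complex. Re \<zeta> < 0}" by (rule open_halfspace_Re_lt)

lemma exp_in: "Re \<zeta> < 0 \<Longrightarrow> exp \<zeta> \<in> ball 0 1 - {0}" by simp

lemma psi_holomorphic: "psi holomorphic_on {\<zeta>. Re \<zeta> < 0}"
proof -
  have "\<phi> holomorphic_on ball 0 1 - {0}" using em unfolding end_map_def by blast
  then have "deriv \<phi> holomorphic_on ball 0 1 - {0}" by (rule holomorphic_deriv) (simp add: open_Diff)
  then have "(\<lambda>\<zeta>. deriv \<phi> (exp \<zeta>)) holomorphic_on {\<zeta>. Re \<zeta> < 0}"
    by (rule holomorphic_compose2) (use exp_in in \<open>auto intro!: holomorphic_intros\<close>)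
  then show ?thesis unfolding psi_def by (intro holomorphic_intros)
qed

lemma psi_facts: "Re \<zeta> < 0 \<Longrightarrow> psi \<zeta> \<noteq> 0" "Re \<zeta> < 0 \<Longrightarrow> cmod (psi \<zeta>) = cmod (\<phi> (exp \<zeta>) - p)"
  "psi (\<zeta> + 2 * of_real pi * \<i>) = psi \<zeta>"
proof -
  show "cmod (psi \<zeta>) = cmod (\<phi> (exp \<zeta>) - p)" if "Re \<zeta> < 0"
    using end_mapD(3)[OF em, of "exp \<zeta>"] that by (simp add: psi_def)
  show "psi \<zeta> \<noteq> 0" if "Re \<zeta> < 0"
    using end_mapD(4)[OF em, of "exp \<zeta>"] that by (simp add: psi_def)
  show "psi (\<zeta> + 2 * of_real pi * \<i>) = psi \<zeta>"
    by (simp add: psi_def exp_add exp_two_pi_i)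
qed

lemma E_deriv:
  assumes \<zeta>: "Re \<zeta> < 0"
  shows "(E has_field_derivative deriv E \<zeta>) (at \<zeta>)" "deriv cov (E \<zeta>) * deriv E \<zeta> = psi \<zeta>" "deriv E \<zeta> \<noteq> 0"
proof -
  show E': "(E has_field_derivative deriv E \<zeta>) (at \<zeta>)"
    by (rule holomorphic_derivI[OF Eh oH]) (use \<zeta> in simp)
  have c: "(cov has_field_derivative deriv cov (E \<zeta>)) (at (E \<zeta>))"
    by (rule holomorphic_derivI[OF U_facts(3,1) EU[OF \<zeta>]])
  have 1: "((\<lambda>\<zeta>. cov (E \<zeta>)) has_field_derivative deriv cov (E \<zeta>) * deriv E \<zeta>) (at \<zeta>)"
    by (rule DERIV_chain2[OF c E'])
  have x: "exp \<zeta> \<noteq> 0" "cmod (exp \<zeta>) < 1" using \<zeta> by auto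
  have "((\<lambda>\<zeta>. \<phi> (exp \<zeta>)) has_field_derivative deriv \<phi> (exp \<zeta>) * exp \<zeta>) (at \<zeta>)"
    by (rule DERIV_chain2[of \<phi> "deriv \<phi> (exp \<zeta>)" exp \<zeta> "exp \<zeta>" UNIV, OF end_mapD(8)[OF em x] DERIV_exp])
  then have "((\<lambda>\<zeta>. cov (E \<zeta>)) has_field_derivative deriv \<phi> (exp \<zeta>) * exp \<zeta>) (at \<zeta>)"
    by (rule has_field_derivative_transform_within_open[OF _ oH]) (use \<zeta> Ecov in auto)
  then show 2: "deriv cov (E \<zeta>) * deriv E \<zeta> = psi \<zeta>" using DERIV_unique[OF 1] by (simp add: psi_def)
  then show "deriv E \<zeta> \<noteq> 0" using psi_facts(1)[OF \<zeta>] by auto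
qed

lemma eventually_E_nonpole:
  assumes \<zeta>: "Re \<zeta> < 0"
  shows "\<forall>\<^sub>F \<zeta>' in at \<zeta>. \<not> is_pole g (E \<zeta>')"
proof -
  have "((\<lambda>z. (E z - E \<zeta>) / (z - \<zeta>)) \<longlongrightarrow> deriv E \<zeta>) (at \<zeta>)"
    using E_deriv(1)[OF \<zeta>] by (simp add: has_field_derivative_iff)
  then have "\<forall>\<^sub>F z in at \<zeta>. (E z - E \<zeta>) / (z - \<zeta>) \<noteq> 0" by (rule tendsto_imp_eventually_ne) (rule E_deriv(3)[OF \<zeta>])
  then have "\<forall>\<^sub>F z in at \<zeta>. E z \<noteq> E \<zeta>" by eventually_elim auto
  moreover have "(E \<longlongrightarrow> E \<zeta>) (at \<zeta>)" using DERIV_isCont[OF E_deriv(1)[OF \<zeta>]] by (simp add: isContD)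
  ultimately have "filterlim E (at (E \<zeta>)) (at \<zeta>)" by (simp add: filterlim_at)
  moreover have "\<forall>\<^sub>F w in at (E \<zeta>). \<not> is_pole g w"
    using eventually_nonpole[OF EU[OF \<zeta>]] by (rule eventually_mono) simp
  ultimately show ?thesis by (rule eventually_compose_filterlim[rotated])
qed

lemma r0: "0 < r0" "r0 \<le> 1" "P holomorphic_on ball 0 r0" "x \<in> ball 0 r0 \<Longrightarrow> P x \<noteq> 0" "ln r0 \<le> 0"
  using hp unfolding hopf_def by auto

text \<open>In the logarithmic coordinate the double pole disappears: the Hopf differential, the
  derivative of g times the coefficient of eta, is P(exp \<zeta>).\<close>

lemma E_local:
  assumes \<zeta>: "Re \<zeta> < ln r0" and np: "\<not> is_pole g (E \<zeta>)"
  obtains G where "((\<lambda>z. g (E z)) has_field_derivative G) (at \<zeta>)" "A (E \<zeta>) * psi \<zeta> * G = P (exp \<zeta>)"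
    "\<forall>\<^sub>F z in nhds \<zeta>. \<not> is_pole g (E z)"
proof -
  have \<zeta>0: "Re \<zeta> < 0" using \<zeta> r0(5) by linarith
  define w where "w = E \<zeta>"
  have w: "w \<in> U" "\<not> is_pole g w" using EU[OF \<zeta>0] np by (auto simp: w_def)
  have g': "(g has_field_derivative deriv g w) (at w)"
    by (rule analytic_derivI[OF nonpole(1)[OF w]])
  have d: "((\<lambda>z. g (E z)) has_field_derivative deriv g w * deriv E \<zeta>) (at \<zeta>)"
    by (rule DERIV_chain2[of g "deriv g w" E \<zeta> "deriv E \<zeta>" UNIV]) (use g' E_deriv(1)[OF \<zeta>0] in \<open>auto simp: w_def\<close>)
  have ev: "\<forall>\<^sub>F z in nhds \<zeta>. \<not> is_pole g (E z)"
    using eventually_E_nonpole[OF \<zeta>0] np by (simp add: eventually_nhds_conv_at)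
  have x: "exp \<zeta> \<in> ball 0 r0 - {0}" using \<zeta> r0(1) by simp (metis exp_less_cancel_iff exp_ln)
  have h1: "deriv g w * \<alpha> w = P (exp \<zeta>) / (exp \<zeta>)\<^sup>2 * (deriv cov w / deriv \<phi> (exp \<zeta>))\<^sup>2"
    using hp x w Ecov[OF \<zeta>0] unfolding hopf_def w_def by blast
  have nz: "deriv cov w \<noteq> 0" using cov_deriv_nz w by blast
  have x': "exp \<zeta> \<noteq> 0" "cmod (exp \<zeta>) < 1" using \<zeta>0 by auto
  have nz2: "deriv \<phi> (exp \<zeta>) \<noteq> 0" by (rule end_mapD(4)[OF em x'])
  have E': "deriv E \<zeta> = psi \<zeta> / deriv cov w" using E_deriv(2)[OF \<zeta>0] nz by (simp add: w_def field_simps)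
  have "A w * psi \<zeta> * (deriv g w * deriv E \<zeta>) = (deriv g w * \<alpha> w) * (psi \<zeta>)\<^sup>2 / (deriv cov w)\<^sup>2"
    unfolding E' A_def by (simp add: power2_eq_square)
  also have "\<dots> = P (exp \<zeta>)"
    unfolding h1 psi_def using nz nz2 x'(1) by (simp add: power_divide power_mult_distrib)
  finally show ?thesis using that d ev unfolding w_def by blast
qed

context
  fixes r1 r2 :: complex
  assumes unit: "(cmod r1)\<^sup>2 + (cmod r2)\<^sup>2 = 1"
begin

text \<open>\<open>aa\<close> and \<open>cc\<close> are the coefficients in \<zeta> of the forms
  attached to an orthonormal pair of rows.\<close>

definition aa where "aa \<zeta> = Q r1 r2 (E \<zeta>) * psi \<zeta>"
definition cc where "cc \<zeta> = Q (- cnj r2) (cnj r1) (E \<zeta>) * psi \<zeta>"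

lemma QE_holomorphic: "(\<lambda>\<zeta>. Q s1 s2 (E \<zeta>)) holomorphic_on {\<zeta>. Re \<zeta> < 0}"
  by (rule holomorphic_compose2[OF Q_holomorphic Eh]) (use EU in auto)

lemma aa_cc_holomorphic: "aa holomorphic_on {\<zeta>. Re \<zeta> < 0}" "cc holomorphic_on {\<zeta>. Re \<zeta> < 0}"
  unfolding aa_def cc_def by (intro holomorphic_intros QE_holomorphic psi_holomorphic)+

text \<open>With aa = a0 X^2 psi and cc = a0 Y^2 psi, where X and Y are the two linear expressions
  in g, the Wronskian is 2 a0^2 psi^2 X Y (X Y' - Y X'). Orthonormality gives X Y' - Y X' = -G, and
  a0 psi G = P. Squaring removes the square root X Y of the product of the forms.\<close>

lemma wronskian_nonpole:
  assumes \<zeta>: "Re \<zeta> < ln r0" and np: "\<not> is_pole g (E \<zeta>)"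
  shows "(aa \<zeta> * deriv cc \<zeta> - cc \<zeta> * deriv aa \<zeta>)\<^sup>2 = 4 * (P (exp \<zeta>))\<^sup>2 * aa \<zeta> * cc \<zeta>"
proof -
  have \<zeta>0: "Re \<zeta> < 0" using \<zeta> r0(5) by linarith
  obtain G where G: "((\<lambda>z. g (E z)) has_field_derivative G) (at \<zeta>)" "A (E \<zeta>) * psi \<zeta> * G = P (exp \<zeta>)"
    "\<forall>\<^sub>F z in nhds \<zeta>. \<not> is_pole g (E z)" by (rule E_local[OF \<zeta> np])
  have AE: "(\<lambda>z. A (E z)) holomorphic_on {\<zeta>. Re \<zeta> < 0}"
    by (rule holomorphic_compose2[OF A_holomorphic Eh]) (use EU in auto)
  have \<zeta>H: "\<zeta> \<in> {\<zeta>. Re \<zeta> < 0}" using \<zeta>0 by simp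
  define A1 where "A1 = deriv (\<lambda>z. A (E z)) \<zeta>"
  have A1: "((\<lambda>z. A (E z)) has_field_derivative A1) (at \<zeta>)"
    unfolding A1_def by (rule holomorphic_derivI[OF AE oH \<zeta>H])
  define p1 where "p1 = deriv psi \<zeta>"
  have p1: "(psi has_field_derivative p1) (at \<zeta>)"
    unfolding p1_def by (rule holomorphic_derivI[OF psi_holomorphic oH \<zeta>H])
  have evH: "\<forall>\<^sub>F z in nhds \<zeta>. Re z < 0" using eventually_nhds_in_open[OF oH] \<zeta>0 by simp
  have ev: "\<forall>\<^sub>F z in nhds \<zeta>. Q s1 s2 (E z) * psi z = A (E z) * (s1 * g (E z) + s2)\<^sup>2 * psi z" for s1 s2
    using G(3) evH by eventually_elim (simp add: Q_nonpole EU)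
  have der: "deriv (\<lambda>z. Q s1 s2 (E z) * psi z) \<zeta> =
     (A1 * (s1 * g (E \<zeta>) + s2)\<^sup>2 + 2 * A (E \<zeta>) * (s1 * g (E \<zeta>) + s2) * (s1 * G)) * psi \<zeta>
       + A (E \<zeta>) * (s1 * g (E \<zeta>) + s2)\<^sup>2 * p1" for s1 s2
  proof -
    have "((\<lambda>z. (s1 * g (E z) + s2)\<^sup>2) has_field_derivative 2 * (s1 * g (E \<zeta>) + s2) * (s1 * G)) (at \<zeta>)"
      using DERIV_power[OF DERIV_add[OF DERIV_cmult[OF G(1), of s1] DERIV_const[of s2]], of 2] by (simp add: mult_ac)
    from DERIV_mult[OF DERIV_mult[OF A1 this] p1]
    have "((\<lambda>z. A (E z) * (s1 * g (E z) + s2)\<^sup>2 * psi z) has_field_derivative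
     (A1 * (s1 * g (E \<zeta>) + s2)\<^sup>2 + 2 * A (E \<zeta>) * (s1 * g (E \<zeta>) + s2) * (s1 * G)) * psi \<zeta>
       + A (E \<zeta>) * (s1 * g (E \<zeta>) + s2)\<^sup>2 * p1) (at \<zeta>)"
      by (rule DERIV_cong) (simp add: algebra_simps)
    then show ?thesis unfolding deriv_cong_ev[OF ev refl] by (rule DERIV_imp_deriv)
  qed
  have orth: "r1 * cnj r1 + r2 * cnj r2 = 1"
    using arg_cong[OF unit, of complex_of_real] unfolding of_real_add complex_norm_square by simp
  define X where "X = r1 * g (E \<zeta>) + r2"
  define Y where "Y = - cnj r2 * g (E \<zeta>) + cnj r1"
  define a0 where "a0 = A (E \<zeta>)"
  have XY: "X * (- cnj r2) - Y * r1 = - 1" unfolding X_def Y_def using orth by (simp add: algebra_simps)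
  have da: "deriv aa \<zeta> = (A1 * X\<^sup>2 + 2 * a0 * X * (r1 * G)) * psi \<zeta> + a0 * X\<^sup>2 * p1"
    unfolding aa_def[abs_def] der X_def a0_def ..
  have dc: "deriv cc \<zeta> = (A1 * Y\<^sup>2 + 2 * a0 * Y * (- cnj r2 * G)) * psi \<zeta> + a0 * Y\<^sup>2 * p1"
    unfolding cc_def[abs_def] der Y_def a0_def ..
  have qa: "aa \<zeta> = a0 * X\<^sup>2 * psi \<zeta>" and qc: "cc \<zeta> = a0 * Y\<^sup>2 * psi \<zeta>"
    unfolding aa_def cc_def X_def Y_def a0_def using Q_nonpole[OF EU[OF \<zeta>0] np] by auto
  have "aa \<zeta> * deriv cc \<zeta> - cc \<zeta> * deriv aa \<zeta> = 2 * a0 * X * Y * psi \<zeta> * (a0 * psi \<zeta> * G) * (X * (- cnj r2) - Y * r1)"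
    unfolding da dc qa qc by (simp add: power2_eq_square algebra_simps)
  also have "\<dots> = - (2 * a0 * X * Y * psi \<zeta> * P (exp \<zeta>))"
    using G(2) XY unfolding a0_def by simp
  finally show ?thesis unfolding qa qc by (simp add: power2_eq_square)
qed

lemma wronskian:
  assumes \<zeta>: "Re \<zeta> < ln r0"
  shows "(aa \<zeta> * deriv cc \<zeta> - cc \<zeta> * deriv aa \<zeta>)\<^sup>2 = 4 * (P (exp \<zeta>))\<^sup>2 * aa \<zeta> * cc \<zeta>"
proof -
  define V where "V = {\<zeta>::complex. Re \<zeta> < ln r0}"
  have V: "open V" "V \<subseteq> {\<zeta>. Re \<zeta> < 0}" "\<zeta> \<in> V" unfolding V_def using r0(5) \<zeta> by (auto simp: open_halfspace_Re_lt)
  have hol: "aa holomorphic_on V" "cc holomorphic_on V" using aa_cc_holomorphic V(2) holomorphic_on_subset by blast+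
  have c: "continuous_on V aa" "continuous_on V cc" "continuous_on V (deriv aa)" "continuous_on V (deriv cc)"
    using hol holomorphic_deriv[OF hol(1) V(1)] holomorphic_deriv[OF hol(2) V(1)] holomorphic_on_imp_continuous_on by blast+
  have cP: "continuous_on V (\<lambda>\<zeta>. P (exp \<zeta>))"
  proof (rule continuous_on_compose2[OF holomorphic_on_imp_continuous_on[OF r0(3)]])
    show "exp ` V \<subseteq> ball 0 r0" unfolding V_def using r0(1) by auto (metis exp_less_cancel_iff exp_ln)
  qed (intro continuous_intros)
  show ?thesis
  proof (rule continuous_eq_of_eventually[OF V(1) _ _ V(3)])
    show "continuous_on V (\<lambda>\<zeta>. (aa \<zeta> * deriv cc \<zeta> - cc \<zeta> * deriv aa \<zeta>)\<^sup>2)"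
      "continuous_on V (\<lambda>\<zeta>. 4 * (P (exp \<zeta>))\<^sup>2 * aa \<zeta> * cc \<zeta>)"
      by (intro continuous_intros c cP)+
    have "\<forall>\<^sub>F z in at \<zeta>. z \<in> V - {\<zeta>}" by (rule eventually_at_in_open[OF V(1,3)])
    moreover have "\<forall>\<^sub>F z in at \<zeta>. \<not> is_pole g (E z)" using eventually_E_nonpole[of \<zeta>] V by auto
    ultimately show "\<forall>\<^sub>F \<zeta> in at \<zeta>. (aa \<zeta> * deriv cc \<zeta> - cc \<zeta> * deriv aa \<zeta>)\<^sup>2 = 4 * (P (exp \<zeta>))\<^sup>2 * aa \<zeta> * cc \<zeta>"
      by eventually_elim (rule wronskian_nonpole, auto simp: V_def)
  qed
qed

lemma aa_growth:
  "\<exists>C R. \<forall>\<zeta>. Re \<zeta> < - R \<longrightarrow> Re \<zeta> < 0 \<and> cmod (aa \<zeta>) \<le> exp (C * (1 + \<bar>Re \<zeta>\<bar>)) \<and> cmod (cc \<zeta>) \<le> exp (C * (1 + \<bar>Re \<zeta>\<bar>))"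
proof -
  obtain C R where C: "0 < R" "R \<le> 1" "\<And>x. x \<noteq> 0 \<Longrightarrow> cmod x < R \<Longrightarrow> u (\<phi> x) + ln (cmod (\<phi> x - p)) \<le> C * (1 + \<bar>ln (cmod x)\<bar>)"
    using end_growth[OF em hp] by blast
  show ?thesis
  proof (rule exI[of _ "C + 1"], rule exI[of _ "- ln R"], intro allI impI)
    fix \<zeta> assume \<zeta>: "Re \<zeta> < - (- ln R)"
    have lR: "ln R \<le> 0" using C by simp
    then have \<zeta>0: "Re \<zeta> < 0" using \<zeta> by linarith
    have x: "exp \<zeta> \<noteq> 0" "cmod (exp \<zeta>) < R" "cmod (exp \<zeta>) < 1" using \<zeta> \<zeta>0 C(1) by simp_all (metis exp_less_cancel_iff exp_ln)
    note e = end_mapD[OF em x(1,3)]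
    have "cmod (aa \<zeta>) + cmod (cc \<zeta>) = (cmod (Q r1 r2 (E \<zeta>)) + cmod (Q (- cnj r2) (cnj r1) (E \<zeta>))) * cmod (psi \<zeta>)"
      by (simp add: aa_def cc_def norm_mult distrib_right)
    also have "\<dots> = 2 * sqrt (h (\<phi> (exp \<zeta>))) * cmod (\<phi> (exp \<zeta>) - p)"
      unfolding Q_norm_sum[OF unit EU[OF \<zeta>0]] Ecov[OF \<zeta>0] psi_facts(2)[OF \<zeta>0] ..
    also have "sqrt (h (\<phi> (exp \<zeta>))) = exp (u (\<phi> (exp \<zeta>)))" by (rule exp_u[OF e(1), symmetric])
    also have "2 * exp (u (\<phi> (exp \<zeta>))) * cmod (\<phi> (exp \<zeta>) - p) = 2 * exp (u (\<phi> (exp \<zeta>)) + ln (cmod (\<phi> (exp \<zeta>) - p)))"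
      using e(2) by (simp add: exp_add)
    also have "\<dots> \<le> 2 * exp (C * (1 + \<bar>Re \<zeta>\<bar>))" using C(3)[OF x(1,2)] by simp
    \<comment> \<open>The factor 2 is absorbed by raising \<open>C\<close> by 1.\<close>
    also have "(2::real) \<le> exp (1 + \<bar>Re \<zeta>\<bar>)" using exp_ge_add_one_self[of "1 + \<bar>Re \<zeta>\<bar>"] by linarith
    then have "2 * exp (C * (1 + \<bar>Re \<zeta>\<bar>)) \<le> exp (1 + \<bar>Re \<zeta>\<bar>) * exp (C * (1 + \<bar>Re \<zeta>\<bar>))" by (intro mult_right_mono) auto
    also have "\<dots> = exp ((C + 1) * (1 + \<bar>Re \<zeta>\<bar>))" by (simp add: exp_add[symmetric] algebra_simps)
    finally have "cmod (aa \<zeta>) + cmod (cc \<zeta>) \<le> exp ((C + 1) * (1 + \<bar>Re \<zeta>\<bar>))" .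
    then show "Re \<zeta> < 0 \<and> cmod (aa \<zeta>) \<le> exp ((C + 1) * (1 + \<bar>Re \<zeta>\<bar>)) \<and> cmod (cc \<zeta>) \<le> exp ((C + 1) * (1 + \<bar>Re \<zeta>\<bar>))"
      using \<zeta>0 norm_ge_zero[of "aa \<zeta>"] norm_ge_zero[of "cc \<zeta>"] by linarith
  qed
qed

lemma sum_aa_cc:
  assumes x: "x \<noteq> 0" "cmod x < 1"
  shows "cmod (aa (Ln x)) + cmod (cc (Ln x)) = 2 * exp (u (\<phi> x) + ln (cmod (\<phi> x - p)))"
proof -
  have \<zeta>0: "Re (Ln x) < 0" using x by simp
  note e = end_mapD[OF em x]
  have "cmod (aa (Ln x)) + cmod (cc (Ln x)) = (cmod (Q r1 r2 (E (Ln x))) + cmod (Q (- cnj r2) (cnj r1) (E (Ln x)))) * cmod (psi (Ln x))"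
    by (simp add: aa_def cc_def norm_mult distrib_right)
  also have "\<dots> = 2 * sqrt (h (\<phi> x)) * cmod (\<phi> x - p)"
    unfolding Q_norm_sum[OF unit EU[OF \<zeta>0]] Ecov[OF \<zeta>0] psi_facts(2)[OF \<zeta>0] using x by simp
  also have "sqrt (h (\<phi> x)) = exp (u (\<phi> x))" by (rule exp_u[OF e(1), symmetric])
  also have "2 * exp (u (\<phi> x)) * cmod (\<phi> x - p) = 2 * exp (u (\<phi> x) + ln (cmod (\<phi> x - p)))"
    using e(2) by (simp add: exp_add)
  finally show ?thesis .
qed

end

text \<open>If the form vanished, s1 g + s2 would be 0 along the lift. Differentiation gives s1 G =
  0, but G \<noteq> 0 because the Hopf differential has no zeros at the end; so s1 = 0 and then s2 =
  0.\<close>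

lemma Q_not_zero:
  assumes unit: "(cmod s1)\<^sup>2 + (cmod s2)\<^sup>2 = 1"
  shows "\<exists>\<zeta>. Re \<zeta> < 0 \<and> Q s1 s2 (E \<zeta>) \<noteq> 0"
proof (rule ccontr)
  assume "\<not> ?thesis"
  then have z: "Q s1 s2 (E \<zeta>) = 0" if "Re \<zeta> < 0" for \<zeta> using that by blast
  define \<zeta>0 :: complex where "\<zeta>0 = of_real (ln r0 - 1)"
  define V where "V = {\<zeta>::complex. Re \<zeta> < ln r0}"
  have V: "open V" "\<zeta>0 \<in> V" unfolding V_def \<zeta>0_def by (auto simp: open_halfspace_Re_lt)
  have "Re \<zeta>0 < 0" using r0(5) by (simp add: \<zeta>0_def)
  then have "\<forall>\<^sub>F \<zeta> in at \<zeta>0. \<not> is_pole g (E \<zeta>) \<and> \<zeta> \<in> V - {\<zeta>0}"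
    using eventually_E_nonpole[of \<zeta>0] eventually_at_in_open[OF V] by (intro eventually_conj)
  then obtain \<zeta> where \<zeta>: "\<not> is_pole g (E \<zeta>)" "\<zeta> \<in> V" using eventually_happens'[OF at_neq_bot] by blast
  have \<zeta>r: "Re \<zeta> < ln r0" using \<zeta> by (simp add: V_def)
  then have \<zeta>n: "Re \<zeta> < 0" using r0(5) by linarith
  obtain G where G: "((\<lambda>z. g (E z)) has_field_derivative G) (at \<zeta>)" "A (E \<zeta>) * psi \<zeta> * G = P (exp \<zeta>)"
    "\<forall>\<^sub>F z in nhds \<zeta>. \<not> is_pole g (E z)" by (rule E_local[OF \<zeta>r \<zeta>(1)])
  have evH: "\<forall>\<^sub>F z in nhds \<zeta>. Re z < 0" using eventually_nhds_in_open[OF oH] \<zeta>n by simp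
  have "\<forall>\<^sub>F z in nhds \<zeta>. s1 * g (E z) + s2 = 0"
    using G(3) evH
  proof eventually_elim
    case (elim w)
    then show ?case using z[of w] Q_nonpole[OF EU[of w], of s1 s2] nonpole(2)[OF EU[of w]] by auto
  qed
  then have "((\<lambda>z. s1 * g (E z) + s2) has_field_derivative 0) (at \<zeta>)"
    using DERIV_cong_ev[OF refl _ refl, of "\<lambda>z. s1 * g (E z) + s2" "\<lambda>_. 0" \<zeta> 0] by simp
  moreover have "((\<lambda>z. s1 * g (E z) + s2) has_field_derivative s1 * G + 0) (at \<zeta>)"
    by (intro DERIV_add DERIV_cmult G(1) DERIV_const)
  ultimately have sG: "s1 * G = 0" using DERIV_unique by fastforce
  have "exp \<zeta> \<in> ball 0 r0" using \<zeta>r r0(1) by simp (metis exp_less_cancel_iff exp_ln)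
  then have "P (exp \<zeta>) \<noteq> 0" by (rule r0(4))
  then have "G \<noteq> 0" using G(2) by auto
  then have s1: "s1 = 0" using sG by simp
  have "s1 * g (E \<zeta>) + s2 = 0" using z[OF \<zeta>n] Q_nonpole[OF EU[OF \<zeta>n] \<zeta>(1), of s1 s2] nonpole(2)[OF EU[OF \<zeta>n] \<zeta>(1)] by auto
  then show False using s1 unit by simp
qed

text \<open>As ln|x| tends to minus infinity the smaller exponent dominates, and continuous
  functions without zeros are bounded above and away from 0 on the closed disc of half the
  radius.\<close>

lemma exponential_sum_log_bound:
  fixes F1 F2 :: "complex \<Rightarrow> complex" and ea eb :: real
  assumes \<rho>: "0 < \<rho>" "\<rho> \<le> 1" and F: "continuous_on (ball 0 \<rho>) F1" "continuous_on (ball 0 \<rho>) F2"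
    "\<And>x. x \<in> ball 0 \<rho> \<Longrightarrow> F1 x \<noteq> 0 \<and> F2 x \<noteq> 0"
  shows "\<exists>B. \<forall>x. x \<noteq> 0 \<longrightarrow> cmod x < \<rho> / 2 \<longrightarrow>
    \<bar>ln ((exp (ea * ln (cmod x)) * cmod (F1 x) + exp (eb * ln (cmod x)) * cmod (F2 x)) / 2) - min ea eb * ln (cmod x)\<bar> \<le> B"
proof -
  define K where "K = cball (0::complex) (\<rho> / 2)"
  have K: "compact K" "K \<subseteq> ball 0 \<rho>" "K \<noteq> {}" using \<rho> by (auto simp: K_def)
  have bd: "\<exists>m M. 0 < m \<and> (\<forall>x\<in>K. m \<le> cmod (f x) \<and> cmod (f x) \<le> M)"
    if f: "continuous_on (ball 0 \<rho>) f" "\<And>x. x \<in> ball 0 \<rho> \<Longrightarrow> f x \<noteq> 0" for f :: "complex \<Rightarrow> complex"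
  proof -
    have c: "continuous_on K (\<lambda>x. cmod (f x))" by (intro continuous_intros continuous_on_subset[OF f(1)] K)
    obtain x1 where x1: "x1 \<in> K" "\<And>x. x \<in> K \<Longrightarrow> cmod (f x1) \<le> cmod (f x)"
      using continuous_attains_inf[OF K(1,3) c] by blast
    obtain x2 where x2: "x2 \<in> K" "\<And>x. x \<in> K \<Longrightarrow> cmod (f x) \<le> cmod (f x2)"
      using continuous_attains_sup[OF K(1,3) c] by blast
    have "f x1 \<noteq> 0" using f(2) x1(1) K(2) by blast
    then show ?thesis using x1(2) x2(2) by (intro exI[of _ "cmod (f x1)"] exI[of _ "cmod (f x2)"]) auto
  qed
  obtain m1 M1 where m1: "0 < m1" "\<And>x. x \<in> K \<Longrightarrow> m1 \<le> cmod (F1 x) \<and> cmod (F1 x) \<le> M1"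
    using bd[OF F(1)] F(3) by blast
  obtain m2 M2 where m2: "0 < m2" "\<And>x. x \<in> K \<Longrightarrow> m2 \<le> cmod (F2 x) \<and> cmod (F2 x) \<le> M2"
    using bd[OF F(2)] F(3) by blast
  define lo where "lo = min m1 m2 / 2"
  define hi where "hi = (M1 + M2) / 2"
  have lo: "lo > 0" using m1 m2 by (simp add: lo_def)
  show ?thesis
  proof (rule exI[of _ "\<bar>ln lo\<bar> + \<bar>ln hi\<bar>"], intro allI impI)
    fix x :: complex assume x: "x \<noteq> 0" "cmod x < \<rho> / 2"
    define t where "t = ln (cmod x)"
    have "cmod x < 1" using x \<rho> by linarith
    then have t: "t \<le> 0" using x by (simp add: t_def)
    have xK: "x \<in> K" using x by (simp add: K_def)
    define m where "m = min ea eb"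
    define S where "S = (exp ((ea - m) * t) * cmod (F1 x) + exp ((eb - m) * t) * cmod (F2 x)) / 2"
    have e: "exp ((ea - m) * t) \<le> 1" "exp ((eb - m) * t) \<le> 1"
      using t by (auto simp: m_def mult_nonneg_nonpos)
    have "exp ((ea - m) * t) * cmod (F1 x) \<le> 1 * M1" "exp ((eb - m) * t) * cmod (F2 x) \<le> 1 * M2"
      using e m1(2)[OF xK] m2(2)[OF xK] by (intro mult_mono; force)+
    then have S2: "S \<le> hi" unfolding S_def hi_def by simp
    have S1: "lo \<le> S"
    proof (cases "m = ea")
      case True
      have "min m1 m2 \<le> cmod (F1 x)" using m1(2)[OF xK] by auto
      moreover have "0 \<le> exp ((eb - m) * t) * cmod (F2 x)" by simp
      ultimately show ?thesis unfolding S_def lo_def using True by (simp add: add_increasing2)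
    next
      case False
      then have "m = eb" by (auto simp: m_def min_def)
      moreover have "min m1 m2 \<le> cmod (F2 x)" using m2(2)[OF xK] by auto
      moreover have "0 \<le> exp ((ea - m) * t) * cmod (F1 x)" by simp
      ultimately show ?thesis unfolding S_def lo_def by (simp add: add_increasing)
    qed
    have S0: "S > 0" using S1 lo by linarith
    have "(exp (ea * t) * cmod (F1 x) + exp (eb * t) * cmod (F2 x)) / 2 = exp (m * t) * S"
      unfolding S_def by (simp add: distrib_left mult.assoc[symmetric] exp_add[symmetric] left_diff_distrib)
    then have "ln ((exp (ea * t) * cmod (F1 x) + exp (eb * t) * cmod (F2 x)) / 2) = m * t + ln S"
      using S0 by (simp add: ln_mult)
    moreover have "ln lo \<le> ln S" "ln S \<le> ln hi" using lo S0 S1 S2 by simp_all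
    ultimately show "\<bar>ln ((exp (ea * ln (cmod x)) * cmod (F1 x) + exp (eb * ln (cmod x)) * cmod (F2 x)) / 2) - min ea eb * ln (cmod x)\<bar> \<le> \<bar>ln lo\<bar> + \<bar>ln hi\<bar>"
      unfolding t_def[symmetric] m_def[symmetric] by linarith
  qed
qed

text \<open>Both forms receive an exponent as soon as their moduli are single-valued around the end,
  the Wronskian relates the two exponents, and the sum of the moduli, being 2 exp(u + ln|z-p|),
  determines \<open>u\<close> up to a bounded term.\<close>

lemma end_normal_form:
  assumes unit: "(cmod r1)\<^sup>2 + (cmod r2)\<^sup>2 = 1"
    and per: "\<And>\<zeta>. Re \<zeta> < 0 \<Longrightarrow> cmod (Q r1 r2 (E (\<zeta> + 2 * of_real pi * \<i>))) = cmod (Q r1 r2 (E \<zeta>))"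
    "\<And>\<zeta>. Re \<zeta> < 0 \<Longrightarrow> cmod (Q (- cnj r2) (cnj r1) (E (\<zeta> + 2 * of_real pi * \<i>))) = cmod (Q (- cnj r2) (cnj r1) (E \<zeta>))"
  obtains ea eb \<rho> :: real and F1 F2 where "0 < \<rho>" "\<rho> \<le> 1" "F1 holomorphic_on ball 0 \<rho>" "F2 holomorphic_on ball 0 \<rho>"
    "\<And>x. x \<in> ball 0 \<rho> \<Longrightarrow> F1 x \<noteq> 0 \<and> F2 x \<noteq> 0"
    "\<And>\<zeta>. Re \<zeta> < ln \<rho> \<Longrightarrow> Q r1 r2 (E \<zeta>) * psi \<zeta> = exp (of_real ea * \<zeta>) * F1 (exp \<zeta>)"
    "\<And>\<zeta>. Re \<zeta> < ln \<rho> \<Longrightarrow> Q (- cnj r2) (cnj r1) (E \<zeta>) * psi \<zeta> = exp (of_real eb * \<zeta>) * F2 (exp \<zeta>)"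
    "(ea \<noteq> 0 \<and> eb = - ea) \<or> (ea = eb \<and> ea \<le> - 1)"
    "\<exists>B R. 0 < R \<and> R \<le> 1 \<and> (\<forall>x. x \<noteq> 0 \<longrightarrow> cmod x < R \<longrightarrow>
        \<bar>u (\<phi> x) + ln (cmod (\<phi> x - p)) - min ea eb * ln (cmod x)\<bar> \<le> B)"
proof -
  have unit': "(cmod (- cnj r2))\<^sup>2 + (cmod (cnj r1))\<^sup>2 = 1" using unit by simp
  define a where "a = aa r1 r2"
  define c where "c = cc r1 r2"
  note hol = aa_cc_holomorphic[OF unit, folded a_def c_def]
  obtain C R where CR: "\<And>\<zeta>. Re \<zeta> < - R \<Longrightarrow> Re \<zeta> < 0 \<and> cmod (a \<zeta>) \<le> exp (C * (1 + \<bar>Re \<zeta>\<bar>)) \<and> cmod (c \<zeta>) \<le> exp (C * (1 + \<bar>Re \<zeta>\<bar>))"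
    using aa_growth[OF unit] unfolding a_def c_def by blast
  have a_eq: "a \<zeta> = Q r1 r2 (E \<zeta>) * psi \<zeta>" and c_eq: "c \<zeta> = Q (- cnj r2) (cnj r1) (E \<zeta>) * psi \<zeta>" for \<zeta>
    by (simp_all add: a_def c_def aa_def[OF unit] cc_def[OF unit])
  have pa: "cmod (a (\<zeta> + 2 * of_real pi * \<i>)) = cmod (a \<zeta>)" and pc: "cmod (c (\<zeta> + 2 * of_real pi * \<i>)) = cmod (c \<zeta>)"
    if "Re \<zeta> < 0" for \<zeta>
    unfolding a_eq c_eq norm_mult psi_facts(3) per(1)[OF that] per(2)[OF that] by simp_all
  have nza: "\<exists>\<zeta>. Re \<zeta> < 0 \<and> a \<zeta> \<noteq> 0" using Q_not_zero[OF unit] psi_facts(1) unfolding a_eq by auto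
  have nzc: "\<exists>\<zeta>. Re \<zeta> < 0 \<and> c \<zeta> \<noteq> 0" using Q_not_zero[OF unit'] psi_facts(1) unfolding c_eq by auto
  have ga: "cmod (a \<zeta>) \<le> exp (C * (1 + \<bar>Re \<zeta>\<bar>))" if "Re \<zeta> < - R" for \<zeta> using CR[OF that] by blast
  have gc: "cmod (c \<zeta>) \<le> exp (C * (1 + \<bar>Re \<zeta>\<bar>))" if "Re \<zeta> < - R" for \<zeta> using CR[OF that] by blast
  obtain ea \<rho>1 F1 where f1: "0 < \<rho>1" "\<rho>1 \<le> 1" "F1 holomorphic_on ball 0 \<rho>1" "\<And>x. x \<in> ball 0 \<rho>1 \<Longrightarrow> F1 x \<noteq> 0"
    "\<And>\<zeta>. Re \<zeta> < ln \<rho>1 \<Longrightarrow> a \<zeta> = exp (of_real ea * \<zeta>) * F1 (exp \<zeta>)"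
    by (rule periodic_modulus_exponent[OF hol(1) pa nza ga]; (assumption | rule that))
  obtain eb \<rho>2 F2 where f2: "0 < \<rho>2" "\<rho>2 \<le> 1" "F2 holomorphic_on ball 0 \<rho>2" "\<And>x. x \<in> ball 0 \<rho>2 \<Longrightarrow> F2 x \<noteq> 0"
    "\<And>\<zeta>. Re \<zeta> < ln \<rho>2 \<Longrightarrow> c \<zeta> = exp (of_real eb * \<zeta>) * F2 (exp \<zeta>)"
    by (rule periodic_modulus_exponent[OF hol(2) pc nzc gc]; (assumption | rule that))
  define \<rho> where "\<rho> = min r0 (min \<rho>1 \<rho>2)"
  have \<rho>: "0 < \<rho>" "\<rho> \<le> 1" "\<rho> \<le> r0" "\<rho> \<le> \<rho>1" "\<rho> \<le> \<rho>2" using r0 f1 f2 by (auto simp: \<rho>_def)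
  have ln\<rho>: "ln \<rho> \<le> ln r0" "ln \<rho> \<le> ln \<rho>1" "ln \<rho> \<le> ln \<rho>2" using \<rho> r0(1) f1(1) f2(1) by simp_all
  have F1h: "F1 holomorphic_on ball 0 \<rho>" using f1(3) by (rule holomorphic_on_subset) (use \<rho> in auto)
  have F2h: "F2 holomorphic_on ball 0 \<rho>" using f2(3) by (rule holomorphic_on_subset) (use \<rho> in auto)
  have Fnz: "F1 x \<noteq> 0 \<and> F2 x \<noteq> 0" if "x \<in> ball 0 \<rho>" for x using that f1(4) f2(4) \<rho> by auto
  have a': "a \<zeta> = exp (of_real ea * \<zeta>) * F1 (exp \<zeta>)" if "Re \<zeta> < ln \<rho>" for \<zeta>
    by (rule f1(5)) (use that ln\<rho> in linarith)
  have c': "c \<zeta> = exp (of_real eb * \<zeta>) * F2 (exp \<zeta>)" if "Re \<zeta> < ln \<rho>" for \<zeta>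
    by (rule f2(5)) (use that ln\<rho> in linarith)
  have W: "(a \<zeta> * deriv c \<zeta> - c \<zeta> * deriv a \<zeta>)\<^sup>2 = 4 * (P (exp \<zeta>))\<^sup>2 * a \<zeta> * c \<zeta>" if "Re \<zeta> < ln \<rho>" for \<zeta>
    unfolding a_def c_def by (rule wronskian[OF unit]) (use that ln\<rho> in linarith)
  have "isCont P 0" using holomorphic_on_imp_continuous_on[OF r0(3)] r0(1)
    by (simp add: continuous_on_eq_continuous_at)
  then have Pl: "(P \<longlongrightarrow> P 0) (at 0)" by (simp add: isContD)
  have P0: "P 0 \<noteq> 0" using r0(1,4) by simp
  have F0: "F1 0 \<noteq> 0" "F2 0 \<noteq> 0" using Fnz[of 0] \<rho>(1) by auto
  have ex: "(ea \<noteq> 0 \<and> eb = - ea) \<or> (ea = eb \<and> ea \<le> - 1)"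
    by (rule end_exponents[OF \<rho>(1) F1h F2h F0 a' c' W Pl P0])
  obtain B where B: "\<And>x. x \<noteq> 0 \<Longrightarrow> cmod x < \<rho> / 2 \<Longrightarrow>
    \<bar>ln ((exp (ea * ln (cmod x)) * cmod (F1 x) + exp (eb * ln (cmod x)) * cmod (F2 x)) / 2) - min ea eb * ln (cmod x)\<bar> \<le> B"
    using exponential_sum_log_bound[OF \<rho>(1,2) holomorphic_on_imp_continuous_on[OF F1h] holomorphic_on_imp_continuous_on[OF F2h] Fnz] by blast
  have asy: "\<exists>B R. 0 < R \<and> R \<le> 1 \<and> (\<forall>x. x \<noteq> 0 \<longrightarrow> cmod x < R \<longrightarrow>
        \<bar>u (\<phi> x) + ln (cmod (\<phi> x - p)) - min ea eb * ln (cmod x)\<bar> \<le> B)"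
  proof (rule exI[of _ B], rule exI[of _ "\<rho> / 2"], intro conjI allI impI)
    fix x :: complex assume x: "x \<noteq> 0" "cmod x < \<rho> / 2"
    have x1: "cmod x < 1" using x \<rho> by linarith
    have "cmod x < \<rho>" using x \<rho> by linarith
    then have "ln (cmod x) < ln \<rho>" using x(1) \<rho>(1) by simp
    then have lx: "Re (Ln x) < ln \<rho>" using x(1) by simp
    have "cmod (a (Ln x)) = exp (ea * ln (cmod x)) * cmod (F1 x)" "cmod (c (Ln x)) = exp (eb * ln (cmod x)) * cmod (F2 x)"
      unfolding a'[OF lx] c'[OF lx] norm_mult norm_exp_eq_Re using x(1) by simp_all
    then have "exp (ea * ln (cmod x)) * cmod (F1 x) + exp (eb * ln (cmod x)) * cmod (F2 x) = 2 * exp (u (\<phi> x) + ln (cmod (\<phi> x - p)))"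
      using sum_aa_cc[OF unit x(1) x1] unfolding a_def c_def by simp
    then show "\<bar>u (\<phi> x) + ln (cmod (\<phi> x - p)) - min ea eb * ln (cmod x)\<bar> \<le> B" using B[OF x] by simp
  qed (use \<rho> in auto)
  show ?thesis
    by (rule that[OF \<rho>(1,2) F1h F2h Fnz a'[unfolded a_eq] c'[unfolded c_eq] ex asy])
qed

end

section \<open>Descent of logarithmic derivatives\<close>

text \<open>Where k has no zero the quotient f / k has derivative 0; the constant found on a ball
  persists by analytic continuation.\<close>

lemma proportional_of_wronskian_zero:
  assumes U: "open U" "connected U" and f: "f holomorphic_on U" and k: "k holomorphic_on U"
    and nz: "w0 \<in> U" "k w0 \<noteq> 0"
    and W: "\<And>w. w \<in> U \<Longrightarrow> deriv f w * k w = f w * deriv k w"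
  shows "\<exists>K. \<forall>w\<in>U. f w = K * k w"
proof -
  have "continuous_on U k" using k by (rule holomorphic_on_imp_continuous_on)
  then have "open (U \<inter> k -` (- {0}))" by (rule continuous_open_preimage) (auto simp: U open_Compl)
  moreover have "w0 \<in> U \<inter> k -` (- {0})" using nz by simp
  ultimately obtain r where r: "r > 0" "ball w0 r \<subseteq> U \<inter> k -` (- {0})" by (rule openE)
  have bU: "w \<in> U" "k w \<noteq> 0" if "w \<in> ball w0 r" for w using r(2) that by auto
  have "((\<lambda>w. f w / k w) has_field_derivative 0) (at w)" if w: "w \<in> ball w0 r" for w
  proof -
    have "((\<lambda>w. f w / k w) has_field_derivative (deriv f w * k w - f w * deriv k w) / (k w * k w)) (at w)"
      by (rule DERIV_divide[OF holomorphic_derivI[OF f U(1) bU(1)[OF w]] holomorphic_derivI[OF k U(1) bU(1)[OF w]] bU(2)[OF w]])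
    then show ?thesis using W[OF bU(1)[OF w]] by simp
  qed
  then have "(\<lambda>w. f w / k w) constant_on ball w0 r"
    by (intro has_field_derivative_0_imp_constant_on) auto
  then obtain K where K: "\<And>w. w \<in> ball w0 r \<Longrightarrow> f w / k w = K" unfolding constant_on_def by blast
  have K': "f w = K * k w" if "w \<in> ball w0 r" for w using K[OF that] bU(2)[OF that] by (simp add: field_simps)
  have "f w = K * k w" if w: "w \<in> U" for w
    by (rule analytic_continuation_open[of "ball w0 r" U f "\<lambda>w. K * k w"])
       (use U r bU w K' f k in \<open>auto intro!: holomorphic_intros\<close>)
  then show ?thesis by blast
qed

text \<open>If the powers on the two sides differed, cancelling the smaller one would leave a
  positive power on one side and force the nonzero limit of the other side to be 0.\<close>

lemma even_order_of_square:
  fixes G K M :: "complex \<Rightarrow> complex"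
  assumes ev: "\<forall>\<^sub>F z in at z0. (z - z0) ^ n * G z * K z = ((z - z0) ^ j * M z)\<^sup>2"
    and c: "isCont G z0" "isCont K z0" "isCont M z0" and nz: "G z0 \<noteq> 0" "K z0 \<noteq> 0" "M z0 \<noteq> 0"
  shows "n = 2 * j"
proof -
  have l: "(G \<longlongrightarrow> G z0) (at z0)" "(K \<longlongrightarrow> K z0) (at z0)" "(M \<longlongrightarrow> M z0) (at z0)" using c by (auto simp: isContD)
  have ne: "\<forall>\<^sub>F z in at z0. z \<noteq> z0" by (rule eventually_neq_at_within)
  have pl: "((\<lambda>z. (z - z0) ^ d * f z) \<longlongrightarrow> 0) (at z0)" if "d > 0" "(f \<longlongrightarrow> L) (at z0)" for d L and f :: "complex \<Rightarrow> complex"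
  proof -
    have "((\<lambda>z. (z - z0) ^ d * f z) \<longlongrightarrow> (z0 - z0) ^ d * L) (at z0)" by (intro tendsto_intros that(2))
    then show ?thesis using that(1) by (simp add: power_0_left)
  qed
  show ?thesis
  proof (rule ccontr)
    assume "n \<noteq> 2 * j"
    then consider "n < 2 * j" | "2 * j < n" by linarith
    then show False
    proof cases
      case 1
      have "\<forall>\<^sub>F z in at z0. (z - z0) ^ (2 * j - n) * (M z)\<^sup>2 = G z * K z"
        using ev ne
      proof eventually_elim
        case (elim z)
        have "(z - z0) ^ (2 * j) = (z - z0) ^ n * (z - z0) ^ (2 * j - n)" using 1 by (simp add: power_add[symmetric])
        then have "(z - z0) ^ n * (G z * K z) = (z - z0) ^ n * ((z - z0) ^ (2 * j - n) * (M z)\<^sup>2)"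
          using elim(1) by (simp add: power_mult_distrib mult_ac flip: power_mult)
        then show ?case using elim(2) by simp
      qed
      moreover have "((\<lambda>z. (z - z0) ^ (2 * j - n) * (M z)\<^sup>2) \<longlongrightarrow> 0) (at z0)"
        by (rule pl[of _ _ "(M z0)\<^sup>2"]) (use 1 in \<open>auto intro!: tendsto_intros l\<close>)
      ultimately have "((\<lambda>z. G z * K z) \<longlongrightarrow> 0) (at z0)" using tendsto_cong by fast
      moreover have "((\<lambda>z. G z * K z) \<longlongrightarrow> G z0 * K z0) (at z0)" by (intro tendsto_intros l)
      ultimately have "G z0 * K z0 = 0" using tendsto_unique[OF at_neq_bot] by blast
      then show False using nz by simp
    next
      case 2
      have "\<forall>\<^sub>F z in at z0. (z - z0) ^ (n - 2 * j) * (G z * K z) = (M z)\<^sup>2"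
        using ev ne
      proof eventually_elim
        case (elim z)
        have "(z - z0) ^ n = (z - z0) ^ (2 * j) * (z - z0) ^ (n - 2 * j)" using 2 by (simp add: power_add[symmetric])
        then have "(z - z0) ^ (2 * j) * ((z - z0) ^ (n - 2 * j) * (G z * K z)) = (z - z0) ^ (2 * j) * (M z)\<^sup>2"
          using elim(1) by (simp add: power_mult_distrib mult_ac flip: power_mult)
        then show ?case using elim(2) by simp
      qed
      moreover have "((\<lambda>z. (z - z0) ^ (n - 2 * j) * (G z * K z)) \<longlongrightarrow> 0) (at z0)"
        by (rule pl[of _ _ "G z0 * K z0"]) (use 2 in \<open>auto intro!: tendsto_intros l\<close>)
      ultimately have "((\<lambda>z. (M z)\<^sup>2) \<longlongrightarrow> 0) (at z0)" using tendsto_cong by fast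
      moreover have "((\<lambda>z. (M z)\<^sup>2) \<longlongrightarrow> (M z0)\<^sup>2) (at z0)" by (intro tendsto_intros l)
      ultimately have "(M z0)\<^sup>2 = 0" using tendsto_unique[OF at_neq_bot] by blast
      then show False using nz by simp
    qed
  qed
qed

lemma holomorphic_zero_factor:
  assumes f: "f holomorphic_on S" and S: "open S" "connected S" "z0 \<in> S" and nz: "\<exists>w\<in>S. f w \<noteq> 0"
  obtains n r G where "r > 0" "cball z0 r \<subseteq> S" "G holomorphic_on cball z0 r" "\<And>w. w \<in> cball z0 r \<Longrightarrow> f w = (w - z0) ^ n * G w"
    "\<And>w. w \<in> cball z0 r \<Longrightarrow> G w \<noteq> 0" "f z0 = 0 \<Longrightarrow> n > 0"
proof -
  note Z = zorder_exist_zero[OF f S nz]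
  define n where "n = nat (zorder f z0)"
  define G where "G = zor_poly f z0"
  obtain r where r: "r > 0 \<and> cball z0 r \<subseteq> S \<and> G holomorphic_on cball z0 r \<and> (\<forall>w\<in>cball z0 r. f w = G w * (w - z0) ^ n \<and> G w \<noteq> 0)"
    using conjunct2[OF Z] unfolding n_def G_def by blast
  have "f z0 = 0 \<Longrightarrow> n > 0" using conjunct1[OF Z] unfolding n_def by (simp split: if_splits)
  then show ?thesis using r by (intro that[of r G n]) (auto simp: mult.commute)
qed

lemma log_derivative_residue:
  assumes r: "r > 0" and G: "G holomorphic_on cball z0 r" "\<And>w. w \<in> cball z0 r \<Longrightarrow> G w \<noteq> 0"
    and f: "\<And>w. w \<in> cball z0 r \<Longrightarrow> f w = (w - z0) ^ n * G w"
  shows "((\<lambda>z. (z - z0) * (deriv f z / f z)) \<longlongrightarrow> of_nat n) (at z0)"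
proof -
  have Gb: "G holomorphic_on ball z0 r" using G(1) by (rule holomorphic_on_subset) auto
  have Gc: "(G \<longlongrightarrow> G z0) (at z0)" "(deriv G \<longlongrightarrow> deriv G z0) (at z0)"
    using holomorphic_on_imp_continuous_on[OF Gb] holomorphic_on_imp_continuous_on[OF holomorphic_deriv[OF Gb open_ball]] r
    by (auto simp: continuous_on_eq_continuous_at isContD)
  have "\<forall>\<^sub>F z in at z0. z \<in> ball z0 r - {z0}" by (rule eventually_at_in_open) (use r in auto)
  then have ev: "\<forall>\<^sub>F z in at z0. of_nat n + (z - z0) * deriv G z / G z = (z - z0) * (deriv f z / f z)"
  proof eventually_elim
    case (elim z)
    have z: "z \<in> ball z0 r" "z \<noteq> z0" "G z \<noteq> 0" using elim G(2)[of z] by auto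
    have "((\<lambda>z. (z - z0) ^ n * G z) has_field_derivative of_nat n * (z - z0) ^ (n - 1) * G z + deriv G z * (z - z0) ^ n) (at z)"
    proof -
      have "((\<lambda>z. (z - z0) ^ n) has_field_derivative of_nat n * (z - z0) ^ (n - 1)) (at z)"
        by (auto intro!: derivative_eq_intros)
      from DERIV_mult[OF this holomorphic_derivI[OF Gb open_ball z(1)]] show ?thesis .
    qed
    then have "(f has_field_derivative of_nat n * (z - z0) ^ (n - 1) * G z + deriv G z * (z - z0) ^ n) (at z)"
      by (rule has_field_derivative_transform_within_open[OF _ open_ball z(1)]) (use f in auto)
    then have df: "deriv f z = of_nat n * (z - z0) ^ (n - 1) * G z + deriv G z * (z - z0) ^ n" by (rule DERIV_imp_deriv)
    have fz: "f z = (z - z0) ^ n * G z" using f z by simp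
    have "(z - z0) * (of_nat n * (z - z0) ^ (n - 1)) = of_nat n * (z - z0) ^ n"
      by (cases n) (auto simp: algebra_simps)
    then have "(z - z0) * deriv f z = (of_nat n * G z + (z - z0) * deriv G z) * (z - z0) ^ n"
      unfolding df by (simp add: algebra_simps)
    moreover have "(z - z0) * (deriv f z / f z) = (z - z0) * deriv f z / f z" by simp
    ultimately have "(z - z0) * (deriv f z / f z) = (of_nat n * G z + (z - z0) * deriv G z) / G z"
      unfolding fz using z by simp
    then show ?case using z by (simp add: add_divide_distrib)
  qed
  have "((\<lambda>z. of_nat n + (z - z0) * deriv G z / G z) \<longlongrightarrow> of_nat n + (z0 - z0) * deriv G z0 / G z0) (at z0)"
    using G(2)[of z0] r by (intro tendsto_intros Gc) auto
  then show ?thesis using tendsto_cong[OF ev] by simp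
qed

context ricci_weierstrass
begin

text \<open>As |f| depends only on the point below, local branches of f differ by constants of
  modulus 1, so the logarithmic derivative descends to \<open>punct\<close>. Its poles are simple
  with the orders of the zeros of f as residues, and these are finitely many because f has no zeros
  near the ends. The residues at 0 and 1 and the coefficient at infinity are those of the exponents,
  shifted by the factor \<open>psi\<close> that relates the two coordinates: f psi = x^a F makes f
  of order a - 1 in z at a finite puncture and of order -a - 1 at infinity.\<close>

lemma descended_log_derivative:
  fixes f k m :: "complex \<Rightarrow> complex" and a0 a1 a2 \<rho> :: real
  assumes f: "f holomorphic_on U" and k: "k holomorphic_on U" and m: "m holomorphic_on U"
    and sq: "\<And>w. w \<in> U \<Longrightarrow> f w * k w = (m w)\<^sup>2" and nocommon: "\<And>w. w \<in> U \<Longrightarrow> f w = 0 \<Longrightarrow> k w \<noteq> 0"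
    and inv: "\<And>w1 w2. w1 \<in> U \<Longrightarrow> w2 \<in> U \<Longrightarrow> cov w1 = cov w2 \<Longrightarrow> cmod (f w1) = cmod (f w2)"
    and invk: "\<exists>w\<in>U. k w \<noteq> 0"
    and \<rho>: "\<rho> > 0" "\<And>w. w \<in> U \<Longrightarrow> cmod (cov w) < \<rho> \<or> cmod (cov w - 1) < \<rho> \<or> cmod (cov w) > 1 / \<rho> \<Longrightarrow> f w \<noteq> 0"
    and lims: "\<And>B. (\<And>w. w \<in> U \<Longrightarrow> f w \<noteq> 0 \<Longrightarrow> B (cov w) = deriv f w / (f w * deriv cov w)) \<Longrightarrow>
        ((\<lambda>z. z * B z) \<longlongrightarrow> of_real (a0 - 1)) (at 0) \<and> ((\<lambda>z. (z - 1) * B z) \<longlongrightarrow> of_real (a1 - 1)) (at 1) \<and>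
        ((\<lambda>z. z * B z) \<longlongrightarrow> of_real (- a2 - 1)) at_infinity"
  obtains Z n where "finite Z" "Z \<subseteq> punct" "\<And>c. c \<in> Z \<Longrightarrow> even (n c) \<and> n c > 0"
    "real (\<Sum>c\<in>Z. n c) = 1 - (a0 + a1 + a2)"
    "\<And>w. w \<in> U \<Longrightarrow> cov w \<notin> Z \<Longrightarrow> f w \<noteq> 0 \<and> deriv f w / (f w * deriv cov w) =
       (\<Sum>c\<in>Z. of_nat (n c) / (cov w - c)) + of_real (a0 - 1) / cov w + of_real (a1 - 1) / (cov w - 1)"
proof -
  \<comment> \<open>A point near the puncture 0, where f is known not to vanish; it shows that f is
    not identically 0.\<close>
  obtain b0 where b0: "0 < b0" "b0 < min \<rho> 1" using \<rho>(1) by (metis dense min_less_iff_conj zero_less_one)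
  have "complex_of_real b0 \<in> punct" using b0 by (auto simp: punct_def)
  then obtain w0 where w0: "w0 \<in> U" "cov w0 = of_real b0" using U_facts(5) by (metis imageE)
  have fw0: "f w0 \<noteq> 0" using \<rho>(2)[OF w0(1)] b0 w0(2) by simp
  obtain wk where wk: "wk \<in> U" "k wk \<noteq> 0" using invk by blast
  \<comment> \<open>If m were 0, then f k = 0 and its derivative would make the Wronskian of f and k
    vanish. So f would be a multiple of k, which contradicts f \<noteq> 0 and k = 0 at
    \<open>w0\<close>.\<close>
  have mnz: "\<exists>w\<in>U. m w \<noteq> 0"
  proof (rule ccontr)
    assume "\<not> ?thesis"
    then have fk: "f w * k w = 0" if "w \<in> U" for w using sq[OF that] that by simp
    have "deriv f w * k w = f w * deriv k w" if "w \<in> U" for w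
    proof -
      have "((\<lambda>w. f w * k w) has_field_derivative deriv f w * k w + deriv k w * f w) (at w)"
        by (rule DERIV_mult[OF holomorphic_derivI[OF f U_facts(1) that] holomorphic_derivI[OF k U_facts(1) that]])
      moreover have "((\<lambda>w. f w * k w) has_field_derivative 0) (at w)"
        by (rule has_field_derivative_transform_within_open[OF DERIV_const[of 0] U_facts(1) that]) (simp add: fk)
      ultimately have d: "deriv f w * k w + deriv k w * f w = 0" using DERIV_unique by blast
      have "f w = 0 \<or> k w = 0" using fk[OF that] by simp
      then show ?thesis
      proof
        assume "f w = 0" then show ?thesis using d by simp
      next
        assume "k w = 0" then show ?thesis using d by (simp add: mult.commute)
      qed
    qed
    then obtain K where K: "\<And>w. w \<in> U \<Longrightarrow> f w = K * k w"
      using proportional_of_wronskian_zero[OF U_facts(1,6) f k wk] by blast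
    have "k w0 = 0" using fk[OF w0(1)] fw0 by simp
    then show False using K[OF w0(1)] fw0 by simp
  qed
  define Z where "Z = cov ` {w \<in> U. f w = 0}"
  have Zf: "cov w \<in> Z \<longleftrightarrow> f w = 0" if "w \<in> U" for w
  proof
    assume "cov w \<in> Z"
    then obtain w' where "w' \<in> U" "f w' = 0" "cov w' = cov w" unfolding Z_def by auto
    then show "f w = 0" using inv[of w' w] that by simp
  qed (use that in \<open>auto simp: Z_def\<close>)
  \<comment> \<open>An arbitrary point is chosen in each fibre; \<open>Bcov\<close> below shows that
    the logarithmic derivative does not depend on it.\<close>
  define fib where "fib z = (SOME w. w \<in> U \<and> cov w = z)" for z
  have fib: "fib z \<in> U \<and> cov (fib z) = z" if "z \<in> punct" for z
  proof -
    have "z \<in> cov ` U" using that U_facts(5) by simp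
    then show ?thesis unfolding fib_def by (intro someI_ex[of "\<lambda>w. w \<in> U \<and> cov w = z"]) auto
  qed
  define B where "B z = deriv f (fib z) / (f (fib z) * deriv cov (fib z))" for z
  have loc: "\<exists>V \<psi>. open V \<and> connected V \<and> z0 \<in> V \<and> V \<subseteq> punct \<and> \<psi> holomorphic_on V \<and> \<psi> ` V \<subseteq> U \<and> \<psi> z0 = w \<and>
      (\<forall>z\<in>V. cov (\<psi> z) = z \<and> deriv cov (\<psi> z) * deriv \<psi> z = 1 \<and>
        deriv (\<lambda>z. f (\<psi> z)) z / f (\<psi> z) = deriv f (\<psi> z) / (f (\<psi> z) * deriv cov (\<psi> z)))"
    if w: "w \<in> U" "cov w = z0" for w z0
  proof -
    obtain V \<psi> where V: "open V" "z0 \<in> V" "V \<subseteq> punct" "\<psi> holomorphic_on V" "\<psi> ` V \<subseteq> U" "\<psi> z0 = w"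
      "\<And>z. z \<in> V \<Longrightarrow> cov (\<psi> z) = z" "\<And>z. z \<in> V \<Longrightarrow> deriv cov (\<psi> z) * deriv \<psi> z = 1"
      using cov_local_inverse[OF w(1)] unfolding w(2) by metis
    obtain e where e: "e > 0" "ball z0 e \<subseteq> V" using V(1,2) open_contains_ball by blast
    have ld: "deriv (\<lambda>z. f (\<psi> z)) z / f (\<psi> z) = deriv f (\<psi> z) / (f (\<psi> z) * deriv cov (\<psi> z))" if z: "z \<in> V" for z
    proof -
      have zU: "\<psi> z \<in> U" using V(5) z by auto
      have "((\<lambda>z. f (\<psi> z)) has_field_derivative deriv f (\<psi> z) * deriv \<psi> z) (at z)"
        by (rule DERIV_chain2[of f "deriv f (\<psi> z)" \<psi> z "deriv \<psi> z" UNIV, OF holomorphic_derivI[OF f U_facts(1) zU] holomorphic_derivI[OF V(4,1) z]])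
      then have "deriv (\<lambda>z. f (\<psi> z)) z = deriv f (\<psi> z) * deriv \<psi> z" by (rule DERIV_imp_deriv)
      moreover have "deriv \<psi> z = 1 / deriv cov (\<psi> z)" using V(8)[OF z] cov_deriv_nz[OF zU] by (simp add: field_simps)
      ultimately show ?thesis by simp
    qed
    show ?thesis
      by (rule exI[of _ "ball z0 e"], rule exI[of _ \<psi>], intro conjI ballI)
         (use e V ld holomorphic_on_subset[OF V(4) e(2)] in \<open>auto simp: subset_iff image_subset_iff\<close>)
  qed
  have Bcov: "B (cov w) = deriv f w / (f w * deriv cov w)" if w: "w \<in> U" "f w \<noteq> 0" for w
  proof -
    define z0 where "z0 = cov w"
    have z0: "z0 \<in> punct" using cov_in[OF w(1)] by (simp add: z0_def)
    define v where "v = fib z0"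
    have v: "v \<in> U" "cov v = z0" using fib[OF z0] by (auto simp: v_def)
    obtain V1 \<psi>1 where 1: "open V1" "connected V1" "z0 \<in> V1" "\<psi>1 holomorphic_on V1" "\<psi>1 ` V1 \<subseteq> U" "\<psi>1 z0 = w"
      "\<forall>z\<in>V1. cov (\<psi>1 z) = z \<and> deriv cov (\<psi>1 z) * deriv \<psi>1 z = 1 \<and>
        deriv (\<lambda>z. f (\<psi>1 z)) z / f (\<psi>1 z) = deriv f (\<psi>1 z) / (f (\<psi>1 z) * deriv cov (\<psi>1 z))"
      using loc[OF w(1) z0_def[symmetric]] by blast
    obtain V2 \<psi>2 where 2: "open V2" "connected V2" "z0 \<in> V2" "\<psi>2 holomorphic_on V2" "\<psi>2 ` V2 \<subseteq> U" "\<psi>2 z0 = v"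
      "\<forall>z\<in>V2. cov (\<psi>2 z) = z \<and> deriv cov (\<psi>2 z) * deriv \<psi>2 z = 1 \<and>
        deriv (\<lambda>z. f (\<psi>2 z)) z / f (\<psi>2 z) = deriv f (\<psi>2 z) / (f (\<psi>2 z) * deriv cov (\<psi>2 z))"
      using loc[OF v] by blast
    obtain e where e: "e > 0" "ball z0 e \<subseteq> V1 \<inter> V2" using 1(1,3) 2(1,3) open_contains_ball[of "V1 \<inter> V2"] by blast
    have sub: "\<psi>1 z \<in> U" "\<psi>2 z \<in> U" "cov (\<psi>1 z) = z" "cov (\<psi>2 z) = z" if "z \<in> ball z0 e" for z
      using that e(2) 1(5,7) 2(5,7) by (auto simp: image_subset_iff subset_iff)
    have h1: "(\<lambda>z. f (\<psi>1 z)) holomorphic_on ball z0 e"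
      by (rule holomorphic_compose2[OF f holomorphic_on_subset[OF 1(4)]]) (use e(2) sub in auto)
    have h2: "(\<lambda>z. f (\<psi>2 z)) holomorphic_on ball z0 e"
      by (rule holomorphic_compose2[OF f holomorphic_on_subset[OF 2(4)]]) (use e(2) sub in auto)
    \<comment> \<open>The two branches have equal modulus at corresponding points, so they differ by
      a constant, which cancels in the logarithmic derivative.\<close>
    obtain \<kappa> where \<kappa>: "cmod \<kappa> = 1" "\<And>z. z \<in> ball z0 e \<Longrightarrow> f (\<psi>1 z) = \<kappa> * f (\<psi>2 z)"
      using holomorphic_equal_modulus[OF h1 h2 open_ball connected_ball] inv sub by metis
    have z0e: "z0 \<in> ball z0 e" using e(1) by simp
    have "((\<lambda>z. \<kappa> * f (\<psi>2 z)) has_field_derivative \<kappa> * deriv (\<lambda>z. f (\<psi>2 z)) z0) (at z0)"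
      by (rule DERIV_cmult[OF holomorphic_derivI[OF h2 open_ball z0e]])
    then have "((\<lambda>z. f (\<psi>1 z)) has_field_derivative \<kappa> * deriv (\<lambda>z. f (\<psi>2 z)) z0) (at z0)"
      by (rule has_field_derivative_transform_within_open[OF _ open_ball z0e]) (simp add: \<kappa>(2))
    then have d: "deriv (\<lambda>z. f (\<psi>1 z)) z0 = \<kappa> * deriv (\<lambda>z. f (\<psi>2 z)) z0" by (rule DERIV_imp_deriv)
    have k0: "\<kappa> \<noteq> 0" using \<kappa>(1) by auto
    have "deriv (\<lambda>z. f (\<psi>1 z)) z0 / f (\<psi>1 z0) = deriv (\<lambda>z. f (\<psi>2 z)) z0 / f (\<psi>2 z0)"
      unfolding d \<kappa>(2)[OF z0e] using k0 by simp
    then have "deriv f w / (f w * deriv cov w) = deriv f v / (f v * deriv cov v)"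
      using 1(3,6,7) 2(3,6,7) by metis
    then show ?thesis unfolding B_def z0_def[symmetric] v_def[symmetric] by simp
  qed
  have fac: "\<exists>V r n G. open V \<and> r > 0 \<and> cball z0 r \<subseteq> V \<and> V \<subseteq> punct \<and> G holomorphic_on cball z0 r \<and> (\<forall>z\<in>cball z0 r. G z \<noteq> 0) \<and>
      (\<exists>\<psi>. \<psi> holomorphic_on V \<and> \<psi> ` V \<subseteq> U \<and> (\<forall>z\<in>V. cov (\<psi> z) = z) \<and>
        (\<forall>z\<in>cball z0 r. f (\<psi> z) = (z - z0) ^ n * G z) \<and> (z0 \<in> Z \<longrightarrow> n > 0) \<and>
        (\<forall>z\<in>V. f (\<psi> z) \<noteq> 0 \<longrightarrow> B z = deriv (\<lambda>z. f (\<psi> z)) z / f (\<psi> z)))" if z0: "z0 \<in> punct" for z0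
  proof -
    define w where "w = fib z0"
    have w: "w \<in> U" "cov w = z0" using fib[OF z0] by (auto simp: w_def)
    obtain V \<psi> where V: "open V" "connected V" "z0 \<in> V" "V \<subseteq> punct" "\<psi> holomorphic_on V" "\<psi> ` V \<subseteq> U" "\<psi> z0 = w"
      "\<forall>z\<in>V. cov (\<psi> z) = z \<and> deriv cov (\<psi> z) * deriv \<psi> z = 1 \<and>
        deriv (\<lambda>z. f (\<psi> z)) z / f (\<psi> z) = deriv f (\<psi> z) / (f (\<psi> z) * deriv cov (\<psi> z))"
      using loc[OF w] by blast
    have hol: "(\<lambda>z. f (\<psi> z)) holomorphic_on V" by (rule holomorphic_compose2[OF f V(5,6)])
    \<comment> \<open>Otherwise f would vanish on the open image of the local inverse and hence on
      all of \<open>U\<close>.\<close>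
    have nz: "\<exists>z\<in>V. f (\<psi> z) \<noteq> 0"
    proof (rule ccontr)
      assume n: "\<not> ?thesis"
      have "open (\<psi> ` V)"
        by (rule open_mapping_thm3[OF V(5,1)]) (use V(8) in \<open>metis inj_onI\<close>)
      then have "f w0 = 0"
        using analytic_continuation_open[of "\<psi> ` V" U f "\<lambda>_. 0" w0] n V U_facts f w0 by auto
      then show False using fw0 by simp
    qed
    obtain n r G where G: "r > 0" "cball z0 r \<subseteq> V" "G holomorphic_on cball z0 r"
      "\<And>z. z \<in> cball z0 r \<Longrightarrow> f (\<psi> z) = (z - z0) ^ n * G z" "\<And>z. z \<in> cball z0 r \<Longrightarrow> G z \<noteq> 0" "f (\<psi> z0) = 0 \<Longrightarrow> n > 0"
      by (rule holomorphic_zero_factor[OF hol V(1,2,3) nz]) (rule that)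
    have Zn: "z0 \<in> Z \<longrightarrow> n > 0" using Zf[OF w(1)] w(2) V(7) G(6) by simp
    have Bz: "B z = deriv (\<lambda>z. f (\<psi> z)) z / f (\<psi> z)" if z: "z \<in> V" "f (\<psi> z) \<noteq> 0" for z
    proof -
      have v: "\<psi> z \<in> U" "cov (\<psi> z) = z" "deriv (\<lambda>z. f (\<psi> z)) z / f (\<psi> z) = deriv f (\<psi> z) / (f (\<psi> z) * deriv cov (\<psi> z))"
        using V(6) V(8)[rule_format, OF z(1)] z(1) by auto
      show ?thesis unfolding v(3) using Bcov[OF v(1) z(2)] v(2) by simp
    qed
    show ?thesis
      by (rule exI[of _ V], rule exI[of _ r], rule exI[of _ n], rule exI[of _ G], intro conjI ballI V(1,4) G(1,2,3,5),
          assumption, rule exI[of _ \<psi>], intro conjI ballI impI V(5,6) G(4) Bz Zn[rule_format])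
         (use V(8) in auto)
  qed
  have Zd: "\<forall>\<^sub>F z in at z0. z \<notin> Z" and Blim: "\<exists>n. ((\<lambda>z. (z - z0) * B z) \<longlongrightarrow> of_nat n) (at z0) \<and> (z0 \<in> Z \<longrightarrow> n > 0 \<and> even n)"
    and Bhol: "z0 \<notin> Z \<Longrightarrow> B field_differentiable (at z0)"
    if z0: "z0 \<in> punct" for z0
  proof -
    obtain V r n G \<psi> where *: "open V" "r > 0" "cball z0 r \<subseteq> V" "V \<subseteq> punct" "G holomorphic_on cball z0 r" "\<forall>z\<in>cball z0 r. G z \<noteq> 0"
      "\<psi> holomorphic_on V" "\<psi> ` V \<subseteq> U" "\<forall>z\<in>V. cov (\<psi> z) = z"
      "\<forall>z\<in>cball z0 r. f (\<psi> z) = (z - z0) ^ n * G z" "z0 \<in> Z \<longrightarrow> n > 0"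
      "\<forall>z\<in>V. f (\<psi> z) \<noteq> 0 \<longrightarrow> B z = deriv (\<lambda>z. f (\<psi> z)) z / f (\<psi> z)"
      using fac[OF z0] by (elim exE conjE) (rule that)
    note * = *[rule_format]
    have \<psi>U: "\<psi> z \<in> U" if "z \<in> V" for z using *(8) that by auto
    have z0V: "z0 \<in> V" using *(2,3) by auto
    have evb: "\<forall>\<^sub>F z in at z0. z \<in> ball z0 r - {z0}" by (rule eventually_at_in_open) (use *(2) in auto)
    have nzb: "f (\<psi> z) \<noteq> 0 \<and> z \<in> V" if "z \<in> ball z0 r - {z0}" for z
    proof -
      have "z \<in> cball z0 r" "z \<in> V" "z - z0 \<noteq> 0" using that *(3) by auto
      then show ?thesis using *(10)[of z] *(6)[of z] by simp
    qed
    show "\<forall>\<^sub>F z in at z0. z \<notin> Z" using evb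
    proof eventually_elim
      case (elim z)
      then show ?case using nzb[OF elim] Zf[OF \<psi>U[of z]] *(9)[of z] by auto
    qed
    have "((\<lambda>z. (z - z0) * (deriv (\<lambda>z. f (\<psi> z)) z / f (\<psi> z))) \<longlongrightarrow> of_nat n) (at z0)"
      by (rule log_derivative_residue[OF *(2,5,6,10)])
    moreover have "\<forall>\<^sub>F z in at z0. (z - z0) * (deriv (\<lambda>z. f (\<psi> z)) z / f (\<psi> z)) = (z - z0) * B z"
      using evb by eventually_elim (use nzb *(12) in simp)
    ultimately have l: "((\<lambda>z. (z - z0) * B z) \<longlongrightarrow> of_nat n) (at z0)" using tendsto_cong by fast
    \<comment> \<open>At a zero of f the factor k is nonzero, so f k = m^2 forces the order to be
      even.\<close>
    have ev: "even n" if zZ: "z0 \<in> Z"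
    proof -
      have fz: "f (\<psi> z0) = 0" using Zf[OF \<psi>U[OF z0V]] *(9)[OF z0V] zZ by simp
      have kz: "k (\<psi> z0) \<noteq> 0" by (rule nocommon[OF \<psi>U[OF z0V] fz])
      have bV: "ball z0 r \<subseteq> V" using *(3) by auto
      have \<psi>b: "\<psi> holomorphic_on ball z0 r" using *(7) bV by (rule holomorphic_on_subset)
      have mh: "(\<lambda>z. m (\<psi> z)) holomorphic_on ball z0 r" by (rule holomorphic_compose2[OF m \<psi>b]) (use \<psi>U bV in auto)
      have kh: "(\<lambda>z. k (\<psi> z)) holomorphic_on ball z0 r" by (rule holomorphic_compose2[OF k \<psi>b]) (use \<psi>U bV in auto)
      have "inj_on \<psi> (ball z0 r)" using *(9) bV by (metis inj_onI subsetD)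
      then have op: "open (\<psi> ` ball z0 r)" by (rule open_mapping_thm3[OF \<psi>b open_ball])
      have z0b: "z0 \<in> ball z0 r" using *(2) by simp
      have mn: "\<exists>z\<in>ball z0 r. m (\<psi> z) \<noteq> 0"
      proof (rule ccontr)
        assume n: "\<not> ?thesis"
        obtain wm where wm: "wm \<in> U" "m wm \<noteq> 0" using mnz by blast
        have "m wm = 0"
          by (rule analytic_continuation_open[of "\<psi> ` ball z0 r" U m "\<lambda>_. 0" wm])
             (use op n \<psi>U bV U_facts m wm *(2) in auto)
        then show False using wm by simp
      qed
      obtain j r' M where M: "r' > 0" "cball z0 r' \<subseteq> ball z0 r" "M holomorphic_on cball z0 r'"
        "\<And>z. z \<in> cball z0 r' \<Longrightarrow> m (\<psi> z) = (z - z0) ^ j * M z" "\<And>z. z \<in> cball z0 r' \<Longrightarrow> M z \<noteq> 0"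
        "m (\<psi> z0) = 0 \<Longrightarrow> j > 0"
        by (rule holomorphic_zero_factor[OF mh open_ball connected_ball z0b mn]) (rule that)
      have "n = 2 * j"
      proof (rule even_order_of_square[where G = G and K = "\<lambda>z. k (\<psi> z)" and M = M and ?z0.0 = z0 and n = n and j = j])
        have "\<forall>\<^sub>F z in at z0. z \<in> ball z0 r' - {z0}" by (rule eventually_at_in_open) (use M(1) in auto)
        then show "\<forall>\<^sub>F z in at z0. (z - z0) ^ n * G z * k (\<psi> z) = ((z - z0) ^ j * M z)\<^sup>2"
        proof eventually_elim
          case (elim z)
          have z1: "z \<in> cball z0 r'" using elim by auto
          have "z \<in> ball z0 r" using M(2) z1 by blast
          then have z2: "z \<in> cball z0 r" by auto
          have z3: "z \<in> V" using *(3) z2 by blast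
          show ?case using sq[OF \<psi>U[OF z3]] unfolding *(10)[OF z2] M(4)[OF z1] .
        qed
        show "isCont G z0" by (rule continuous_on_interior[OF holomorphic_on_imp_continuous_on[OF *(5)]]) (use *(2) in auto)
        show "isCont M z0" by (rule continuous_on_interior[OF holomorphic_on_imp_continuous_on[OF M(3)]]) (use M(1) in auto)
        show "isCont (\<lambda>z. k (\<psi> z)) z0" by (rule continuous_on_interior[OF holomorphic_on_imp_continuous_on[OF kh]]) (use *(2) in auto)
      qed (use *(2,6) M(1,5) kz in auto)
      then show ?thesis by simp
    qed
    show "\<exists>n. ((\<lambda>z. (z - z0) * B z) \<longlongrightarrow> of_nat n) (at z0) \<and> (z0 \<in> Z \<longrightarrow> n > 0 \<and> even n)"
      using l *(11) ev by blast
    show "B field_differentiable (at z0)" if "z0 \<notin> Z"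
    proof -
      have hol: "(\<lambda>z. f (\<psi> z)) holomorphic_on V" by (rule holomorphic_compose2[OF f *(7,8)])
      have z0n: "f (\<psi> z0) \<noteq> 0" using Zf[OF \<psi>U[OF z0V]] *(9)[OF z0V] that by simp
      have nz: "f (\<psi> z) \<noteq> 0" if "z \<in> ball z0 r" for z using nzb[of z] z0n that by (cases "z = z0") auto
      have bV: "ball z0 r \<subseteq> V" using *(3) by auto
      have "(\<lambda>z. deriv (\<lambda>z. f (\<psi> z)) z / f (\<psi> z)) holomorphic_on ball z0 r"
        using holomorphic_on_subset[OF hol bV] holomorphic_on_subset[OF holomorphic_deriv[OF hol *(1)] bV] nz
        by (intro holomorphic_on_divide) auto
      then have "B holomorphic_on ball z0 r"
        by (rule holomorphic_transform) (use *(12) bV nz in auto)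
      then show ?thesis by (rule holomorphic_on_imp_differentiable_at) (use *(2) in auto)
    qed
  qed
  have ZP: "Z \<subseteq> punct" unfolding Z_def using cov_in by auto
  \<comment> \<open>All zeros lie over a compact subset of \<open>punct\<close>, and an accumulation
    point there would contradict their isolation.\<close>
  have Zfin: "finite Z"
  proof (rule ccontr)
    assume inf: "infinite Z"
    define K where "K = cball 0 (1 / \<rho>) - (ball 0 \<rho> \<union> ball (1::complex) \<rho>)"
    have K: "compact K" unfolding K_def by (intro compact_diff) auto
    have "Z \<subseteq> K"
    proof
      fix z assume "z \<in> Z"
      then obtain w where "w \<in> U" "f w = 0" "cov w = z" unfolding Z_def by auto
      then have "\<not> (cmod z < \<rho> \<or> cmod (z - 1) < \<rho> \<or> cmod z > 1 / \<rho>)" using \<rho>(2)[of w] by auto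
      then show "z \<in> K" unfolding K_def using norm_minus_commute[of 1 z] by (auto simp: dist_norm)
    qed
    then obtain z0 where z0: "z0 \<in> K" "z0 islimpt Z" using K inf unfolding compact_eq_Bolzano_Weierstrass by blast
    have "z0 \<in> punct" using z0(1) \<rho>(1) by (auto simp: K_def punct_def)
    then show False using Zd[of z0] z0(2) by (simp add: islimpt_iff_eventually)
  qed
  define n where "n c = (SOME n. ((\<lambda>z. (z - c) * B z) \<longlongrightarrow> of_nat n) (at c) \<and> (c \<in> Z \<longrightarrow> n > 0 \<and> even n))" for c
  have n: "((\<lambda>z. (z - c) * B z) \<longlongrightarrow> of_nat (n c)) (at c) \<and> (n c > 0 \<and> even (n c))" if "c \<in> Z" for c
    using someI_ex[OF Blim[of c]] that ZP unfolding n_def by blast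
  define N where "N c = (if c = 0 then of_real (a0 - 1) else if c = 1 then of_real (a1 - 1) else (of_nat (n c) :: complex))" for c
  have Z01: "0 \<notin> Z" "1 \<notin> Z" using ZP by (auto simp: punct_def)
  have LB: "((\<lambda>z. z * B z) \<longlongrightarrow> of_real (a0 - 1)) (at 0)" "((\<lambda>z. (z - 1) * B z) \<longlongrightarrow> of_real (a1 - 1)) (at 1)"
        "((\<lambda>z. z * B z) \<longlongrightarrow> of_real (- a2 - 1)) at_infinity" by (intro conjunct1[OF lims[OF Bcov]] conjunct1[OF conjunct2[OF lims[OF Bcov]]] conjunct2[OF conjunct2[OF lims[OF Bcov]]]; assumption)+
  have BH: "B holomorphic_on - (insert 0 (insert 1 Z))"
    unfolding holomorphic_on_def
  proof
    fix z assume "z \<in> - (insert 0 (insert 1 Z))"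
    then have "z \<in> punct" "z \<notin> Z" by (auto simp: punct_def)
    then show "B field_differentiable at z within - (insert 0 (insert 1 Z))"
      by (rule field_differentiable_at_within[OF Bhol])
  qed
  have res: "((\<lambda>z. (z - c) * B z) \<longlongrightarrow> N c) (at c)" if "c \<in> insert 0 (insert 1 Z)" for c
  proof -
    consider "c = 0" | "c = 1" | "c \<in> Z" "c \<noteq> 0" "c \<noteq> 1" using \<open>c \<in> _\<close> by auto
    then show ?thesis
    proof cases
      case 1 then show ?thesis using LB(1) by (simp add: N_def)
    next
      case 2 then show ?thesis using LB(2) by (simp add: N_def)
    next
      case 3 then show ?thesis using conjunct1[OF n[OF 3(1)]] by (simp add: N_def)
    qed
  qed
  have Zfin': "finite (insert 0 (insert 1 Z))" using Zfin by simp
  have S: "B z = (\<Sum>c\<in>insert 0 (insert 1 Z). N c / (z - c))" if "z \<notin> insert 0 (insert 1 Z)" for z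
    by (rule simple_poles_rational(1)[OF Zfin' BH _ LB(3) that]) (rule res)
  have S2: "of_real (- a2 - 1) = (\<Sum>c\<in>insert 0 (insert 1 Z). N c)"
    by (rule simple_poles_rational(2)[OF Zfin' BH _ LB(3)]) (rule res)
  have NZ: "(\<Sum>c\<in>Z. F (N c) c) = (\<Sum>c\<in>Z. F (of_nat (n c)) c)" for F :: "complex \<Rightarrow> complex \<Rightarrow> complex"
    by (rule sum.cong) (use Z01 in \<open>auto simp: N_def\<close>)
  have "complex_of_real (- a2 - 1) = of_real (a0 - 1) + (of_real (a1 - 1) + (\<Sum>c\<in>Z. of_nat (n c)))"
    using S2 Zfin Z01 NZ[of "\<lambda>x c. x"] by (simp add: N_def)
  then have "complex_of_real (- a2 - 1) = of_real ((a0 - 1) + ((a1 - 1) + real (\<Sum>c\<in>Z. n c)))" by simp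
  then have tot: "- a2 - 1 = (a0 - 1) + ((a1 - 1) + real (\<Sum>c\<in>Z. n c))" unfolding of_real_eq_iff .
  show ?thesis
  proof (rule that[OF Zfin ZP])
    show "even (n c) \<and> n c > 0" if "c \<in> Z" for c using n[OF that] by blast
    show "real (\<Sum>c\<in>Z. n c) = 1 - (a0 + a1 + a2)" using tot by linarith
    show "f w \<noteq> 0 \<and> deriv f w / (f w * deriv cov w) =
       (\<Sum>c\<in>Z. of_nat (n c) / (cov w - c)) + of_real (a0 - 1) / cov w + of_real (a1 - 1) / (cov w - 1)"
      if w: "w \<in> U" "cov w \<notin> Z" for w
    proof
      show fw: "f w \<noteq> 0" using Zf[OF w(1)] w(2) by simp
      have "cov w \<notin> insert 0 (insert 1 Z)" using cov_in[OF w(1)] w(2) by (auto simp: punct_def)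
      from S[OF this] have "B (cov w) = of_real (a0 - 1) / cov w + (of_real (a1 - 1) / (cov w - 1) + (\<Sum>c\<in>Z. of_nat (n c) / (cov w - c)))"
        using Zfin Z01 NZ[of "\<lambda>x c. x / (cov w - c)"] by (simp add: N_def)
      then show "deriv f w / (f w * deriv cov w) =
       (\<Sum>c\<in>Z. of_nat (n c) / (cov w - c)) + of_real (a0 - 1) / cov w + of_real (a1 - 1) / (cov w - 1)"
        unfolding Bcov[OF w(1) fw] by (simp add: algebra_simps)
    qed
  qed
qed

end

section \<open>Exponents at the three ends\<close>

lemma end_maps_deriv:
  fixes x :: complex
  assumes "x \<noteq> 0"
  shows "deriv (\<lambda>x. x) x * x = of_real 1 * (x - 0)" "deriv (\<lambda>x. 1 + x) x * x = of_real 1 * ((1 + x) - 1)"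
    "deriv (\<lambda>x. 1 / x) x * x = of_real (- 1) * (1 / x - 0)"
proof -
  show "deriv (\<lambda>x. x) x * x = of_real 1 * (x - 0)" by simp
  have "((\<lambda>x. 1 + x) has_field_derivative 1) (at x)" by (auto intro!: derivative_eq_intros)
  then show "deriv (\<lambda>x. 1 + x) x * x = of_real 1 * ((1 + x) - 1)" by (simp add: DERIV_imp_deriv)
  have "((\<lambda>x. 1 / x) has_field_derivative - 1 / (x * x)) (at x)" using assms by (auto intro!: derivative_eq_intros)
  then show "deriv (\<lambda>x. 1 / x) x * x = of_real (- 1) * (1 / x - 0)" using assms by (simp add: DERIV_imp_deriv power2_eq_square)
qed

context ricci_finite
begin

text \<open>Equivalently, the metric is comparable to |x|^(-2\<nu>-2) |dx|^2 at the end, where x is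
  the end coordinate.\<close>

definition end_exponent :: "(complex \<Rightarrow> complex) \<Rightarrow> complex \<Rightarrow> real \<Rightarrow> bool" where
  "end_exponent \<phi> p \<nu> \<longleftrightarrow> (\<exists>B R. 0 < R \<and> R \<le> 1 \<and>
     (\<forall>x. x \<noteq> 0 \<longrightarrow> cmod x < R \<longrightarrow> \<bar>u (\<phi> x) + ln (cmod (\<phi> x - p)) + \<nu> * ln (cmod x)\<bar> \<le> B))"

text \<open>At a finite puncture \<open>u\<close> grows like -(1 + \<nu>) ln|x|, at infinity like
  (\<nu> - 1) ln|z|, since ln|\<phi>| = -ln|x| there. So the Laplacian integrates to 2 pi times (1 +
  \<nu>0) + (1 + \<nu>1) + (\<nu>2 - 1), which the total curvature fixes as 4 pi.\<close>

lemma exponent_sum: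
  assumes e: "end_exponent (\<lambda>x. x) 0 \<nu>0" "end_exponent (\<lambda>x. 1 + x) 1 \<nu>1" "end_exponent (\<lambda>x. 1 / x) 0 \<nu>2"
    and tot: "(LINT z:punct|lborel. ld z) = 4 * pi"
  shows "\<nu>0 + \<nu>1 + \<nu>2 = 1"
proof -
  obtain B0 R0 where 0: "0 < R0" "\<And>x. x \<noteq> 0 \<Longrightarrow> cmod x < R0 \<Longrightarrow> \<bar>u x + ln (cmod x) + \<nu>0 * ln (cmod x)\<bar> \<le> B0"
    using e(1) unfolding end_exponent_def by auto
  obtain B1 R1 where 1: "0 < R1" "\<And>x. x \<noteq> 0 \<Longrightarrow> cmod x < R1 \<Longrightarrow> \<bar>u (1 + x) + ln (cmod x) + \<nu>1 * ln (cmod x)\<bar> \<le> B1"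
    using e(2) unfolding end_exponent_def by auto
  obtain B2 R2 where 2: "0 < R2" "\<And>x. x \<noteq> 0 \<Longrightarrow> cmod x < R2 \<Longrightarrow> \<bar>u (1 / x) + ln (cmod (1 / x)) + \<nu>2 * ln (cmod x)\<bar> \<le> B2"
    using e(3) unfolding end_exponent_def by auto
  define r where "r = min (min R0 R1) (min R2 (1/2))"
  define B where "B = max B0 (max B1 B2)"
  have r: "r > 0" "r \<le> 1/2" "r \<le> R0" "r \<le> R1" "r \<le> R2" using 0(1) 1(1) 2(1) by (auto simp: r_def)
  have B: "B0 \<le> B" "B1 \<le> B" "B2 \<le> B" by (auto simp: B_def)
  obtain k where k: "lapG punct u k ld" using lap_u by blast
  have "(LINT z:punct|lborel. ld z) = 2 * pi * ((1 + \<nu>0) + (1 + \<nu>1) + (\<nu>2 - 1))"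
  proof (rule integral_laplacian_log_asymptotics[OF k ld_int r(1,2), of _ B])
    fix z :: complex
    show "\<bar>u z + (1 + \<nu>0) * ln (cmod z)\<bar> \<le> B" if "z \<noteq> 0" "cmod z < r"
      using 0(2)[of z] that r B by (simp add: algebra_simps)
    show "\<bar>u z + (1 + \<nu>1) * ln (cmod (z - 1))\<bar> \<le> B" if "z \<noteq> 1" "cmod (z - 1) < r"
      using 1(2)[of "z - 1"] that r B by (simp add: algebra_simps)
    show "\<bar>u z - (\<nu>2 - 1) * ln (cmod z)\<bar> \<le> B" if "cmod z > 1 / r"
    proof -
      have z: "z \<noteq> 0" using that r(1) by auto
      have "cmod (1 / z) < r" using that r(1) z by (simp add: norm_divide field_simps)
      then have "\<bar>u z + ln (cmod z) + \<nu>2 * ln (cmod (1 / z))\<bar> \<le> B2" using 2(2)[of "1 / z"] z r by simp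
      then show ?thesis using B(3) z by (simp add: norm_divide ln_div algebra_simps)
    qed
  qed
  then have "(2 * pi) * ((1 + \<nu>0) + (1 + \<nu>1) + (\<nu>2 - 1)) = (2 * pi) * 2" using tot by simp
  then have "(1 + \<nu>0) + (1 + \<nu>1) + (\<nu>2 - 1) = 2" by (subst (asm) mult_left_cancel) auto
  then show ?thesis by simp
qed

end

context ricci_end
begin

lemma E_shift: "Re \<zeta> < 0 \<Longrightarrow> cov (E (\<zeta> + 2 * of_real pi * \<i>)) = cov (E \<zeta>)"
  using Ecov[of \<zeta>] Ecov[of "\<zeta> + 2 * of_real pi * \<i>"] by (simp add: exp_add exp_two_pi_i)

text \<open>The loop around the end: a deck transformation is matched with the translation by 2 pi i
  at the single point -1, and uniqueness of lifts makes them agree on the whole half-plane.\<close>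

lemma end_deck:
  obtains \<tau> where "\<tau> \<in> carrier (deck_group U cov)" "\<And>\<zeta>. Re \<zeta> < 0 \<Longrightarrow> inv_into U \<tau> (E \<zeta>) = E (\<zeta> + 2 * of_real pi * \<i>)"
proof -
  have m: "Re (- 1) < 0" "Re (- 1 + 2 * of_real pi * \<i>) < 0" by auto
  obtain \<tau> where \<tau>: "\<tau> \<in> carrier (deck_group U cov)" "inv_into U \<tau> (E (- 1)) = E (- 1 + 2 * of_real pi * \<i>)"
    using deck_transitive[OF EU[OF m(1)] EU[OF m(2)] E_shift[OF m(1), symmetric]] by blast
  note d = deck_inverse[OF \<tau>(1)]
  have cE: "continuous_on {\<zeta>. Re \<zeta> < 0} E" using Eh by (rule holomorphic_on_imp_continuous_on)
  have c1: "continuous_on {\<zeta>. Re \<zeta> < 0} (\<lambda>\<zeta>. inv_into U \<tau> (E \<zeta>))"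
    by (rule continuous_on_compose2[OF d(1) cE]) (use EU in auto)
  have c2: "continuous_on {\<zeta>. Re \<zeta> < 0} (\<lambda>\<zeta>. E (\<zeta> + 2 * of_real pi * \<i>))"
    by (rule continuous_on_compose2[OF cE]) (auto intro!: continuous_intros)
  have "inv_into U \<tau> (E \<zeta>) = E (\<zeta> + 2 * of_real pi * \<i>)" if "Re \<zeta> < 0" for \<zeta>
  proof (rule lift_unique[OF c1 _ c2 _ _ _ _ \<tau>(2)])
    show "connected {\<zeta>. Re \<zeta> < 0}" by (rule convex_connected[OF convex_halfspace_Re_lt])
    show "cov (inv_into U \<tau> (E x)) = cov (E (x + 2 * of_real pi * \<i>))" if "x \<in> {\<zeta>. Re \<zeta> < 0}" for x
      using that d(4)[OF EU[of x]] E_shift[of x] by simp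
  qed (use d(3) EU that in auto)
  then show ?thesis using that \<tau>(1) by blast
qed

text \<open>If $l^4 = 1$, the rotation about the end acts on both forms by the same factor, so \<open>2 \<nu>\<close> is an integer unless the exponents are equal.\<close>

lemma end_rotation:
  assumes Mx: "\<And>\<tau>. \<tau> \<in> carrier (deck_group U cov) \<Longrightarrow> su2 (Mx \<tau>)"
    "\<And>\<tau> w. \<tau> \<in> carrier (deck_group U cov) \<Longrightarrow> w \<in> U \<Longrightarrow> \<not> is_pole g w \<Longrightarrow> \<not> is_pole g (inv_into U \<tau> w) \<Longrightarrow>
        moebius_rel (Mx \<tau>) (g w) (g (inv_into U \<tau> w))"
  obtains \<tau> r1 r2 l \<nu> where "\<tau> \<in> carrier (deck_group U cov)" "row_eigen (Mx \<tau>) r1 r2 l" "\<nu> > 0" "end_exponent \<phi> p \<nu>"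
    "l ^ 4 = 1 \<Longrightarrow> \<nu> \<ge> 1 / 2"
proof -
  obtain \<tau> where \<tau>: "\<tau> \<in> carrier (deck_group U cov)" "\<And>\<zeta>. Re \<zeta> < 0 \<Longrightarrow> inv_into U \<tau> (E \<zeta>) = E (\<zeta> + 2 * of_real pi * \<i>)"
    by (rule end_deck) (rule that)
  have M: "su2 (Mx \<tau>)" by (rule Mx(1)[OF \<tau>(1)])
  obtain r1 r2 l where r: "row_eigen (Mx \<tau>) r1 r2 l" using row_eigen_exists[OF M] by blast
  have o: "row_eigen (Mx \<tau>) (- cnj r2) (cnj r1) (cnj l)" by (rule row_eigen_orth[OF M r])
  have unit: "(cmod r1)\<^sup>2 + (cmod r2)\<^sup>2 = 1" and l1: "cmod l = 1" using r by (auto simp: row_eigen_def)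
  have Qd: "cmod (Q s1 s2 (inv_into U \<tau> w)) = cmod (Q s1 s2 w)"
    "row_eigen (Mx \<tau>) t1 t2 l' \<Longrightarrow> k\<^sup>2 * Q t1 t2 (inv_into U \<tau> w) * Q s1 s2 w = l'\<^sup>2 * Q t1 t2 w * Q s1 s2 (inv_into U \<tau> w)"
    if "row_eigen (Mx \<tau>) s1 s2 k" "w \<in> U" for s1 s2 k t1 t2 l' w
    by (rule Q_deck[OF \<tau>(1) M _ that], rule Mx(2)[OF \<tau>(1)], assumption+)+
  have per: "cmod (Q r1 r2 (E (\<zeta> + 2 * of_real pi * \<i>))) = cmod (Q r1 r2 (E \<zeta>))"
    "cmod (Q (- cnj r2) (cnj r1) (E (\<zeta> + 2 * of_real pi * \<i>))) = cmod (Q (- cnj r2) (cnj r1) (E \<zeta>))" if "Re \<zeta> < 0" for \<zeta>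
    using Qd(1)[OF r EU[OF that]] Qd(1)[OF o EU[OF that]] \<tau>(2)[OF that] by simp_all
  obtain ea eb \<rho> F1 F2 where nf: "0 < \<rho>" "\<rho> \<le> 1" "F1 holomorphic_on ball 0 \<rho>" "F2 holomorphic_on ball 0 \<rho>"
    "\<And>x. x \<in> ball 0 \<rho> \<Longrightarrow> F1 x \<noteq> 0 \<and> F2 x \<noteq> 0"
    "\<And>\<zeta>. Re \<zeta> < ln \<rho> \<Longrightarrow> Q r1 r2 (E \<zeta>) * psi \<zeta> = exp (of_real ea * \<zeta>) * F1 (exp \<zeta>)"
    "\<And>\<zeta>. Re \<zeta> < ln \<rho> \<Longrightarrow> Q (- cnj r2) (cnj r1) (E \<zeta>) * psi \<zeta> = exp (of_real eb * \<zeta>) * F2 (exp \<zeta>)"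
    "(ea \<noteq> 0 \<and> eb = - ea) \<or> (ea = eb \<and> ea \<le> - 1)"
    "\<exists>B R. 0 < R \<and> R \<le> 1 \<and> (\<forall>x. x \<noteq> 0 \<longrightarrow> cmod x < R \<longrightarrow>
        \<bar>u (\<phi> x) + ln (cmod (\<phi> x - p)) - min ea eb * ln (cmod x)\<bar> \<le> B)"
    by (rule end_normal_form[OF unit], rule per(1), assumption, rule per(2), assumption, rule that)
  define \<nu> where "\<nu> = - min ea eb"
  have ex: "end_exponent \<phi> p \<nu>" unfolding end_exponent_def \<nu>_def using nf(9) by simp
  have \<nu>: "\<nu> > 0" using nf(8) by (auto simp: \<nu>_def min_def)
  have "\<nu> \<ge> 1 / 2" if l4: "l ^ 4 = 1"
  proof -
    have "l * cnj l = 1" using l1 by (simp add: complex_norm_square[symmetric])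
    then have "l\<^sup>2 * (cnj l)\<^sup>2 = 1" by (simp flip: power_mult_distrib)
    moreover have "l\<^sup>2 * l\<^sup>2 = 1" using l4 by (simp add: power4_eq_xxxx power2_eq_square mult.assoc)
    ultimately have ll: "l\<^sup>2 * (cnj l)\<^sup>2 = l\<^sup>2 * l\<^sup>2" by simp
    have ln: "l\<^sup>2 \<noteq> 0" using l1 by auto
    \<comment> \<open>l has modulus 1 and l^4 = 1, so l^2 equals its conjugate. The two forms, which
      belong to l and its conjugate, are thus multiplied by the same factor.\<close>
    then have l2: "(cnj l)\<^sup>2 = l\<^sup>2" using ll mult_left_cancel[OF ln] by blast
    define \<zeta> where "\<zeta> = complex_of_real (ln \<rho> - 1)"
    define \<zeta>' where "\<zeta>' = \<zeta> + 2 * of_real pi * \<i>"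
    have lr: "ln \<rho> \<le> 0" using nf(1,2) by simp
    have \<zeta>: "Re \<zeta> < ln \<rho>" "Re \<zeta>' < ln \<rho>" "Re \<zeta> < 0" using lr by (auto simp: \<zeta>_def \<zeta>'_def)
    have e: "exp \<zeta>' = exp \<zeta>" "psi \<zeta>' = psi \<zeta>" by (simp_all add: \<zeta>'_def exp_add exp_two_pi_i psi_facts(3))
    have eb: "exp \<zeta> \<in> ball 0 \<rho>" using \<zeta>(1) nf(1) by simp (metis exp_less_cancel_iff exp_ln)
    have n2: "Q r1 r2 (E \<zeta>') * psi \<zeta> = exp (of_real ea * \<zeta>') * F1 (exp \<zeta>)" using nf(6)[OF \<zeta>(2)] unfolding e .
    have n4: "Q (- cnj r2) (cnj r1) (E \<zeta>') * psi \<zeta> = exp (of_real eb * \<zeta>') * F2 (exp \<zeta>)" using nf(7)[OF \<zeta>(2)] unfolding e .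
    have "l\<^sup>2 * (Q (- cnj r2) (cnj r1) (E \<zeta>') * Q r1 r2 (E \<zeta>)) = l\<^sup>2 * (Q (- cnj r2) (cnj r1) (E \<zeta>) * Q r1 r2 (E \<zeta>'))"
      using Qd(2)[OF r EU[OF \<zeta>(3)] o] unfolding \<tau>(2)[OF \<zeta>(3)] \<zeta>'_def l2 by (simp add: mult.assoc)
    then have "Q (- cnj r2) (cnj r1) (E \<zeta>') * Q r1 r2 (E \<zeta>) = Q (- cnj r2) (cnj r1) (E \<zeta>) * Q r1 r2 (E \<zeta>')"
      using mult_left_cancel[OF ln] by blast
    then have "(Q (- cnj r2) (cnj r1) (E \<zeta>') * psi \<zeta>') * (Q r1 r2 (E \<zeta>) * psi \<zeta>) = (Q (- cnj r2) (cnj r1) (E \<zeta>) * psi \<zeta>) * (Q r1 r2 (E \<zeta>') * psi \<zeta>')"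
      unfolding e by simp
    then have "exp (of_real eb * \<zeta>') * exp (of_real ea * \<zeta>) = exp (of_real eb * \<zeta>) * exp (of_real ea * \<zeta>')"
      unfolding e n2 n4 nf(6)[OF \<zeta>(1)] nf(7)[OF \<zeta>(1)] using nf(5)[OF eb] by simp
    then have "exp (of_real eb * \<zeta>' + of_real ea * \<zeta>) = exp (of_real eb * \<zeta> + of_real ea * \<zeta>')"
      by (simp add: exp_add)
    then obtain n :: int where "of_real eb * \<zeta>' + of_real ea * \<zeta> = of_real eb * \<zeta> + of_real ea * \<zeta>' + (of_int (2 * n) * pi) * \<i>"
      unfolding exp_eq by blast
    then have "of_real (2 * pi) * \<i> * of_real (eb - ea) = of_real (2 * pi) * \<i> * complex_of_real (of_int n)"
      by (simp add: \<zeta>'_def algebra_simps)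
    moreover have "complex_of_real (2 * pi) * \<i> \<noteq> 0" by simp
    ultimately have "complex_of_real (eb - ea) = complex_of_real (of_int n)" using mult_left_cancel by blast
    \<comment> \<open>Comparing the forms at \<zeta> and \<zeta> + 2 pi i has given exp(2 pi i (eb -
      ea)) = 1. For eb = -ea \<noteq> 0 this makes 2 |ea| a positive integer, so \<nu> = |ea| is at
      least 1/2.\<close>
    then have n: "eb - ea = of_int n" unfolding of_real_eq_iff .
    show ?thesis using nf(8)
    proof
      assume c: "ea \<noteq> 0 \<and> eb = - ea"
      then have "n \<noteq> 0" using n by auto
      then have "\<bar>real_of_int n\<bar> \<ge> 1" by linarith
      moreover have "\<nu> = \<bar>ea\<bar>" using c by (auto simp: \<nu>_def min_def)
      ultimately show ?thesis using n c by linarith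
    qed (auto simp: \<nu>_def)
  qed
  then show ?thesis using that[OF \<tau>(1) r \<nu> ex] by blast
qed

text \<open>Logarithmic differentiation of the normal form in \<zeta> gives B psi + \<sigma> = a + x
  F' / F. Since psi = \<sigma> (\<phi> - p) and \<sigma>^2 = 1, multiplication by \<sigma> isolates
  (\<phi> - p) B, and x F' / F tends to 0.\<close>

lemma end_log_derivative_limit:
  assumes ed: "\<And>x. x \<noteq> 0 \<Longrightarrow> deriv \<phi> x * x = of_real \<sigma> * (\<phi> x - p)"
    and f: "f holomorphic_on U" and \<rho>: "0 < \<rho>" "\<rho> \<le> 1" and F: "F holomorphic_on ball 0 \<rho>" "\<And>x. x \<in> ball 0 \<rho> \<Longrightarrow> F x \<noteq> 0"
    and fE: "\<And>\<zeta>. Re \<zeta> < ln \<rho> \<Longrightarrow> f (E \<zeta>) * psi \<zeta> = exp (of_real a * \<zeta>) * F (exp \<zeta>)"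
    and B: "\<And>w. w \<in> U \<Longrightarrow> f w \<noteq> 0 \<Longrightarrow> B (cov w) = deriv f w / (f w * deriv cov w)"
  shows "((\<lambda>x. (\<phi> x - p) * B (\<phi> x)) \<longlongrightarrow> of_real (\<sigma> * a - 1)) (at 0)"
proof -
  have \<sigma>2: "\<sigma> * \<sigma> = 1" using em unfolding end_map_def by (simp add: power2_eq_square)
  then have \<sigma>c: "complex_of_real \<sigma> * of_real \<sigma> = 1" by (metis of_real_1 of_real_mult)
  have "\<forall>\<^sub>F x in at 0. x \<in> ball 0 \<rho> - {0}" by (rule eventually_at_in_open) (use \<rho> in auto)
  then have ev: "\<forall>\<^sub>F x in at 0. of_real (\<sigma> * a - 1) + of_real \<sigma> * (x * deriv F x / F x) = (\<phi> x - p) * B (\<phi> x)"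
  proof eventually_elim
    case (elim x)
    define \<zeta> where "\<zeta> = Ln x"
    have x: "x \<noteq> 0" "x \<in> ball 0 \<rho>" "cmod x < 1" and ex: "exp \<zeta> = x" using elim \<rho> by (auto simp: \<zeta>_def)
    have \<zeta>: "Re \<zeta> < ln \<rho>" using x \<rho>(1) by (simp add: \<zeta>_def)
    have \<zeta>0: "Re \<zeta> < 0" using x by (simp add: \<zeta>_def)
    have fnz: "f (E \<zeta>) \<noteq> 0" using fE[OF \<zeta>] F(2)[of x] x ex by auto
    have f': "((\<lambda>\<zeta>. f (E \<zeta>)) has_field_derivative deriv f (E \<zeta>) * deriv E \<zeta>) (at \<zeta>)"
      by (rule DERIV_chain2[of f "deriv f (E \<zeta>)" E \<zeta> "deriv E \<zeta>" UNIV, OF holomorphic_derivI[OF f U_facts(1) EU[OF \<zeta>0]] E_deriv(1)[OF \<zeta>0]])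
    have p': "(psi has_field_derivative of_real \<sigma> * psi \<zeta>) (at \<zeta>)"
    proof -
      have ex1: "exp \<zeta> \<noteq> 0" "cmod (exp \<zeta>) < 1" using x ex by auto
      have "((\<lambda>\<zeta>. \<phi> (exp \<zeta>)) has_field_derivative psi \<zeta>) (at \<zeta>)" unfolding psi_def
        by (rule DERIV_chain2[of \<phi> "deriv \<phi> (exp \<zeta>)" exp \<zeta> "exp \<zeta>" UNIV, OF end_mapD(8)[OF em ex1] DERIV_exp])
      from DERIV_cmult[OF DERIV_diff[OF this DERIV_const[of p]], of "of_real \<sigma>"]
      have "((\<lambda>\<zeta>. of_real \<sigma> * (\<phi> (exp \<zeta>) - p)) has_field_derivative of_real \<sigma> * psi \<zeta>) (at \<zeta>)" by simp
      then show ?thesis using ed by (simp add: psi_def[abs_def])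
    qed
    have F': "((\<lambda>\<zeta>. F (exp \<zeta>)) has_field_derivative deriv F x * x) (at \<zeta>)"
      by (rule DERIV_chain2[of F "deriv F x" exp \<zeta> x UNIV]) (use holomorphic_derivI[OF F(1) open_ball x(2)] DERIV_exp[of \<zeta>] ex in auto)
    have e': "((\<lambda>\<zeta>. exp (of_real a * \<zeta>)) has_field_derivative exp (of_real a * \<zeta>) * of_real a) (at \<zeta>)"
      by (auto intro!: derivative_eq_intros)
    have "((\<lambda>\<zeta>. f (E \<zeta>) * psi \<zeta>) has_field_derivative exp (of_real a * \<zeta>) * of_real a * F (exp \<zeta>) + deriv F x * x * exp (of_real a * \<zeta>)) (at \<zeta>)"
      by (rule has_field_derivative_transform_within_open[OF DERIV_mult[OF e' F'] open_halfspace_Re_lt[of "ln \<rho>"]])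
         (use \<zeta> fE in auto)
    then have eq: "deriv f (E \<zeta>) * deriv E \<zeta> * psi \<zeta> + of_real \<sigma> * psi \<zeta> * f (E \<zeta>) =
       exp (of_real a * \<zeta>) * of_real a * F x + deriv F x * x * exp (of_real a * \<zeta>)"
      using DERIV_unique[OF DERIV_mult[OF f' p']] ex by simp
    define T where "T = x * deriv F x / F x"
    define e where "e = exp (of_real a * \<zeta>)"
    have nz: "psi \<zeta> \<noteq> 0" "F x \<noteq> 0" "e \<noteq> 0" "deriv cov (E \<zeta>) \<noteq> 0"
      using psi_facts(1)[OF \<zeta>0] F(2)[OF x(2)] cov_deriv_nz[OF EU[OF \<zeta>0]] by (auto simp: e_def)
    have fe: "f (E \<zeta>) * psi \<zeta> = e * F x" using fE[OF \<zeta>] ex by (simp add: e_def)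
    have E': "deriv E \<zeta> = psi \<zeta> / deriv cov (E \<zeta>)" using E_deriv(2)[OF \<zeta>0] nz by (simp add: field_simps)
    have Bx: "B (\<phi> x) = deriv f (E \<zeta>) / (f (E \<zeta>) * deriv cov (E \<zeta>))"
      using B[OF EU[OF \<zeta>0] fnz] Ecov[OF \<zeta>0] ex by simp
    have "deriv f (E \<zeta>) * deriv E \<zeta> = B (\<phi> x) * psi \<zeta> * f (E \<zeta>)"
      unfolding Bx E' using fnz by simp
    then have "(B (\<phi> x) * psi \<zeta> + of_real \<sigma>) * (f (E \<zeta>) * psi \<zeta>) = (of_real a + x * deriv F x / F x) * (e * F x)"
      using eq nz(2) unfolding e_def by (simp add: algebra_simps)
    then have "B (\<phi> x) * psi \<zeta> + of_real \<sigma> = of_real a + x * deriv F x / F x"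
      unfolding fe using nz by simp
    then have "B (\<phi> x) * psi \<zeta> = of_real a + T - of_real \<sigma>" by (simp add: eq_diff_eq T_def)
    then have "of_real \<sigma> * (B (\<phi> x) * psi \<zeta>) = of_real \<sigma> * (of_real a + T - of_real \<sigma>)" by simp
    moreover have "psi \<zeta> = of_real \<sigma> * (\<phi> x - p)" using ed[OF x(1)] ex by (simp add: psi_def)
    ultimately have "(of_real \<sigma> * of_real \<sigma>) * ((\<phi> x - p) * B (\<phi> x)) = of_real \<sigma> * of_real a + of_real \<sigma> * T - of_real \<sigma> * of_real \<sigma>"
      by (simp add: algebra_simps)
    then show ?case unfolding \<sigma>c by (simp add: T_def)
  qed
  have "isCont F 0" "isCont (deriv F) 0"
    using holomorphic_on_imp_continuous_on[OF F(1)] holomorphic_on_imp_continuous_on[OF holomorphic_deriv[OF F(1) open_ball]] \<rho>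
    by (auto simp: continuous_on_eq_continuous_at)
  then have Fl: "(F \<longlongrightarrow> F 0) (at 0)" "(deriv F \<longlongrightarrow> deriv F 0) (at 0)" by (auto simp: isContD)
  have "((\<lambda>x. of_real (\<sigma> * a - 1) + of_real \<sigma> * (x * deriv F x / F x)) \<longlongrightarrow> of_real (\<sigma> * a - 1) + of_real \<sigma> * (0 * deriv F 0 / F 0)) (at 0)"
    using F(2)[of 0] \<rho> by (intro tendsto_intros Fl) auto
  then show ?thesis using tendsto_cong[OF ev] by simp
qed

text \<open>Collects what an end contributes when both forms have single-valued moduli, in terms of
  the surface alone: neither the lift \<open>E\<close> nor the logarithmic coordinate
  appears.\<close>

lemma end_data:
  assumes ed: "\<And>x. x \<noteq> 0 \<Longrightarrow> deriv \<phi> x * x = of_real \<sigma> * (\<phi> x - p)"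
    and unit: "(cmod r1)\<^sup>2 + (cmod r2)\<^sup>2 = 1"
    and inv: "\<And>w1 w2. w1 \<in> U \<Longrightarrow> w2 \<in> U \<Longrightarrow> cov w1 = cov w2 \<Longrightarrow> cmod (Q r1 r2 w1) = cmod (Q r1 r2 w2)"
      "\<And>w1 w2. w1 \<in> U \<Longrightarrow> w2 \<in> U \<Longrightarrow> cov w1 = cov w2 \<Longrightarrow> cmod (Q (- cnj r2) (cnj r1) w1) = cmod (Q (- cnj r2) (cnj r1) w2)"
  obtains a b \<rho> :: real where "0 < \<rho>" "\<rho> \<le> 1" "(a \<noteq> 0 \<and> b = - a) \<or> (a = b \<and> a \<le> - 1)" "end_exponent \<phi> p (- min a b)"
    "\<And>w x. w \<in> U \<Longrightarrow> x \<noteq> 0 \<Longrightarrow> cmod x < \<rho> \<Longrightarrow> cov w = \<phi> x \<Longrightarrow> Q r1 r2 w \<noteq> 0 \<and> Q (- cnj r2) (cnj r1) w \<noteq> 0"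
    "\<And>B. (\<And>w. w \<in> U \<Longrightarrow> Q r1 r2 w \<noteq> 0 \<Longrightarrow> B (cov w) = deriv (Q r1 r2) w / (Q r1 r2 w * deriv cov w)) \<Longrightarrow>
       ((\<lambda>x. (\<phi> x - p) * B (\<phi> x)) \<longlongrightarrow> of_real (\<sigma> * a - 1)) (at 0)"
    "\<And>B. (\<And>w. w \<in> U \<Longrightarrow> Q (- cnj r2) (cnj r1) w \<noteq> 0 \<Longrightarrow>
         B (cov w) = deriv (Q (- cnj r2) (cnj r1)) w / (Q (- cnj r2) (cnj r1) w * deriv cov w)) \<Longrightarrow>
       ((\<lambda>x. (\<phi> x - p) * B (\<phi> x)) \<longlongrightarrow> of_real (\<sigma> * b - 1)) (at 0)"
proof -
  have EUs: "E (\<zeta> + 2 * of_real pi * \<i>) \<in> U" if "Re \<zeta> < 0" for \<zeta> using EU[of "\<zeta> + 2 * of_real pi * \<i>"] that by simp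
  have per: "cmod (Q r1 r2 (E (\<zeta> + 2 * of_real pi * \<i>))) = cmod (Q r1 r2 (E \<zeta>))"
    "cmod (Q (- cnj r2) (cnj r1) (E (\<zeta> + 2 * of_real pi * \<i>))) = cmod (Q (- cnj r2) (cnj r1) (E \<zeta>))" if "Re \<zeta> < 0" for \<zeta>
    using inv[OF EUs[OF that] EU[OF that] E_shift[OF that]] by simp_all
  obtain ea eb \<rho> F1 F2 where nf: "0 < \<rho>" "\<rho> \<le> 1" "F1 holomorphic_on ball 0 \<rho>" "F2 holomorphic_on ball 0 \<rho>"
    "\<And>x. x \<in> ball 0 \<rho> \<Longrightarrow> F1 x \<noteq> 0 \<and> F2 x \<noteq> 0"
    "\<And>\<zeta>. Re \<zeta> < ln \<rho> \<Longrightarrow> Q r1 r2 (E \<zeta>) * psi \<zeta> = exp (of_real ea * \<zeta>) * F1 (exp \<zeta>)"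
    "\<And>\<zeta>. Re \<zeta> < ln \<rho> \<Longrightarrow> Q (- cnj r2) (cnj r1) (E \<zeta>) * psi \<zeta> = exp (of_real eb * \<zeta>) * F2 (exp \<zeta>)"
    "(ea \<noteq> 0 \<and> eb = - ea) \<or> (ea = eb \<and> ea \<le> - 1)"
    "\<exists>B R. 0 < R \<and> R \<le> 1 \<and> (\<forall>x. x \<noteq> 0 \<longrightarrow> cmod x < R \<longrightarrow>
        \<bar>u (\<phi> x) + ln (cmod (\<phi> x - p)) - min ea eb * ln (cmod x)\<bar> \<le> B)"
    by (rule end_normal_form[OF unit], rule per(1), assumption, rule per(2), assumption, rule that)
  show ?thesis
  proof (rule that[OF nf(1,2,8)])
    show "end_exponent \<phi> p (- min ea eb)" unfolding end_exponent_def using nf(9) by simp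
    fix w x assume w: "w \<in> U" and x: "x \<noteq> 0" "cmod x < \<rho>" and wx: "cov w = \<phi> x"
    define \<zeta> where "\<zeta> = Ln x"
    have \<zeta>: "Re \<zeta> < ln \<rho>" "Re \<zeta> < 0" "exp \<zeta> = x" using x nf(1,2) by (auto simp: \<zeta>_def)
    have nz: "Q r1 r2 (E \<zeta>) \<noteq> 0" "Q (- cnj r2) (cnj r1) (E \<zeta>) \<noteq> 0"
      using nf(6)[OF \<zeta>(1)] nf(7)[OF \<zeta>(1)] nf(5)[of x] x \<zeta>(3) by auto
    have c: "cov w = cov (E \<zeta>)" using wx Ecov[OF \<zeta>(2)] \<zeta>(3) by simp
    show "Q r1 r2 w \<noteq> 0 \<and> Q (- cnj r2) (cnj r1) w \<noteq> 0"
      using inv(1)[OF w EU[OF \<zeta>(2)] c] inv(2)[OF w EU[OF \<zeta>(2)] c] nz by auto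
  next
    fix B assume B: "\<And>w. w \<in> U \<Longrightarrow> Q r1 r2 w \<noteq> 0 \<Longrightarrow> B (cov w) = deriv (Q r1 r2) w / (Q r1 r2 w * deriv cov w)"
    show "((\<lambda>x. (\<phi> x - p) * B (\<phi> x)) \<longlongrightarrow> of_real (\<sigma> * ea - 1)) (at 0)"
      by (rule end_log_derivative_limit[OF ed Q_holomorphic nf(1,2,3) conjunct1[OF nf(5)] nf(6) B])
  next
    fix B assume B: "\<And>w. w \<in> U \<Longrightarrow> Q (- cnj r2) (cnj r1) w \<noteq> 0 \<Longrightarrow>
         B (cov w) = deriv (Q (- cnj r2) (cnj r1)) w / (Q (- cnj r2) (cnj r1) w * deriv cov w)"
    show "((\<lambda>x. (\<phi> x - p) * B (\<phi> x)) \<longlongrightarrow> of_real (\<sigma> * eb - 1)) (at 0)"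
      by (rule end_log_derivative_limit[OF ed Q_holomorphic nf(1,2,4) conjunct2[OF nf(5)] nf(7) B])
  qed
qed

end

section \<open>Integration of a logarithmic derivative\<close>

context ricci_weierstrass
begin

text \<open>On the simply connected \<open>U\<close> both cov and cov - 1 have logarithms, so the
  explicit function (cov - b)^n exp(s0 L0 + s1 L1) exists and has the same logarithmic derivative as
  f. They are proportional, and because s0 and s1 are real the modulus is given by real powers of
  |cov| and |cov - 1|.\<close>

lemma modulus_from_log_derivative:
  fixes s0 s1 :: real
  assumes f: "f holomorphic_on U"
    and fd: "\<And>w. w \<in> U \<Longrightarrow> cov w \<noteq> b \<Longrightarrow> f w \<noteq> 0 \<and> deriv f w / (f w * deriv cov w) =
      of_nat n / (cov w - b) + of_real s0 / cov w + of_real s1 / (cov w - 1)"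
  obtains K where "K > 0" "\<And>w. w \<in> U \<Longrightarrow> cmod (f w) = K * cmod (cov w - b) ^ n * cmod (cov w) powr s0 * cmod (cov w - 1) powr s1"
proof -
  have cn: "cov w \<noteq> 0" "cov w \<noteq> 1" if "w \<in> U" for w using cov_in[OF that] by (auto simp: punct_def)
  have log: "\<exists>g. g holomorphic_on U \<and> (\<forall>z\<in>U. k z = exp (g z))" if "k holomorphic_on U" "\<forall>z\<in>U. k z \<noteq> 0" for k :: "complex \<Rightarrow> complex"
    using simply_connected_eq_holomorphic_log[OF U_facts(1)] U_facts(2) that by blast
  obtain L0 where L0: "L0 holomorphic_on U" "\<forall>z\<in>U. cov z = exp (L0 z)"
    using log[OF U_facts(3)] cn(1) by blast
  have c1: "(\<lambda>w. cov w - 1) holomorphic_on U" by (intro holomorphic_intros U_facts(3))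
  obtain L1 where L1: "L1 holomorphic_on U" "\<forall>z\<in>U. cov z - 1 = exp (L1 z)"
    using log[OF c1] cn(2) by auto
  have dexp: "deriv L w = deriv cov w / (cov w - c)" if L: "L holomorphic_on U" "\<forall>z\<in>U. cov z - c = exp (L z)" and w: "w \<in> U" for L c w
  proof -
    have "((\<lambda>z. exp (L z)) has_field_derivative exp (L w) * deriv L w) (at w)"
      by (rule DERIV_chain2[of exp "exp (L w)" L w "deriv L w" UNIV, OF DERIV_exp holomorphic_derivI[OF L(1) U_facts(1) w]])
    then have "((\<lambda>z. cov z - c) has_field_derivative exp (L w) * deriv L w) (at w)"
      by (rule has_field_derivative_transform_within_open[OF _ U_facts(1) w]) (use L(2) in simp)
    moreover have "((\<lambda>z. cov z - c) has_field_derivative deriv cov w - 0) (at w)"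
      by (rule DERIV_diff[OF holomorphic_derivI[OF U_facts(3,1) w] DERIV_const])
    ultimately have "exp (L w) * deriv L w = deriv cov w - 0" by (rule DERIV_unique)
    then show ?thesis using L(2) w by simp (metis exp_not_eq_zero nonzero_mult_div_cancel_left)
  qed
  define S where "S w = of_real s0 * L0 w + of_real s1 * L1 w" for w
  have Sh: "S holomorphic_on U" unfolding S_def by (intro holomorphic_intros L0(1) L1(1))
  define k where "k w = (cov w - b) ^ n * exp (S w)" for w
  have kh: "k holomorphic_on U" unfolding k_def by (intro holomorphic_intros U_facts(3) Sh)
  have Sd: "deriv S w = deriv cov w * (of_real s0 / cov w + of_real s1 / (cov w - 1))" if w: "w \<in> U" for w
  proof -
    have "(S has_field_derivative of_real s0 * deriv L0 w + of_real s1 * deriv L1 w) (at w)" unfolding S_def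
      by (rule DERIV_add[OF DERIV_cmult[OF holomorphic_derivI[OF L0(1) U_facts(1) w]] DERIV_cmult[OF holomorphic_derivI[OF L1(1) U_facts(1) w]]])
    then have "deriv S w = of_real s0 * deriv L0 w + of_real s1 * deriv L1 w" by (rule DERIV_imp_deriv)
    also have "\<dots> = deriv cov w * (of_real s0 / cov w + of_real s1 / (cov w - 1))"
      using dexp[OF L0(1) _ w, of 0] dexp[OF L1 w] L0(2) by (simp add: algebra_simps)
    finally show ?thesis .
  qed
  \<comment> \<open>The Wronskian vanishes off the fibre of b by comparison of logarithmic
    derivatives; the points over b, where nothing is assumed about f, follow by
    continuation.\<close>
  define W where "W w = deriv f w * k w - f w * deriv k w" for w
  have Wh: "W holomorphic_on U" unfolding W_def by (intro holomorphic_intros f kh holomorphic_deriv U_facts(1))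
  have W1: "W w = 0" if w: "w \<in> U" "cov w \<noteq> b" for w
  proof -
    have p: "((\<lambda>z. (cov z - b) ^ n) has_field_derivative of_nat n * ((deriv cov w - 0) * (cov w - b) ^ (n - Suc 0))) (at w)"
      by (rule DERIV_power[OF DERIV_diff[OF holomorphic_derivI[OF U_facts(3,1) w(1)] DERIV_const]])
    have e: "((\<lambda>z. exp (S z)) has_field_derivative exp (S w) * deriv S w) (at w)"
      by (rule DERIV_chain2[of exp "exp (S w)" S w "deriv S w" UNIV, OF DERIV_exp holomorphic_derivI[OF Sh U_facts(1) w(1)]])
    have "deriv k w = of_nat n * ((deriv cov w - 0) * (cov w - b) ^ (n - Suc 0)) * exp (S w) + exp (S w) * deriv S w * (cov w - b) ^ n"
      unfolding k_def[abs_def] by (rule DERIV_imp_deriv[OF DERIV_mult[OF p e]])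
    then have "deriv k w = (of_nat n * (cov w - b) ^ (n - Suc 0)) * deriv cov w * exp (S w) + exp (S w) * deriv S w * (cov w - b) ^ n"
      by (simp add: mult_ac)
    moreover have pe: "of_nat n * (cov w - b) ^ (n - Suc 0) = of_nat n / (cov w - b) * (cov w - b) ^ n"
      using w(2) by (cases n) auto
    ultimately have "deriv k w = (of_nat n / (cov w - b) * (cov w - b) ^ n) * deriv cov w * exp (S w) + exp (S w) * deriv S w * (cov w - b) ^ n"
      by (simp only: pe)
    also have "\<dots> = k w * (deriv cov w * (of_nat n / (cov w - b) + of_real s0 / cov w + of_real s1 / (cov w - 1)))"
      unfolding Sd[OF w(1)] k_def by (simp only: distrib_left mult_ac add_ac)
    also have "\<dots> = k w * (deriv f w / f w)"
      using fd[OF w] cov_deriv_nz[OF w(1)] by (metis nonzero_mult_divide_mult_cancel_left mult.commute times_divide_eq_right)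
    finally show ?thesis using fd[OF w] by (simp add: W_def)
  qed
  have "\<exists>w\<in>U. cov w \<noteq> b"
  proof -
    have "(if b = 2 then 3 else 2) \<in> punct" "(if b = 2 then 3 else 2) \<noteq> b" by (auto simp: punct_def)
    then show ?thesis using U_facts(5) by (metis imageE)
  qed
  then obtain w0 where w0: "w0 \<in> U" "cov w0 \<noteq> b" by blast
  have oS: "open (U \<inter> cov -` (- {b}))"
    by (rule continuous_open_preimage[OF holomorphic_on_imp_continuous_on[OF U_facts(3)] U_facts(1)]) (simp add: open_Compl)
  have W0: "W w = 0" if w: "w \<in> U" for w
    by (rule analytic_continuation_open[OF oS U_facts(1) _ U_facts(6) _ Wh holomorphic_on_const _ w])
       (use w0 W1 in auto)
  have k0: "k w0 \<noteq> 0" using w0(2) by (simp add: k_def)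
  obtain K where K: "\<And>w. w \<in> U \<Longrightarrow> f w = K * k w"
    using proportional_of_wronskian_zero[OF U_facts(1,6) f kh w0(1) k0] W0 unfolding W_def by auto
  have "K \<noteq> 0" using K[OF w0(1)] fd[OF w0] by auto
  moreover have "cmod (f w) = cmod K * cmod (cov w - b) ^ n * cmod (cov w) powr s0 * cmod (cov w - 1) powr s1" if w: "w \<in> U" for w
  proof -
    have "cmod (cov w) powr s0 = exp (s0 * Re (L0 w))" "cmod (cov w - 1) powr s1 = exp (s1 * Re (L1 w))"
      using L0(2) L1(2) w by (simp_all add: powr_def)
    then show ?thesis unfolding K[OF w] k_def S_def
      by (simp add: norm_mult norm_power exp_add)
  qed
  ultimately show ?thesis using that[of "cmod K"] by simp
qed

end

lemma even_weights_sum_two: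
  fixes n :: "'a \<Rightarrow> nat"
  assumes Z: "finite Z" and n: "\<And>c. c \<in> Z \<Longrightarrow> even (n c) \<and> n c > 0" and s: "(\<Sum>c\<in>Z. n c) = 2"
  obtains b where "Z = {b}" "n b = 2"
proof -
  obtain b where b: "b \<in> Z" using s by fastforce
  have b2: "n b \<ge> 2" using n[OF b] by (metis dvd_imp_le)
  have sp: "n b + (\<Sum>c\<in>Z - {b}. n c) = 2" using s sum.remove[OF Z b, of n] by simp
  then have "(\<Sum>c\<in>Z - {b}. n c) = 0" using b2 by linarith
  then have z: "\<forall>c\<in>Z - {b}. n c = 0" using Z by simp
  have "c = b" if "c \<in> Z" for c using n[OF that] z that by (cases "c = b") auto
  then have zb: "Z = {b}" using b by blast
  have "n b = 2" using sp unfolding zb by simp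
  with zb show ?thesis by (rule that)
qed

section \<open>Common eigenvector, zeros of the forms and the metric\<close>

context ricci_finite
begin

lemma ends_exist:
  assumes em: "end_map \<phi> p \<sigma>" and c: "catenoidal_end U cov g \<alpha> \<phi>"
  obtains P r0 E where "ricci_end h U cov g \<alpha> \<phi> p \<sigma> P r0 E"
proof -
  obtain P r0 where "hopf \<phi> P r0" using catenoid_hopf[OF c] by blast
  moreover obtain E where "E holomorphic_on {\<zeta>. Re \<zeta> < 0}" "\<And>\<zeta>. Re \<zeta> < 0 \<Longrightarrow> E \<zeta> \<in> U" "\<And>\<zeta>. Re \<zeta> < 0 \<Longrightarrow> cov (E \<zeta>) = \<phi> (exp \<zeta>)"
    using lift_end[OF em] by auto
  ultimately have "ricci_end h U cov g \<alpha> \<phi> p \<sigma> P r0 E" using em by unfold_locales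
  then show ?thesis by (rule that)
qed

lemma common_eigenvector:
  assumes c: "catenoidal_end U cov g \<alpha> (\<lambda>x. x)" "catenoidal_end U cov g \<alpha> (\<lambda>x. 1 + x)" "catenoidal_end U cov g \<alpha> (\<lambda>x. 1 / x)"
    and red: "reducible U cov g" and tot: "(LINT z:punct|lborel. ld z) = 4 * pi"
  obtains r1 r2 where "(cmod r1)\<^sup>2 + (cmod r2)\<^sup>2 = 1"
    "\<And>w1 w2. w1 \<in> U \<Longrightarrow> w2 \<in> U \<Longrightarrow> cov w1 = cov w2 \<Longrightarrow> cmod (Q r1 r2 w1) = cmod (Q r1 r2 w2)"
    "\<And>w1 w2. w1 \<in> U \<Longrightarrow> w2 \<in> U \<Longrightarrow> cov w1 = cov w2 \<Longrightarrow> cmod (Q (- cnj r2) (cnj r1) w1) = cmod (Q (- cnj r2) (cnj r1) w2)"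
proof -
  obtain Mx where Mx: "\<And>\<tau>. \<tau> \<in> carrier (deck_group U cov) \<Longrightarrow> su2 (Mx \<tau>)"
    "\<And>\<tau> w. \<tau> \<in> carrier (deck_group U cov) \<Longrightarrow> w \<in> U \<Longrightarrow> \<not> is_pole g w \<Longrightarrow> \<not> is_pole g (inv_into U \<tau> w) \<Longrightarrow>
        moebius_rel (Mx \<tau>) (g w) (g (inv_into U \<tau> w))"
    "\<And>\<sigma> \<tau>. \<sigma> \<in> carrier (deck_group U cov) \<Longrightarrow> \<tau> \<in> carrier (deck_group U cov) \<Longrightarrow>
        Mx \<sigma> ** Mx \<tau> = Mx \<tau> ** Mx \<sigma> \<or> Mx \<sigma> ** Mx \<tau> = - (Mx \<tau> ** Mx \<sigma>)"
    by (rule reducible_matrices[OF red]) (rule that)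
  have rot: "\<exists>\<tau> r1 r2 l \<nu>. \<tau> \<in> carrier (deck_group U cov) \<and> row_eigen (Mx \<tau>) r1 r2 l \<and> end_exponent \<phi> p \<nu> \<and> (l ^ 4 = 1 \<longrightarrow> \<nu> \<ge> 1 / 2) \<and> \<nu> > 0"
    if em: "end_map \<phi> p \<sigma>" and c: "catenoidal_end U cov g \<alpha> \<phi>" for \<phi> p \<sigma>
  proof -
    obtain P r0 E where R: "ricci_end h U cov g \<alpha> \<phi> p \<sigma> P r0 E" by (rule ends_exist[OF em c]) (rule that)
    obtain \<tau> r1 r2 l \<nu> where x: "\<tau> \<in> carrier (deck_group U cov)" "row_eigen (Mx \<tau>) r1 r2 l" "\<nu> > 0" "end_exponent \<phi> p \<nu>"
      "l ^ 4 = 1 \<Longrightarrow> \<nu> \<ge> 1 / 2"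
      by (rule ricci_end.end_rotation[OF R, of Mx], rule Mx(1), assumption, rule Mx(2), assumption+, rule that)
    then show ?thesis by (intro exI[of _ \<tau>] exI[of _ r1] exI[of _ r2] exI[of _ l] exI[of _ \<nu>] conjI impI)
  qed
  obtain \<tau>0 s0 t0 l0 \<nu>0 where 0: "\<tau>0 \<in> carrier (deck_group U cov)" "row_eigen (Mx \<tau>0) s0 t0 l0" "end_exponent (\<lambda>x. x) 0 \<nu>0" "l0 ^ 4 = 1 \<longrightarrow> \<nu>0 \<ge> 1 / 2" "\<nu>0 > 0"
    using rot[OF end_maps(1) c(1)] by blast
  obtain \<tau>1 s1 t1 l1 \<nu>1 where 1: "\<tau>1 \<in> carrier (deck_group U cov)" "row_eigen (Mx \<tau>1) s1 t1 l1" "end_exponent (\<lambda>x. 1 + x) 1 \<nu>1" "l1 ^ 4 = 1 \<longrightarrow> \<nu>1 \<ge> 1 / 2" "\<nu>1 > 0"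
    using rot[OF end_maps(2) c(2)] by blast
  obtain \<nu>2 where 2: "end_exponent (\<lambda>x. 1 / x) 0 \<nu>2" "\<nu>2 > 0"
    using rot[OF end_maps(3) c(3)] by blast
  have "\<nu>0 + \<nu>1 + \<nu>2 = 1" by (rule exponent_sum[OF 0(3) 1(3) 2(1) tot])
  \<comment> \<open>Otherwise \<nu>0 and \<nu>1 would both be at least 1/2, and \<nu>2 > 0 would
    push the sum above 1. Two ends are enough for this.\<close>
  then have "l0 ^ 4 \<noteq> 1 \<or> l1 ^ 4 \<noteq> 1" using 0(4) 1(4) 2(2) by linarith
  then obtain \<tau> r1 r2 l where r: "\<tau> \<in> carrier (deck_group U cov)" "row_eigen (Mx \<tau>) r1 r2 l" "l ^ 4 \<noteq> 1" using 0(1,2) 1(1,2) by blast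
  have inv: "cmod (Q r1 r2 w1) = cmod (Q r1 r2 w2) \<and> cmod (Q (- cnj r2) (cnj r1) w1) = cmod (Q (- cnj r2) (cnj r1) w2)"
    if w: "w1 \<in> U" "w2 \<in> U" "cov w1 = cov w2" for w1 w2
  proof -
    obtain \<tau>' where t: "\<tau>' \<in> carrier (deck_group U cov)" "inv_into U \<tau>' w1 = w2" by (rule deck_transitive[OF w]) (rule that)
    \<comment> \<open>As l^4 \<noteq> 1, the eigenvector of this one rotation is an eigenvector of
      every deck transformation, even if the matrices commute only up to sign.\<close>
    obtain k where k: "row_eigen (Mx \<tau>') r1 r2 k"
      using row_eigen_commuting[OF Mx(1)[OF r(1)] Mx(1)[OF t(1)] r(2,3) Mx(3)[OF r(1) t(1)]] by blast
    note k' = row_eigen_orth[OF Mx(1)[OF t(1)] k]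
    have "cmod (Q x y (inv_into U \<tau>' w1)) = cmod (Q x y w1)" if "row_eigen (Mx \<tau>') x y m" for x y m
      by (rule Q_deck(1)[OF t(1) Mx(1)[OF t(1)] _ that w(1)], rule Mx(2)[OF t(1)], assumption+)
    from this[OF k] this[OF k'] show ?thesis unfolding t(2) by simp
  qed
  have unit: "(cmod r1)\<^sup>2 + (cmod r2)\<^sup>2 = 1" using r(2) by (simp add: row_eigen_def)
  show ?thesis
    by (rule that[OF unit]) (use inv in blast)+
qed

text \<open>With opposite exponents at every end, the two forms have 1 - s and 1 + s zeros in total,
  where s is the sum of the exponents of the first. Both numbers are even and nonnegative, so s is 1
  or -1; up to exchanging the forms, f has one double zero and k has none.\<close>

lemma decomposition:
  assumes c: "catenoidal_end U cov g \<alpha> (\<lambda>x. x)" "catenoidal_end U cov g \<alpha> (\<lambda>x. 1 + x)" "catenoidal_end U cov g \<alpha> (\<lambda>x. 1 / x)"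
    and red: "reducible U cov g" and tot: "(LINT z:punct|lborel. ld z) = 4 * pi"
  obtains f k :: "complex \<Rightarrow> complex" and \<nu> \<mu> :: real and b where
    "f holomorphic_on U" "k holomorphic_on U" "\<And>w. w \<in> U \<Longrightarrow> cmod (f w) + cmod (k w) = 2 * sqrt (h (cov w))"
    "\<nu> > 0" "\<mu> > 0" "\<mu> + \<nu> < 1" "b \<in> punct"
    "\<And>w. w \<in> U \<Longrightarrow> cov w \<noteq> b \<Longrightarrow> f w \<noteq> 0 \<and> deriv f w / (f w * deriv cov w) =
        of_nat 2 / (cov w - b) + of_real (- \<nu> - 1) / cov w + of_real (- \<mu> - 1) / (cov w - 1)"
    "\<And>w. w \<in> U \<Longrightarrow> k w \<noteq> 0 \<and> deriv k w / (k w * deriv cov w) = of_real (\<nu> - 1) / cov w + of_real (\<mu> - 1) / (cov w - 1)"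
proof -
  \<comment> \<open>Kept under its own name because \<open>that\<close> is rebound inside the local
    fact \<open>fin\<close>.\<close>
  note result = that
  obtain r1 r2 where unit: "(cmod r1)\<^sup>2 + (cmod r2)\<^sup>2 = 1"
    and inv: "\<And>w1 w2. w1 \<in> U \<Longrightarrow> w2 \<in> U \<Longrightarrow> cov w1 = cov w2 \<Longrightarrow> cmod (Q r1 r2 w1) = cmod (Q r1 r2 w2)"
    "\<And>w1 w2. w1 \<in> U \<Longrightarrow> w2 \<in> U \<Longrightarrow> cov w1 = cov w2 \<Longrightarrow> cmod (Q (- cnj r2) (cnj r1) w1) = cmod (Q (- cnj r2) (cnj r1) w2)"
    by (rule common_eigenvector[OF c red tot]) (rule that)
  define f where "f = Q r1 r2"
  define k where "k = Q (- cnj r2) (cnj r1)"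
  define m where "m = Qm r1 r2 (- cnj r2) (cnj r1)"
  note fk = f_def[symmetric] k_def[symmetric]
  have hol: "f holomorphic_on U" "k holomorphic_on U" "m holomorphic_on U" unfolding f_def k_def m_def by (rule Q_holomorphic Qm_holomorphic)+
  have norm: "cmod (f w) + cmod (k w) = 2 * sqrt (h (cov w))" if "w \<in> U" for w unfolding f_def k_def by (rule Q_norm_sum[OF unit that])
  have sq: "f w * k w = (m w)\<^sup>2" if "w \<in> U" for w unfolding f_def k_def m_def by (rule Q_mult_eq_square[OF that])
  have nocommon: "k w \<noteq> 0" if "w \<in> U" "f w = 0" for w
    using norm[OF that(1)] that(2) h_facts(2)[OF cov_in[OF that(1)]] by auto
  define LD where "LD F B \<longleftrightarrow> (\<forall>w\<in>U. F w \<noteq> 0 \<longrightarrow> B (cov w) = deriv F w / (F w * deriv cov w))" for F B :: "complex \<Rightarrow> complex"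
  have ed: "\<exists>a b \<rho>. 0 < \<rho> \<and> \<rho> \<le> 1 \<and> ((a \<noteq> 0 \<and> b = - a) \<or> (a = b \<and> a \<le> - 1)) \<and> end_exponent \<phi> p (- min a b) \<and>
    (\<forall>w x. w \<in> U \<longrightarrow> x \<noteq> 0 \<longrightarrow> cmod x < \<rho> \<longrightarrow> cov w = \<phi> x \<longrightarrow> f w \<noteq> 0 \<and> k w \<noteq> 0) \<and>
    (\<forall>B. LD f B \<longrightarrow> ((\<lambda>x. (\<phi> x - p) * B (\<phi> x)) \<longlongrightarrow> of_real (\<sigma> * a - 1)) (at 0)) \<and>
    (\<forall>B. LD k B \<longrightarrow> ((\<lambda>x. (\<phi> x - p) * B (\<phi> x)) \<longlongrightarrow> of_real (\<sigma> * b - 1)) (at 0))"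
    if em: "end_map \<phi> p \<sigma>" and c: "catenoidal_end U cov g \<alpha> \<phi>" and d: "\<forall>x. x \<noteq> 0 \<longrightarrow> deriv \<phi> x * x = of_real \<sigma> * (\<phi> x - p)" for \<phi> p \<sigma>
  proof -
    obtain P r0 E where R: "ricci_end h U cov g \<alpha> \<phi> p \<sigma> P r0 E" by (rule ends_exist[OF em c]) (rule that)
    show ?thesis
    proof (rule ricci_end.end_data[OF R _ unit], rule d[rule_format], assumption, rule inv(1), assumption+, rule inv(2), assumption+)
      fix a b \<rho>
      assume A: "0 < \<rho>" "\<rho> \<le> 1" "(a \<noteq> 0 \<and> b = - a) \<or> (a = b \<and> a \<le> - 1)" "end_exponent \<phi> p (- min a b)"
        and N: "\<And>w x. w \<in> U \<Longrightarrow> x \<noteq> 0 \<Longrightarrow> cmod x < \<rho> \<Longrightarrow> cov w = \<phi> x \<Longrightarrow> Q r1 r2 w \<noteq> 0 \<and> Q (- cnj r2) (cnj r1) w \<noteq> 0"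
        and B1: "\<And>B. (\<And>w. w \<in> U \<Longrightarrow> Q r1 r2 w \<noteq> 0 \<Longrightarrow> B (cov w) = deriv (Q r1 r2) w / (Q r1 r2 w * deriv cov w)) \<Longrightarrow>
          ((\<lambda>x. (\<phi> x - p) * B (\<phi> x)) \<longlongrightarrow> of_real (\<sigma> * a - 1)) (at 0)"
        and B2: "\<And>B. (\<And>w. w \<in> U \<Longrightarrow> Q (- cnj r2) (cnj r1) w \<noteq> 0 \<Longrightarrow>
            B (cov w) = deriv (Q (- cnj r2) (cnj r1)) w / (Q (- cnj r2) (cnj r1) w * deriv cov w)) \<Longrightarrow>
          ((\<lambda>x. (\<phi> x - p) * B (\<phi> x)) \<longlongrightarrow> of_real (\<sigma> * b - 1)) (at 0)"
      show ?thesis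
      proof (rule exI[of _ a], rule exI[of _ b], rule exI[of _ \<rho>], intro conjI allI impI A)
        fix w x assume "w \<in> U" "x \<noteq> 0" "cmod x < \<rho>" "cov w = \<phi> x"
        from N[OF this] show "f w \<noteq> 0" "k w \<noteq> 0" unfolding f_def k_def by auto
      next
        fix B assume "LD f B"
        then show "((\<lambda>x. (\<phi> x - p) * B (\<phi> x)) \<longlongrightarrow> of_real (\<sigma> * a - 1)) (at 0)"
          by (intro B1) (simp add: LD_def f_def)
      next
        fix B assume "LD k B"
        then show "((\<lambda>x. (\<phi> x - p) * B (\<phi> x)) \<longlongrightarrow> of_real (\<sigma> * b - 1)) (at 0)"
          by (intro B2) (simp add: LD_def k_def)
      qed
    qed
  qed
  have dd: "\<forall>x::complex. x \<noteq> 0 \<longrightarrow> deriv (\<lambda>x. x) x * x = of_real 1 * (x - 0)"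
    "\<forall>x::complex. x \<noteq> 0 \<longrightarrow> deriv (\<lambda>x. 1 + x) x * x = of_real 1 * ((1 + x) - 1)"
    "\<forall>x::complex. x \<noteq> 0 \<longrightarrow> deriv (\<lambda>x. 1 / x) x * x = of_real (- 1) * (1 / x - 0)"
    by (intro allI impI end_maps_deriv; assumption)+
  obtain a0 b0 \<rho>0 where 0: "0 < \<rho>0" "(a0 \<noteq> 0 \<and> b0 = - a0) \<or> (a0 = b0 \<and> a0 \<le> - 1)" "end_exponent (\<lambda>x. x) 0 (- min a0 b0)"
    "\<forall>w x. w \<in> U \<longrightarrow> x \<noteq> 0 \<longrightarrow> cmod x < \<rho>0 \<longrightarrow> cov w = x \<longrightarrow> f w \<noteq> 0 \<and> k w \<noteq> 0"
    "\<forall>B. LD f B \<longrightarrow> ((\<lambda>x. (x - 0) * B x) \<longlongrightarrow> of_real (1 * a0 - 1)) (at 0)" "\<forall>B. LD k B \<longrightarrow> ((\<lambda>x. (x - 0) * B x) \<longlongrightarrow> of_real (1 * b0 - 1)) (at 0)"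
    using ed[OF end_maps(1) c(1) dd(1)] by (elim exE conjE) (rule that)
  obtain a1 b1 \<rho>1 where 1: "0 < \<rho>1" "(a1 \<noteq> 0 \<and> b1 = - a1) \<or> (a1 = b1 \<and> a1 \<le> - 1)" "end_exponent (\<lambda>x. 1 + x) 1 (- min a1 b1)"
    "\<forall>w x. w \<in> U \<longrightarrow> x \<noteq> 0 \<longrightarrow> cmod x < \<rho>1 \<longrightarrow> cov w = 1 + x \<longrightarrow> f w \<noteq> 0 \<and> k w \<noteq> 0"
    "\<forall>B. LD f B \<longrightarrow> ((\<lambda>x. (1 + x - 1) * B (1 + x)) \<longlongrightarrow> of_real (1 * a1 - 1)) (at 0)" "\<forall>B. LD k B \<longrightarrow> ((\<lambda>x. (1 + x - 1) * B (1 + x)) \<longlongrightarrow> of_real (1 * b1 - 1)) (at 0)"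
    using ed[OF end_maps(2) c(2) dd(2)] by (elim exE conjE) (rule that)
  obtain a2 b2 \<rho>2 where 2: "0 < \<rho>2" "(a2 \<noteq> 0 \<and> b2 = - a2) \<or> (a2 = b2 \<and> a2 \<le> - 1)" "end_exponent (\<lambda>x. 1 / x) 0 (- min a2 b2)"
    "\<forall>w x. w \<in> U \<longrightarrow> x \<noteq> 0 \<longrightarrow> cmod x < \<rho>2 \<longrightarrow> cov w = 1 / x \<longrightarrow> f w \<noteq> 0 \<and> k w \<noteq> 0"
    "\<forall>B. LD f B \<longrightarrow> ((\<lambda>x. (1 / x - 0) * B (1 / x)) \<longlongrightarrow> of_real (- 1 * a2 - 1)) (at 0)" "\<forall>B. LD k B \<longrightarrow> ((\<lambda>x. (1 / x - 0) * B (1 / x)) \<longlongrightarrow> of_real (- 1 * b2 - 1)) (at 0)"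
    using ed[OF end_maps(3) c(3) dd(3)] by (elim exE conjE) (rule that)
  have "- min a0 b0 + - min a1 b1 + - min a2 b2 = 1" by (rule exponent_sum[OF 0(3) 1(3) 2(3) tot])
  \<comment> \<open>An end with equal exponents would have \<nu> \<ge> 1 while the other two are
    positive, against the sum 1. So the exponents are opposite everywhere and each \<nu> is the
    absolute value of an exponent.\<close>
  then have ab: "a0 \<noteq> 0" "b0 = - a0" "a1 \<noteq> 0" "b1 = - a1" "a2 \<noteq> 0" "b2 = - a2" and abs1: "\<bar>a0\<bar> + \<bar>a1\<bar> + \<bar>a2\<bar> = 1"
    using 0(2) 1(2) 2(2) by (auto simp: min_def split: if_splits)
  define \<rho> where "\<rho> = min \<rho>0 (min \<rho>1 \<rho>2)"
  have \<rho>: "\<rho> > 0" "\<rho> \<le> \<rho>0" "\<rho> \<le> \<rho>1" "\<rho> \<le> \<rho>2" using 0(1) 1(1) 2(1) by (auto simp: \<rho>_def)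
  have nz: "f w \<noteq> 0 \<and> k w \<noteq> 0" if w: "w \<in> U" and r: "cmod (cov w) < \<rho> \<or> cmod (cov w - 1) < \<rho> \<or> cmod (cov w) > 1 / \<rho>" for w
  proof -
    have z: "cov w \<noteq> 0" "cov w - 1 \<noteq> 0" using cov_in[OF w] by (auto simp: punct_def)
    show ?thesis using r
    proof (elim disjE)
      assume "cmod (cov w) < \<rho>"
      then show ?thesis using 0(4)[rule_format, OF w z(1)] \<rho> by auto
    next
      assume "cmod (cov w - 1) < \<rho>"
      then show ?thesis using 1(4)[rule_format, OF w z(2)] \<rho> by auto
    next
      assume "cmod (cov w) > 1 / \<rho>"
      then have "cmod (1 / cov w) < \<rho>" using \<rho>(1) z(1) by (simp add: norm_divide field_simps)
      moreover have "1 / cov w \<noteq> 0" using z(1) by simp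
      ultimately show ?thesis using 2(4)[rule_format, OF w, of "1 / cov w"] \<rho> by auto
    qed
  qed
  have conv: "((\<lambda>z. z * B z) \<longlongrightarrow> of_real (x0 - 1)) (at 0) \<and> ((\<lambda>z. (z - 1) * B z) \<longlongrightarrow> of_real (x1 - 1)) (at 1) \<and>
        ((\<lambda>z. z * B z) \<longlongrightarrow> of_real (- x2 - 1)) at_infinity"
    if "((\<lambda>x. (x - 0) * B x) \<longlongrightarrow> of_real (1 * x0 - 1)) (at 0)" "((\<lambda>x. (1 + x - 1) * B (1 + x)) \<longlongrightarrow> of_real (1 * x1 - 1)) (at 0)"
      "((\<lambda>x. (1 / x - 0) * B (1 / x)) \<longlongrightarrow> of_real (- 1 * x2 - 1)) (at 0)" for B :: "complex \<Rightarrow> complex" and x0 x1 x2 :: real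
  proof (intro conjI)
    show "((\<lambda>z. z * B z) \<longlongrightarrow> of_real (x0 - 1)) (at 0)" using that(1) by simp
    show "((\<lambda>z. (z - 1) * B z) \<longlongrightarrow> of_real (x1 - 1)) (at 1)"
      by (rule LIM_offset_zero_cancel) (use that(2) in simp)
    show "((\<lambda>z. z * B z) \<longlongrightarrow> of_real (- x2 - 1)) at_infinity"
      unfolding lim_at_infinity_0 using that(3) by (simp add: o_def inverse_eq_divide)
  qed
  obtain w0 where w0: "w0 \<in> U" "cmod (cov w0) < \<rho>"
  proof -
    define x where "x = complex_of_real (min (\<rho> / 2) (1 / 2))"
    have "x \<in> punct" "cmod x < \<rho>" using \<rho>(1) by (auto simp: x_def punct_def min_def)
    then show ?thesis using that U_facts(5) by (metis imageE)
  qed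
  have exnz: "\<exists>w\<in>U. k w \<noteq> 0" "\<exists>w\<in>U. f w \<noteq> 0" using nz w0 by blast+
  have LDI: "LD F B" if "\<And>w. w \<in> U \<Longrightarrow> F w \<noteq> 0 \<Longrightarrow> B (cov w) = deriv F w / (F w * deriv cov w)" for F B
    unfolding LD_def using that by simp
  obtain Zf nf where Zf: "finite Zf" "Zf \<subseteq> punct" "\<And>c. c \<in> Zf \<Longrightarrow> even (nf c) \<and> nf c > 0"
    "real (\<Sum>c\<in>Zf. nf c) = 1 - (a0 + a1 + a2)"
    "\<And>w. w \<in> U \<Longrightarrow> cov w \<notin> Zf \<Longrightarrow> f w \<noteq> 0 \<and> deriv f w / (f w * deriv cov w) =
       (\<Sum>c\<in>Zf. of_nat (nf c) / (cov w - c)) + of_real (a0 - 1) / cov w + of_real (a1 - 1) / (cov w - 1)"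
  proof (rule descended_log_derivative[OF hol sq nocommon _ exnz(1) \<rho>(1), of a0 a1 a2])
    show "cmod (f w1) = cmod (f w2)" if "w1 \<in> U" "w2 \<in> U" "cov w1 = cov w2" for w1 w2 unfolding f_def by (rule inv(1)[OF that])
    show "f w \<noteq> 0" if "w \<in> U" "cmod (cov w) < \<rho> \<or> cmod (cov w - 1) < \<rho> \<or> cmod (cov w) > 1 / \<rho>" for w using nz[OF that] by simp
    fix B assume B: "\<And>w. w \<in> U \<Longrightarrow> f w \<noteq> 0 \<Longrightarrow> B (cov w) = deriv f w / (f w * deriv cov w)"
    have L: "LD f B" by (rule LDI[OF B])
    show "((\<lambda>z. z * B z) \<longlongrightarrow> of_real (a0 - 1)) (at 0) \<and> ((\<lambda>z. (z - 1) * B z) \<longlongrightarrow> of_real (a1 - 1)) (at 1) \<and>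
        ((\<lambda>z. z * B z) \<longlongrightarrow> of_real (- a2 - 1)) at_infinity"
      by (rule conv[OF 0(5)[rule_format, OF L] 1(5)[rule_format, OF L] 2(5)[rule_format, OF L]])
  qed (assumption | rule that)+
  have sq': "k w * f w = (m w)\<^sup>2" and nocommon': "k w = 0 \<Longrightarrow> f w \<noteq> 0" if "w \<in> U" for w
    using sq[OF that] nocommon[OF that] by (auto simp: mult.commute)
  obtain Zk nk where Zk: "finite Zk" "Zk \<subseteq> punct" "\<And>c. c \<in> Zk \<Longrightarrow> even (nk c) \<and> nk c > 0"
    "real (\<Sum>c\<in>Zk. nk c) = 1 - (b0 + b1 + b2)"
    "\<And>w. w \<in> U \<Longrightarrow> cov w \<notin> Zk \<Longrightarrow> k w \<noteq> 0 \<and> deriv k w / (k w * deriv cov w) =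
       (\<Sum>c\<in>Zk. of_nat (nk c) / (cov w - c)) + of_real (b0 - 1) / cov w + of_real (b1 - 1) / (cov w - 1)"
  proof (rule descended_log_derivative[OF hol(2,1,3) sq' nocommon' _ exnz(2) \<rho>(1), of b0 b1 b2])
    show "cmod (k w1) = cmod (k w2)" if "w1 \<in> U" "w2 \<in> U" "cov w1 = cov w2" for w1 w2 unfolding k_def by (rule inv(2)[OF that])
    show "k w \<noteq> 0" if "w \<in> U" "cmod (cov w) < \<rho> \<or> cmod (cov w - 1) < \<rho> \<or> cmod (cov w) > 1 / \<rho>" for w using nz[OF that] by simp
    fix B assume B: "\<And>w. w \<in> U \<Longrightarrow> k w \<noteq> 0 \<Longrightarrow> B (cov w) = deriv k w / (k w * deriv cov w)"
    have L: "LD k B" by (rule LDI[OF B])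
    show "((\<lambda>z. z * B z) \<longlongrightarrow> of_real (b0 - 1)) (at 0) \<and> ((\<lambda>z. (z - 1) * B z) \<longlongrightarrow> of_real (b1 - 1)) (at 1) \<and>
        ((\<lambda>z. z * B z) \<longlongrightarrow> of_real (- b2 - 1)) at_infinity"
      by (rule conv[OF 0(6)[rule_format, OF L] 1(6)[rule_format, OF L] 2(6)[rule_format, OF L]])
  qed (assumption | rule that)+
  \<comment> \<open>Here F is the form with the zeros, so that the two symmetric cases share one
    argument. Exponents with sum -1 and absolute values adding up to 1 are all negative; \<nu> and
    \<mu> are minus the exponents of F at 0 and 1.\<close>
  have fin: thesis
    if F: "F holomorphic_on U" "K holomorphic_on U" "\<And>w. w \<in> U \<Longrightarrow> cmod (F w) + cmod (K w) = 2 * sqrt (h (cov w))"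
      and ZF: "finite ZF" "ZF \<subseteq> punct" "\<And>c. c \<in> ZF \<Longrightarrow> even (nF c) \<and> nF c > 0" "real (\<Sum>c\<in>ZF. nF c) = 1 - (x0 + x1 + x2)"
        "\<And>w. w \<in> U \<Longrightarrow> cov w \<notin> ZF \<Longrightarrow> F w \<noteq> 0 \<and> deriv F w / (F w * deriv cov w) =
       (\<Sum>c\<in>ZF. of_nat (nF c) / (cov w - c)) + of_real (x0 - 1) / cov w + of_real (x1 - 1) / (cov w - 1)"
      and ZK: "finite ZK" "\<And>c. c \<in> ZK \<Longrightarrow> even (nK c) \<and> nK c > 0" "real (\<Sum>c\<in>ZK. nK c) = 1 + (x0 + x1 + x2)"
        "\<And>w. w \<in> U \<Longrightarrow> cov w \<notin> ZK \<Longrightarrow> K w \<noteq> 0 \<and> deriv K w / (K w * deriv cov w) =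
       (\<Sum>c\<in>ZK. of_nat (nK c) / (cov w - c)) + of_real (- x0 - 1) / cov w + of_real (- x1 - 1) / (cov w - 1)"
      and x: "x0 \<noteq> 0" "x1 \<noteq> 0" "x2 \<noteq> 0" "\<bar>x0\<bar> + \<bar>x1\<bar> + \<bar>x2\<bar> = 1" "x0 + x1 + x2 = - 1"
    for F K :: "complex \<Rightarrow> complex" and ZF ZK nF nK x0 x1 x2
  proof -
    have neg: "x0 < 0" "x1 < 0" "x2 < 0" using x by linarith+
    have s2: "(\<Sum>c\<in>ZF. nF c) = 2" using ZF(4) x(5) by linarith
    obtain b where b: "ZF = {b}" "nF b = 2" by (rule even_weights_sum_two[OF ZF(1) _ s2], rule ZF(3), assumption, rule that)
    have "(\<Sum>c\<in>ZK. nK c) = 0" using ZK(3) x(5) by linarith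
    then have "\<forall>c\<in>ZK. nK c = 0" using ZK(1) by simp
    then have ZK0: "ZK = {}" using ZK(2) by fastforce
    show thesis
    proof (rule result[OF F(1,2), of "- x0" "- x1" b])
      show "cmod (F w) + cmod (K w) = 2 * sqrt (h (cov w))" if "w \<in> U" for w by (rule F(3)[OF that])
      show "- x0 > 0" "- x1 > 0" "- x1 + - x0 < 1" using neg x(4) by linarith+
      show "b \<in> punct" using ZF(2) b(1) by simp
      show "F w \<noteq> 0 \<and> deriv F w / (F w * deriv cov w) =
        of_nat 2 / (cov w - b) + of_real (- (- x0) - 1) / cov w + of_real (- (- x1) - 1) / (cov w - 1)"
        if "w \<in> U" "cov w \<noteq> b" for w
        using ZF(5)[OF that(1)] that(2) b by simp
      show "K w \<noteq> 0 \<and> deriv K w / (K w * deriv cov w) = of_real (- x0 - 1) / cov w + of_real (- x1 - 1) / (cov w - 1)"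
        if "w \<in> U" for w
        using ZK(4)[OF that] ZK0 by simp
    qed
  qed
  have rN: "real (\<Sum>c\<in>Zf. nf c) + real (\<Sum>c\<in>Zk. nk c) = 2" using Zf(4) Zk(4) ab by simp
  have ev: "even (\<Sum>c\<in>Zf. nf c)" using Zf(3) by (auto intro: dvd_sum)
  have "(\<Sum>c\<in>Zf. nf c) = 0 \<or> (\<Sum>c\<in>Zf. nf c) = 2"
  proof -
    have "(\<Sum>c\<in>Zf. nf c) \<le> 2" using rN by linarith
    then show ?thesis using ev by (auto simp: le_Suc_eq numeral_2_eq_2)
  qed
  then show thesis
  proof
    assume "(\<Sum>c\<in>Zf. nf c) = 2"
    then have S: "a0 + a1 + a2 = - 1" using Zf(4) by simp
    show thesis
    proof (rule fin[OF hol(1,2) norm Zf Zk(1,3)])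
      show "a0 \<noteq> 0" "a1 \<noteq> 0" "a2 \<noteq> 0" "\<bar>a0\<bar> + \<bar>a1\<bar> + \<bar>a2\<bar> = 1" "a0 + a1 + a2 = - 1" using ab abs1 S by auto
      show "real (\<Sum>c\<in>Zk. nk c) = 1 + (a0 + a1 + a2)" using Zk(4) ab by simp
      show "k w \<noteq> 0 \<and> deriv k w / (k w * deriv cov w) =
       (\<Sum>c\<in>Zk. of_nat (nk c) / (cov w - c)) + of_real (- a0 - 1) / cov w + of_real (- a1 - 1) / (cov w - 1)" if "w \<in> U" "cov w \<notin> Zk" for w
        using Zk(5)[OF that] unfolding ab .
    qed
  next
    assume "(\<Sum>c\<in>Zf. nf c) = 0"
    then have S: "b0 + b1 + b2 = - 1" using Zf(4) ab by simp
    show thesis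
    proof (rule fin[OF hol(2,1) _ Zk Zf(1,3)])
      show "cmod (k w) + cmod (f w) = 2 * sqrt (h (cov w))" if "w \<in> U" for w using norm[OF that] by simp
      show "b0 \<noteq> 0" "b1 \<noteq> 0" "b2 \<noteq> 0" "\<bar>b0\<bar> + \<bar>b1\<bar> + \<bar>b2\<bar> = 1" "b0 + b1 + b2 = - 1" using ab abs1 S by auto
      show "real (\<Sum>c\<in>Zf. nf c) = 1 + (b0 + b1 + b2)" using Zf(4) ab by simp
      show "f w \<noteq> 0 \<and> deriv f w / (f w * deriv cov w) =
       (\<Sum>c\<in>Zf. of_nat (nf c) / (cov w - c)) + of_real (- b0 - 1) / cov w + of_real (- b1 - 1) / (cov w - 1)" if "w \<in> U" "cov w \<notin> Zf" for w
        using Zf(5)[OF that] unfolding ab by simp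
    qed
  qed
qed

lemma metric_formula:
  assumes c: "catenoidal_end U cov g \<alpha> (\<lambda>x. x)" "catenoidal_end U cov g \<alpha> (\<lambda>x. 1 + x)" "catenoidal_end U cov g \<alpha> (\<lambda>x. 1 / x)"
    and red: "reducible U cov g" and tot: "(LINT z:punct|lborel. ld z) = 4 * pi"
  obtains \<nu> \<mu> K1 K2 :: real and b where "\<nu> > 0" "\<mu> > 0" "\<mu> + \<nu> < 1" "K1 > 0" "K2 > 0" "b \<in> punct"
    "\<And>z. z \<in> punct \<Longrightarrow> 2 * sqrt (h z) = K1 * (cmod (z - b))\<^sup>2 * cmod z powr (- \<nu> - 1) * cmod (z - 1) powr (- \<mu> - 1)
       + K2 * cmod z powr (\<nu> - 1) * cmod (z - 1) powr (\<mu> - 1)"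
proof -
  obtain f k :: "complex \<Rightarrow> complex" and \<nu> \<mu> :: real and b where fk:
    "f holomorphic_on U" "k holomorphic_on U" "\<And>w. w \<in> U \<Longrightarrow> cmod (f w) + cmod (k w) = 2 * sqrt (h (cov w))"
    "\<nu> > 0" "\<mu> > 0" "\<mu> + \<nu> < 1" "b \<in> punct"
    "\<And>w. w \<in> U \<Longrightarrow> cov w \<noteq> b \<Longrightarrow> f w \<noteq> 0 \<and> deriv f w / (f w * deriv cov w) =
        of_nat 2 / (cov w - b) + of_real (- \<nu> - 1) / cov w + of_real (- \<mu> - 1) / (cov w - 1)"
    "\<And>w. w \<in> U \<Longrightarrow> k w \<noteq> 0 \<and> deriv k w / (k w * deriv cov w) = of_real (\<nu> - 1) / cov w + of_real (\<mu> - 1) / (cov w - 1)"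
    by (rule decomposition[OF c red tot]) (rule that)
  obtain K1 where K1: "K1 > 0" "\<And>w. w \<in> U \<Longrightarrow> cmod (f w) = K1 * cmod (cov w - b) ^ 2 * cmod (cov w) powr (- \<nu> - 1) * cmod (cov w - 1) powr (- \<mu> - 1)"
    by (rule modulus_from_log_derivative[OF fk(1,8)]) (assumption+, rule that)
  have k': "k w \<noteq> 0 \<and> deriv k w / (k w * deriv cov w) = of_nat 0 / (cov w - b) + of_real (\<nu> - 1) / cov w + of_real (\<mu> - 1) / (cov w - 1)"
    if "w \<in> U" for w using fk(9)[OF that] by simp
  obtain K2 where K2: "K2 > 0" "\<And>w. w \<in> U \<Longrightarrow> cmod (k w) = K2 * cmod (cov w - b) ^ 0 * cmod (cov w) powr (\<nu> - 1) * cmod (cov w - 1) powr (\<mu> - 1)"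
    by (rule modulus_from_log_derivative[OF fk(2) k']) (assumption+, rule that)
  show ?thesis
  proof (rule that[OF fk(4,5,6) K1(1) K2(1) fk(7)])
    fix z assume "z \<in> punct"
    then obtain w where w: "w \<in> U" "cov w = z" using U_facts(5) by (metis imageE)
    show "2 * sqrt (h z) = K1 * (cmod (z - b))\<^sup>2 * cmod z powr (- \<nu> - 1) * cmod (z - 1) powr (- \<mu> - 1)
       + K2 * cmod z powr (\<nu> - 1) * cmod (z - 1) powr (\<mu> - 1)"
      using fk(3)[OF w(1)] K1(2)[OF w(1)] K2(2)[OF w(1)] w(2) by simp
  qed
qed

end

section \<open>The Weierstrass data\<close>

text \<open>\<open>a1\<close> and \<open>a2\<close> are the roots of $(\mu+\nu-1)z^2 - ((\mu+\nu)b+\nu-1)z + \nu b$.\<close>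

lemma quadratic_parameters:
  fixes b :: complex and \<mu> \<nu> :: real
  assumes \<mu>: "\<mu> > 0" and \<nu>: "\<nu> > 0" and s: "\<mu> + \<nu> < 1" and b: "b \<noteq> 0" "b \<noteq> 1"
  obtains a1 a2 where "a1 \<notin> {0, 1}" "a2 \<notin> {0, 1}" "b = of_real (\<mu> + \<nu> - 1) * a1 * a2 / of_real \<nu>" "b \<noteq> a1" "b \<noteq> a2"
    "of_real (\<nu> * (\<nu> - 1)) =
        of_real (\<mu> + \<nu> - 1) * (of_real \<nu> * (a1 + a2) - of_real (\<mu> + \<nu>) * a1 * a2)"
    "of_real (\<mu> - 1) / (b - 1) + of_real (\<nu> - 1) / b + 1 / (b - a1) + 1 / (b - a2) = 0"
proof -
  define m where "m = complex_of_real \<mu>"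
  define n where "n = complex_of_real \<nu>"
  define S where "S = m + n - 1"
  have "complex_of_real (\<mu> + \<nu> - 1) \<noteq> 0" using s by (simp only: of_real_eq_0_iff)
  then have S: "S \<noteq> 0" unfolding S_def m_def n_def by simp
  have nz: "m \<noteq> 0" "n \<noteq> 0" using \<mu> \<nu> by (auto simp: m_def n_def)
  have conv: "of_real (\<mu> + \<nu> - 1) = S" "of_real (\<mu> + \<nu>) = m + n" "of_real (\<nu> * (\<nu> - 1)) = n * (n - 1)" "of_real \<nu> = n"
    "of_real (\<mu> - 1) = m - 1" "of_real (\<nu> - 1) = n - 1" by (simp_all add: S_def m_def n_def)
  define B where "B = (m + n) * b + n - 1"
  define \<delta> where "\<delta> = csqrt (B\<^sup>2 - 4 * S * (n * b))"
  have \<delta>: "\<delta> * \<delta> = B * B - 4 * S * (n * b)" unfolding \<delta>_def by (simp flip: power2_eq_square)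
  define a1 where "a1 = (B + \<delta>) / (2 * S)"
  define a2 where "a2 = (B - \<delta>) / (2 * S)"
  have sum: "S * (a1 + a2) = B" using S by (simp add: a1_def a2_def field_simps)
  have "S * (a1 * a2) = (B * B - \<delta> * \<delta>) / (4 * S)" using S by (simp add: a1_def a2_def field_simps)
  then have prod: "S * (a1 * a2) = n * b" unfolding \<delta> using S by simp
  have vals: "S * ((z - a1) * (z - a2)) = S * (z * z) - B * z + n * b" for z
  proof -
    have "S * ((z - a1) * (z - a2)) = S * (z * z) - (S * (a1 + a2)) * z + S * (a1 * a2)" by (simp add: algebra_simps)
    then show ?thesis unfolding sum prod .
  qed
  \<comment> \<open>The values of the quadratic polynomial at 1 and at b are nonzero, so its roots
    avoid both points; the product of the roots keeps them away from 0.\<close>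
  have v1: "S * ((1 - a1) * (1 - a2)) = m * (1 - b)" unfolding vals unfolding B_def S_def by (simp add: algebra_simps)
  have vb: "S * ((b - a1) * (b - a2)) = - (b * (b - 1))" unfolding vals unfolding B_def S_def by (simp add: algebra_simps)
  have ne: "a1 \<noteq> 0" "a2 \<noteq> 0" "a1 \<noteq> 1" "a2 \<noteq> 1" "b - a1 \<noteq> 0" "b - a2 \<noteq> 0"
    using prod v1 vb b nz by auto
  show ?thesis
  proof (rule that[of a1 a2], unfold conv)
    show "a1 \<notin> {0, 1}" "a2 \<notin> {0, 1}" "b \<noteq> a1" "b \<noteq> a2" using ne by auto
    show "b = S * a1 * a2 / n" using prod nz by (simp add: mult.assoc)
    have "S * (n * (a1 + a2) - (m + n) * a1 * a2) = n * (S * (a1 + a2)) - (m + n) * (S * (a1 * a2))" by (simp add: algebra_simps)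
    also have "\<dots> = n * (n - 1)" unfolding sum prod unfolding B_def by (simp add: algebra_simps)
    finally show "n * (n - 1) = S * (n * (a1 + a2) - (m + n) * a1 * a2)" ..
    \<comment> \<open>The derivative of the quadratic polynomial at b. The sum 1/(b - a1) + 1/(b -
      a2) is its logarithmic derivative there.\<close>
    have X: "S * (2 * b) - B = (m - 1) * b + (n - 1) * (b - 1)" by (simp add: B_def S_def algebra_simps)
    have b1: "b - 1 \<noteq> 0" using b by simp
    have "1 / (b - a1) + 1 / (b - a2) = (S * (2 * b) - S * (a1 + a2)) / (S * ((b - a1) * (b - a2)))"
      using ne S by (simp add: divide_simps) (simp add: algebra_simps)
    also have "\<dots> = - ((m - 1) * b + (n - 1) * (b - 1)) / (b * (b - 1))"
      unfolding sum vb X by (metis minus_divide_left minus_divide_right)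
    also have "\<dots> = - ((m - 1) / (b - 1) + (n - 1) / b)"
      using b(1) b1 by (simp add: divide_simps)
    finally show "(m - 1) / (b - 1) + (n - 1) / b + 1 / (b - a1) + 1 / (b - a2) = 0" by (simp only: eq_neg_iff_add_eq_0 add_ac)
  qed
qed

text \<open>At z = b division by zero gives the value 0, and the coefficient of eta vanishes there,
  so the metric formula would fail at b if b did not count as a pole. The modulus alone is used
  because b may lie on a branch cut of the principal powers, where \<open>data_g\<close> need not be
  continuous nearby.\<close>

lemma is_pole_data_g:
  assumes "lam \<noteq> 0" "b \<noteq> 0" "b \<noteq> 1"
  shows "is_pole (data_g lam \<mu> \<nu> b) b"
  unfolding is_pole_def
proof (rule filterlim_norm_at_top_imp_at_infinity)
  define C where "C z = cmod lam * cmod (z - 1) powr \<mu> * cmod z powr \<nu>" for z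
  have "(C \<longlongrightarrow> C b) (at b)" unfolding C_def by (intro tendsto_intros) (use assms in auto)
  moreover have "C b > 0" using assms by (simp add: C_def)
  moreover have "filterlim (\<lambda>z. inverse (cmod (z - b))) at_top (at b)"
  proof (rule filterlim_inverse_at_top)
    have "((\<lambda>z. cmod (z - b)) \<longlongrightarrow> cmod (b - b)) (at b)" by (intro tendsto_intros)
    then show "((\<lambda>z. cmod (z - b)) \<longlongrightarrow> 0) (at b)" by simp
    show "\<forall>\<^sub>F z in at b. 0 < cmod (z - b)" using eventually_neq_at_within[of b b UNIV] by eventually_elim simp
  qed
  ultimately have "filterlim (\<lambda>z. C z * inverse (cmod (z - b))) at_top (at b)" by (rule filterlim_tendsto_pos_mult_at_top)
  moreover have "C z * inverse (cmod (z - b)) = cmod (data_g lam \<mu> \<nu> b z)" for z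
    by (simp add: C_def data_g_def norm_mult norm_divide norm_powr_real_powr' divide_inverse norm_inverse)
  ultimately show "filterlim (\<lambda>z. cmod (data_g lam \<mu> \<nu> b z)) at_top (at b)" by simp
qed

text \<open>The formula for the data reads 2 sqrt(h) = |eta| (1 + |g|^2). The first summand of the
  hypothesis is |eta|, which forces |\<kappa>| = K1; the second is |eta| |g|^2, which forces
  |\<lambda>|^2 = K2 / K1.\<close>

lemma metric_of_data_standard:
  assumes b: "b \<notin> {0, 1}" and K: "K1 > 0" "K2 > 0"
    and h: "\<And>z. z \<notin> {0, 1} \<Longrightarrow> h z > 0 \<and> 2 * sqrt (h z) = K1 * (cmod (z - b))\<^sup>2 * cmod z powr (- \<nu> - 1) * cmod (z - 1) powr (- \<mu> - 1)
       + K2 * cmod z powr (\<nu> - 1) * cmod (z - 1) powr (\<mu> - 1)"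
  shows "metric_of_data (- {0, 1}) (data_g (of_real (sqrt (K2 / K1))) \<mu> \<nu> b) (data_eta (of_real K1) \<mu> \<nu> b) h"
  unfolding metric_of_data_def
proof (intro ballI impI)
  define l where "l = sqrt (K2 / K1)"
  have l: "l > 0" "l\<^sup>2 = K2 / K1" using K by (auto simp: l_def)
  fix z assume z: "z \<in> - {0, 1}" and np: "\<not> is_pole (data_g (of_real (sqrt (K2 / K1))) \<mu> \<nu> b) z"
  have zb: "z \<noteq> b"
  proof
    assume zb: "z = b"
    have "complex_of_real l \<noteq> 0" "b \<noteq> 0" "b \<noteq> 1" using l(1) b by auto
    then have "is_pole (data_g (of_real l) \<mu> \<nu> b) b" by (rule is_pole_data_g)
    then show False using np unfolding zb l_def by blast
  qed
  define x where "x = cmod z"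
  define y where "y = cmod (z - 1)"
  define d where "d = cmod (z - b)"
  have pos: "x > 0" "y > 0" "d > 0" using z zb by (auto simp: x_def y_def d_def)
  define G where "G = cmod (data_g (of_real l) \<mu> \<nu> b z)"
  define N where "N = cmod (data_eta (of_real K1) \<mu> \<nu> b z)"
  have G: "G = l * y powr \<mu> * x powr \<nu> / d" using l(1)
    by (simp add: G_def data_g_def norm_mult norm_divide norm_powr_real_powr' x_def y_def d_def)
  have N: "N = K1 * y powr (- \<mu> - 1) * x powr (- \<nu> - 1) * d\<^sup>2" using K(1)
    by (simp add: N_def data_eta_def norm_mult norm_power norm_powr_real_powr' x_def y_def d_def)
  have sqp: "(t powr e)\<^sup>2 = t powr (2 * e)" if "t > 0" for t e :: real
    using that by (simp add: power2_eq_square flip: powr_add)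
  have G2: "G\<^sup>2 = K2 / K1 * y powr (2 * \<mu>) * x powr (2 * \<nu>) / d\<^sup>2"
    unfolding G power_divide power_mult_distrib l(2) sqp[OF pos(1)] sqp[OF pos(2)] ..
  have px: "x powr (- \<nu> - 1) * x powr (2 * \<nu>) = x powr (\<nu> - 1)" "y powr (- \<mu> - 1) * y powr (2 * \<mu>) = y powr (\<mu> - 1)"
    by (simp_all flip: powr_add)
  have "N * G\<^sup>2 = K2 * (x powr (- \<nu> - 1) * x powr (2 * \<nu>)) * (y powr (- \<mu> - 1) * y powr (2 * \<mu>))"
    unfolding G2 N using pos K by simp
  then have NG: "N * G\<^sup>2 = K2 * x powr (\<nu> - 1) * y powr (\<mu> - 1)" unfolding px .
  have hz: "h z > 0" "2 * sqrt (h z) = K1 * d\<^sup>2 * x powr (- \<nu> - 1) * y powr (- \<mu> - 1) + K2 * x powr (\<nu> - 1) * y powr (\<mu> - 1)"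
    using h[of z] z unfolding x_def y_def d_def by auto
  have "2 * sqrt (h z) = N + N * G\<^sup>2" unfolding hz(2) NG unfolding N by simp
  then have sh: "sqrt (h z) = N * (1 + G\<^sup>2) / 2" by (simp add: algebra_simps)
  have "(sqrt (h z))\<^sup>2 = (N * (1 + G\<^sup>2) / 2)\<^sup>2" unfolding sh ..
  then have "h z = 1 / 4 * N\<^sup>2 * (1 + G\<^sup>2)\<^sup>2" using hz(1) by (simp add: power_mult_distrib power_divide)
  then show "h z = 1 / 4 * (cmod (data_eta (of_real K1) \<mu> \<nu> b z))\<^sup>2 * (1 + (cmod (data_g (of_real (sqrt (K2 / K1))) \<mu> \<nu> b z))\<^sup>2)\<^sup>2"
    unfolding N_def G_def l_def .
qed

lemma smooth_on_id: "smooth_on S (\<lambda>z. z)"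
proof -
  have c: "Ck_on k S (\<lambda>_. c)" for k and c :: complex
  proof (induction k arbitrary: c)
    case (Suc k)
    have "partial_x (\<lambda>_. c) = (\<lambda>_. 0)" "partial_y (\<lambda>_. c) = (\<lambda>_. 0)"
      by (auto simp: partial_x_def partial_y_def fun_eq_iff frechet_derivative_const)
    then show ?case using Suc by simp
  qed simp
  have "partial_x (\<lambda>z. z) = (\<lambda>_. 1)" "partial_y (\<lambda>z. z) = (\<lambda>_. \<i>)"
    by (auto simp: partial_x_def partial_y_def fun_eq_iff frechet_derivative_ident)
  then have "Ck_on k S (\<lambda>z. z)" for k using c by (cases k) (auto simp: continuous_on_id)
  then show ?thesis by (simp add: smooth_on_def)
qed

lemma isometric_refl: "isometric S h S h"
  unfolding isometric_def
  by (rule exI[of _ "\<lambda>z. z"], rule exI[of _ "\<lambda>z. z"])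
     (auto simp: homeomorphism_def smooth_on_id frechet_derivative_ident continuous_on_id)

theorem theorem6p3:
  fixes h :: "complex \<Rightarrow> real"
    and U :: "complex set"
    and cov g \<alpha> :: "complex \<Rightarrow> complex"
  assumes "ricci_surface (- {0, 1}) h"
    and "nonpositively_curved (- {0, 1}) h"
    and "complete_metric (- {0, 1}) h"
    and "universal_cover U cov (- {0, 1})"
    and "weierstrass_data U cov h g \<alpha>"
    and "catenoidal_end U cov g \<alpha> (\<lambda>\<zeta>. \<zeta>)"
    and "catenoidal_end U cov g \<alpha> (\<lambda>\<zeta>. 1 + \<zeta>)"
    and "catenoidal_end U cov g \<alpha> (\<lambda>\<zeta>. 1 / \<zeta>)"
    and "reducible U cov g"
    and "finite_total_curvature (- {0, 1}) h"
    and "total_curvature (- {0, 1}) h = - 4 * pi"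
  shows "\<exists>(a1::complex) (a2::complex) (b::complex) (lam::complex) (\<kappa>::complex)
           (\<mu>::real) (\<nu>::real) (hN :: complex \<Rightarrow> real).
      a1 \<notin> {0, 1} \<and> a2 \<notin> {0, 1} \<and> lam \<noteq> 0 \<and> \<kappa> \<noteq> 0 \<and>
      0 < \<mu> \<and> 0 < \<nu> \<and> 0 < \<mu> + \<nu> \<and> \<mu> + \<nu> < 1 \<and>
      b = of_real (\<mu> + \<nu> - 1) * a1 * a2 / of_real \<nu> \<and>
      b \<notin> {0, 1, a1, a2} \<and>
      of_real (\<nu> * (\<nu> - 1)) =
        of_real (\<mu> + \<nu> - 1) * (of_real \<nu> * (a1 + a2) - of_real (\<mu> + \<nu>) * a1 * a2) \<and>
      of_real (\<mu> - 1) / (b - 1) + of_real (\<nu> - 1) / b + 1 / (b - a1) + 1 / (b - a2) = 0 \<and>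
      conformal_metric (- {0, 1}) hN \<and>
      metric_of_data (- {0, 1}) (data_g lam \<mu> \<nu> b) (data_eta \<kappa> \<mu> \<nu> b) hN \<and>
      isometric (- {0, 1}) h (- {0, 1}) hN"
proof -
  have punct: "- {0, 1} = punct" by (simp add: punct_def)
  have conf: "conformal_metric punct h" using assms(1) unfolding ricci_surface_def punct by blast
  interpret ricci_weierstrass h U cov g \<alpha>
    by unfold_locales (use conf assms(4,5) in \<open>simp_all add: punct\<close>)
  have lds: "ld = (\<lambda>z. - (gauss_curvature h z * h z))" by (simp add: ld_def fun_eq_iff)
  interpret ricci_finite h U cov g \<alpha>
  proof unfold_locales
    show "ld z \<ge> 0" if "z \<in> punct" for z
    proof -
      have "gauss_curvature h z \<le> 0" using assms(2) that unfolding nonpositively_curved_def punct by blast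
      then show ?thesis using h_facts(2)[OF that] unfolding lds by (simp add: mult_nonpos_nonneg)
    qed
    show "set_integrable lborel punct ld"
      using assms(10) unfolding finite_total_curvature_def punct lds set_integrable_def by simp
  qed
  have tot: "(LINT z:punct|lborel. ld z) = 4 * pi"
    using assms(11) unfolding total_curvature_def punct lds set_lebesgue_integral_def by simp
  obtain \<nu> \<mu> K1 K2 :: real and b where F: "\<nu> > 0" "\<mu> > 0" "\<mu> + \<nu> < 1" "K1 > 0" "K2 > 0" "b \<in> punct"
    "\<And>z. z \<in> punct \<Longrightarrow> 2 * sqrt (h z) = K1 * (cmod (z - b))\<^sup>2 * cmod z powr (- \<nu> - 1) * cmod (z - 1) powr (- \<mu> - 1)
       + K2 * cmod z powr (\<nu> - 1) * cmod (z - 1) powr (\<mu> - 1)"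
    by (rule metric_formula[OF assms(6,7,8,9) tot]) (rule that)
  have b: "b \<noteq> 0" "b \<noteq> 1" "b \<notin> {0, 1}" using F(6) by (auto simp: punct_def)
  obtain a1 a2 where a: "a1 \<notin> {0, 1}" "a2 \<notin> {0, 1}" "b = of_real (\<mu> + \<nu> - 1) * a1 * a2 / of_real \<nu>" "b \<noteq> a1" "b \<noteq> a2"
    "of_real (\<nu> * (\<nu> - 1)) =
        of_real (\<mu> + \<nu> - 1) * (of_real \<nu> * (a1 + a2) - of_real (\<mu> + \<nu>) * a1 * a2)"
    "of_real (\<mu> - 1) / (b - 1) + of_real (\<nu> - 1) / b + 1 / (b - a1) + 1 / (b - a2) = 0"
    by (rule quadratic_parameters[OF F(2,1,3) b(1,2)]) (rule that)
  have md: "metric_of_data (- {0, 1}) (data_g (of_real (sqrt (K2 / K1))) \<mu> \<nu> b) (data_eta (of_real K1) \<mu> \<nu> b) h"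
    by (rule metric_of_data_standard[OF b(3) F(4,5)]) (use F(7) h_facts(2) in \<open>auto simp: punct_def\<close>)
  have b4: "b \<notin> {0, 1, a1, a2}" using b a(4,5) by blast
  have nz: "complex_of_real (sqrt (K2 / K1)) \<noteq> 0" "complex_of_real K1 \<noteq> 0" "0 < \<mu> + \<nu>" using F by auto
  \<comment> \<open>The metric of the data is h itself, so hN = h and the isometry is the
    identity.\<close>
  show ?thesis
    by (rule exI[of _ a1], rule exI[of _ a2], rule exI[of _ b], rule exI[of _ "of_real (sqrt (K2 / K1))"],
        rule exI[of _ "of_real K1"], rule exI[of _ \<mu>], rule exI[of _ \<nu>], rule exI[of _ h],
        intro conjI a(1,2,3,6,7) nz F(1,2,3) b4 md isometric_refl conf[folded punct])
qed

end
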